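(* Let $r_{det}>0$ and let $f\in C^\infty(\mathbb{R}^3)$ be an even function ($f(\vec x)=f(-\vec x)$) with compact support in $B(0,r_{det})$. For $(\hat\omega,s,t)\in S^1\times\mathbb{R}\times[0,\infty)$ set $$G(\hat\omega,s,t)=\frac{1}{\sqrt{1+s^2}}\;\mathcal{R}_Pf\left(\Big(\frac{\hat\omega}{\sqrt{1+s^2}},\frac{-s}{\sqrt{1+s^2}}\Big),t\right).$$ Then for every $\vec x\in B(0,r_{det})$, $$f(\vec x)=-\frac{r_{det}}{64\pi^4}\int_{S^2}\left(\int_{S^1}\mathrm{p.v.}\!\int_{\mathbb{R}}\frac{\partial_s\partial_t t\,\partial_t t\,G(\hat\omega,s,t)\big|_{t=|r_{det}\hat\alpha-\vec x|}}{\alpha_3\,\hat\omega\cdot\alpha'-s\,\alpha_3^2}\;\frac{ds\,dS(\hat\omega)}{|r_{det}\hat\alpha-\vec x|}\right)dS(\hat\alpha),$$ where $\hat\alpha=(\alpha',\alpha_3)\in S^2$ with $\alpha'\in\mathbb{R}^2$.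
   Context: $B(0,r_{det})$ is the open ball in $\mathbb{R}^3$ of radius $r_{det}$ centered at the origin; $S^2\subset\mathbb{R}^3$ is the unit sphere and $S^1\subset\mathbb{R}^2$ the unit circle; $dS$ denotes the standard (unnormalized) measure on the unit sphere or on a unit circle, according to the domain of integration. The Radon-type transform is $$\mathcal{R}_Pf(\hat\theta,t)=\int_{\hat\alpha\in S^2,\ \hat\theta\cdot\hat\alpha=0}\int_{S^2} f(r_{det}\hat\alpha+t\hat\beta)\,dS(\hat\beta)\,dS(\hat\alpha),\qquad(\hat\theta,t)\in S^2\times[0,\infty).$$ The expression $\partial_s\partial_t t\,\partial_t t\,G$ is a composition of operators: $\partial_s\,\partial_t\big(t\,\partial_t(t\,G)\big)$. The principal value is taken in $s$ at the zero $s=\hat\omega\cdot\alpha'/\alpha_3$ of the denominator; the integrand of the outer integral is defined for $\alpha_3\neq0$, i.e. for almost every $\hat\alpha\in S^2$. *)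

theory Defs
  imports "HOL-Analysis.Analysis"
begin

primrec C_k :: "nat \<Rightarrow> ('a::real_normed_vector \<Rightarrow> 'b::real_normed_vector) \<Rightarrow> bool" where
  "C_k 0 f \<longleftrightarrow> continuous_on UNIV f"
| "C_k (Suc k) f \<longleftrightarrow>
     (\<forall>x. f differentiable at x) \<and> (\<forall>v. C_k k (\<lambda>x. frechet_derivative f (at x) v))"

definition C_infinity :: "('a::real_normed_vector \<Rightarrow> 'b::real_normed_vector) \<Rightarrow> bool" where
  "C_infinity f \<longleftrightarrow> (\<forall>k. C_k k f)"

text \<open>Surface measure of the unit sphere in an \<open>n\<close>-dimensional space: the measure of \<open>A\<close> is \<open>n\<close>
  times the volume of the cone \<open>{\<rho> \<alpha> | 0 < \<rho> < 1, \<alpha> \<in> A}\<close>. The underlying space of the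
  measure is the sphere itself, so that values of an integrand off the sphere are irrelevant, also
  for measurability.\<close>

definition sphere_measure :: "'a::euclidean_space measure" where
  "sphere_measure =
     scale_measure (of_nat DIM('a))
       (distr (restrict_space lborel (ball 0 1 - {0})) (restrict_space borel (sphere 0 1))
         (\<lambda>x. x /\<^sub>R norm x))"

lemma sets_sphere_measure [simp, measurable_cong]:
  "sets (sphere_measure :: 'a::euclidean_space measure) = sets (restrict_space borel (sphere 0 1))"
  by (simp add: sphere_measure_def)

lemma space_sphere_measure [simp]:
  "space (sphere_measure :: 'a::euclidean_space measure) = sphere 0 1"
  by (simp add: sphere_measure_def space_scale_measure space_restrict_space)

lemma emeasure_sphere_measure:
  fixes A :: "'a::euclidean_space set"
  assumes "A \<in> sets borel" "A \<subseteq> sphere 0 1"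
  shows "emeasure sphere_measure A =
    of_nat DIM('a) * emeasure lborel {x \<in> ball 0 1 - {0}. x /\<^sub>R norm x \<in> A}"
proof -
  let ?R = "restrict_space lborel (ball 0 1 - {0}) :: 'a measure"
  let ?S = "restrict_space borel (sphere 0 1) :: 'a measure"
  have m: "(\<lambda>x. x /\<^sub>R norm x) \<in> measurable ?R ?S"
    by (intro measurable_restrict_space2 measurable_restrict_space1)
      (auto simp: space_restrict_space)
  have A: "A \<in> sets ?S"
    using assms by (auto simp: sets_restrict_space_iff)
  have "(\<lambda>x. x /\<^sub>R norm x) -` A \<inter> space ?R = {x \<in> ball 0 1 - {0}. x /\<^sub>R norm x \<in> A}"
    by (auto simp: space_restrict_space)
  then show ?thesis
    using m A
    by (simp add: sphere_measure_def emeasure_distr emeasure_restrict_space subset_eq)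
qed

lemma emeasure_sphere_measure_sphere:
  "emeasure sphere_measure (sphere (0::real^3) 1) = 4 * pi"
proof -
  have "{x \<in> ball 0 1 - {0}. x /\<^sub>R norm x \<in> sphere 0 1} = ball (0::real^3) 1 - {0}"
    by auto
  then have "emeasure sphere_measure (sphere (0::real^3) 1) =
      3 * emeasure lborel (ball (0::real^3) 1 - {0})"
    by (simp add: emeasure_sphere_measure)
  also have "emeasure lborel (ball (0::real^3) 1 - {0}) = emeasure lborel (ball (0::real^3) 1)"
    by (subst emeasure_Diff) auto
  also have "\<dots> = ennreal (4 / 3 * pi)"
    by (simp add: emeasure_ball unit_ball_vol_3)
  finally show ?thesis
    by (simp flip: ennreal_numeral ennreal_mult')
qed

text \<open>Arc length on the unit circle spanned by an orthonormal pair \<open>u\<close>, \<open>v\<close>.\<close>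

definition circle_measure :: "'a::euclidean_space \<Rightarrow> 'a \<Rightarrow> 'a measure" where
  "circle_measure u v =
     distr (restrict_space lborel {0..<2 * pi}) (restrict_space borel (sphere 0 1))
       (\<lambda>\<phi>. cos \<phi> *\<^sub>R u + sin \<phi> *\<^sub>R v)"

lemma emeasure_circle_measure:
  assumes uv: "norm u = 1" "norm v = 1" "u \<bullet> v = 0"
    and A: "A \<in> sets borel" "A \<subseteq> sphere 0 1"
  shows "emeasure (circle_measure u v) A =
    emeasure lborel {\<phi> \<in> {0..<2 * pi}. cos \<phi> *\<^sub>R u + sin \<phi> *\<^sub>R v \<in> A}"
proof -
  let ?g = "\<lambda>\<phi>. cos \<phi> *\<^sub>R u + sin \<phi> *\<^sub>R v"
  let ?R = "restrict_space lborel {0..<2 * pi} :: real measure"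
  let ?S = "restrict_space borel (sphere 0 1) :: 'a measure"
  have "u \<bullet> u = 1" "v \<bullet> v = 1"
    using uv by (simp_all add: norm_eq_1)
  then have "?g \<phi> \<bullet> ?g \<phi> = (cos \<phi>)\<^sup>2 + (sin \<phi>)\<^sup>2" for \<phi>
    using uv by (simp only: inner_add_left inner_add_right inner_scaleR_left inner_scaleR_right
        inner_commute[of v u]) (simp add: power2_eq_square)
  then have "norm (?g \<phi>) = 1" for \<phi>
    by (simp add: norm_eq_1)
  moreover have "?g \<in> borel_measurable borel"
    by (intro borel_measurable_continuous_onI continuous_intros)
  ultimately have m: "?g \<in> measurable ?R ?S"
    by (intro measurable_restrict_space2 measurable_restrict_space1) auto
  have S: "A \<in> sets ?S"
    using A by (auto simp: sets_restrict_space_iff)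
  have "?g -` A \<inter> space ?R = {\<phi> \<in> {0..<2 * pi}. ?g \<phi> \<in> A}"
    by (auto simp: space_restrict_space)
  then show ?thesis
    using m S by (simp add: circle_measure_def emeasure_distr emeasure_restrict_space subset_eq)
qed

definition S1_measure :: "(real^2) measure" where
  "S1_measure = circle_measure (axis 1 1) (axis 2 1)"

text \<open>Arc length on the great circle \<open>{\<alpha> \<in> sphere 0 1. \<theta> \<bullet> \<alpha> = 0}\<close>, for \<open>\<theta> \<noteq> 0\<close>. Any two
  orthonormal bases of the plane orthogonal to \<open>\<theta>\<close> differ by a rotation or reflection, so the
  measure does not depend on the choice.\<close>

definition great_circle_measure :: "real^3 \<Rightarrow> (real^3) measure" where
  "great_circle_measure \<theta> =
     (SOME M. \<exists>u v. norm u = 1 \<and> norm v = 1 \<and> u \<bullet> v = 0 \<and> \<theta> \<bullet> u = 0 \<and> \<theta> \<bullet> v = 0 \<and>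
        M = circle_measure u v)"

definition radon_P :: "real \<Rightarrow> (real^3 \<Rightarrow> real) \<Rightarrow> real^3 \<Rightarrow> real \<Rightarrow> real" where
  "radon_P r f \<theta> t =
     (\<integral>\<alpha>. (\<integral>\<beta>. f (r *\<^sub>R \<alpha> + t *\<^sub>R \<beta>) \<partial>sphere_measure) \<partial>great_circle_measure \<theta>)"

definition radon_G :: "real \<Rightarrow> (real^3 \<Rightarrow> real) \<Rightarrow> real^2 \<Rightarrow> real \<Rightarrow> real \<Rightarrow> real" where
  "radon_G r f \<omega> s t =
     1 / sqrt (1 + s\<^sup>2) *
     radon_P r f
       (vector [\<omega>$1 / sqrt (1 + s\<^sup>2), \<omega>$2 / sqrt (1 + s\<^sup>2), - s / sqrt (1 + s\<^sup>2)]) t"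

definition ds_dt_t_dt_t :: "(real \<Rightarrow> real \<Rightarrow> real) \<Rightarrow> real \<Rightarrow> real \<Rightarrow> real" where
  "ds_dt_t_dt_t g s t =
     deriv (\<lambda>s'. deriv (\<lambda>t'. t' * deriv (\<lambda>t''. t'' * g s' t'') t') t) s"

text \<open>Principal value over the real line with a single singularity at \<open>a\<close>.\<close>

definition has_pv_integral :: "(real \<Rightarrow> real) \<Rightarrow> real \<Rightarrow> real \<Rightarrow> bool" where
  "has_pv_integral g a I \<longleftrightarrow>
     (\<forall>\<epsilon>>0. set_integrable lborel {s. \<bar>s - a\<bar> > \<epsilon>} g) \<and>
     ((\<lambda>\<epsilon>. LINT s:{s. \<bar>s - a\<bar> > \<epsilon>}|lborel. g s) \<longlongrightarrow> I) (at_right 0)"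

definition pv_integral :: "(real \<Rightarrow> real) \<Rightarrow> real \<Rightarrow> real" where
  "pv_integral g a = (THE I. has_pv_integral g a I)"

lemma pv_integral_eq: "has_pv_integral g a I \<Longrightarrow> pv_integral g a = I"
  unfolding pv_integral_def
  by (rule the_equality) (auto simp: has_pv_integral_def intro: tendsto_unique[rotated])

definition proj_xy :: "real^3 \<Rightarrow> real^2" where
  "proj_xy \<alpha> = vector [\<alpha>$1, \<alpha>$2]"

definition inversion_kernel ::
  "real \<Rightarrow> (real^3 \<Rightarrow> real) \<Rightarrow> real^3 \<Rightarrow> real^3 \<Rightarrow> real^2 \<Rightarrow> real \<Rightarrow> real" where
  "inversion_kernel r f x \<alpha> \<omega> s =
     ds_dt_t_dt_t (radon_G r f \<omega>) s (norm (r *\<^sub>R \<alpha> - x)) /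
       (\<alpha>$3 * (\<omega> \<bullet> proj_xy \<alpha>) - s * (\<alpha>$3)\<^sup>2) *
     (1 / norm (r *\<^sub>R \<alpha> - x))"

definition pole :: "real^3 \<Rightarrow> real^2 \<Rightarrow> real" where
  "pole \<alpha> \<omega> = (\<omega> \<bullet> proj_xy \<alpha>) / \<alpha>$3"

end

theory Submission
  imports Defs
begin

text \<open>Write \<open>m a t\<close> for the integral of \<open>f (a + t \<beta>)\<close> over the unit sphere. For \<open>t = \<bar>r \<alpha> - x\<bar>\<close>,
  the integral over \<open>\<alpha>\<close> of \<open>(d/dt (t d/dt (t m))) (r \<alpha>) t / t\<close> is \<open>- 8 \<pi>\<^sup>2 f x / r\<close>: by Darboux's equation
  the integrand splits into a first-order part, whose integral vanishes, and spherical means of the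
  Laplacian, whose integral is a Newtonian potential because, by Archimedes, almost every \<open>p\<close> sees the
  family of spheres through \<open>x\<close> with uniform density.

  The transform of \<open>f\<close> at fixed \<open>t\<close> integrates \<open>\<alpha> \<mapsto> m (r \<alpha>) t\<close> over great circles, and the radial
  operator commutes with this integration. It remains to recover an even function from its great circle
  integrals. In the gnomonic chart these become line integrals, \<open>G\<close> becomes a Radon transform of the
  plane, and the inner principal value is its filtered backprojection; averaging over directions turns
  it into an Abel integral that returns the value of the function at \<open>\<alpha>\<close>.\<close>

section \<open>The surface measure of the sphere\<close>

text \<open>The radius \<open>t\<close> of the kernel depends on the outer direction
  \<open>\<alpha>\<close> but not on \<open>s\<close> or \<open>\<omega>\<close>. The inner
  integrals therefore act, at a frozen radius, on the even function
  \<open>\<lambda>\<beta>. radial_op f (r *\<^sub>R \<beta>) t\<close>, and only its value at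
  \<open>\<alpha>\<close> is used. So the proof consists of two separate inversions; each
  contributes a factor \<open>8 * pi\<^sup>2\<close>, whence \<open>64 * pi ^ 4\<close>. In the
  first, the obstacle is that the spheres through \<open>x\<close> are null sets. They are thickened
  to shells by adding \<open>k\<close> to the squared radius. The mass of a function in these
  shells, integrated over \<open>\<alpha>\<close>, is linear in \<open>k\<close> up to
  \<open>O(k\<^sup>3)\<close>: its first derivative at 0 is the potential, its second derivative
  vanishes and disposes of the first-order part. The cubic error rests on the distance
  \<open>\<delta>\<close> between the support and the sphere of radius \<open>r\<close>. In the
  second, the principal value converges only by cancellation across the pole. The work is done with
  a cut-off \<open>\<epsilon>\<close>, where Fubini and integration by parts apply, and with bounds
  that are uniform in the direction.\<close>

lemma distr_lborel_orthogonal: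
  fixes T :: "real^'n::{finite,wellorder} \<Rightarrow> real^'n::_"
  assumes T: "orthogonal_transformation T"
  shows "distr lborel borel T = lborel"
proof (rule lborel_eqI[symmetric])
  have lin: "linear T" using T orthogonal_transformation_linear by blast
  have Tm [measurable]: "T \<in> borel_measurable borel"
    using lin by (intro borel_measurable_continuous_onI linear_continuous_on) (simp add: linear_linear)
  fix l u :: "real^'n::{finite,wellorder}"
  assume "\<And>b. b \<in> Basis \<Longrightarrow> l \<bullet> b \<le> u \<bullet> b"
  then have box: "measure lebesgue (box l u) = (\<Prod>b\<in>Basis. (u - l) \<bullet> b)"
    by (simp add: measure_lborel_box_eq inner_diff_left)
  have bij: "bij T" using T by (rule orthogonal_transformation_bij)
  have inv: "orthogonal_transformation (inv T)" using T by (rule orthogonal_transformation_inv)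
  have eq: "T -` box l u = inv T ` box l u"
    using bij by (simp add: bij_vimage_eq_inv_image)
  have m: "inv T ` box l u \<in> lmeasurable" "measure lebesgue (inv T ` box l u) = measure lebesgue (box l u)"
    using measurable_orthogonal_image[OF inv] measure_orthogonal_image[OF inv] by auto
  have b: "T -` box l u \<in> sets borel"
    using measurable_sets[OF Tm, of "box l u"] by simp
  have "emeasure lborel (T -` box l u) = emeasure lebesgue (inv T ` box l u)"
    using b by (simp add: eq)
  also have "\<dots> = ennreal (measure lebesgue (inv T ` box l u))"
    using m(1) by (intro emeasure_eq_measure2) (auto simp: fmeasurableD)
  finally show "emeasure (distr lborel borel T) (box l u) = ennreal (\<Prod>b\<in>Basis. (u - l) \<bullet> b)"
    by (simp add: emeasure_distr m(2) box)
qed simp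

lemma nn_integral_sphere_measure:
  fixes F :: "'a::euclidean_space \<Rightarrow> ennreal"
  assumes [measurable]: "F \<in> borel_measurable borel"
  shows "(\<integral>\<^sup>+\<beta>. F \<beta> \<partial>sphere_measure) =
    of_nat DIM('a) * (\<integral>\<^sup>+x. F (x /\<^sub>R norm x) * indicator (ball 0 1 - {0}) x \<partial>lborel)"
proof -
  have m: "(\<lambda>x::'a. x /\<^sub>R norm x) \<in> measurable (restrict_space lborel (ball 0 1 - {0}))
      (restrict_space borel (sphere 0 1))"
    by (intro measurable_restrict_space2 measurable_restrict_space1)
      (auto simp: space_restrict_space)
  have "F \<in> borel_measurable (restrict_space borel (sphere 0 1))"
    by (intro measurable_restrict_space1) simp
  then show ?thesis
    using m by (simp add: sphere_measure_def nn_integral_scale_measure nn_integral_distr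
        nn_integral_restrict_space)
qed

lemma measurable_sphere_measure [measurable (raw)]:
  assumes "f \<in> measurable borel N"
  shows "f \<in> measurable (sphere_measure :: 'a::euclidean_space measure) N"
proof -
  have "f \<in> measurable (restrict_space borel (sphere (0::'a) 1)) N"
    using assms by (rule measurable_restrict_space1)
  then show ?thesis
    by (simp cong: measurable_cong_sets)
qed

lemma finite_sphere_measure [simp]: "finite_measure (sphere_measure :: 'a::euclidean_space measure)"
proof
  have "emeasure sphere_measure (sphere (0::'a) 1) =
     of_nat DIM('a) * emeasure lborel {x \<in> ball 0 1 - {0}. x /\<^sub>R norm x \<in> sphere (0::'a) 1}"
    by (rule emeasure_sphere_measure) auto
  also have "\<dots> \<le> of_nat DIM('a) * emeasure lborel (ball (0::'a) 1)"
    by (intro mult_left_mono emeasure_mono) auto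
  also have "\<dots> < \<infinity>"
    by (simp add: emeasure_ball ennreal_mult_less_top of_nat_less_top)
  finally show "emeasure sphere_measure (space (sphere_measure :: 'a measure)) \<noteq> \<infinity>"
    by simp
qed

interpretation sphere_measure: finite_measure "sphere_measure :: 'a::euclidean_space measure"
  by simp

lemma nn_integral_lborel_scale:
  fixes f :: "'a::euclidean_space \<Rightarrow> ennreal"
  assumes [measurable]: "f \<in> borel_measurable borel" and c: "c > 0"
  shows "(\<integral>\<^sup>+x. f x \<partial>lborel) = ennreal (c ^ DIM('a)) * (\<integral>\<^sup>+x. f (c *\<^sub>R x) \<partial>lborel)"
  using c by (subst lborel_affine[of c 0])
    (simp_all add: nn_integral_density nn_integral_distr nn_integral_cmult)

text \<open>In \<open>nn_integral_polar\<close> the auxiliary variable \<open>\<tau>\<close> is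
  integrated out last, over \<open>\<tau> > norm z\<close>. The value found here is exactly what
  cancels the factor \<open>norm z ^ n\<close> produced by the two substitutions.\<close>

lemma nn_integral_inverse_power_tail:
  assumes a: "a > 0" and n: "n > 0"
  shows "(\<integral>\<^sup>+\<tau>. ennreal (real n / \<tau> ^ Suc n) * indicator {a..} \<tau> \<partial>lborel) = ennreal (1 / a ^ n)"
proof -
  have "(\<integral>\<^sup>+\<tau>. ennreal (real n / \<tau> ^ Suc n) * indicator {a..} \<tau> \<partial>lborel) =
      ennreal (0 - (- (1 / a ^ n)))"
  proof (rule nn_integral_FTC_atLeast[where F = "\<lambda>\<tau>. - (1 / \<tau> ^ n)"])
    fix \<tau> assume \<tau>: "a \<le> \<tau>"
    have "\<tau> * \<tau> ^ (n - 1) = \<tau> ^ n"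
      using n by (cases n) auto
    then have "real n * \<tau> ^ (n - 1) / (\<tau> ^ n * \<tau> ^ n) = real n / \<tau> ^ Suc n"
      using \<tau> a n by (simp add: field_simps)
    then show "((\<lambda>\<tau>. - (1 / \<tau> ^ n)) has_real_derivative real n / \<tau> ^ Suc n) (at \<tau>)"
      using \<tau> a by (auto intro!: derivative_eq_intros simp: power2_eq_square)
    show "0 \<le> real n / \<tau> ^ Suc n" using \<tau> a by simp
  next
    have "((\<lambda>\<tau>::real. inverse (\<tau> ^ n)) \<longlongrightarrow> 0) at_top"
      using n by (intro tendsto_inverse_0_at_top filterlim_pow_at_top filterlim_ident) auto
    from tendsto_minus[OF this] show "((\<lambda>\<tau>::real. - (1 / \<tau> ^ n)) \<longlongrightarrow> 0) at_top"
      by (simp add: inverse_eq_divide)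
  qed simp_all
  then show ?thesis by simp
qed

lemma ennreal_mult_sandwich:
  assumes "0 \<le> a" "0 \<le> b" "0 \<le> c"
  shows "ennreal a * (ennreal b * x * ennreal c) = x * ennreal (a * b * c)"
  using assms by (simp add: ennreal_mult mult_ac)

text \<open>Tonelli and scaling reduce polar coordinates to the definition of the sphere measure as a cone
  measure: substitute \<open>t = norm x * \<tau>\<close>, then \<open>z = \<tau> x\<close>, and integrate out \<open>\<tau>\<close>.\<close>

lemma nn_integral_polar:
  fixes F :: "'a::euclidean_space \<Rightarrow> ennreal"
  assumes [measurable]: "F \<in> borel_measurable borel"
  shows "(\<integral>\<^sup>+x. F x \<partial>lborel) =
    (\<integral>\<^sup>+t. ennreal (t ^ (DIM('a) - 1)) * indicator {0<..} t * (\<integral>\<^sup>+\<beta>. F (t *\<^sub>R \<beta>) \<partial>sphere_measure) \<partial>lborel)"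
    (is "_ = ?R")
proof -
  let ?n = "DIM('a)"
  define I :: "'a \<Rightarrow> ennreal" where "I = indicator (ball 0 1 - {0})"
  have [measurable]: "I \<in> borel_measurable borel"
    unfolding I_def by (intro borel_measurable_indicator) auto
  have n: "Suc (?n - 1) = ?n" using DIM_positive[where 'a='a] by simp
  have "?R = (\<integral>\<^sup>+t. (\<integral>\<^sup>+x. of_nat ?n * (ennreal (t ^ (?n - 1)) * indicator {0<..} t *
      (F (t *\<^sub>R (x /\<^sub>R norm x)) * I x)) \<partial>lborel) \<partial>lborel)"
  proof (rule nn_integral_cong)
    fix t :: real
    have "(\<integral>\<^sup>+\<beta>. F (t *\<^sub>R \<beta>) \<partial>sphere_measure) = of_nat ?n * (\<integral>\<^sup>+x. F (t *\<^sub>R (x /\<^sub>R norm x)) * I x \<partial>lborel)"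
      by (simp add: nn_integral_sphere_measure I_def)
    moreover have "(\<integral>\<^sup>+x. of_nat ?n * (ennreal (t ^ (?n - 1)) * indicator {0<..} t *
        (F (t *\<^sub>R (x /\<^sub>R norm x)) * I x)) \<partial>lborel) =
      of_nat ?n * (ennreal (t ^ (?n - 1)) * indicator {0<..} t * (\<integral>\<^sup>+x. F (t *\<^sub>R (x /\<^sub>R norm x)) * I x \<partial>lborel))"
      by (simp add: nn_integral_cmult)
    ultimately show "ennreal (t ^ (?n - 1)) * indicator {0<..} t * (\<integral>\<^sup>+\<beta>. F (t *\<^sub>R \<beta>) \<partial>sphere_measure) =
      (\<integral>\<^sup>+x. of_nat ?n * (ennreal (t ^ (?n - 1)) * indicator {0<..} t *
        (F (t *\<^sub>R (x /\<^sub>R norm x)) * I x)) \<partial>lborel)"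
      by (simp add: mult_ac)
  qed
  also have "\<dots> = (\<integral>\<^sup>+x. (\<integral>\<^sup>+t. of_nat ?n * (ennreal (t ^ (?n - 1)) * indicator {0<..} t *
      (F (t *\<^sub>R (x /\<^sub>R norm x)) * I x)) \<partial>lborel) \<partial>(lborel :: 'a measure))"
    by (rule lborel_pair.Fubini') measurable
  also have "\<dots> = (\<integral>\<^sup>+x. (\<integral>\<^sup>+\<tau>. of_nat ?n * (ennreal (norm x ^ ?n) * (ennreal (\<tau> ^ (?n - 1)) * indicator {0<..} \<tau> *
      (F (\<tau> *\<^sub>R x) * I x))) \<partial>lborel) \<partial>(lborel :: 'a measure))"
  proof (rule nn_integral_cong)
    fix x :: 'a
    show "(\<integral>\<^sup>+t. of_nat ?n * (ennreal (t ^ (?n - 1)) * indicator {0<..} t *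
      (F (t *\<^sub>R (x /\<^sub>R norm x)) * I x)) \<partial>lborel) =
      (\<integral>\<^sup>+\<tau>. of_nat ?n * (ennreal (norm x ^ ?n) * (ennreal (\<tau> ^ (?n - 1)) * indicator {0<..} \<tau> *
      (F (\<tau> *\<^sub>R x) * I x))) \<partial>lborel)"
    proof (cases "x = 0")
      case False
      then have p: "norm x > 0" by simp
      have pw: "norm x * norm x ^ (?n - 1) = norm x ^ ?n"
        using n by (metis power_Suc)
      have "(\<integral>\<^sup>+t. of_nat ?n * (ennreal (t ^ (?n - 1)) * indicator {0<..} t *
          (F (t *\<^sub>R (x /\<^sub>R norm x)) * I x)) \<partial>lborel) =
        ennreal (norm x) * (\<integral>\<^sup>+\<tau>. of_nat ?n * (ennreal ((norm x * \<tau>) ^ (?n - 1)) * indicator {0<..} (norm x * \<tau>) *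
          (F (\<tau> *\<^sub>R x) * I x)) \<partial>lborel)"
        using p by (subst nn_integral_real_affine[where c = "norm x" and t = 0])
            (auto intro!: arg_cong2[where f = "(*)"] nn_integral_cong simp: field_simps)
      also have "\<dots> = (\<integral>\<^sup>+\<tau>. ennreal (norm x) * (of_nat ?n * (ennreal ((norm x * \<tau>) ^ (?n - 1)) * indicator {0<..} (norm x * \<tau>) *
          (F (\<tau> *\<^sub>R x) * I x))) \<partial>lborel)"
        by (rule nn_integral_cmult[symmetric]) measurable
      also have "\<dots> = (\<integral>\<^sup>+\<tau>. of_nat ?n * (ennreal (norm x ^ ?n) * (ennreal (\<tau> ^ (?n - 1)) * indicator {0<..} \<tau> *
          (F (\<tau> *\<^sub>R x) * I x))) \<partial>lborel)"
        using p by (intro nn_integral_cong)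
          (auto simp: indicator_def zero_less_mult_iff power_mult_distrib ennreal_mult mult_ac pw[symmetric])
      finally show ?thesis .
    qed (simp add: I_def)
  qed
  also have "\<dots> = (\<integral>\<^sup>+\<tau>. (\<integral>\<^sup>+x. of_nat ?n * (ennreal (norm x ^ ?n) * (ennreal (\<tau> ^ (?n - 1)) * indicator {0<..} \<tau> *
      (F (\<tau> *\<^sub>R x) * I x))) \<partial>(lborel :: 'a measure)) \<partial>lborel)"
    by (rule lborel_pair.Fubini') measurable
  also have "\<dots> = (\<integral>\<^sup>+\<tau>. (\<integral>\<^sup>+z. ennreal (norm z ^ ?n) * F z * indicator {0<..} (norm z) *
      (ennreal (real ?n / \<tau> ^ Suc ?n) * (if norm z < \<tau> then 1 else 0)) \<partial>(lborel :: 'a measure)) \<partial>lborel)"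
  proof (rule nn_integral_cong)
    fix \<tau> :: real
    show "(\<integral>\<^sup>+x. of_nat ?n * (ennreal (norm x ^ ?n) * (ennreal (\<tau> ^ (?n - 1)) * indicator {0<..} \<tau> *
      (F (\<tau> *\<^sub>R x) * I x))) \<partial>(lborel :: 'a measure)) =
      (\<integral>\<^sup>+z. ennreal (norm z ^ ?n) * F z * indicator {0<..} (norm z) *
      (ennreal (real ?n / \<tau> ^ Suc ?n) * (if norm z < \<tau> then 1 else 0)) \<partial>(lborel :: 'a measure))"
    proof (cases "\<tau> > 0")
      case False
      have "\<not> norm z < \<tau>" for z :: 'a
        using False norm_ge_zero[of z] by linarith
      then show ?thesis using False by simp
    next
      case True
      have a: "\<tau> ^ ?n * (norm z ^ ?n * \<tau> ^ ?n * (real ?n / \<tau> ^ Suc ?n)) = real ?n * (norm z ^ ?n * \<tau> ^ (?n - 1))"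
        for z :: 'a
      proof -
        have "\<tau> * \<tau> ^ (?n - 1) = \<tau> ^ ?n"
          using n by (metis power_Suc)
        then have "\<tau> ^ ?n * \<tau> ^ ?n = \<tau> ^ Suc ?n * \<tau> ^ (?n - 1)"
          by simp
        then show ?thesis using True by (simp add: field_simps)
      qed
      have "(\<integral>\<^sup>+z. ennreal (norm z ^ ?n) * F z * indicator {0<..} (norm z) *
          (ennreal (real ?n / \<tau> ^ Suc ?n) * (if norm z < \<tau> then 1 else 0)) \<partial>(lborel :: 'a measure)) =
        ennreal (\<tau> ^ ?n) * (\<integral>\<^sup>+x. ennreal (norm (\<tau> *\<^sub>R x) ^ ?n) * F (\<tau> *\<^sub>R x) * indicator {0<..} (norm (\<tau> *\<^sub>R x)) *
          (ennreal (real ?n / \<tau> ^ Suc ?n) * (if norm (\<tau> *\<^sub>R x) < \<tau> then 1 else 0)) \<partial>(lborel :: 'a measure))"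
        by (rule nn_integral_lborel_scale[OF _ True]) measurable
      also have "\<dots> = (\<integral>\<^sup>+x. ennreal (\<tau> ^ ?n) * (ennreal (norm (\<tau> *\<^sub>R x) ^ ?n) * F (\<tau> *\<^sub>R x) * indicator {0<..} (norm (\<tau> *\<^sub>R x)) *
          (ennreal (real ?n / \<tau> ^ Suc ?n) * (if norm (\<tau> *\<^sub>R x) < \<tau> then 1 else 0))) \<partial>(lborel :: 'a measure))"
        by (rule nn_integral_cmult[symmetric]) measurable
      also have "\<dots> = (\<integral>\<^sup>+x. of_nat ?n * (ennreal (norm x ^ ?n) * (ennreal (\<tau> ^ (?n - 1)) * indicator {0<..} \<tau> *
          (F (\<tau> *\<^sub>R x) * I x))) \<partial>(lborel :: 'a measure))"
      proof (rule nn_integral_cong)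
        fix x :: 'a
        have e: "ennreal (\<tau> ^ ?n) * (ennreal (norm (\<tau> *\<^sub>R x) ^ ?n) * F (\<tau> *\<^sub>R x) * ennreal (real ?n / \<tau> ^ Suc ?n)) =
          F (\<tau> *\<^sub>R x) * ennreal (\<tau> ^ ?n * (norm x ^ ?n * \<tau> ^ ?n * (real ?n / \<tau> ^ Suc ?n)))"
          using True by (subst ennreal_mult_sandwich) (simp_all add: power_mult_distrib mult_ac)
        show "ennreal (\<tau> ^ ?n) * (ennreal (norm (\<tau> *\<^sub>R x) ^ ?n) * F (\<tau> *\<^sub>R x) * indicator {0<..} (norm (\<tau> *\<^sub>R x)) *
          (ennreal (real ?n / \<tau> ^ Suc ?n) * (if norm (\<tau> *\<^sub>R x) < \<tau> then 1 else 0))) =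
          of_nat ?n * (ennreal (norm x ^ ?n) * (ennreal (\<tau> ^ (?n - 1)) * indicator {0<..} \<tau> * (F (\<tau> *\<^sub>R x) * I x)))"
        proof (cases "x \<in> ball 0 1 - {0}")
          case xB: True
          then have "\<tau> * norm x < \<tau>" "\<tau> * norm x > 0" using True by auto
          then show ?thesis
            using True xB e a[of x]
            by (simp add: I_def mult.assoc) (simp add: ennreal_mult ennreal_of_nat_eq_real_of_nat mult_ac)
        next
          case False
          then show ?thesis using True by (auto simp: I_def indicator_def)
        qed
      qed
      finally show ?thesis by simp
    qed
  qed
  also have "\<dots> = (\<integral>\<^sup>+z. (\<integral>\<^sup>+\<tau>. ennreal (norm z ^ ?n) * F z * indicator {0<..} (norm z) *
      (ennreal (real ?n / \<tau> ^ Suc ?n) * (if norm z < \<tau> then 1 else 0)) \<partial>lborel) \<partial>(lborel :: 'a measure))"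
    by (rule lborel_pair.Fubini') measurable
  also have "\<dots> = (\<integral>\<^sup>+z. F z \<partial>lborel)"
  proof (rule nn_integral_cong_AE)
    have tail: "(\<integral>\<^sup>+\<tau>. ennreal (norm z ^ ?n) * F z * indicator {0<..} (norm z) *
      (ennreal (real ?n / \<tau> ^ Suc ?n) * (if norm z < \<tau> then 1 else 0)) \<partial>lborel) = F z" if z: "z \<noteq> 0" for z :: 'a
    proof -
      have "(\<integral>\<^sup>+\<tau>. ennreal (real ?n / \<tau> ^ Suc ?n) * (if norm z < \<tau> then 1 else 0) \<partial>lborel) =
        (\<integral>\<^sup>+\<tau>. ennreal (real ?n / \<tau> ^ Suc ?n) * indicator {norm z..} \<tau> \<partial>lborel)"
        by (intro nn_integral_cong_AE, rule AE_mp[OF AE_lborel_singleton[of "norm z"]])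
          (auto simp: indicator_def)
      also have "\<dots> = ennreal (1 / norm z ^ ?n)"
        using z by (intro nn_integral_inverse_power_tail) auto
      finally have 1: "(\<integral>\<^sup>+\<tau>. ennreal (real ?n / \<tau> ^ Suc ?n) * (if norm z < \<tau> then 1 else 0) \<partial>lborel) =
        ennreal (1 / norm z ^ ?n)" .
      have "(\<integral>\<^sup>+\<tau>. ennreal (norm z ^ ?n) * F z * indicator {0<..} (norm z) *
          (ennreal (real ?n / \<tau> ^ Suc ?n) * (if norm z < \<tau> then 1 else 0)) \<partial>lborel) =
        ennreal (norm z ^ ?n) * F z * indicator {0<..} (norm z) * ennreal (1 / norm z ^ ?n)"
        unfolding 1[symmetric] by (rule nn_integral_cmult) measurable
      also have "\<dots> = F z * (ennreal (norm z ^ ?n) * ennreal (1 / norm z ^ ?n))"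
        using z by (simp add: mult_ac)
      also have "\<dots> = F z"
        using z by (simp flip: ennreal_mult)
      finally show ?thesis .
    qed
    show "AE z in lborel. (\<integral>\<^sup>+\<tau>. ennreal (norm z ^ ?n) * F z * indicator {0<..} (norm z) *
      (ennreal (real ?n / \<tau> ^ Suc ?n) * (if norm z < \<tau> then 1 else 0)) \<partial>lborel) = F z"
      by (rule AE_mp[OF AE_lborel_singleton[of "0::'a"]]) (use tail in auto)
  qed
  finally show ?thesis by simp
qed

lemma prod_Basis_vec:
  fixes g :: "real^'n \<Rightarrow> real"
  shows "(\<Prod>b\<in>Basis. g b) = (\<Prod>i\<in>UNIV. g (axis i 1))"
proof -
  have 1: "inj (\<lambda>i::'n. axis i (1::real))"
    by (auto simp: inj_on_def axis_eq_axis)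
  have 2: "(Basis :: (real^'n) set) = range (\<lambda>i. axis i 1)"
    by (auto simp: Basis_vec_def)
  show ?thesis
    unfolding 2 by (subst prod.reindex) (use 1 in \<open>auto simp: inj_on_def axis_eq_axis\<close>)
qed

lemma prod_UNIV_3:
  fixes f :: "3 \<Rightarrow> 'a::comm_monoid_mult"
  shows "(\<Prod>i\<in>UNIV. f i) = f 1 * f 2 * f 3"
  unfolding UNIV_3 by (simp add: ac_simps)

lemma vector_3_continuous: "continuous_on UNIV (\<lambda>p :: real \<times> (real^2). vector [fst p, snd p $ 1, snd p $ 2] :: real^3)"
proof -
  have "(vector [fst p, snd p $ 1, snd p $ 2] :: real^3) = (\<chi> i. if i = 1 then fst p else if i = 2 then snd p $ 1 else snd p $ 2)" for p :: "real \<times> (real^2)"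
    by (simp add: vec_eq_iff forall_3)
  moreover have "continuous_on UNIV (\<lambda>p :: real \<times> (real^2). (\<chi> i::3. if i = 1 then fst p else if i = 2 then snd p $ 1 else snd p $ 2))"
  proof (rule continuous_on_vec_lambda)
    fix i :: 3
    show "continuous_on UNIV (\<lambda>p :: real \<times> (real^2). if i = 1 then fst p else if i = 2 then snd p $ 1 else snd p $ 2)"
      by (cases "i = 1"; cases "i = 2") (auto intro!: continuous_intros)
  qed
  ultimately show ?thesis by simp
qed

text \<open>Slicing by planes orthogonal to the first axis, the form in which the proof of
  Archimedes' theorem meets the volume. Boxes determine Lebesgue measure, and on boxes both sides
  are the product of the same three lengths.\<close>

lemma nn_integral_lborel_vec3:
  fixes F :: "real^3 \<Rightarrow> ennreal"
  assumes [measurable]: "F \<in> borel_measurable borel"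
  shows "(\<integral>\<^sup>+x. F x \<partial>lborel) = (\<integral>\<^sup>+z. (\<integral>\<^sup>+y. F (vector [z, y $ 1, y $ 2]) \<partial>(lborel :: (real^2) measure)) \<partial>lborel)"
proof -
  let ?V = "\<lambda>p :: real \<times> (real^2). vector [fst p, snd p $ 1, snd p $ 2] :: real^3"
  have V: "?V \<in> borel_measurable borel"
    using vector_3_continuous by (rule borel_measurable_continuous_onI)
  then have V' [measurable]: "?V \<in> measurable (lborel \<Otimes>\<^sub>M lborel) borel"
    by (simp add: lborel_prod)
  have "lborel = distr (lborel \<Otimes>\<^sub>M lborel) borel ?V"
  proof (rule lborel_eqI)
    fix l u :: "real^3"
    assume "\<And>b. b \<in> Basis \<Longrightarrow> l \<bullet> b \<le> u \<bullet> b"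
    then have le: "l $ i \<le> u $ i" for i
      using inner_axis[of l i 1] inner_axis[of u i 1] by (metis axis_in_Basis_iff[of i "1::real"] Basis_real_def inner_real_def insertI1 mult.right_neutral)
    let ?p = "\<lambda>v. vector [v $ 2, v $ 3] :: real^2"
    have eq: "?V -` box l u = {l $ 1<..<u $ 1} \<times> box (?p l) (?p u)"
      by (auto simp: mem_box_cart forall_3 forall_2)
    have "emeasure (distr (lborel \<Otimes>\<^sub>M lborel) borel ?V) (box l u) =
      emeasure (lborel \<Otimes>\<^sub>M lborel) ({l $ 1<..<u $ 1} \<times> box (?p l) (?p u))"
      by (subst emeasure_distr) (auto simp: eq space_pair_measure)
    also have "\<dots> = emeasure lborel {l $ 1<..<u $ 1} * emeasure lborel (box (?p l) (?p u))"
      by (rule lborel.emeasure_pair_measure_Times) auto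
    also have "emeasure lborel (box (?p l) (?p u)) = ennreal ((u $ 2 - l $ 2) * (u $ 3 - l $ 3))"
      using le by (subst emeasure_lborel_box)
        (simp_all only: prod_Basis_vec, auto simp: inner_axis UNIV_2 Basis_vec_def forall_2)
    moreover have axis3: "(u - l) \<bullet> axis i 1 = u $ i - l $ i" for i
      by (simp add: inner_axis)
    moreover have prodB: "(\<Prod>b\<in>Basis. (u - l) \<bullet> b) = (u $ 1 - l $ 1) * ((u $ 2 - l $ 2) * (u $ 3 - l $ 3))"
      unfolding prod_Basis_vec axis3 prod_UNIV_3 by (simp add: mult.assoc)
    ultimately show "emeasure (distr (lborel \<Otimes>\<^sub>M lborel) borel ?V) (box l u) = ennreal (\<Prod>b\<in>Basis. (u - l) \<bullet> b)"
      using le[of 1] le[of 2] le[of 3] by (simp add: prodB flip: ennreal_mult)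
  qed simp
  then have "(\<integral>\<^sup>+x. F x \<partial>lborel) = (\<integral>\<^sup>+p. F (?V p) \<partial>(lborel \<Otimes>\<^sub>M lborel))"
    using nn_integral_distr[OF V', of F] by simp
  also have "\<dots> = (\<integral>\<^sup>+z. (\<integral>\<^sup>+y. F (?V (z, y)) \<partial>lborel) \<partial>lborel)"
    by (rule lborel.nn_integral_fst[symmetric]) measurable
  finally show ?thesis by simp
qed

text \<open>A disc of squared radius \<open>a\<close> has area \<open>pi * a\<close>. Hence the
  squared norm, unlike the norm, pushes plane measure to a constant density on the half line, and no
  Jacobian has to be carried along.\<close>

lemma nn_integral_plane_radial:
  fixes \<phi> :: "real \<Rightarrow> ennreal"
  assumes [measurable]: "\<phi> \<in> borel_measurable borel"
  shows "(\<integral>\<^sup>+y. \<phi> ((norm y)\<^sup>2) \<partial>(lborel :: (real^2) measure)) = ennreal pi * (\<integral>\<^sup>+q. \<phi> q * indicator {0..} q \<partial>lborel)"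
proof -
  let ?M = "distr (lborel :: (real^2) measure) borel (\<lambda>y. (norm y)\<^sup>2)"
  let ?N = "density lborel (\<lambda>q :: real. ennreal pi * indicator {0..} q)"
  have em: "emeasure ?M {..a} = ennreal (pi * max 0 a)" for a
  proof -
    have "{y :: real^2. (norm y)\<^sup>2 \<le> a} = (if a < 0 then {} else cball 0 (sqrt a))"
      by (auto simp: real_le_rsqrt real_sqrt_le_iff real_le_lsqrt power2_eq_square not_less)
        (smt (verit) zero_le_square, smt (verit) norm_ge_zero real_sqrt_pow2 mult_mono power2_eq_square)
    moreover have "emeasure ?M {..a} = emeasure lborel {y :: real^2. (norm y)\<^sup>2 \<le> a}"
      by (subst emeasure_distr) (auto intro!: arg_cong2[where f = emeasure])
    ultimately show ?thesis
      by (auto simp: emeasure_cball unit_ball_vol_2 mult_ac max_def)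
  qed
  have en: "emeasure ?N {..a} = ennreal (pi * max 0 a)" for a
  proof -
    have "emeasure ?N {..a} = (\<integral>\<^sup>+q. ennreal pi * indicator {0..a} q \<partial>lborel)"
      by (subst emeasure_density) (auto intro!: nn_integral_cong simp: indicator_def)
    also have "\<dots> = ennreal (pi * max 0 a)"
      by (subst nn_integral_cmult) (auto simp: max_def ennreal_mult)
    finally show ?thesis .
  qed
  have "sets (sigma UNIV (range (atMost :: real \<Rightarrow> _))) = sigma_sets UNIV (range atMost)"
    by (rule sets_measure_of) simp
  then have sb: "sets (borel :: real measure) = sigma_sets UNIV (range atMost)"
    by (subst borel_eq_atMost)
  have "?M = ?N"
  proof (rule measure_eqI_generator_eq[where E = "range atMost" and \<Omega> = UNIV and A = "\<lambda>i::nat. {..real i}"])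
    show "Int_stable (range (atMost :: real \<Rightarrow> _))"
      by (auto simp: Int_stable_def)
    show "(\<Union>i::nat. {..real i}) = UNIV"
      by (auto intro: real_arch_simple)
      show "sets ?M = sigma_sets UNIV (range atMost)" "sets ?N = sigma_sets UNIV (range atMost)"
      by (simp_all only: sets_density sets_distr sets_lborel sb)
  qed (auto simp only: em en, auto)
  then have "(\<integral>\<^sup>+q. \<phi> q \<partial>?M) = (\<integral>\<^sup>+q. \<phi> q \<partial>?N)" by simp
  then show ?thesis
    by (simp add: nn_integral_distr nn_integral_density nn_integral_cmult mult_ac)
qed

text \<open>\<open>T\<close> preserves the punctured ball and commutes with the radial projection,
  so the invariance of Lebesgue measure descends to the cone measure.\<close>

lemma nn_integral_sphere_orthogonal:
  fixes F :: "(real, 'n::{finite,wellorder}) vec \<Rightarrow> ennreal" and T :: "(real, 'n) vec \<Rightarrow> (real, 'n) vec"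
  assumes [measurable]: "F \<in> borel_measurable borel" and T: "orthogonal_transformation T"
  shows "(\<integral>\<^sup>+\<beta>. F (T \<beta>) \<partial>sphere_measure) = (\<integral>\<^sup>+\<beta>. F \<beta> \<partial>sphere_measure)"
proof -
  have lin: "linear T" using T orthogonal_transformation_linear by blast
  have Tm [measurable]: "T \<in> borel_measurable borel"
    using lin by (intro borel_measurable_continuous_onI linear_continuous_on) (simp add: linear_linear)
  have nT: "norm (T x) = norm x" for x using T by (rule orthogonal_transformation_norm)
  have T0: "T x = 0 \<longleftrightarrow> x = 0" for x using nT[of x] by (metis norm_eq_zero)
  define I :: "(real, 'n) vec \<Rightarrow> ennreal" where "I = indicator (ball 0 1 - {0})"
  have [measurable]: "I \<in> borel_measurable borel"
    unfolding I_def by (intro borel_measurable_indicator) auto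
  have IT: "I (T x) = I x" for x
    by (simp add: I_def indicator_def nT T0)
  have "(\<integral>\<^sup>+x. F (T (x /\<^sub>R norm x)) * I x \<partial>lborel) = (\<integral>\<^sup>+x. F (T x /\<^sub>R norm (T x)) * I (T x) \<partial>lborel)"
    by (simp add: nT IT linear_scale[OF lin])
  also have "\<dots> = (\<integral>\<^sup>+x. F (x /\<^sub>R norm x) * I x \<partial>(distr lborel borel T))"
    by (subst nn_integral_distr) auto
  finally show ?thesis
    by (simp add: nn_integral_sphere_measure distr_lborel_orthogonal[OF T] flip: I_def)
qed

lemma nn_integral_sqrt_unit: "(\<integral>\<^sup>+m. ennreal (sqrt m) * indicator {0..1} m \<partial>lborel) = ennreal (2 / 3)"
proof -
  have "(\<integral>\<^sup>+m. ennreal (sqrt m) * indicator {0..1} m \<partial>lborel) = ennreal (2 / 3 * (sqrt 1) ^ 3 - 2 / 3 * (sqrt 0) ^ 3)"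
  proof (rule nn_integral_FTC_Icc[where F = "\<lambda>m. 2 / 3 * (sqrt m) ^ 3"])
    fix m :: real assume m: "m \<in> {0..1}"
    show "((\<lambda>m. 2 / 3 * (sqrt m) ^ 3) has_real_derivative sqrt m) (at m)"
    proof (cases "m = 0")
      case False
      then show ?thesis using m
        by (auto intro!: derivative_eq_intros simp: field_simps power2_eq_square)
    next
      case True
      \<comment> \<open>The fundamental theorem asks for a two-sided derivative at the endpoint 0.
        For negative \<open>y\<close> the root is the odd extension, so the quotient equals a
        multiple of \<open>\<bar>sqrt y\<bar>\<close> on both sides and tends to 0.\<close>
      have sqrt3: "2 / 3 * \<bar>sqrt y\<bar> = (2 / 3 * (sqrt y) ^ 3) / y" if "y \<noteq> 0" for y :: real
      proof -
        have "sqrt y * \<bar>sqrt y\<bar> = y"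
          by (cases "y \<ge> 0") (auto simp: abs_if real_sqrt_minus)
        moreover have "2 / 3 * \<bar>s\<bar> = (2 / 3 * s ^ 3) / (s * \<bar>s\<bar>)" if "s \<noteq> 0" for s :: real
          using that by (cases "s > 0") (auto simp: power3_eq_cube)
        ultimately show ?thesis
          using that by (metis real_sqrt_eq_0_iff)
      qed
      have "((\<lambda>y. (2 / 3 * (sqrt y) ^ 3) / y) \<longlongrightarrow> 0) (at 0)"
      proof (rule Lim_transform_eventually)
        show "((\<lambda>y. 2 / 3 * \<bar>sqrt y\<bar>) \<longlongrightarrow> 0) (at 0)"
          by (auto intro!: tendsto_eq_intros)
        show "\<forall>\<^sub>F y in at 0. 2 / 3 * \<bar>sqrt y\<bar> = (2 / 3 * (sqrt y) ^ 3) / y"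
          unfolding eventually_at_filter
          by (rule always_eventually) (use sqrt3 in auto)
      qed
      then show ?thesis using True by (simp add: has_field_derivative_iff)
    qed
  qed auto
  then show ?thesis by simp
qed

text \<open>Archimedes' theorem. Slice the cone over the sphere by planes orthogonal to the diameter, and use
  \<open>m = \<bar>x\<bar>\<^sup>2\<close> as the radial coordinate.\<close>

lemma nn_integral_sphere_projection:
  fixes \<psi> :: "real \<Rightarrow> ennreal" and e :: "real^3"
  assumes [measurable]: "\<psi> \<in> borel_measurable borel" and e: "norm e = 1"
  shows "(\<integral>\<^sup>+\<alpha>. \<psi> (e \<bullet> \<alpha>) \<partial>sphere_measure) = ennreal (2 * pi) * (\<integral>\<^sup>+u. \<psi> u * indicator {-1..1} u \<partial>lborel)"
proof -
  obtain T :: "real^3 \<Rightarrow> real^3" where T: "orthogonal_transformation T" "T (axis 1 1) = e"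
    using orthogonal_transformation_exists[of "axis 1 1 :: real^3" e] e by (auto simp: norm_axis_1)
  have "(\<integral>\<^sup>+\<alpha>. \<psi> (e \<bullet> \<alpha>) \<partial>sphere_measure) = (\<integral>\<^sup>+\<alpha>. \<psi> (e \<bullet> T \<alpha>) \<partial>sphere_measure)"
    by (rule nn_integral_sphere_orthogonal[OF _ T(1), symmetric]) measurable
  also have "\<dots> = (\<integral>\<^sup>+\<alpha>. \<psi> (\<alpha> $ 1) \<partial>(sphere_measure :: (real^3) measure))"
  proof (rule nn_integral_cong)
    fix \<alpha>
    have "e \<bullet> T \<alpha> = axis 1 1 \<bullet> \<alpha>"
      using T unfolding orthogonal_transformation_def by metis
    then show "\<psi> (e \<bullet> T \<alpha>) = \<psi> (\<alpha> $ 1)" by (simp add: inner_axis')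
  qed
  also have "\<dots> = 3 * (\<integral>\<^sup>+x. \<psi> ((x /\<^sub>R norm x) $ 1) * indicator (ball 0 1 - {0}) x \<partial>(lborel :: (real^3) measure))"
    by (subst nn_integral_sphere_measure) simp_all
  also have "(\<integral>\<^sup>+x. \<psi> ((x /\<^sub>R norm x) $ 1) * indicator (ball 0 1 - {0}) x \<partial>(lborel :: (real^3) measure)) =
     (\<integral>\<^sup>+z. (\<integral>\<^sup>+y. \<psi> (z / sqrt (z\<^sup>2 + (norm y)\<^sup>2)) * indicator {0<..<1} (z\<^sup>2 + (norm y)\<^sup>2) \<partial>(lborel :: (real^2) measure)) \<partial>lborel)"
  proof -
    have nm: "norm (vector [z, y $ 1, y $ 2] :: real^3) = sqrt (z\<^sup>2 + (norm y)\<^sup>2)" for z and y :: "real^2"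
      by (simp add: norm_eq_sqrt_inner inner_vec_def sum_3 sum_2 power2_eq_square add.assoc)
    have mm: "(\<lambda>x :: real^3. \<psi> ((x /\<^sub>R norm x) $ 1) * indicator (ball 0 1 - {0}) x) \<in> borel_measurable borel"
    proof -
      have [measurable]: "(indicator (ball 0 1 - {0}) :: real^3 \<Rightarrow> ennreal) \<in> borel_measurable borel"
        by (intro borel_measurable_indicator) auto
      have [measurable]: "(\<lambda>x :: real^3. x $ 1) \<in> borel_measurable borel"
        by (intro borel_measurable_continuous_onI continuous_intros)
      show ?thesis
        unfolding vector_scaleR_component by measurable
    qed
    have "\<psi> (((vector [z, y $ 1, y $ 2] :: real^3) /\<^sub>R norm (vector [z, y $ 1, y $ 2] :: real^3)) $ 1) *
      indicator (ball 0 1 - {0}) (vector [z, y $ 1, y $ 2] :: real^3) =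
      \<psi> (z / sqrt (z\<^sup>2 + (norm y)\<^sup>2)) * indicator {0<..<1} (z\<^sup>2 + (norm y)\<^sup>2)" for z and y :: "real^2"
    proof -
      have "vector [z, y $ 1, y $ 2] \<in> ball 0 1 - {0::real^3} \<longleftrightarrow> z\<^sup>2 + (norm y)\<^sup>2 \<in> {0<..<1}"
        unfolding zero_less_norm_iff[symmetric, where 'a = "real^3"] Diff_iff mem_ball dist_0_norm singleton_iff
        by (metis nm greaterThanLessThan_iff norm_le_zero_iff not_le real_sqrt_gt_0_iff real_sqrt_lt_1_iff)
      then show ?thesis
        by (simp add: nm divide_inverse mult.commute indicator_def)
    qed
    then show ?thesis
      by (subst nn_integral_lborel_vec3[OF mm]) simp
  qed
  also have "\<dots> = (\<integral>\<^sup>+z. ennreal pi * (\<integral>\<^sup>+q. \<psi> (z / sqrt (z\<^sup>2 + q)) * indicator {0<..<1} (z\<^sup>2 + q) * indicator {0..} q \<partial>lborel) \<partial>lborel)"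
    by (intro nn_integral_cong nn_integral_plane_radial) measurable
  also have "\<dots> = (\<integral>\<^sup>+z. ennreal pi * (\<integral>\<^sup>+m. \<psi> (z / sqrt m) * indicator {0<..<1} m * indicator {0..} (m - z\<^sup>2) \<partial>lborel) \<partial>lborel)"
  proof (rule nn_integral_cong, rule arg_cong2[where f = "(*)", OF refl])
    fix z :: real
    have "(\<integral>\<^sup>+m. \<psi> (z / sqrt m) * indicator {0<..<1} m * indicator {0..} (m - z\<^sup>2) \<partial>lborel) =
      ennreal \<bar>1\<bar> * (\<integral>\<^sup>+q. \<psi> (z / sqrt (z\<^sup>2 + 1 * q)) * indicator {0<..<1} (z\<^sup>2 + 1 * q) * indicator {0..} (z\<^sup>2 + 1 * q - z\<^sup>2) \<partial>lborel)"
      by (rule nn_integral_real_affine) simp_all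
    then show "(\<integral>\<^sup>+q. \<psi> (z / sqrt (z\<^sup>2 + q)) * indicator {0<..<1} (z\<^sup>2 + q) * indicator {0..} q \<partial>lborel) =
      (\<integral>\<^sup>+m. \<psi> (z / sqrt m) * indicator {0<..<1} m * indicator {0..} (m - z\<^sup>2) \<partial>lborel)"
      by simp
  qed
  also have "\<dots> = ennreal pi * (\<integral>\<^sup>+z. \<integral>\<^sup>+m. \<psi> (z / sqrt m) * indicator {0<..<1} m * indicator {0..} (m - z\<^sup>2) \<partial>lborel \<partial>lborel)"
    by (subst nn_integral_cmult) (auto simp: indicator_def)
  also have "(\<integral>\<^sup>+z. \<integral>\<^sup>+m. \<psi> (z / sqrt m) * indicator {0<..<1} m * indicator {0..} (m - z\<^sup>2) \<partial>lborel \<partial>lborel) =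
     (\<integral>\<^sup>+m. \<integral>\<^sup>+z. \<psi> (z / sqrt m) * indicator {0<..<1} m * indicator {0..} (m - z\<^sup>2) \<partial>lborel \<partial>lborel)"
    by (rule lborel_pair.Fubini') measurable
  \<comment> \<open>Scaling \<open>z = sqrt m * u\<close> decouples the height \<open>u\<close> on
    the unit sphere from the radius. What remains in \<open>m\<close> is independent of
    \<open>\<psi>\<close>, which is the uniform distribution of heights.\<close>
  also have "\<dots> = (\<integral>\<^sup>+m. ennreal (sqrt m) * indicator {0..1} m * (\<integral>\<^sup>+u. \<psi> u * indicator {-1..1} u \<partial>lborel) \<partial>lborel)"
  proof (rule nn_integral_cong_AE)
    have "(\<integral>\<^sup>+z. \<psi> (z / sqrt m) * indicator {0<..<1} m * indicator {0..} (m - z\<^sup>2) \<partial>lborel) =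
      ennreal (sqrt m) * indicator {0..1} m * (\<integral>\<^sup>+u. \<psi> u * indicator {-1..1} u \<partial>lborel)"
      if m: "m \<noteq> 0" "m \<noteq> 1" for m :: real
    proof (cases "0 < m \<and> m < 1")
      case True
      have "(\<integral>\<^sup>+z. \<psi> (z / sqrt m) * indicator {0..} (m - z\<^sup>2) \<partial>lborel) =
        ennreal \<bar>sqrt m\<bar> * (\<integral>\<^sup>+u. \<psi> ((0 + sqrt m * u) / sqrt m) * indicator {0..} (m - (0 + sqrt m * u)\<^sup>2) \<partial>lborel)"
        using True by (intro nn_integral_real_affine) simp_all
      also have "(\<integral>\<^sup>+u. \<psi> ((0 + sqrt m * u) / sqrt m) * indicator {0..} (m - (0 + sqrt m * u)\<^sup>2) \<partial>lborel) =
        (\<integral>\<^sup>+u. \<psi> u * indicator {-1..1} u \<partial>lborel)"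
        using True by (intro nn_integral_cong) (auto simp: power_mult_distrib indicator_def abs_square_le_1 abs_le_iff)
      finally show ?thesis using True by (simp add: indicator_def)
    next
      case False
      then show ?thesis using m by (auto simp: indicator_def)
    qed
    then show "AE m in lborel. (\<integral>\<^sup>+z. \<psi> (z / sqrt m) * indicator {0<..<1} m * indicator {0..} (m - z\<^sup>2) \<partial>lborel) =
      ennreal (sqrt m) * indicator {0..1} m * (\<integral>\<^sup>+u. \<psi> u * indicator {-1..1} u \<partial>lborel)"
      using AE_lborel_singleton[of "0::real"] AE_lborel_singleton[of "1::real"] by auto
  qed
  \<comment> \<open>Together with the dimension factor 3 and the disc factor \<open>pi\<close>, this
    2/3 makes \<open>2 * pi\<close>.\<close>
  also have "\<dots> = ennreal (2 / 3) * (\<integral>\<^sup>+u. \<psi> u * indicator {-1..1} u \<partial>lborel)"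
    by (subst nn_integral_multc) (auto simp: nn_integral_sqrt_unit)
  finally show ?thesis
    by (simp add: mult.assoc[symmetric] flip: ennreal_mult ennreal_numeral)
qed

lemma integral_sphere_orthogonal:
  fixes g :: "(real, 'n::{finite,wellorder}) vec \<Rightarrow> real" and T :: "(real, 'n) vec \<Rightarrow> (real, 'n) vec"
  assumes g [measurable]: "g \<in> borel_measurable borel" and T: "orthogonal_transformation T"
  shows "(\<integral>\<beta>. g (T \<beta>) \<partial>sphere_measure) = (\<integral>\<beta>. g \<beta> \<partial>sphere_measure)"
proof -
  have lin: "linear T" using T orthogonal_transformation_linear by blast
  have Tm: "T \<in> borel_measurable borel"
    using lin by (intro borel_measurable_continuous_onI linear_continuous_on) (simp add: linear_linear)
  have T1 [measurable]: "T \<in> borel_measurable sphere_measure"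
    using Tm by (rule measurable_sphere_measure)
  have I1 [measurable]: "(\<lambda>x. x) \<in> borel_measurable (sphere_measure :: (real, 'n) vec measure)"
    by (intro measurable_sphere_measure) simp
  have "distr sphere_measure borel T = distr sphere_measure borel (\<lambda>x. x)"
  proof (rule measure_eqI)
    fix A assume "A \<in> sets (distr sphere_measure borel T)"
    then have A [measurable]: "A \<in> sets borel" by simp
    have "emeasure (distr sphere_measure borel T) A = (\<integral>\<^sup>+x. indicator A (T x) \<partial>sphere_measure)"
      by (subst nn_integral_distr[symmetric, where M' = borel]) auto
    also have "\<dots> = (\<integral>\<^sup>+x. indicator A x \<partial>sphere_measure)"
      by (rule nn_integral_sphere_orthogonal[OF _ T]) simp
    also have "\<dots> = emeasure (distr sphere_measure borel (\<lambda>x. x)) A"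
      by (subst nn_integral_distr[symmetric, where M' = borel and T = "\<lambda>x. x"]) auto
    finally show "emeasure (distr sphere_measure borel T) A = emeasure (distr sphere_measure borel (\<lambda>x. x)) A" .
  qed simp
  then show ?thesis
    using integral_distr[OF T1 g] integral_distr[OF I1 g] by simp
qed

text \<open>Applied to indicators, \<open>nn_integral_polar\<close> says that Lebesgue measure is
  the image of a product measure under scaling. Both claims for signed integrands are then Fubini's
  theorem on that product.\<close>

lemma integral_polar:
  fixes F :: "'a::euclidean_space \<Rightarrow> real"
  assumes F: "integrable lborel F"
  shows "integrable lborel (\<lambda>t. (if 0 < t then t ^ (DIM('a) - 1) else 0) * (\<integral>\<beta>. F (t *\<^sub>R \<beta>) \<partial>sphere_measure))"
    and "(\<integral>x. F x \<partial>lborel) =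
      (\<integral>t. (if 0 < t then t ^ (DIM('a) - 1) else 0) * (\<integral>\<beta>. F (t *\<^sub>R \<beta>) \<partial>sphere_measure) \<partial>lborel)"
proof -
  let ?w = "\<lambda>t. (if 0 < t then t ^ (DIM('a) - 1) else 0) :: real"
  let ?D = "density lborel (\<lambda>t. ennreal (?w t))"
  let ?S = "sphere_measure :: 'a measure"
  have sf: "sigma_finite_measure ?D"
    by (rule sigma_finite_measure.sigma_finite_iff_density_finite[OF sigma_finite_lborel, THEN iffD2]) auto
  interpret D: sigma_finite_measure ?D by (rule sf)
  interpret P: pair_sigma_finite ?D ?S by standard
  have [measurable]: "F \<in> borel_measurable borel" using F by auto
  have I1 [measurable]: "(\<lambda>x. x) \<in> borel_measurable ?S"
    by (intro measurable_sphere_measure) simp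
  have c [measurable]: "(\<lambda>p. fst p *\<^sub>R snd p) \<in> borel_measurable (?D \<Otimes>\<^sub>M ?S)"
  proof -
    have "(\<lambda>p. snd p) \<in> borel_measurable (?D \<Otimes>\<^sub>M ?S)"
      using measurable_compose[OF measurable_snd I1] by simp
    moreover have "(\<lambda>p. fst p) \<in> borel_measurable (?D \<Otimes>\<^sub>M ?S)"
      using measurable_fst[of ?D ?S] by (simp cong: measurable_cong_sets)
    ultimately show ?thesis by (intro borel_measurable_scaleR)
  qed
  have w: "ennreal (?w t) * x = ennreal (t ^ (DIM('a) - 1)) * indicator {0<..} t * x" for t x
    by (simp add: indicator_def)
  have eq: "distr (?D \<Otimes>\<^sub>M ?S) borel (\<lambda>p. fst p *\<^sub>R snd p) = lborel"
  proof (rule measure_eqI)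
    fix A assume "A \<in> sets (distr (?D \<Otimes>\<^sub>M ?S) borel (\<lambda>p. fst p *\<^sub>R snd p))"
    then have A [measurable]: "A \<in> sets borel" by simp
    have "emeasure (distr (?D \<Otimes>\<^sub>M ?S) borel (\<lambda>p. fst p *\<^sub>R snd p)) A =
      (\<integral>\<^sup>+p. indicator A (fst p *\<^sub>R snd p) \<partial>(?D \<Otimes>\<^sub>M ?S))"
      by (subst nn_integral_distr[symmetric, OF c]) auto
    also have "\<dots> = (\<integral>\<^sup>+t. \<integral>\<^sup>+\<beta>. indicator A (t *\<^sub>R \<beta>) \<partial>?S \<partial>?D)"
      by (subst sphere_measure.nn_integral_fst[symmetric]) auto
    also have "\<dots> = (\<integral>\<^sup>+t. ennreal (?w t) * (\<integral>\<^sup>+\<beta>. indicator A (t *\<^sub>R \<beta>) \<partial>?S) \<partial>lborel)"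
    proof (rule nn_integral_density)
      have "(\<lambda>t. \<integral>\<^sup>+\<beta>. indicator A (fst (t, \<beta>) *\<^sub>R snd (t, \<beta>)) \<partial>?S) \<in> borel_measurable ?D"
        by (rule sphere_measure.borel_measurable_nn_integral_fst) measurable
      then show "(\<lambda>t. \<integral>\<^sup>+\<beta>. indicator A (t *\<^sub>R \<beta>) \<partial>?S) \<in> borel_measurable lborel" by simp
    qed simp
    also have "\<dots> = emeasure lborel A"
      using nn_integral_polar[of "indicator A :: 'a \<Rightarrow> ennreal"] by (simp add: w)
    finally show "emeasure (distr (?D \<Otimes>\<^sub>M ?S) borel (\<lambda>p. fst p *\<^sub>R snd p)) A = emeasure lborel A" .
  qed simp
  have "integrable (distr (?D \<Otimes>\<^sub>M ?S) borel (\<lambda>p. fst p *\<^sub>R snd p)) F"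
    using F eq by simp
  then have i: "integrable (?D \<Otimes>\<^sub>M ?S) (\<lambda>p. F (fst p *\<^sub>R snd p))"
    by (subst (asm) integrable_distr_eq) auto
  have m: "(\<lambda>t. \<integral>\<beta>. F (t *\<^sub>R \<beta>) \<partial>?S) \<in> borel_measurable lborel"
    using P.integrable_fst'[OF i] by (auto dest: borel_measurable_integrable)
  have "integrable ?D (\<lambda>t. \<integral>\<beta>. F (t *\<^sub>R \<beta>) \<partial>?S)"
    using P.integrable_fst'[OF i] by simp
  then show "integrable lborel (\<lambda>t. ?w t * (\<integral>\<beta>. F (t *\<^sub>R \<beta>) \<partial>?S))"
    using m by (subst (asm) integrable_density) auto
  have "(\<integral>x. F x \<partial>lborel) = (\<integral>p. F (fst p *\<^sub>R snd p) \<partial>(?D \<Otimes>\<^sub>M ?S))"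
    by (subst eq[symmetric], subst integral_distr) auto
  also have "\<dots> = (\<integral>t. \<integral>\<beta>. F (t *\<^sub>R \<beta>) \<partial>?S \<partial>?D)"
    using P.integral_fst'[OF i] by simp
  also have "\<dots> = (\<integral>t. ?w t * (\<integral>\<beta>. F (t *\<^sub>R \<beta>) \<partial>?S) \<partial>lborel)"
    using m by (subst integral_density) auto
  finally show "(\<integral>x. F x \<partial>lborel) = (\<integral>t. ?w t * (\<integral>\<beta>. F (t *\<^sub>R \<beta>) \<partial>?S) \<partial>lborel)" .
qed

lemma emeasure_sphere_slab:
  fixes y :: "real^3"
  assumes y: "y \<noteq> 0"
  shows "emeasure sphere_measure {\<alpha> \<in> sphere 0 1. y \<bullet> \<alpha> \<in> {a<..<b}} =
    ennreal (2 * pi) * emeasure lborel ({a / norm y<..<b / norm y} \<inter> {-1..1})"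
proof -
  let ?e = "y /\<^sub>R norm y"
  have e: "norm ?e = 1" using y by simp
  have "emeasure sphere_measure {\<alpha> \<in> sphere 0 1. y \<bullet> \<alpha> \<in> {a<..<b}} =
    (\<integral>\<^sup>+\<alpha>. indicator {\<alpha> \<in> sphere 0 1. y \<bullet> \<alpha> \<in> {a<..<b}} \<alpha> \<partial>sphere_measure)"
  proof (rule nn_integral_indicator[symmetric])
    have "{\<alpha> \<in> space sphere_measure. (y \<bullet> \<alpha>) \<in> {a<..<b}} \<in> sets sphere_measure"
      by measurable
    then show "{\<alpha> \<in> sphere 0 1. y \<bullet> \<alpha> \<in> {a<..<b}} \<in> sets sphere_measure" by simp
  qed
  also have "\<dots> = (\<integral>\<^sup>+\<alpha>. indicator {a / norm y<..<b / norm y} (?e \<bullet> \<alpha>) \<partial>sphere_measure)"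
    using y by (intro nn_integral_cong) (auto simp: indicator_def field_simps)
  also have "\<dots> = ennreal (2 * pi) * (\<integral>\<^sup>+u. indicator {a / norm y<..<b / norm y} u * indicator {-1..1} u \<partial>lborel)"
    by (rule nn_integral_sphere_projection[OF _ e]) simp
  also have "(\<integral>\<^sup>+u. indicator {a / norm y<..<b / norm y} u * indicator {-1..1} u \<partial>lborel) =
    (\<integral>\<^sup>+u. indicator ({a / norm y<..<b / norm y} \<inter> {-1..1}) u \<partial>lborel)"
    by (intro nn_integral_cong) (auto simp: indicator_def)
  finally show ?thesis by simp
qed

text \<open>Cutting the slab off at the heights that occur on the sphere can only lose measure, and
  it loses none when both faces still meet the sphere.\<close>

lemma measure_sphere_slab:
  fixes y :: "real^3"
  assumes y: "y \<noteq> 0" and ab: "a \<le> b"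
  shows "measure sphere_measure {\<alpha> \<in> sphere 0 1. y \<bullet> \<alpha> \<in> {a<..<b}} \<le> 2 * pi * (b - a) / norm y" (is ?le)
    and "- norm y \<le> a \<Longrightarrow> b \<le> norm y \<Longrightarrow>
      measure sphere_measure {\<alpha> \<in> sphere 0 1. y \<bullet> \<alpha> \<in> {a<..<b}} = 2 * pi * (b - a) / norm y" (is "_ \<Longrightarrow> _ \<Longrightarrow> ?eq")
proof -
  let ?I = "{a / norm y<..<b / norm y}"
  have I: "emeasure lborel ?I = ennreal ((b - a) / norm y)"
    using y ab by (simp add: divide_right_mono diff_divide_distrib)
  have "emeasure lborel (?I \<inter> {-1..1}) \<le> ennreal ((b - a) / norm y)"
    unfolding I[symmetric] by (intro emeasure_mono) auto
  then have "emeasure sphere_measure {\<alpha> \<in> sphere 0 1. y \<bullet> \<alpha> \<in> {a<..<b}} \<le> ennreal (2 * pi) * ennreal ((b - a) / norm y)"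
    unfolding emeasure_sphere_slab[OF y] by (intro mult_left_mono) auto
  also have "\<dots> = ennreal (2 * pi * (b - a) / norm y)"
    using ab by (simp flip: ennreal_mult)
  finally show ?le
    using ab unfolding measure_def by (intro enn2real_leI) auto
  assume *: "- norm y \<le> a" "b \<le> norm y"
  have "?I \<inter> {-1..1} = ?I"
  proof -
    have "-1 \<le> a / norm y" "b / norm y \<le> 1" using * y by (auto simp: field_simps)
    then show ?thesis by auto
  qed
  then have "emeasure sphere_measure {\<alpha> \<in> sphere 0 1. y \<bullet> \<alpha> \<in> {a<..<b}} = ennreal (2 * pi) * ennreal ((b - a) / norm y)"
    using emeasure_sphere_slab[OF y] I by simp
  also have "\<dots> = ennreal (2 * pi * (b - a) / norm y)"
    using ab by (simp flip: ennreal_mult)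
  finally show ?eq
    using ab by (simp add: measure_def)
qed

section \<open>Differentiation under the integral sign\<close>

text \<open>On the convex set \<open>X\<close> the bound on the derivatives makes every
  \<open>F y w\<close> Lipschitz in \<open>y\<close> with the same constant. The normalised
  remainders are then dominated by the constant \<open>2 * B\<close>, which is integrable because
  \<open>M\<close> is finite.\<close>

lemma has_derivative_lebesgue_integral:
  fixes F :: "'a::real_normed_vector \<Rightarrow> 'b \<Rightarrow> real"
  assumes M: "finite_measure M" and X: "open X" "convex X" "x \<in> X"
    and meas: "\<And>y. y \<in> X \<Longrightarrow> F y \<in> borel_measurable M"
    and int: "integrable M (F x)"
    and der: "\<And>y w. y \<in> X \<Longrightarrow> w \<in> space M \<Longrightarrow> ((\<lambda>y. F y w) has_derivative F' y w) (at y)"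
    and bd: "\<And>y w. y \<in> X \<Longrightarrow> w \<in> space M \<Longrightarrow> onorm (F' y w) \<le> B"
  shows "((\<lambda>y. \<integral>w. F y w \<partial>M) has_derivative (\<lambda>v. \<integral>w. F' x w v \<partial>M)) (at x)"
    and "integrable M (\<lambda>w. F' x w v)"
proof -
  interpret finite_measure M by (rule M)
  have lin: "bounded_linear (F' y w)" if "y \<in> X" "w \<in> space M" for y w
    using der[OF that] by (rule has_derivative_bounded_linear)
  have F'b: "\<bar>F' y w v\<bar> \<le> B * norm v" if "y \<in> X" "w \<in> space M" for y w v
    using onorm[OF lin[OF that], of v] bd[OF that] mult_right_mono[OF bd[OF that], of "norm v"] by simp
  have lip: "\<bar>F y w - F x w\<bar> \<le> B * norm (y - x)" if "y \<in> X" "w \<in> space M" for y w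
  proof -
    have "norm (F y w - F x w) \<le> B * norm (y - x)"
      using X that der bd
      by (intro differentiable_bound[where f = "\<lambda>y. F y w" and S = X and f' = "\<lambda>y. F' y w"])
        (auto intro: has_derivative_at_withinI)
    then show ?thesis by simp
  qed
  have Fint: "integrable M (F y)" if y: "y \<in> X" for y
  proof -
    have "integrable M (\<lambda>w. F y w - F x w)"
      using lip[OF y] meas[OF y] int
      by (intro integrable_const_bound[where B = "B * norm (y - x)"]) auto
    then have "integrable M (\<lambda>w. (F y w - F x w) + F x w)"
      using int by (rule Bochner_Integration.integrable_add)
    then show ?thesis by simp
  qed
  \<comment> \<open>Measurability of the derivative in \<open>w\<close> is obtained by writing it as
    a pointwise limit of difference quotients along \<open>1 / (n + N)\<close>; \<open>N\<close> is
    chosen so that all the points lie in a ball inside \<open>X\<close>.\<close>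
  have F'int: "integrable M (\<lambda>w. F' x w v)" for v
  proof -
    obtain d where d: "d > 0" "ball x d \<subseteq> X" using X open_contains_ball by blast
    obtain N :: nat where N: "norm v / d < real N" using reals_Archimedean2 by blast
    have N0: "N > 0" using N d by (metis divide_nonneg_pos less_le_trans norm_ge_zero not_less of_nat_0 gr0I)
    let ?h = "\<lambda>n::nat. 1 / real (n + N)"
    have inX: "x + ?h n *\<^sub>R v \<in> X" for n
    proof -
      have "norm v < d * real N" using N d by (simp add: field_simps)
      also have "\<dots> \<le> d * real (n + N)" using d by simp
      finally have "norm (?h n *\<^sub>R v) < d" using N0 by (simp add: field_simps)
      then show ?thesis using d by (auto simp: dist_norm subset_eq)
    qed
    have "(\<lambda>w. F' x w v) \<in> borel_measurable M"
    proof (rule borel_measurable_LIMSEQ_real)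
      fix w assume w: "w \<in> space M"
      have h0: "?h \<longlonglongrightarrow> 0"
        using LIMSEQ_ignore_initial_segment[OF lim_1_over_n, of N] by simp
      have "filterlim ?h (at 0) sequentially"
        unfolding filterlim_at using h0 N0 by simp
      moreover have "((\<lambda>h. (F (x + h *\<^sub>R v) w - F x w) / h) \<longlongrightarrow> F' x w v) (at 0)"
      proof -
        have a: "((\<lambda>h::real. x + h *\<^sub>R v) has_derivative (\<lambda>h. h *\<^sub>R v)) (at 0)"
          by (auto intro!: derivative_eq_intros)
        have "((\<lambda>h::real. F (x + h *\<^sub>R v) w) has_derivative (\<lambda>h. F' x w (h *\<^sub>R v))) (at 0)"
          using has_derivative_compose[OF a, of "\<lambda>y. F y w" "F' x w"] der[OF X(3) w] by simp
        moreover have "(\<lambda>h. F' x w (h *\<^sub>R v)) = (*) (F' x w v)"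
          using linear_scale[OF bounded_linear.linear[OF lin[OF X(3) w]]] by (auto simp: mult.commute)
        ultimately have "((\<lambda>h::real. F (x + h *\<^sub>R v) w) has_field_derivative F' x w v) (at 0)"
          by (simp add: has_field_derivative_def)
        then show ?thesis by (simp add: has_field_derivative_iff)
      qed
      ultimately show "(\<lambda>n. (F (x + ?h n *\<^sub>R v) w - F x w) / ?h n) \<longlonglongrightarrow> F' x w v"
        by (rule filterlim_compose[rotated])
    next
      fix n show "(\<lambda>w. (F (x + ?h n *\<^sub>R v) w - F x w) / ?h n) \<in> borel_measurable M"
        using meas[OF inX] meas[OF X(3)] by measurable
    qed
    then show ?thesis
      using F'b[OF X(3)] by (intro integrable_const_bound[where B = "B * norm v"]) auto
  qed
  then show "integrable M (\<lambda>w. F' x w v)" .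
  show "((\<lambda>y. \<integral>w. F y w \<partial>M) has_derivative (\<lambda>v. \<integral>w. F' x w v \<partial>M)) (at x)"
    unfolding has_derivative_iff_norm
  proof (intro conjI)
    show "bounded_linear (\<lambda>v. \<integral>w. F' x w v \<partial>M)"
    proof (rule bounded_linear_intro)
      fix u v and c :: real
      show "(\<integral>w. F' x w (u + v) \<partial>M) = (\<integral>w. F' x w u \<partial>M) + (\<integral>w. F' x w v \<partial>M)"
        unfolding Bochner_Integration.integral_add[OF F'int F'int, symmetric]
        by (intro Bochner_Integration.integral_cong) (auto simp: linear_add[OF bounded_linear.linear[OF lin[OF X(3)]]])
      have "(\<integral>w. F' x w (c *\<^sub>R v) \<partial>M) = (\<integral>w. c * F' x w v \<partial>M)"
        by (intro Bochner_Integration.integral_cong) (auto simp: linear_scale[OF bounded_linear.linear[OF lin[OF X(3)]]])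
      then show "(\<integral>w. F' x w (c *\<^sub>R v) \<partial>M) = c *\<^sub>R (\<integral>w. F' x w v \<partial>M)" by simp
      have "\<bar>\<integral>w. F' x w v \<partial>M\<bar> \<le> (\<integral>w. \<bar>F' x w v\<bar> \<partial>M)" by (rule integral_abs_bound)
      also have "\<dots> \<le> (\<integral>w. B * norm v \<partial>M)"
        using F'int F'b[OF X(3)] by (intro integral_mono) auto
      finally show "norm (\<integral>w. F' x w v \<partial>M) \<le> norm v * (B * measure M (space M))"
        by (simp add: mult_ac)
    qed
    let ?q = "\<lambda>y w. (F y w - F x w - F' x w (y - x)) / norm (y - x)"
    have lim: "((\<lambda>y. \<integral>w. ?q y w \<partial>M) \<longlongrightarrow> 0) (at x)"
    proof (subst tendsto_at_iff_sequentially, intro allI impI)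
      fix S :: "nat \<Rightarrow> 'a" assume S: "\<forall>i. S i \<in> UNIV - {x}" "S \<longlonglongrightarrow> x"
      have "eventually (\<lambda>i. S i \<in> X) sequentially"
        using S(2) X topological_tendstoD by blast
      then obtain N where N: "\<And>i. i \<ge> N \<Longrightarrow> S i \<in> X" by (auto simp: eventually_sequentially)
      have Sn: "S i \<noteq> x" for i using S by auto
      have "(\<lambda>i. \<integral>w. ?q (S (i + N)) w \<partial>M) \<longlonglongrightarrow> (\<integral>w. 0 \<partial>M)"
      proof (rule integral_dominated_convergence[where w = "\<lambda>_. 2 * B"])
        show "AE w in M. norm (?q (S (i + N)) w) \<le> 2 * B" for i
        proof (rule AE_I2)
          fix w assume w: "w \<in> space M"
          have "\<bar>F (S (i + N)) w - F x w - F' x w (S (i + N) - x)\<bar> \<le> 2 * B * norm (S (i + N) - x)"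
            using lip[OF N w, of "i + N"] F'b[OF X(3) w, of "S (i + N) - x"] by simp
          then show "norm (?q (S (i + N)) w) \<le> 2 * B" using Sn[of "i + N"] by (simp add: field_simps)
        qed
        show "AE w in M. (\<lambda>i. ?q (S (i + N)) w) \<longlonglongrightarrow> 0"
        proof (rule AE_I2)
          fix w assume w: "w \<in> space M"
          have "((\<lambda>y. norm (?q y w)) \<longlongrightarrow> 0) (at x)"
            using der[OF X(3) w] by (simp add: has_derivative_iff_norm)
          then have "((\<lambda>y. ?q y w) \<longlongrightarrow> 0) (at x)" by (rule tendsto_norm_zero_cancel)
          then have "(\<lambda>i. ?q (S i) w) \<longlonglongrightarrow> 0"
            using S unfolding tendsto_at_iff_sequentially o_def by blast
          then show "(\<lambda>i. ?q (S (i + N)) w) \<longlonglongrightarrow> 0" by (rule LIMSEQ_ignore_initial_segment)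
        qed
        show "(\<lambda>w. ?q (S (i + N)) w) \<in> borel_measurable M" for i
          using Fint[OF N, of "i + N"] Fint[OF X(3)] F'int by simp
      qed auto
      then have "(\<lambda>i. \<integral>w. ?q (S i) w \<partial>M) \<longlonglongrightarrow> (\<integral>w. 0 \<partial>M)"
        by (rule LIMSEQ_offset)
      then show "((\<lambda>y. \<integral>w. ?q y w \<partial>M) \<circ> S) \<longlonglongrightarrow> 0" by (simp add: o_def)
    qed
    show "((\<lambda>y. norm ((\<integral>w. F y w \<partial>M) - (\<integral>w. F x w \<partial>M) - (\<integral>w. F' x w (y - x) \<partial>M)) / norm (y - x)) \<longlongrightarrow> 0) (at x)"
    proof (rule Lim_transform_eventually[OF tendsto_norm_zero[OF lim]])
      have "eventually (\<lambda>y. y \<in> X) (at x)"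
        using X by (auto simp: eventually_at_topological)
      then show "\<forall>\<^sub>F y in at x. norm (\<integral>w. ?q y w \<partial>M) =
        norm ((\<integral>w. F y w \<partial>M) - (\<integral>w. F x w \<partial>M) - (\<integral>w. F' x w (y - x) \<partial>M)) / norm (y - x)"
      proof eventually_elim
        case (elim y)
        show ?case
          using Fint[OF elim] Fint[OF X(3)] F'int by simp
      qed
    qed
  qed
qed

lemma has_real_derivative_lebesgue_integral:
  fixes F :: "real \<Rightarrow> 'b \<Rightarrow> real"
  assumes M: "finite_measure M" and X: "open X" "convex X" "x \<in> X"
    and meas: "\<And>y. y \<in> X \<Longrightarrow> F y \<in> borel_measurable M"
    and int: "integrable M (F x)"
    and der: "\<And>y w. y \<in> X \<Longrightarrow> w \<in> space M \<Longrightarrow> ((\<lambda>y. F y w) has_real_derivative F' y w) (at y)"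
    and bd: "\<And>y w. y \<in> X \<Longrightarrow> w \<in> space M \<Longrightarrow> \<bar>F' y w\<bar> \<le> B"
  shows "((\<lambda>y. \<integral>w. F y w \<partial>M) has_real_derivative (\<integral>w. F' x w \<partial>M)) (at x)"
    and "integrable M (F' x)"
proof -
  have o: "onorm ((*) (F' y w)) \<le> B" if "y \<in> X" "w \<in> space M" for y w
    by (rule onorm_le) (use bd[OF that] in \<open>auto simp: abs_mult intro!: mult_right_mono\<close>)
  note d = has_derivative_lebesgue_integral[where F = F and X = X and M = M and x = x and F' = "\<lambda>y w. (*) (F' y w)" and B = B, OF M X meas int]
  have "((\<lambda>y. \<integral>w. F y w \<partial>M) has_derivative (\<lambda>v. \<integral>w. F' x w * v \<partial>M)) (at x)"
    by (rule d) (use der o in \<open>auto simp: has_field_derivative_def\<close>)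
  then show "((\<lambda>y. \<integral>w. F y w \<partial>M) has_real_derivative (\<integral>w. F' x w \<partial>M)) (at x)"
    by (simp add: has_field_derivative_def)
  have "integrable M (\<lambda>w. F' x w * 1)"
    by (rule d) (use der o in \<open>auto simp: has_field_derivative_def\<close>)
  then show "integrable M (F' x)" by simp
qed

section \<open>Spherical means\<close>

abbreviation dir_deriv :: "('a::real_normed_vector \<Rightarrow> real) \<Rightarrow> 'a \<Rightarrow> 'a \<Rightarrow> real" where
  "dir_deriv f v \<equiv> (\<lambda>x. frechet_derivative f (at x) v)"

text \<open>Boundedness of the set where \<open>f\<close> is not zero stands for compact support: in
  a Euclidean space its closure is then compact.\<close>

definition test_fun :: "('a::euclidean_space \<Rightarrow> real) \<Rightarrow> bool" where
  "test_fun f \<longleftrightarrow> C_infinity f \<and> bounded {x. f x \<noteq> 0}"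

lemma C_infinity_has_derivative:
  assumes "C_infinity f"
  shows "(f has_derivative frechet_derivative f (at x)) (at x)"
proof -
  have "C_k (Suc 0) f" using assms unfolding C_infinity_def by blast
  then show ?thesis by (simp add: frechet_derivative_works)
qed

lemma C_infinity_dir_deriv: "C_infinity f \<Longrightarrow> C_infinity (dir_deriv f v)"
  unfolding C_infinity_def using C_k.simps(2) by blast

lemma C_infinity_continuous: "C_infinity f \<Longrightarrow> continuous_on UNIV f"
  unfolding C_infinity_def by (metis C_k.simps(1))

lemma frechet_derivative_add:
  assumes "f differentiable at x" "g differentiable at x"
  shows "frechet_derivative (\<lambda>x. f x + g x) (at x) = (\<lambda>v. frechet_derivative f (at x) v + frechet_derivative g (at x) v)"
proof -
  have "(f has_derivative frechet_derivative f (at x)) (at x)" "(g has_derivative frechet_derivative g (at x)) (at x)"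
    using assms frechet_derivative_works by blast+
  then show ?thesis
    by (rule frechet_derivative_at[OF has_derivative_add, symmetric])
qed

lemma C_k_add: "C_k k f \<Longrightarrow> C_k k g \<Longrightarrow> C_k k (\<lambda>x. f x + g x)"
proof (induction k arbitrary: f g)
  case 0
  then show ?case by (auto intro: continuous_on_add)
next
  case (Suc k)
  then show ?case
    by (auto intro!: differentiable_add simp: frechet_derivative_add)
qed

lemma frechet_derivative_cmult:
  fixes f :: "'a::real_normed_vector \<Rightarrow> real"
  assumes "f differentiable at x"
  shows "frechet_derivative (\<lambda>x. c * f x) (at x) = (\<lambda>v. c * frechet_derivative f (at x) v)"
proof -
  have "(f has_derivative frechet_derivative f (at x)) (at x)"
    using assms frechet_derivative_works by blast
  then show ?thesis
    by (rule frechet_derivative_at[OF has_derivative_mult_right, symmetric])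
qed

lemma C_k_cmult:
  fixes f :: "'a::real_normed_vector \<Rightarrow> real"
  shows "C_k k f \<Longrightarrow> C_k k (\<lambda>x. c * f x)"
proof (induction k arbitrary: f)
  case 0
  then show ?case by (auto intro: continuous_on_mult_left)
next
  case (Suc k)
  then show ?case
    by (auto intro!: differentiable_mult simp: frechet_derivative_cmult)
qed

lemma C_k_sum:
  fixes f :: "'i \<Rightarrow> 'a::real_normed_vector \<Rightarrow> real"
  shows "finite I \<Longrightarrow> (\<And>i. i \<in> I \<Longrightarrow> C_k k (f i)) \<Longrightarrow> C_k k (\<lambda>x. \<Sum>i\<in>I. f i x)"
proof (induction I rule: finite_induct)
  case empty
  have "C_k k (\<lambda>x::'a. 0 :: real)"
    by (induction k) auto
  then show ?case by simp
qed (auto intro: C_k_add)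

lemma test_fun_dir_deriv:
  fixes f :: "'a::euclidean_space \<Rightarrow> real"
  assumes "test_fun f"
  shows "test_fun (dir_deriv f v)"
proof -
  have "dir_deriv f v x = 0" if x: "x \<notin> closure {x. f x \<noteq> 0}" for x
  proof -
    have o: "open (- closure {x. f x \<noteq> 0})" by (rule open_Compl) (rule closed_closure)
    have "((\<lambda>_. 0) has_derivative (\<lambda>_. 0)) (at x)" by simp
    then have "(f has_derivative (\<lambda>_. 0)) (at x)"
      by (rule has_derivative_transform_within_open[OF _ o])
        (use x closure_subset[of "{x. f x \<noteq> 0}"] in auto)
    then have "(\<lambda>_. 0) = frechet_derivative f (at x)" by (rule frechet_derivative_at)
    then show ?thesis by (rule fun_cong[symmetric])
  qed
  then have "{x. dir_deriv f v x \<noteq> 0} \<subseteq> closure {x. f x \<noteq> 0}" by blast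
  then have "bounded {x. dir_deriv f v x \<noteq> 0}"
    using assms bounded_closure bounded_subset unfolding test_fun_def by blast
  then show ?thesis
    using assms C_infinity_dir_deriv unfolding test_fun_def by blast
qed

lemma test_fun_add: "test_fun f \<Longrightarrow> test_fun g \<Longrightarrow> test_fun (\<lambda>x. f x + g x)"
  unfolding test_fun_def C_infinity_def
  by (auto intro: C_k_add bounded_subset[of "{x. f x \<noteq> 0} \<union> {x. g x \<noteq> 0}"])

lemma test_fun_sum:
  fixes f :: "'i \<Rightarrow> 'a::euclidean_space \<Rightarrow> real"
  shows "finite I \<Longrightarrow> (\<And>i. i \<in> I \<Longrightarrow> test_fun (f i)) \<Longrightarrow> test_fun (\<lambda>x. \<Sum>i\<in>I. f i x)"
proof (induction I rule: finite_induct)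
  case empty
  have "C_k k (\<lambda>x::'a. 0 :: real)" for k
    by (induction k) auto
  then show ?case by (simp add: test_fun_def C_infinity_def)
qed (auto intro: test_fun_add)

lemma test_fun_continuous: "test_fun f \<Longrightarrow> continuous_on UNIV f"
  unfolding test_fun_def by (blast intro: C_infinity_continuous)

lemma test_fun_has_derivative: "test_fun f \<Longrightarrow> (f has_derivative frechet_derivative f (at x)) (at x)"
  unfolding test_fun_def by (blast intro: C_infinity_has_derivative)

lemma test_fun_measurable [measurable_dest]: "test_fun f \<Longrightarrow> f \<in> borel_measurable borel"
  by (intro borel_measurable_continuous_onI test_fun_continuous)

lemma test_fun_bounded:
  fixes f :: "'a::euclidean_space \<Rightarrow> real"
  assumes "test_fun f"
  obtains B where "B > 0" "\<And>x. \<bar>f x\<bar> \<le> B"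
proof -
  obtain R where R: "\<And>x. f x \<noteq> 0 \<Longrightarrow> norm x \<le> R"
    using assms unfolding test_fun_def bounded_iff by auto
  have "compact (f ` cball 0 R)"
    using continuous_on_subset[OF test_fun_continuous[OF assms]] by (intro compact_continuous_image) auto
  then obtain B where B: "B > 0" "\<forall>y\<in>f ` cball 0 R. norm y \<le> B"
    using compact_imp_bounded bounded_pos by metis
  have "\<bar>f x\<bar> \<le> B" for x
    using R[of x] B by (cases "f x = 0") auto
  then show ?thesis using that B by blast
qed

abbreviation pd :: "'n::finite \<Rightarrow> (real^'n \<Rightarrow> real) \<Rightarrow> real^'n \<Rightarrow> real" where
  "pd i f \<equiv> dir_deriv f (axis i 1)"

text \<open>\<open>C_k\<close> speaks about one fixed direction at a time. A direction that moves
  with the point of integration is reduced here to the finitely many axes, for which the regularity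
  results are available.\<close>

lemma dir_deriv_expansion:
  fixes f :: "real^'n \<Rightarrow> real"
  assumes "f differentiable at x"
  shows "dir_deriv f v x = (\<Sum>i\<in>UNIV. v $ i * pd i f x)"
proof -
  have lin: "linear (frechet_derivative f (at x))"
    using assms linear_frechet_derivative by blast
  have "frechet_derivative f (at x) v = frechet_derivative f (at x) (\<Sum>i\<in>UNIV. v $ i *\<^sub>R axis i 1)"
    using basis_expansion[of v] by (simp add: scalar_mult_eq_scaleR)
  also have "\<dots> = (\<Sum>i\<in>UNIV. v $ i * pd i f x)"
    by (simp add: linear_sum[OF lin] linear_scale[OF lin])
  finally show ?thesis .
qed

lemma test_fun_differentiable: "test_fun f \<Longrightarrow> f differentiable at x"
  using test_fun_has_derivative differentiable_def by blast

lemma test_fun_derivative_bounded: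
  fixes f :: "real^'n \<Rightarrow> real"
  assumes f: "test_fun f"
  obtains B where "B > 0" "\<And>x v. \<bar>dir_deriv f v x\<bar> \<le> B * norm v"
proof -
  have "\<exists>B. \<forall>i. B i > 0 \<and> (\<forall>x. \<bar>pd i f x\<bar> \<le> B i)"
  proof (rule choice, rule allI)
    fix i
    obtain C where "C > 0" "\<And>x. \<bar>pd i f x\<bar> \<le> C"
      using test_fun_bounded[OF test_fun_dir_deriv[OF f, of "axis i 1"]] by blast
    then show "\<exists>C. C > 0 \<and> (\<forall>x. \<bar>pd i f x\<bar> \<le> C)" by blast
  qed
  then obtain B where B: "\<And>i. B i > 0" "\<And>i x. \<bar>pd i f x\<bar> \<le> B i" by blast
  have "\<bar>dir_deriv f v x\<bar> \<le> (\<Sum>i\<in>UNIV. B i) * norm v" for x v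
  proof -
    have "\<bar>dir_deriv f v x\<bar> \<le> (\<Sum>i\<in>UNIV. \<bar>v $ i * pd i f x\<bar>)"
      by (subst dir_deriv_expansion[OF test_fun_differentiable[OF f]]) (rule sum_abs)
    also have "\<dots> \<le> (\<Sum>i\<in>UNIV. norm v * B i)"
      using B component_le_norm_cart[of v] by (intro sum_mono) (simp add: abs_mult mult_mono)
    finally show ?thesis by (simp add: sum_distrib_left mult.commute)
  qed
  moreover have "(\<Sum>i\<in>UNIV. B i) > 0" using B by (intro sum_pos) auto
  ultimately show ?thesis using that by blast
qed

section \<open>Weighted spherical means and their derivatives\<close>

text \<open>The weight closes the family under differentiation: a derivative in the radius brings
  down a factor \<open>\<beta> $ i\<close>, a derivative in a scaled centre a constant.\<close>

definition sph_mean :: "(real^'n \<Rightarrow> real) \<Rightarrow> (real^'n \<Rightarrow> real) \<Rightarrow> real^'n \<Rightarrow> real \<Rightarrow> real" where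
  "sph_mean w f a t = (\<integral>\<beta>. w \<beta> * f (a + t *\<^sub>R \<beta>) \<partial>sphere_measure)"

lemma weight_bounded:
  fixes w :: "real^'n \<Rightarrow> real"
  assumes "continuous_on UNIV w"
  obtains B where "B > 0" "\<And>\<beta>. \<beta> \<in> sphere 0 1 \<Longrightarrow> \<bar>w \<beta>\<bar> \<le> B"
proof -
  have "compact (w ` sphere 0 1)"
    using continuous_on_subset[OF assms] by (intro compact_continuous_image) auto
  then obtain B where "B > 0" "\<forall>y\<in>w ` sphere 0 1. norm y \<le> B"
    using compact_imp_bounded bounded_pos by metis
  then show ?thesis using that by auto
qed

lemma sphere_integrable:
  fixes g :: "'a::euclidean_space \<Rightarrow> real"
  assumes "continuous_on UNIV g"
  shows "integrable sphere_measure g"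
proof -
  have "compact (g ` sphere 0 1)"
    using continuous_on_subset[OF assms] by (intro compact_continuous_image) auto
  then obtain B where "B > 0" "\<forall>y\<in>g ` sphere 0 1. norm y \<le> B"
    using compact_imp_bounded bounded_pos by metis
  moreover have "g \<in> borel_measurable sphere_measure"
    using assms by (intro measurable_sphere_measure borel_measurable_continuous_onI)
  ultimately show ?thesis
    by (intro sphere_measure.integrable_const_bound[where B = B]) auto
qed

lemma sph_mean_continuous_integrand:
  assumes "continuous_on UNIV w" "test_fun f"
  shows "continuous_on UNIV (\<lambda>\<beta>. w \<beta> * f (a + t *\<^sub>R \<beta>))"
  by (intro continuous_intros assms(1) continuous_on_compose2[OF test_fun_continuous[OF assms(2)]]) auto

lemma sph_mean_integrable:
  assumes "continuous_on UNIV w" "test_fun f"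
  shows "integrable sphere_measure (\<lambda>\<beta>. w \<beta> * f (a + t *\<^sub>R \<beta>))"
  using assms by (intro sphere_integrable sph_mean_continuous_integrand)

lemma sph_mean_bounded:
  fixes f :: "real^'n \<Rightarrow> real"
  assumes w: "continuous_on UNIV w" and f: "test_fun f"
  obtains B where "B > 0" "\<And>a t. \<bar>sph_mean w f a t\<bar> \<le> B"
proof -
  obtain W where W: "W > 0" "\<And>\<beta>. \<beta> \<in> sphere 0 1 \<Longrightarrow> \<bar>w \<beta>\<bar> \<le> W" using weight_bounded[OF w] by blast
  obtain F where F: "F > 0" "\<And>x. \<bar>f x\<bar> \<le> F" using test_fun_bounded[OF f] by blast
  let ?m = "measure sphere_measure (sphere (0::real^'n) 1)"
  have "\<bar>sph_mean w f a t\<bar> \<le> W * F * ?m" for a t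
  proof -
    have "\<bar>sph_mean w f a t\<bar> \<le> (\<integral>\<beta>. \<bar>w \<beta> * f (a + t *\<^sub>R \<beta>)\<bar> \<partial>sphere_measure)"
      unfolding sph_mean_def by (rule integral_abs_bound)
    also have "\<dots> \<le> (\<integral>\<beta>. W * F \<partial>(sphere_measure :: (real^'n) measure))"
      using W F by (intro integral_mono integrable_abs sph_mean_integrable[OF w f] sphere_measure.integrable_const)
        (auto simp: abs_mult intro!: mult_mono)
    finally show ?thesis by (simp add: mult_ac)
  qed
  then have "\<bar>sph_mean w f a t\<bar> \<le> W * F * ?m + 1" for a t by (meson le_add_same_cancel1 order_trans zero_le_one)
  moreover have "W * F * ?m + 1 > 0" using W F by (intro add_nonneg_pos mult_nonneg_nonneg) auto
  ultimately show ?thesis using that by blast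
qed

text \<open>The scaled centre is there because the means are later viewed as functions of
  \<open>\<alpha>\<close> with centre \<open>r *\<^sub>R \<alpha>\<close>. The chain rule factor
  \<open>c\<close> is absorbed into the weight, so that the derivative has the same shape and the
  induction in \<open>sph_mean_C_k\<close> can repeat the step.\<close>

lemma sph_mean_has_derivative_center:
  fixes f :: "real^'n \<Rightarrow> real"
  assumes w: "continuous_on UNIV w" and f: "test_fun f"
  shows "((\<lambda>a. sph_mean w f (c *\<^sub>R a) t) has_derivative (\<lambda>v. sph_mean (\<lambda>\<beta>. c * w \<beta>) (dir_deriv f v) (c *\<^sub>R a) t)) (at a)"
proof -
  obtain W where W: "W > 0" "\<And>\<beta>. \<beta> \<in> sphere 0 1 \<Longrightarrow> \<bar>w \<beta>\<bar> \<le> W" using weight_bounded[OF w] by blast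
  obtain F where F: "F > 0" "\<And>x v. \<bar>dir_deriv f v x\<bar> \<le> F * norm v" using test_fun_derivative_bounded[OF f] by blast
  have "((\<lambda>a. \<integral>\<beta>. w \<beta> * f (c *\<^sub>R a + t *\<^sub>R \<beta>) \<partial>sphere_measure) has_derivative
    (\<lambda>v. \<integral>\<beta>. (c * w \<beta>) * dir_deriv f v (c *\<^sub>R a + t *\<^sub>R \<beta>) \<partial>sphere_measure)) (at a)"
  proof (rule has_derivative_lebesgue_integral[where X = UNIV and B = "\<bar>c\<bar> * W * F"])
    fix y \<beta> :: "real^'n" assume \<beta>: "\<beta> \<in> space sphere_measure"
    have lin: "linear (frechet_derivative f (at x))" for x
      using test_fun_differentiable[OF f] linear_frechet_derivative by blast
    have a: "((\<lambda>y. c *\<^sub>R y + t *\<^sub>R \<beta>) has_derivative (\<lambda>v. c *\<^sub>R v)) (at y)"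
      by (auto intro!: derivative_eq_intros)
    show "((\<lambda>y. w \<beta> * f (c *\<^sub>R y + t *\<^sub>R \<beta>)) has_derivative
      (\<lambda>v. (c * w \<beta>) * dir_deriv f v (c *\<^sub>R y + t *\<^sub>R \<beta>))) (at y)"
      using has_derivative_mult_right[OF has_derivative_compose[OF a test_fun_has_derivative[OF f]], of "w \<beta>"]
      by (simp add: linear_scale[OF lin] mult_ac)
    show "onorm (\<lambda>v. (c * w \<beta>) * dir_deriv f v (c *\<^sub>R y + t *\<^sub>R \<beta>)) \<le> \<bar>c\<bar> * W * F"
    proof (rule onorm_le)
      fix v
      have "\<bar>c\<bar> * \<bar>w \<beta>\<bar> * \<bar>dir_deriv f v (c *\<^sub>R y + t *\<^sub>R \<beta>)\<bar> \<le> \<bar>c\<bar> * W * (F * norm v)"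
        using W F \<beta> by (intro mult_mono) auto
      then show "norm ((c * w \<beta>) * dir_deriv f v (c *\<^sub>R y + t *\<^sub>R \<beta>)) \<le> \<bar>c\<bar> * W * F * norm v"
        by (simp add: abs_mult mult_ac)
    qed
  qed (use sph_mean_integrable[OF w f] in auto)
  then show ?thesis by (simp add: sph_mean_def)
qed

lemma sph_mean_C_k:
  fixes f :: "real^'n \<Rightarrow> real"
  shows "continuous_on UNIV w \<Longrightarrow> test_fun f \<Longrightarrow> C_k k (\<lambda>a. sph_mean w f (c *\<^sub>R a) t)"
proof (induction k arbitrary: w f)
  case 0
  then show ?case
    using has_derivative_continuous[OF sph_mean_has_derivative_center[OF 0]]
    by (simp add: continuous_on_eq_continuous_at)
next
  case (Suc k)
  note d = sph_mean_has_derivative_center[OF Suc.prems, of c t]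
  have "frechet_derivative (\<lambda>a. sph_mean w f (c *\<^sub>R a) t) (at a) v =
    sph_mean (\<lambda>\<beta>. c * w \<beta>) (dir_deriv f v) (c *\<^sub>R a) t" for a v
    using frechet_derivative_at[OF d] by metis
  moreover have "C_k k (\<lambda>a. sph_mean (\<lambda>\<beta>. c * w \<beta>) (dir_deriv f v) (c *\<^sub>R a) t)" for v
    using Suc.prems by (intro Suc.IH test_fun_dir_deriv continuous_intros)
  ultimately show ?case
    using differentiableI[OF d] by simp
qed

lemma sph_mean_has_derivative_radius:
  fixes f :: "real^'n \<Rightarrow> real"
  assumes w: "continuous_on UNIV w" and f: "test_fun f"
  shows "((\<lambda>t. sph_mean w f a t) has_real_derivative
    (\<Sum>i\<in>UNIV. sph_mean (\<lambda>\<beta>. w \<beta> * \<beta> $ i) (pd i f) a t)) (at t)"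
proof -
  obtain W where W: "W > 0" "\<And>\<beta>. \<beta> \<in> sphere 0 1 \<Longrightarrow> \<bar>w \<beta>\<bar> \<le> W" using weight_bounded[OF w] by blast
  obtain F where F: "F > 0" "\<And>x v. \<bar>dir_deriv f v x\<bar> \<le> F * norm v" using test_fun_derivative_bounded[OF f] by blast
  have "((\<lambda>t. \<integral>\<beta>. w \<beta> * f (a + t *\<^sub>R \<beta>) \<partial>sphere_measure) has_real_derivative
    (\<integral>\<beta>. w \<beta> * dir_deriv f \<beta> (a + t *\<^sub>R \<beta>) \<partial>sphere_measure)) (at t)"
  proof (rule has_real_derivative_lebesgue_integral[where X = UNIV and B = "W * F"])
    fix y :: real and \<beta> :: "real^'n" assume \<beta>: "\<beta> \<in> space sphere_measure"
    have lin: "linear (frechet_derivative f (at x))" for x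
      using test_fun_differentiable[OF f] linear_frechet_derivative by blast
    have a: "((\<lambda>y. a + y *\<^sub>R \<beta>) has_derivative (\<lambda>v. v *\<^sub>R \<beta>)) (at y)"
      by (auto intro!: derivative_eq_intros)
    show "((\<lambda>y. w \<beta> * f (a + y *\<^sub>R \<beta>)) has_real_derivative w \<beta> * dir_deriv f \<beta> (a + y *\<^sub>R \<beta>)) (at y)"
    proof -
      have "(\<lambda>v. w \<beta> * dir_deriv f (v *\<^sub>R \<beta>) (a + y *\<^sub>R \<beta>)) = (*) (w \<beta> * dir_deriv f \<beta> (a + y *\<^sub>R \<beta>))"
        by (rule ext) (simp add: linear_scale[OF lin])
      then show ?thesis
        using has_derivative_mult_right[OF has_derivative_compose[OF a test_fun_has_derivative[OF f]], of "w \<beta>"]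
        by (simp add: has_field_derivative_def)
    qed
    show "\<bar>w \<beta> * dir_deriv f \<beta> (a + y *\<^sub>R \<beta>)\<bar> \<le> W * F"
      using mult_mono[OF W(2)[of \<beta>] F(2)[of "a + y *\<^sub>R \<beta>" \<beta>]] \<beta> W(1) by (simp add: abs_mult)
  qed (use sph_mean_integrable[OF w f] in auto)
  also have "(\<integral>\<beta>. w \<beta> * dir_deriv f \<beta> (a + t *\<^sub>R \<beta>) \<partial>sphere_measure) =
    (\<integral>\<beta>. (\<Sum>i\<in>UNIV. w \<beta> * \<beta> $ i * pd i f (a + t *\<^sub>R \<beta>)) \<partial>sphere_measure)"
  proof (rule Bochner_Integration.integral_cong[OF refl])
    fix \<beta> :: "real^'n"
    show "w \<beta> * dir_deriv f \<beta> (a + t *\<^sub>R \<beta>) = (\<Sum>i\<in>UNIV. w \<beta> * \<beta> $ i * pd i f (a + t *\<^sub>R \<beta>))"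
      by (subst dir_deriv_expansion[OF test_fun_differentiable[OF f], where v = \<beta>])
        (simp only: sum_distrib_left mult.assoc)
  qed
  also have "\<dots> = (\<Sum>i\<in>UNIV. sph_mean (\<lambda>\<beta>. w \<beta> * \<beta> $ i) (pd i f) a t)"
    unfolding sph_mean_def
  proof (rule Bochner_Integration.integral_sum)
    fix i
    have "continuous_on UNIV (\<lambda>\<beta>. w \<beta> * \<beta> $ i)"
      using w by (intro continuous_intros)
    then show "integrable sphere_measure (\<lambda>\<beta>. w \<beta> * \<beta> $ i * pd i f (a + t *\<^sub>R \<beta>))"
      using test_fun_dir_deriv[OF f, of "axis i 1"] by (rule sph_mean_integrable)
  qed
  finally show ?thesis by (simp add: sph_mean_def)
qed

section \<open>Rotation invariance and Darboux's equation\<close>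

text \<open>The rotation in the plane of the axes \<open>i\<close> and \<open>j\<close>, written as
  a perturbation of the identity: this leaves all other coordinates alone in any dimension and makes
  its derivative in the angle a short computation.\<close>

definition plane_rotation :: "'n::finite \<Rightarrow> 'n \<Rightarrow> real \<Rightarrow> real^'n \<Rightarrow> real^'n" where
  "plane_rotation i j \<phi> \<beta> = \<beta> + (cos \<phi> - 1) *\<^sub>R (\<beta> $ i *\<^sub>R axis i 1 + \<beta> $ j *\<^sub>R axis j 1) +
     sin \<phi> *\<^sub>R (\<beta> $ i *\<^sub>R axis j 1 - \<beta> $ j *\<^sub>R axis i 1)"

lemma orthogonal_plane_rotation:
  assumes "i \<noteq> j"
  shows "orthogonal_transformation (plane_rotation i j \<phi>)"
  unfolding orthogonal_transformation
proof (intro conjI allI)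
  show "linear (plane_rotation i j \<phi>)"
    by (rule linearI) (auto simp: plane_rotation_def algebra_simps)
  fix \<beta> :: "real^'a"
  let ?u = "\<beta> $ i *\<^sub>R axis i 1 + \<beta> $ j *\<^sub>R axis j 1 :: real^'a"
  let ?v = "\<beta> $ i *\<^sub>R axis j 1 - \<beta> $ j *\<^sub>R axis i 1 :: real^'a"
  let ?N = "\<beta> $ i * \<beta> $ i + \<beta> $ j * \<beta> $ j"
  have e: "axis i (1::real) \<bullet> axis i 1 = 1" "axis j (1::real) \<bullet> axis j 1 = 1" "axis i (1::real) \<bullet> axis j 1 = 0" "axis j (1::real) \<bullet> axis i 1 = 0"
    using assms by (auto simp: inner_axis_axis)
  have i: "\<beta> \<bullet> ?u = ?N" "?u \<bullet> ?u = ?N" "?v \<bullet> ?v = ?N" "?u \<bullet> ?v = 0" "\<beta> \<bullet> ?v = 0"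
    using assms by (simp_all add: inner_add_left inner_add_right inner_diff_left inner_diff_right e inner_axis,
        auto simp: axis_def algebra_simps)
  have "plane_rotation i j \<phi> \<beta> \<bullet> plane_rotation i j \<phi> \<beta> =
    \<beta> \<bullet> \<beta> + (cos \<phi> - 1) * (cos \<phi> - 1) * (?u \<bullet> ?u) + sin \<phi> * sin \<phi> * (?v \<bullet> ?v) + 2 * (cos \<phi> - 1) * (\<beta> \<bullet> ?u) +
      2 * sin \<phi> * (\<beta> \<bullet> ?v) + 2 * (cos \<phi> - 1) * sin \<phi> * (?u \<bullet> ?v)"
    unfolding plane_rotation_def
    by (simp only: inner_add_left[of "\<beta> + (cos \<phi> - 1) *\<^sub>R ?u"] inner_add_left[of \<beta>]
        inner_add_right[of _ "\<beta> + (cos \<phi> - 1) *\<^sub>R ?u"] inner_add_right[of _ \<beta>] inner_scaleR_left inner_scaleR_right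
        inner_commute[of ?u \<beta>] inner_commute[of ?v \<beta>] inner_commute[of ?v ?u]) (simp add: algebra_simps)
  also have "\<dots> = \<beta> \<bullet> \<beta> + ?N * ((cos \<phi>)\<^sup>2 + (sin \<phi>)\<^sup>2 - 1)"
    unfolding i by (simp add: power2_eq_square algebra_simps del: sin_cos_squared_add sin_cos_squared_add2 sin_cos_squared_add3)
  finally show "norm (plane_rotation i j \<phi> \<beta>) = norm \<beta>"
    by (simp add: norm_eq_sqrt_inner)
qed

lemma plane_rotation_has_derivative:
  assumes "i \<noteq> j"
  shows "((\<lambda>\<phi>. plane_rotation i j \<phi> \<beta>) has_vector_derivative
    (plane_rotation i j \<phi> \<beta> $ i *\<^sub>R axis j 1 - plane_rotation i j \<phi> \<beta> $ j *\<^sub>R axis i 1)) (at \<phi>)"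
proof -
  have c: "plane_rotation i j \<phi> \<beta> $ i = cos \<phi> * \<beta> $ i - sin \<phi> * \<beta> $ j"
    "plane_rotation i j \<phi> \<beta> $ j = cos \<phi> * \<beta> $ j + sin \<phi> * \<beta> $ i"
    using assms by (auto simp: plane_rotation_def axis_def algebra_simps)
  show ?thesis
    unfolding c unfolding plane_rotation_def
    by (auto intro!: derivative_eq_intros simp: algebra_simps)
qed

text \<open>Rotation invariance of the sphere measure, differentiated.\<close>

lemma integral_rotation_field:
  fixes g :: "(real, 'n::{finite,wellorder}) vec \<Rightarrow> real" and i j :: 'n
  assumes ij: "i \<noteq> j"
    and g: "\<And>p. (g has_derivative g' p) (at p)"
    and B: "\<And>p v. norm p = 1 \<Longrightarrow> \<bar>g' p v\<bar> \<le> B * norm v"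
  shows "(\<integral>\<beta>. g' \<beta> (\<beta> $ i *\<^sub>R axis j 1 - \<beta> $ j *\<^sub>R axis i 1) \<partial>sphere_measure) = 0"
proof -
  let ?R = "plane_rotation i j"
  let ?X = "\<lambda>p::(real, 'n) vec. p $ i *\<^sub>R axis j (1::real) - p $ j *\<^sub>R axis i 1"
  have cont: "continuous_on UNIV g"
    using has_derivative_continuous[OF g] by (simp add: continuous_on_eq_continuous_at)
  have gm [measurable]: "g \<in> borel_measurable borel"
    by (rule borel_measurable_continuous_onI[OF cont])
  have nR: "norm (?R \<phi> \<beta>) = norm \<beta>" for \<phi> \<beta>
    using orthogonal_plane_rotation[OF ij] by (rule orthogonal_transformation_norm)
  have B0: "B \<ge> 0"
    using B[of "axis i 1" "axis i 1"] by simp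
  have Rm: "?R \<phi> \<in> borel_measurable borel" for \<phi>
    using orthogonal_transformation_linear[OF orthogonal_plane_rotation[OF ij]]
    by (intro borel_measurable_continuous_onI linear_continuous_on) (simp add: linear_linear)
  have "((\<lambda>\<phi>. \<integral>\<beta>. g (?R \<phi> \<beta>) \<partial>sphere_measure) has_real_derivative
    (\<integral>\<beta>. g' (?R 0 \<beta>) (?X (?R 0 \<beta>)) \<partial>sphere_measure)) (at 0)"
  proof (rule has_real_derivative_lebesgue_integral[where X = UNIV and B = "B * 2"])
    fix \<phi> :: real and \<beta> :: "(real, 'n) vec"
    assume \<beta>: "\<beta> \<in> space sphere_measure"
    have "((\<lambda>\<phi>. ?R \<phi> \<beta>) has_derivative (\<lambda>h. h *\<^sub>R ?X (?R \<phi> \<beta>))) (at \<phi>)"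
      using plane_rotation_has_derivative[OF ij] by (simp add: has_vector_derivative_def)
    from has_derivative_compose[OF this g]
    show "((\<lambda>\<phi>. g (?R \<phi> \<beta>)) has_real_derivative g' (?R \<phi> \<beta>) (?X (?R \<phi> \<beta>))) (at \<phi>)"
      using linear_scale[OF has_derivative_linear[OF g]]
      by (auto simp: has_field_derivative_def mult.commute[of _ "g' (?R \<phi> \<beta>) (?X (?R \<phi> \<beta>))"] elim!: has_derivative_eq_rhs)
    have "norm (?X (?R \<phi> \<beta>)) \<le> \<bar>?R \<phi> \<beta> $ i\<bar> + \<bar>?R \<phi> \<beta> $ j\<bar>"
      by (rule order_trans[OF norm_triangle_ineq4]) simp
    also have "\<dots> \<le> 2"
      using component_le_norm_cart[of "?R \<phi> \<beta>" i] component_le_norm_cart[of "?R \<phi> \<beta>" j] nR[of \<phi> \<beta>] \<beta> by simp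
    finally have "B * norm (?X (?R \<phi> \<beta>)) \<le> B * 2" using B0 by (intro mult_left_mono) auto
    then show "\<bar>g' (?R \<phi> \<beta>) (?X (?R \<phi> \<beta>))\<bar> \<le> B * 2"
      using B[of "?R \<phi> \<beta>" "?X (?R \<phi> \<beta>)"] nR[of \<phi> \<beta>] \<beta> by simp
  next
    show "(\<lambda>\<beta>. g (?R \<phi> \<beta>)) \<in> borel_measurable sphere_measure" for \<phi>
      using measurable_compose[OF Rm gm] by (rule measurable_sphere_measure)
    show "integrable sphere_measure (\<lambda>\<beta>. g (?R 0 \<beta>))"
      using sphere_integrable[OF cont] by (simp add: plane_rotation_def)
  qed auto
  moreover have "(\<integral>\<beta>. g (?R \<phi> \<beta>) \<partial>sphere_measure) = (\<integral>\<beta>. g \<beta> \<partial>sphere_measure)" for \<phi>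
    by (rule integral_sphere_orthogonal[OF gm orthogonal_plane_rotation[OF ij]])
  ultimately have "((\<lambda>\<phi>::real. \<integral>\<beta>. g \<beta> \<partial>sphere_measure) has_real_derivative
    (\<integral>\<beta>. g' (?R 0 \<beta>) (?X (?R 0 \<beta>)) \<partial>sphere_measure)) (at 0)" by simp
  from DERIV_unique[OF this DERIV_const] show ?thesis by (simp add: plane_rotation_def)
qed

lemma sph_mean_weight_add:
  assumes "continuous_on UNIV v" "continuous_on UNIV w" "test_fun f"
  shows "sph_mean (\<lambda>\<beta>. v \<beta> + w \<beta>) f a t = sph_mean v f a t + sph_mean w f a t"
  unfolding sph_mean_def using sph_mean_integrable[OF assms(1,3)] sph_mean_integrable[OF assms(2,3)]
  by (simp add: distrib_right)

lemma sph_mean_fun_sum: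
  assumes "continuous_on UNIV w" "\<And>i. i \<in> I \<Longrightarrow> test_fun (f i)"
  shows "sph_mean w (\<lambda>x. \<Sum>i\<in>I. f i x) a t = (\<Sum>i\<in>I. sph_mean w (f i) a t)"
  unfolding sph_mean_def sum_distrib_left
  using sph_mean_integrable[OF assms(1) assms(2)] by (intro Bochner_Integration.integral_sum) auto

definition laplacian :: "(real^3 \<Rightarrow> real) \<Rightarrow> real^3 \<Rightarrow> real" where
  "laplacian f = (\<lambda>x. \<Sum>i\<in>UNIV. pd i (pd i f) x)"

lemma test_fun_laplacian: "test_fun f \<Longrightarrow> test_fun (laplacian f)"
  unfolding laplacian_def by (intro test_fun_sum test_fun_dir_deriv) auto

abbreviation "sm \<equiv> sph_mean (\<lambda>_. 1)"

text \<open>The first two radial derivatives of the spherical mean. Spelled out through weighted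
  means of coordinate derivatives, they inherit boundedness and smoothness in the centre from
  \<open>sph_mean\<close>.\<close>

definition sm' :: "(real^3 \<Rightarrow> real) \<Rightarrow> real^3 \<Rightarrow> real \<Rightarrow> real" where
  "sm' f a t = (\<Sum>i\<in>UNIV. sph_mean (\<lambda>\<beta>. \<beta> $ i) (pd i f) a t)"

definition sm'' :: "(real^3 \<Rightarrow> real) \<Rightarrow> real^3 \<Rightarrow> real \<Rightarrow> real" where
  "sm'' f a t = (\<Sum>i\<in>UNIV. \<Sum>j\<in>UNIV. sph_mean (\<lambda>\<beta>. \<beta> $ i * \<beta> $ j) (pd j (pd i f)) a t)"

lemma sm_has_derivative: "test_fun f \<Longrightarrow> ((\<lambda>t. sm f a t) has_real_derivative sm' f a t) (at t)"
  using sph_mean_has_derivative_radius[of "\<lambda>_. 1" f a t] by (simp add: sm'_def)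

lemma sm'_has_derivative:
  assumes "test_fun f"
  shows "((\<lambda>t. sm' f a t) has_real_derivative sm'' f a t) (at t)"
proof -
  have "((\<lambda>t. sph_mean (\<lambda>\<beta>. \<beta> $ i) (pd i f) a t) has_real_derivative
    (\<Sum>j\<in>UNIV. sph_mean (\<lambda>\<beta>. \<beta> $ i * \<beta> $ j) (pd j (pd i f)) a t)) (at t)" for i
    by (rule sph_mean_has_derivative_radius[OF _ test_fun_dir_deriv[OF assms]]) (intro continuous_intros)
  then show ?thesis unfolding sm'_def sm''_def by (intro DERIV_sum) auto
qed

text \<open>The function \<open>p $ i * fj (?P p) - p $ j * fi (?P p)\<close> is, up to a factor
  \<open>t\<close>, the derivative of \<open>f (a + t *\<^sub>R p)\<close> along the rotation field
  in the plane \<open>i\<close>, \<open>j\<close>. Differentiating it once more along that field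
  gives an integrand of integral zero; the product rule separates the second derivatives of
  \<open>f\<close> from the first. Summed over the planes this is the statement that the spherical
  Laplacian integrates to zero.\<close>

lemma darboux_rotation:
  fixes i j :: 3
  assumes f: "test_fun f" and ij: "i \<noteq> j"
  shows "t * (sph_mean (\<lambda>\<beta>. \<beta> $ i * \<beta> $ i) (pd j (pd j f)) a t + sph_mean (\<lambda>\<beta>. \<beta> $ j * \<beta> $ j) (pd i (pd i f)) a t
      - sph_mean (\<lambda>\<beta>. \<beta> $ i * \<beta> $ j) (pd j (pd i f)) a t - sph_mean (\<lambda>\<beta>. \<beta> $ j * \<beta> $ i) (pd i (pd j f)) a t) =
    sph_mean (\<lambda>\<beta>. \<beta> $ i) (pd i f) a t + sph_mean (\<lambda>\<beta>. \<beta> $ j) (pd j f) a t"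
proof -
  let ?P = "\<lambda>p. a + t *\<^sub>R p"
  let ?X = "\<lambda>p::real^3. p $ i *\<^sub>R axis j (1::real) - p $ j *\<^sub>R axis i 1"
  define fi where "fi = pd i f"
  define fj where "fj = pd j f"
  have tf: "test_fun fi" "test_fun fj" using test_fun_dir_deriv[OF f] by (auto simp: fi_def fj_def)
  define g' where "g' = (\<lambda>p v. v $ i * fj (?P p) + p $ i * (t * dir_deriv fj v (?P p)) - (v $ j * fi (?P p) + p $ j * (t * dir_deriv fi v (?P p))))"
  have g: "((\<lambda>p. p $ i * fj (?P p) - p $ j * fi (?P p)) has_derivative g' p) (at p)" for p
  proof -
    have P: "(?P has_derivative (\<lambda>v. t *\<^sub>R v)) (at p)"
      by (auto intro!: derivative_eq_intros)
    have d: "((\<lambda>p. h (?P p)) has_derivative (\<lambda>v. t * dir_deriv h v (?P p))) (at p)" if h: "test_fun h" for h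
      using has_derivative_compose[OF P test_fun_has_derivative[OF h]]
      by (simp add: linear_scale[OF linear_frechet_derivative[OF test_fun_differentiable[OF h]]])
    have c: "((\<lambda>p. p $ k) has_derivative (\<lambda>v. v $ k)) (at p)" for k
      by (rule bounded_linear_imp_has_derivative) (rule bounded_linear_vec_nth)
    show ?thesis unfolding g'_def
      by (rule has_derivative_eq_rhs[OF has_derivative_diff[OF has_derivative_mult[OF c d[OF tf(2)]] has_derivative_mult[OF c d[OF tf(1)]]]])
        (simp add: algebra_simps)
  qed
  obtain B1 where B1: "B1 > 0" "\<And>x. \<bar>fi x\<bar> \<le> B1" using test_fun_bounded[OF tf(1)] by blast
  obtain B2 where B2: "B2 > 0" "\<And>x. \<bar>fj x\<bar> \<le> B2" using test_fun_bounded[OF tf(2)] by blast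
  obtain B3 where B3: "B3 > 0" "\<And>x v. \<bar>dir_deriv fi v x\<bar> \<le> B3 * norm v" using test_fun_derivative_bounded[OF tf(1)] by blast
  obtain B4 where B4: "B4 > 0" "\<And>x v. \<bar>dir_deriv fj v x\<bar> \<le> B4 * norm v" using test_fun_derivative_bounded[OF tf(2)] by blast
  have B: "\<bar>g' p v\<bar> \<le> (B2 + \<bar>t\<bar> * B4 + (B1 + \<bar>t\<bar> * B3)) * norm v" if p: "norm p = 1" for p v
  proof -
    have 1: "\<bar>v $ k * h (?P p)\<bar> \<le> norm v * C" if "\<And>x. \<bar>h x\<bar> \<le> C" for k C and h :: "real^3 \<Rightarrow> real"
      using that component_le_norm_cart[of v k] by (simp add: abs_mult mult_mono)
    have 2: "\<bar>p $ k * (t * dir_deriv h v (?P p))\<bar> \<le> 1 * (\<bar>t\<bar> * (C * norm v))" if "\<And>x v. \<bar>dir_deriv h v x\<bar> \<le> C * norm v" for k C h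
      unfolding abs_mult using that component_le_norm_cart[of p k] p by (intro mult_mono) auto
    show ?thesis
      using 1[where h = fj and k = i, OF B2(2)] 1[where h = fi and k = j, OF B1(2)] 2[where h = fj and k = i, OF B4(2)] 2[where h = fi and k = j, OF B3(2)]
      unfolding g'_def by (simp add: algebra_simps)
  qed
  have X: "dir_deriv h (?X p) x = p $ i * pd j h x - p $ j * pd i h x" if h: "test_fun h" for h p x
    using linear_frechet_derivative[OF test_fun_differentiable[OF h]] by (simp add: linear_diff linear_scale)
  have Xi: "?X p $ i = - (p $ j)" "?X p $ j = p $ i" for p
    using ij by (auto simp: axis_def)
  have "g' p (?X p) = t * (p $ i * p $ i * pd j fj (?P p) + p $ j * p $ j * pd i fi (?P p) - p $ i * p $ j * pd j fi (?P p)
      - p $ j * p $ i * pd i fj (?P p)) - (p $ i * fi (?P p) + p $ j * fj (?P p))" for p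
    unfolding g'_def X[OF tf(1)] X[OF tf(2)] Xi by (simp add: algebra_simps)
  with integral_rotation_field[OF ij g B]
  have "(\<integral>p. t * (p $ i * p $ i * pd j fj (?P p) + p $ j * p $ j * pd i fi (?P p) - p $ i * p $ j * pd j fi (?P p)
      - p $ j * p $ i * pd i fj (?P p)) - (p $ i * fi (?P p) + p $ j * fj (?P p)) \<partial>sphere_measure) = 0" by simp
  moreover have I2: "integrable sphere_measure (\<lambda>\<beta>. \<beta> $ k * \<beta> $ l * pd m h (?P \<beta>))" if "test_fun h" for k l m :: 3 and h
    by (rule sph_mean_integrable[OF _ test_fun_dir_deriv[OF that]]) (intro continuous_intros)
  moreover have I1: "integrable sphere_measure (\<lambda>\<beta>. \<beta> $ k * h (?P \<beta>))" if "test_fun h" for k :: 3 and h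
    by (rule sph_mean_integrable[OF _ that]) (intro continuous_intros)
  ultimately show ?thesis
    unfolding sph_mean_def fi_def[symmetric] fj_def[symmetric]
    by (simp add: I2[OF tf(1)] I2[OF tf(2)] I1[OF tf(1)] I1[OF tf(2)])
qed

text \<open>On the unit sphere the squares of the coordinates sum to 1, so a mean of second
  derivatives splits into weighted ones. The three identities of \<open>darboux_rotation\<close>
  convert everything not of the form \<open>sm''\<close> into first derivatives, and every axis lies
  in two of the three planes, whence the factor 2. The common factor \<open>t\<close> keeps the
  equation valid at \<open>t = 0\<close>.\<close>

lemma darboux_equation:
  assumes f: "test_fun f"
  shows "t * sm (laplacian f) a t = t * sm'' f a t + 2 * sm' f a t"
proof -
  have tf: "test_fun (pd i (pd i f))" for i using f by (intro test_fun_dir_deriv)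
  let ?S = "\<lambda>i j. sph_mean (\<lambda>\<beta>. \<beta> $ i * \<beta> $ i) (pd j (pd j f)) a t"
  have s: "sm (pd j (pd j f)) a t = ?S 1 j + ?S 2 j + ?S 3 j" for j
  proof -
    have "sm (pd j (pd j f)) a t = sph_mean (\<lambda>\<beta>. (\<beta> $ 1 * \<beta> $ 1 + \<beta> $ 2 * \<beta> $ 2) + \<beta> $ 3 * \<beta> $ 3) (pd j (pd j f)) a t"
      unfolding sph_mean_def
    proof (rule Bochner_Integration.integral_cong[OF refl])
      fix \<beta> :: "real^3" assume "\<beta> \<in> space sphere_measure"
      then have "\<beta> \<bullet> \<beta> = 1" by (simp add: norm_eq_1)
      then have "\<beta> $ 1 * \<beta> $ 1 + \<beta> $ 2 * \<beta> $ 2 + \<beta> $ 3 * \<beta> $ 3 = 1" by (simp add: inner_vec_def sum_3)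
      then show "1 * pd j (pd j f) (a + t *\<^sub>R \<beta>) = (\<beta> $ 1 * \<beta> $ 1 + \<beta> $ 2 * \<beta> $ 2 + \<beta> $ 3 * \<beta> $ 3) * pd j (pd j f) (a + t *\<^sub>R \<beta>)"
        by simp
    qed
    also have "\<dots> = ?S 1 j + ?S 2 j + ?S 3 j"
      by (subst sph_mean_weight_add[OF _ _ tf], (intro continuous_intros)+)+ simp
    finally show ?thesis .
  qed
  have "sm (laplacian f) a t = sm (pd 1 (pd 1 f)) a t + sm (pd 2 (pd 2 f)) a t + sm (pd 3 (pd 3 f)) a t"
    unfolding laplacian_def using tf by (subst sph_mean_fun_sum) (auto simp: sum_3)
  then show ?thesis
    using darboux_rotation[OF f, of 1 2 t a] darboux_rotation[OF f, of 1 3 t a] darboux_rotation[OF f, of 2 3 t a]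
    unfolding s sm'_def sm''_def sum_3 by (simp add: algebra_simps)
qed

lemma sph_mean_measurable:
  fixes f :: "real^'n \<Rightarrow> real"
  assumes w: "continuous_on UNIV w" and f: "test_fun f"
    and a: "a \<in> borel_measurable N" and t: "t \<in> borel_measurable N"
  shows "(\<lambda>x. sph_mean w f (a x) (t x)) \<in> borel_measurable N"
proof -
  have [measurable]: "w \<in> borel_measurable borel" "f \<in> borel_measurable borel"
    using w test_fun_continuous[OF f] by (auto intro: borel_measurable_continuous_onI)
  have I1 [measurable]: "(\<lambda>x. x) \<in> borel_measurable (sphere_measure :: (real^'n) measure)"
    by (intro measurable_sphere_measure) simp
  note [measurable] = a t measurable_compose[OF measurable_snd I1]
  have "(\<lambda>(x, \<beta>). w \<beta> * f (a x + t x *\<^sub>R \<beta>)) \<in> borel_measurable (N \<Otimes>\<^sub>M sphere_measure)"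
    unfolding split_beta' by measurable
  then show ?thesis
    unfolding sph_mean_def by (rule sphere_measure.borel_measurable_lebesgue_integral)
qed

lemma sm'_bounded:
  assumes f: "test_fun f"
  obtains B where "B > 0" "\<And>a t. \<bar>sm' f a t\<bar> \<le> B"
proof -
  have "\<exists>B. \<forall>i. B i > 0 \<and> (\<forall>a t. \<bar>sph_mean (\<lambda>\<beta>. \<beta> $ i) (pd i f) a t\<bar> \<le> B i)"
  proof (rule choice, rule allI)
    fix i :: 3
    have "continuous_on UNIV (\<lambda>\<beta>::real^3. \<beta> $ i)" by (intro continuous_intros)
    then obtain C where "C > 0" "\<And>a t. \<bar>sph_mean (\<lambda>\<beta>. \<beta> $ i) (pd i f) a t\<bar> \<le> C"
      using sph_mean_bounded[OF _ test_fun_dir_deriv[OF f, of "axis i 1"]] by blast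
    then show "\<exists>C. C > 0 \<and> (\<forall>a t. \<bar>sph_mean (\<lambda>\<beta>. \<beta> $ i) (pd i f) a t\<bar> \<le> C)" by blast
  qed
  then obtain B where B: "\<And>i. B i > 0" "\<And>i a t. \<bar>sph_mean (\<lambda>\<beta>. \<beta> $ i) (pd i f) a t\<bar> \<le> B i" by blast
  have "\<bar>sm' f a t\<bar> \<le> (\<Sum>i\<in>UNIV. B i)" for a t
    unfolding sm'_def by (rule order_trans[OF sum_abs]) (intro sum_mono B)
  moreover have "(\<Sum>i\<in>UNIV. B i) > 0" using B by (intro sum_pos) auto
  ultimately show ?thesis using that by blast
qed

lemma lborel_integral_translate:
  fixes F :: "'a::euclidean_space \<Rightarrow> real"
  assumes [measurable]: "F \<in> borel_measurable borel"
  shows "integrable lborel (\<lambda>y. F (c + y)) \<longleftrightarrow> integrable lborel F"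
    and "(\<integral>y. F (c + y) \<partial>lborel) = (\<integral>y. F y \<partial>lborel)"
proof -
  have "integrable (distr lborel borel ((+) c)) F \<longleftrightarrow> integrable lborel (\<lambda>y. F (c + y))"
    by (subst integrable_distr_eq) auto
  then show "integrable lborel (\<lambda>y. F (c + y)) \<longleftrightarrow> integrable lborel F"
    by (simp add: lborel_distr_plus)
  have "(\<integral>y. F y \<partial>(distr lborel borel ((+) c))) = (\<integral>y. F (c + y) \<partial>lborel)"
    by (subst integral_distr) auto
  then show "(\<integral>y. F (c + y) \<partial>lborel) = (\<integral>y. F y \<partial>lborel)"
    by (simp add: lborel_distr_plus)
qed

lemma test_fun_integrable:
  fixes f :: "'a::euclidean_space \<Rightarrow> real"
  assumes f: "test_fun f"
  shows "integrable lborel f"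
proof -
  obtain R where R: "\<And>x. f x \<noteq> 0 \<Longrightarrow> norm x \<le> R"
    using f unfolding test_fun_def bounded_iff by auto
  obtain B where B: "B > 0" "\<And>x. \<bar>f x\<bar> \<le> B" using test_fun_bounded[OF f] by blast
  show ?thesis
  proof (rule Bochner_Integration.integrable_bound)
    show "integrable lborel (\<lambda>x::'a. B * indicator (cball 0 R) x)"
      by (intro integrable_mult_right integrable_real_indicator) (use emeasure_lborel_cball_finite[of "0::'a" R] in auto)
    show "AE x in lborel. norm (f x) \<le> norm (B * indicator (cball 0 R) x)"
      using R B by (intro AE_I2) (fastforce simp: indicator_def)
  qed (use test_fun_continuous[OF f] in \<open>auto intro: borel_measurable_continuous_onI\<close>)
qed

section \<open>Inversion of spherical means\<close>

text \<open>In polar coordinates the singularity is absorbed and the integrand becomes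
  \<open>4 * pi * t\<close>. The square of \<open>R\<close> is the point: it turns an exceptional
  ball of radius proportional to \<open>k\<close>, with an error proportional to \<open>k\<close> on
  it, into a contribution of order \<open>k ^ 3\<close>.\<close>

lemma newton_kernel_ball:
  assumes R: "R \<ge> 0"
  shows "has_bochner_integral lborel (\<lambda>y::real^3. indicator (ball c R) y / norm (y - c)) (2 * pi * R\<^sup>2)"
proof -
  let ?F = "\<lambda>y::real^3. indicator (ball 0 R) y / norm y :: real"
  have [measurable]: "(indicator (ball 0 R) :: real^3 \<Rightarrow> real) \<in> borel_measurable borel"
    by (intro borel_measurable_indicator) auto
  have "(\<integral>\<^sup>+y. ennreal (?F y) \<partial>lborel) =
    (\<integral>\<^sup>+t. ennreal (t ^ (DIM(real^3) - 1)) * indicator {0<..} t * (\<integral>\<^sup>+\<beta>. ennreal (?F (t *\<^sub>R \<beta>)) \<partial>sphere_measure) \<partial>lborel)"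
    by (rule nn_integral_polar) measurable
  also have "\<dots> = (\<integral>\<^sup>+t. ennreal (4 * pi * t) * indicator {0..R} t \<partial>lborel)"
  proof (rule nn_integral_cong_AE)
    have "ennreal (t ^ (DIM(real^3) - 1)) * indicator {0<..} t * (\<integral>\<^sup>+\<beta>. ennreal (?F (t *\<^sub>R \<beta>)) \<partial>sphere_measure) =
      ennreal (4 * pi * t) * indicator {0..R} t" if "t \<noteq> R" for t
    proof (cases "0 < t")
      case True
      have "(\<integral>\<^sup>+\<beta>. ennreal (?F (t *\<^sub>R \<beta>)) \<partial>sphere_measure) = (\<integral>\<^sup>+\<beta>. ennreal (indicator {0..<R} t / t) \<partial>(sphere_measure :: (real^3) measure))"
        using True by (intro nn_integral_cong) (auto simp: indicator_def)
      also have "\<dots> = ennreal (indicator {0..<R} t / t) * ennreal (4 * pi)"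
        by (simp add: emeasure_sphere_measure_sphere)
      finally show ?thesis
        using True that by (auto simp: indicator_def ennreal_mult'[symmetric] power2_eq_square mult_ac simp flip: ennreal_mult)
    qed (auto simp: indicator_def ennreal_neg)
    then show "AE t in lborel. ennreal (t ^ (DIM(real^3) - 1)) * indicator {0<..} t * (\<integral>\<^sup>+\<beta>. ennreal (?F (t *\<^sub>R \<beta>)) \<partial>sphere_measure) =
      ennreal (4 * pi * t) * indicator {0..R} t"
      using AE_lborel_singleton[of R] by auto
  qed
  also have "\<dots> = ennreal (2 * pi * R\<^sup>2 - 2 * pi * 0\<^sup>2)"
    by (rule nn_integral_FTC_Icc) (use R in \<open>auto intro!: derivative_eq_intros\<close>)
  finally have nn: "(\<integral>\<^sup>+y. ennreal (?F y) \<partial>lborel) = ennreal (2 * pi * R\<^sup>2)" by simp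
  have hb: "has_bochner_integral lborel ?F (2 * pi * R\<^sup>2)"
    by (rule has_bochner_integral_nn_integral[OF _ _ _ nn]) auto
  have [measurable]: "(indicator (ball c R) :: real^3 \<Rightarrow> real) \<in> borel_measurable borel"
    by (intro borel_measurable_indicator) auto
  have s: "indicator (ball c R) (c + y) / norm ((c + y) - c) = ?F y" for y
    by (simp add: indicator_def dist_norm)
  have m: "(\<lambda>y::real^3. indicator (ball c R) y / norm (y - c) :: real) \<in> borel_measurable borel"
    by measurable
  show ?thesis
    using hb lborel_integral_translate[OF m, of c] unfolding s has_bochner_integral_iff by simp
qed

lemma newton_potential_integrable:
  fixes g :: "real^3 \<Rightarrow> real"
  assumes g: "test_fun g"
  shows "integrable lborel (\<lambda>p. g p / norm (p - x))"
proof -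
  obtain R where R: "\<And>x. g x \<noteq> 0 \<Longrightarrow> norm x \<le> R"
    using g unfolding test_fun_def bounded_iff by auto
  obtain B where B: "B > 0" "\<And>x. \<bar>g x\<bar> \<le> B" using test_fun_bounded[OF g] by blast
  have [measurable]: "g \<in> borel_measurable borel" using test_fun_measurable[OF g] .
  let ?R = "\<bar>R\<bar> + norm x + 1"
  show ?thesis
  proof (rule Bochner_Integration.integrable_bound)
    show "integrable lborel (\<lambda>p. B * (indicator (ball x ?R) p / norm (p - x)))"
      using newton_kernel_ball[of ?R x] by (intro integrable_mult_right) (auto simp: has_bochner_integral_iff)
    show "AE p in lborel. norm (g p / norm (p - x)) \<le> norm (B * (indicator (ball x ?R) p / norm (p - x)))"
    proof (rule AE_I2)
      fix p
      show "norm (g p / norm (p - x)) \<le> norm (B * (indicator (ball x ?R) p / norm (p - x)))"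
      proof (cases "g p = 0")
        case False
        then have "norm p \<le> R" by (rule R)
        then have "dist x p < ?R"
          using norm_triangle_ineq4[of x p] by (simp add: dist_norm)
        then show ?thesis using B(2)[of p] B(1) by (simp add: divide_right_mono abs_mult)
      qed simp
    qed
  qed measurable
qed

lemma integral_spherical_shell:
  fixes g :: "real^3 \<Rightarrow> real"
  assumes g: "test_fun g" and a: "0 \<le> a"
  shows "(\<integral>t. indicator {a<..<b} t * (t\<^sup>2 * sm g c t) \<partial>lborel) = (\<integral>p. g p * indicator {a<..<b} (norm (p - c)) \<partial>lborel)"
proof -
  have [measurable]: "g \<in> borel_measurable borel" using test_fun_measurable[OF g] .
  let ?F = "\<lambda>q. g (c + q) * indicator {a<..<b} (norm q)"
  have m: "(\<lambda>p. g p * indicator {a<..<b} (norm (p - c))) \<in> borel_measurable borel" by measurable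
  have i: "integrable lborel (\<lambda>p. g p * indicator {a<..<b} (norm (p - c)))"
    by (rule Bochner_Integration.integrable_bound[OF test_fun_integrable[OF g]]) (auto simp: indicator_def)
  have "(\<integral>p. g p * indicator {a<..<b} (norm (p - c)) \<partial>lborel) = (\<integral>q. ?F q \<partial>lborel)"
    using lborel_integral_translate(2)[OF m, of c] by simp
  also have "\<dots> = (\<integral>t. (if 0 < t then t ^ (DIM(real^3) - 1) else 0) * (\<integral>\<beta>. ?F (t *\<^sub>R \<beta>) \<partial>sphere_measure) \<partial>lborel)"
    using i lborel_integral_translate(1)[OF m, of c] by (intro integral_polar(2)) simp
  also have "\<dots> = (\<integral>t. indicator {a<..<b} t * (t\<^sup>2 * sm g c t) \<partial>lborel)"
  proof (rule Bochner_Integration.integral_cong[OF refl])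
    fix t :: real
    have "(\<integral>\<beta>. ?F (t *\<^sub>R \<beta>) \<partial>sphere_measure) = (\<integral>\<beta>. indicator {a<..<b} t * (1 * g (c + t *\<^sub>R \<beta>)) \<partial>sphere_measure)" if "t > 0"
      using that by (intro Bochner_Integration.integral_cong) auto
    then show "(if 0 < t then t ^ (DIM(real^3) - 1) else 0) * (\<integral>\<beta>. ?F (t *\<^sub>R \<beta>) \<partial>sphere_measure) =
      indicator {a<..<b} t * (t\<^sup>2 * sm g c t)"
      using a by (auto simp: sph_mean_def indicator_def)
  qed
  finally show ?thesis by simp
qed

text \<open>A function that is linear up to a cubic error has no quadratic term. The error estimate
  is available for \<open>k > 0\<close> only, because shells have positive thickness, so all limits
  are taken from the right; L'Hopital's rule identifies the quadratic coefficient with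
  \<open>d / 2\<close>.\<close>

lemma second_order_vanish:
  fixes \<Phi> \<phi> :: "real \<Rightarrow> real"
  assumes k0: "k0 > 0"
    and D: "\<And>k. \<bar>k\<bar> < k0 \<Longrightarrow> (\<Phi> has_real_derivative \<phi> k) (at k)"
    and D2: "(\<phi> has_real_derivative d) (at 0)"
    and b: "\<And>k. 0 < k \<Longrightarrow> k < k0 \<Longrightarrow> \<bar>\<Phi> k - c * k\<bar> \<le> K * k ^ 3"
    and 0: "\<Phi> 0 = 0"
  shows "\<phi> 0 = c" "d = 0"
proof -
  have ev: "\<forall>\<^sub>F k in at_right 0. 0 < k \<and> k < k0"
    using k0 by (auto simp: eventually_at_right_less eventually_at_right intro: exI[of _ k0])
  have "((\<lambda>k. \<Phi> k / k) \<longlongrightarrow> \<phi> 0) (at_right 0)"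
    using D[of 0] k0 0 by (auto simp: has_field_derivative_iff intro: tendsto_mono[OF at_le])
  moreover have "((\<lambda>k. \<Phi> k / k) \<longlongrightarrow> c) (at_right 0)"
  proof (rule Lim_null_comparison[THEN LIM_zero_cancel])
    show "\<forall>\<^sub>F k in at_right 0. norm (\<Phi> k / k - c) \<le> K * k\<^sup>2"
      using ev
    proof eventually_elim
      case (elim k)
      then have "\<bar>\<Phi> k - c * k\<bar> / k \<le> K * k ^ 3 / k" using b by (intro divide_right_mono) auto
      moreover have "\<Phi> k / k - c = (\<Phi> k - c * k) / k" using elim by (simp add: field_simps)
      ultimately show ?case using elim by (simp add: power3_eq_cube power2_eq_square)
    qed
    show "((\<lambda>k. K * k\<^sup>2) \<longlongrightarrow> 0) (at_right 0)"
      by (auto intro!: tendsto_eq_intros)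
  qed
  ultimately show c: "\<phi> 0 = c"
    by (rule tendsto_unique[rotated]) simp
  have "((\<lambda>k. (\<Phi> k - c * k) / k\<^sup>2) \<longlongrightarrow> d / 2) (at_right 0)"
  proof (rule lhopital_right_0[where f' = "\<lambda>k. \<phi> k - c" and g' = "\<lambda>k. 2 * k"])
    have "isCont \<Phi> 0" using D[of 0] k0 DERIV_isCont by auto
    then have "(\<Phi> \<longlongrightarrow> 0) (at_right 0)"
      using 0 by (auto simp: isCont_def intro: tendsto_mono[OF at_le])
    then show "((\<lambda>k. \<Phi> k - c * k) \<longlongrightarrow> 0) (at_right 0)"
      by (auto intro!: tendsto_eq_intros)
    show "((\<lambda>k::real. k\<^sup>2) \<longlongrightarrow> 0) (at_right 0)"
      by (auto intro!: tendsto_eq_intros)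
    show "\<forall>\<^sub>F k in at_right 0. (k::real)\<^sup>2 \<noteq> 0" "\<forall>\<^sub>F k in at_right 0. 2 * (k::real) \<noteq> 0"
      using ev by (auto elim: eventually_mono)
    show "\<forall>\<^sub>F k in at_right 0. ((\<lambda>k. \<Phi> k - c * k) has_real_derivative \<phi> k - c) (at k)"
      using ev by eventually_elim (auto intro!: derivative_eq_intros D)
    show "\<forall>\<^sub>F k in at_right 0. ((\<lambda>k. k\<^sup>2) has_real_derivative 2 * k) (at k)"
      by (auto intro!: derivative_eq_intros always_eventually)
    have "((\<lambda>k. (\<phi> k - \<phi> 0) / k) \<longlongrightarrow> d) (at_right 0)"
      using D2 by (auto simp: has_field_derivative_iff intro: tendsto_mono[OF at_le])
    then have "((\<lambda>k. (\<phi> k - \<phi> 0) / k / 2) \<longlongrightarrow> d / 2) (at_right 0)"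
      by (intro tendsto_intros) auto
    then show "((\<lambda>k. (\<phi> k - c) / (2 * k)) \<longlongrightarrow> d / 2) (at_right 0)"
      by (simp add: c mult.commute)
  qed
  moreover have "((\<lambda>k. (\<Phi> k - c * k) / k\<^sup>2) \<longlongrightarrow> 0) (at_right 0)"
  proof (rule Lim_null_comparison)
    show "\<forall>\<^sub>F k in at_right 0. norm ((\<Phi> k - c * k) / k\<^sup>2) \<le> K * k"
      using ev
    proof eventually_elim
      case (elim k)
      then have "\<bar>\<Phi> k - c * k\<bar> / k\<^sup>2 \<le> K * k ^ 3 / k\<^sup>2" using b by (intro divide_right_mono) auto
      then show ?case using elim by (simp add: power3_eq_cube power2_eq_square)
    qed
    show "((\<lambda>k. K * k) \<longlongrightarrow> 0) (at_right 0)"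
      by (auto intro!: tendsto_eq_intros)
  qed
  ultimately have "d / 2 = 0"
    by (rule tendsto_unique[rotated]) simp
  then show "d = 0" by simp
qed

text \<open>The points \<open>p\<close> of the shell of squared radii \<open>\<bar>r \<alpha> - x\<bar>\<^sup>2 < \<cdot> < \<bar>r \<alpha> - x\<bar>\<^sup>2 + k\<close> about \<open>r \<alpha>\<close> form, for
  fixed \<open>p\<close>, a slab in \<open>\<alpha>\<close>, whose measure is known by Archimedes. The slab is cut off by the sphere only
  for \<open>\<bar>p - x\<bar> = O(k)\<close>, which costs \<open>O(k\<^sup>3)\<close>.\<close>

lemma measure_shell_slab:
  fixes x p :: "real^3"
  assumes r: "r > 0" and x: "norm x < r" and p: "norm p \<le> r - \<delta>" "p \<noteq> x" and k: "k > 0" and \<delta>: "\<delta> > 0"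
  defines "S \<equiv> {\<alpha> \<in> sphere 0 1. (norm (p - r *\<^sub>R \<alpha>))\<^sup>2 - (norm (r *\<^sub>R \<alpha> - x))\<^sup>2 \<in> {0<..<k}}"
  shows "\<bar>measure sphere_measure S - pi * k / r / norm (p - x)\<bar> \<le> pi * k / r * (indicator (ball x (k / \<delta>)) p / norm (p - x))"
proof -
  let ?y = "p - x" and ?A = "(norm p)\<^sup>2 - (norm x)\<^sup>2"
  let ?w = "(2 * r) *\<^sub>R ?y"
  have y: "norm ?y > 0" using p by simp
  have "(norm (p - r *\<^sub>R \<alpha>))\<^sup>2 - (norm (r *\<^sub>R \<alpha> - x))\<^sup>2 = ?A - ?w \<bullet> \<alpha>" for \<alpha>
    by (simp add: power2_norm_eq_inner inner_diff_left inner_diff_right inner_commute algebra_simps)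
  then have S: "S = {\<alpha> \<in> sphere 0 1. ?w \<bullet> \<alpha> \<in> {?A - k<..<?A}}"
    unfolding S_def by auto
  have w: "?w \<noteq> 0" "norm ?w = 2 * r * norm ?y" using r p by auto
  have q: "2 * pi * (?A - (?A - k)) / norm ?w = pi * k / r / norm ?y"
    using r unfolding w by simp
  have le: "measure sphere_measure S \<le> pi * k / r / norm ?y"
    using measure_sphere_slab(1)[OF w(1), of "?A - k" ?A] k unfolding S q by simp
  \<comment> \<open>The factorisation shows that \<open>\<bar>?A\<bar>\<close> stays below
    \<open>norm ?w\<close> by at least \<open>\<delta> * norm ?y\<close>. A slab of thickness
    \<open>k\<close> ending at \<open>?A\<close> lies within the heights of the sphere once this
    margin is at least \<open>k\<close>, which is the case distinction below.\<close>
  have A: "?A = (norm p - norm x) * (norm p + norm x)" by (simp add: power2_eq_square algebra_simps)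
  have "\<bar>?A\<bar> \<le> norm ?y * (norm p + norm x)"
    unfolding A abs_mult using norm_triangle_ineq3[of p x] by (intro mult_mono) auto
  also have "\<dots> \<le> norm ?y * (2 * r - \<delta>)" using p x by (intro mult_left_mono) auto
  finally have A2: "\<bar>?A\<bar> \<le> 2 * r * norm ?y - \<delta> * norm ?y" by (simp add: algebra_simps)
  show ?thesis
  proof (cases "norm ?y < k / \<delta>")
    case True
    then have "indicator (ball x (k / \<delta>)) p = (1::real)"
      by (simp add: indicator_def dist_norm norm_minus_commute)
    moreover have "0 \<le> measure sphere_measure S" by simp
    ultimately show ?thesis using le by simp
  next
    case False
    then have "k \<le> \<delta> * norm ?y" using \<delta> by (simp add: field_simps)
    moreover have "0 \<le> \<delta> * norm ?y" using \<delta> by simp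
    ultimately have "- norm ?w \<le> ?A - k" "?A \<le> norm ?w" using A2 unfolding w by linarith+
    then have "measure sphere_measure S = pi * k / r / norm ?y"
      using measure_sphere_slab(2)[OF w(1), of "?A - k" ?A] k unfolding S q by simp
    then show ?thesis using r k by simp
  qed
qed

text \<open>Exchanging the integrals leaves, for each \<open>p\<close>, the measure of the
  directions whose shell contains \<open>p\<close>. By \<open>measure_shell_slab\<close> its main
  term is the Newton kernel with pole \<open>x\<close>, and the error lives on the ball of radius
  \<open>k / \<delta>\<close> about \<open>x\<close>.\<close>

lemma shell_average:
  fixes g :: "real^3 \<Rightarrow> real" and x :: "real^3"
  assumes g: "test_fun g" and r: "r > 0" and x: "norm x < r" and \<delta>: "\<delta> > 0"
    and supp: "\<And>p. g p \<noteq> 0 \<Longrightarrow> norm p \<le> r - \<delta>"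
  defines "\<rho> \<equiv> \<lambda>\<alpha>. norm (r *\<^sub>R \<alpha> - x)"
  obtains G where "\<And>k. k > 0 \<Longrightarrow>
    \<bar>(\<integral>\<alpha>. (\<integral>p. g p * indicator {\<rho> \<alpha><..<sqrt ((\<rho> \<alpha>)\<^sup>2 + k)} (norm (p - r *\<^sub>R \<alpha>)) \<partial>lborel) \<partial>sphere_measure)
      - pi / r * (\<integral>p. g p / norm (p - x) \<partial>lborel) * k\<bar> \<le> G * k ^ 3"
proof -
  have gm [measurable]: "g \<in> borel_measurable borel" using test_fun_measurable[OF g] .
  have I1 [measurable]: "(\<lambda>x. x) \<in> borel_measurable (sphere_measure :: (real^3) measure)"
    by (intro measurable_sphere_measure) simp
  obtain B where B: "B > 0" "\<And>x. \<bar>g x\<bar> \<le> B" using test_fun_bounded[OF g] by blast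
  interpret P: pair_sigma_finite "sphere_measure :: (real^3) measure" "lborel :: (real^3) measure" by standard
  have bound: "\<bar>(\<integral>\<alpha>. (\<integral>p. g p * indicator {\<rho> \<alpha><..<sqrt ((\<rho> \<alpha>)\<^sup>2 + k)} (norm (p - r *\<^sub>R \<alpha>)) \<partial>lborel) \<partial>sphere_measure)
      - pi / r * (\<integral>p. g p / norm (p - x) \<partial>lborel) * k\<bar> \<le> 2 * pi\<^sup>2 * B / (r * \<delta>\<^sup>2) * k ^ 3" if k: "k > 0" for k
  proof -
    \<comment> \<open>In terms of squared radii, membership in the shell is a condition affine in
      \<open>\<alpha>\<close>, since the quadratic terms cancel. This is why the shells are
      thickened in the squared radius.\<close>
    define J :: "real^3 \<Rightarrow> real^3 \<Rightarrow> real" where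
      "J = (\<lambda>\<alpha> p. indicator {0<..<k} ((norm (p - r *\<^sub>R \<alpha>))\<^sup>2 - (norm (r *\<^sub>R \<alpha> - x))\<^sup>2))"
    have J: "indicator {\<rho> \<alpha><..<sqrt ((\<rho> \<alpha>)\<^sup>2 + k)} (norm (p - r *\<^sub>R \<alpha>)) = J \<alpha> p" for \<alpha> p
    proof -
      have "a < n \<and> n < sqrt (a\<^sup>2 + k) \<longleftrightarrow> 0 < n\<^sup>2 - a\<^sup>2 \<and> n\<^sup>2 - a\<^sup>2 < k" if "a \<ge> 0" "n \<ge> 0" for a n :: real
      proof -
        have "a < n \<longleftrightarrow> a\<^sup>2 < n\<^sup>2" using that by (meson abs_le_square_iff linorder_not_le power2_less_imp_less power_strict_mono zero_less_numeral)
        moreover have "n < sqrt (a\<^sup>2 + k) \<longleftrightarrow> n\<^sup>2 < a\<^sup>2 + k"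
          using that k by (metis real_less_rsqrt real_sqrt_less_iff real_sqrt_abs abs_of_nonneg)
        ultimately show ?thesis by auto
      qed
      then show ?thesis by (simp add: J_def \<rho>_def indicator_def)
    qed
    have Jm: "(\<lambda>q. J (fst q) (snd q)) \<in> borel_measurable (sphere_measure \<Otimes>\<^sub>M lborel)"
      unfolding J_def by measurable
    let ?f = "\<lambda>(\<alpha>, p). g p * J \<alpha> p"
    have fm: "?f \<in> borel_measurable (sphere_measure \<Otimes>\<^sub>M lborel)"
      using Jm unfolding split_beta' by measurable
    have J1: "\<bar>J \<alpha> p\<bar> \<le> 1" for \<alpha> p by (simp add: J_def indicator_def)
    have gi: "integrable lborel g" by (rule test_fun_integrable[OF g])
    have Jm2: "J \<alpha> \<in> borel_measurable borel" for \<alpha>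
      unfolding J_def by measurable
    have fi: "integrable lborel (\<lambda>p. g p * J \<alpha> p)" for \<alpha>
      using J1 Jm2 by (intro Bochner_Integration.integrable_bound[OF gi]) (auto simp: abs_mult mult_left_le)
    have int: "integrable (sphere_measure \<Otimes>\<^sub>M lborel) ?f"
    proof (rule P.Fubini_integrable[OF fm])
      show "AE \<alpha> in sphere_measure. integrable lborel (\<lambda>p. ?f (\<alpha>, p))" using fi by simp
      show "integrable sphere_measure (\<lambda>\<alpha>. \<integral>p. norm (?f (\<alpha>, p)) \<partial>lborel)"
      proof (rule sphere_measure.integrable_const_bound[where B = "\<integral>p. \<bar>g p\<bar> \<partial>lborel"])
        show "AE \<alpha> in sphere_measure. norm (\<integral>p. norm (?f (\<alpha>, p)) \<partial>lborel) \<le> (\<integral>p. \<bar>g p\<bar> \<partial>lborel)"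
        proof (rule AE_I2)
          fix \<alpha> :: "real^3"
          have "(\<integral>p. norm (?f (\<alpha>, p)) \<partial>lborel) \<le> (\<integral>p. \<bar>g p\<bar> \<partial>lborel)"
            using integrable_abs[OF fi[of \<alpha>]] integrable_abs[OF gi] J1
            by (intro integral_mono) (auto simp: abs_mult mult_left_le)
          moreover have "0 \<le> (\<integral>p. norm (?f (\<alpha>, p)) \<partial>lborel)" by simp
          ultimately show "norm (\<integral>p. norm (?f (\<alpha>, p)) \<partial>lborel) \<le> (\<integral>p. \<bar>g p\<bar> \<partial>lborel)" by simp
        qed
        show "(\<lambda>\<alpha>. \<integral>p. norm (?f (\<alpha>, p)) \<partial>lborel) \<in> borel_measurable sphere_measure"
          using fm by (intro lborel.borel_measurable_lebesgue_integral) simp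
      qed
    qed
    let ?S = "\<lambda>p. {\<alpha> \<in> sphere 0 1. (norm (p - r *\<^sub>R \<alpha>))\<^sup>2 - (norm (r *\<^sub>R \<alpha> - x))\<^sup>2 \<in> {0<..<k}}"
    have SJ: "(\<integral>\<alpha>. g p * J \<alpha> p \<partial>sphere_measure) = g p * measure sphere_measure (?S p)" for p
    proof -
      have "(\<integral>\<alpha>. g p * J \<alpha> p \<partial>sphere_measure) = g p * (\<integral>\<alpha>. J \<alpha> p \<partial>sphere_measure)"
        by simp
      also have "(\<integral>\<alpha>. J \<alpha> p \<partial>sphere_measure) = (\<integral>\<alpha>. indicator (?S p) \<alpha> \<partial>sphere_measure)"
        by (intro Bochner_Integration.integral_cong) (auto simp: J_def indicator_def)
      also have "\<dots> = measure sphere_measure (?S p \<inter> space sphere_measure)"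
        by (rule Bochner_Integration.integral_indicator)
      also have "?S p \<inter> space sphere_measure = ?S p" by auto
      finally show ?thesis .
    qed
    have "(\<integral>\<alpha>. (\<integral>p. g p * indicator {\<rho> \<alpha><..<sqrt ((\<rho> \<alpha>)\<^sup>2 + k)} (norm (p - r *\<^sub>R \<alpha>)) \<partial>lborel) \<partial>sphere_measure) =
      (\<integral>p. (\<integral>\<alpha>. g p * J \<alpha> p \<partial>sphere_measure) \<partial>lborel)"
      unfolding J by (rule P.Fubini_integral[OF int, symmetric])
    then have 1: "(\<integral>\<alpha>. (\<integral>p. g p * indicator {\<rho> \<alpha><..<sqrt ((\<rho> \<alpha>)\<^sup>2 + k)} (norm (p - r *\<^sub>R \<alpha>)) \<partial>lborel) \<partial>sphere_measure) =
      (\<integral>p. g p * measure sphere_measure (?S p) \<partial>lborel)"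
      unfolding SJ .
    have i1: "integrable lborel (\<lambda>p. g p * measure sphere_measure (?S p))"
      using P.integrable_snd[OF int] unfolding SJ .
    have i2: "integrable lborel (\<lambda>p. pi * k / r * (g p / norm (p - x)))"
      using newton_potential_integrable[OF g] by (rule integrable_mult_right)
    have hb: "has_bochner_integral lborel (\<lambda>p. B * (pi * k / r * (indicator (ball x (k / \<delta>)) p / norm (p - x))))
      (B * (pi * k / r * (2 * pi * (k / \<delta>)\<^sup>2)))"
      using k \<delta> by (intro has_bochner_integral_mult_right newton_kernel_ball) simp
    have pw: "\<bar>g p * measure sphere_measure (?S p) - pi * k / r * (g p / norm (p - x))\<bar> \<le>
      B * (pi * k / r * (indicator (ball x (k / \<delta>)) p / norm (p - x)))" if px: "p \<noteq> x" for p
    proof (cases "g p = 0")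
      case True
      then show ?thesis using B(1) k r by (simp add: indicator_def)
    next
      case False
      have e: "g p * measure sphere_measure (?S p) - pi * k / r * (g p / norm (p - x)) =
        g p * (measure sphere_measure (?S p) - pi * k / r / norm (p - x))" by (simp add: algebra_simps)
      show ?thesis
        unfolding e abs_mult
        by (intro mult_mono B(2) measure_shell_slab[OF r x supp[OF False] px k \<delta>]) (use B(1) in auto)
    qed
    have "pi / r * (\<integral>p. g p / norm (p - x) \<partial>lborel) * k = (\<integral>p. pi * k / r * (g p / norm (p - x)) \<partial>lborel)"
      by (subst Bochner_Integration.integral_mult_right_zero) simp
    then have "\<bar>(\<integral>p. g p * measure sphere_measure (?S p) \<partial>lborel) - pi / r * (\<integral>p. g p / norm (p - x) \<partial>lborel) * k\<bar> =
      \<bar>\<integral>p. g p * measure sphere_measure (?S p) - pi * k / r * (g p / norm (p - x)) \<partial>lborel\<bar>"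
      using Bochner_Integration.integral_diff[OF i1 i2] by simp
    also have "\<dots> \<le> (\<integral>p. \<bar>g p * measure sphere_measure (?S p) - pi * k / r * (g p / norm (p - x))\<bar> \<partial>lborel)"
      by (rule integral_abs_bound)
    also have "\<dots> \<le> (\<integral>p. B * (pi * k / r * (indicator (ball x (k / \<delta>)) p / norm (p - x))) \<partial>lborel)"
    proof (rule integral_mono_AE)
      show "AE p in lborel. \<bar>g p * measure sphere_measure (?S p) - pi * k / r * (g p / norm (p - x))\<bar> \<le>
        B * (pi * k / r * (indicator (ball x (k / \<delta>)) p / norm (p - x)))"
        by (rule eventually_mono[OF AE_lborel_singleton[of x]]) (rule pw)
    qed (use i1 i2 hb in \<open>auto simp: has_bochner_integral_iff intro!: integrable_abs Bochner_Integration.integrable_diff\<close>)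
    also have "\<dots> = B * (pi * k / r * (2 * pi * (k / \<delta>)\<^sup>2))"
      using hb by (simp only: has_bochner_integral_iff)
    also have "\<dots> = 2 * pi\<^sup>2 * B / (r * \<delta>\<^sup>2) * k ^ 3"
      by (simp add: power2_eq_square power3_eq_cube field_simps)
    finally show ?thesis unfolding 1 .
  qed
  then show ?thesis using that by blast
qed

text \<open>One function of the thickness \<open>k\<close> carries both identities. The outer radius
  \<open>T \<alpha> k\<close> has derivative \<open>1 / (2 * T \<alpha> k)\<close> in
  \<open>k\<close>, so the mass of a shell has first derivative \<open>T * sm / 2\<close> and second
  derivative \<open>(sm + T * sm') / (4 * T)\<close>. Comparing the derivatives at 0 with
  \<open>shell_average\<close> through \<open>second_order_vanish\<close> yields the potential and
  zero.\<close>

lemma sphere_integral_identities: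
  fixes g :: "real^3 \<Rightarrow> real" and x :: "real^3"
  assumes g: "test_fun g" and r: "r > 0" and x: "norm x < r" and \<delta>: "\<delta> > 0"
    and supp: "\<And>p. g p \<noteq> 0 \<Longrightarrow> norm p \<le> r - \<delta>"
  defines "\<rho> \<equiv> \<lambda>\<alpha>. norm (r *\<^sub>R \<alpha> - x)"
  shows "integrable sphere_measure (\<lambda>\<alpha>. \<rho> \<alpha> * sm g (r *\<^sub>R \<alpha>) (\<rho> \<alpha>))"
    and "(\<integral>\<alpha>. \<rho> \<alpha> * sm g (r *\<^sub>R \<alpha>) (\<rho> \<alpha>) \<partial>sphere_measure) = 2 * pi / r * (\<integral>p. g p / norm (p - x) \<partial>lborel)"
    and "integrable sphere_measure (\<lambda>\<alpha>. (sm g (r *\<^sub>R \<alpha>) (\<rho> \<alpha>) + \<rho> \<alpha> * sm' g (r *\<^sub>R \<alpha>) (\<rho> \<alpha>)) / \<rho> \<alpha>)"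
    and "(\<integral>\<alpha>. (sm g (r *\<^sub>R \<alpha>) (\<rho> \<alpha>) + \<rho> \<alpha> * sm' g (r *\<^sub>R \<alpha>) (\<rho> \<alpha>)) / \<rho> \<alpha> \<partial>sphere_measure) = 0"
proof -
  \<comment> \<open>The centres have distance at least \<open>r - norm x\<close> from
    \<open>x\<close>. With half of its square as range for \<open>k\<close>, the quantity under the
    root in \<open>T\<close> exceeds \<open>k0\<close>, so \<open>T\<close> stays away from 0
    uniformly in \<open>\<alpha>\<close>.\<close>
  define k0 where "k0 = (r - norm x)\<^sup>2 / 2"
  have k0: "k0 > 0" using x by (simp add: k0_def)
  define T where "T = (\<lambda>\<alpha> k. sqrt ((\<rho> \<alpha>)\<^sup>2 + k))"
  define m where "m = sqrt k0"
  define Tm where "Tm = sqrt ((r + norm x)\<^sup>2 + k0)"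
  have m: "m > 0" using k0 by (simp add: m_def)
  have \<rho>_ge: "\<rho> \<alpha> \<ge> r - norm x" and \<rho>_le: "\<rho> \<alpha> \<le> r + norm x" if "\<alpha> \<in> sphere 0 1" for \<alpha>
    using norm_triangle_ineq2[of "r *\<^sub>R \<alpha>" x] norm_triangle_ineq4[of "r *\<^sub>R \<alpha>" x] that r by (auto simp: \<rho>_def)
  have T: "(\<rho> \<alpha>)\<^sup>2 + k > 0" "T \<alpha> k \<ge> m" "T \<alpha> k \<le> Tm" if \<alpha>: "\<alpha> \<in> sphere 0 1" and k: "\<bar>k\<bar> < k0" for \<alpha> k
  proof -
    have "2 * k0 \<le> (\<rho> \<alpha>)\<^sup>2"
      using \<rho>_ge[OF \<alpha>] x by (simp add: k0_def power_mono)
    then show "(\<rho> \<alpha>)\<^sup>2 + k > 0" "T \<alpha> k \<ge> m" using k k0 by (auto simp: T_def m_def)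
    have "(\<rho> \<alpha>)\<^sup>2 \<le> (r + norm x)\<^sup>2" using \<rho>_le[OF \<alpha>] by (intro power_mono) (auto simp: \<rho>_def)
    then show "T \<alpha> k \<le> Tm" using k by (simp add: T_def Tm_def)
  qed
  have T0: "T \<alpha> 0 = \<rho> \<alpha>" for \<alpha> by (simp add: T_def \<rho>_def)
  have dT: "((\<lambda>k. T \<alpha> k) has_real_derivative 1 / (2 * T \<alpha> k)) (at k)" if "\<alpha> \<in> sphere 0 1" "\<bar>k\<bar> < k0" for \<alpha> k
    unfolding T_def using T(1)[OF that] by (auto intro!: derivative_eq_intros simp: field_simps)
  have w1: "continuous_on UNIV (\<lambda>_::real^3. 1::real)" by simp
  obtain S where S: "S > 0" "\<And>a t. \<bar>sm g a t\<bar> \<le> S" using sph_mean_bounded[OF w1 g] by blast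
  obtain S' where S': "S' > 0" "\<And>a t. \<bar>sm' g a t\<bar> \<le> S'" using sm'_bounded[OF g] by blast
  have \<rho>m [measurable]: "\<rho> \<in> borel_measurable borel" unfolding \<rho>_def by measurable
  have Tmeas: "(\<lambda>\<alpha>. T \<alpha> k) \<in> borel_measurable borel" for k unfolding T_def by measurable
  have cm: "(\<lambda>\<alpha>::real^3. r *\<^sub>R \<alpha>) \<in> borel_measurable borel" by measurable
  have smm: "(\<lambda>\<alpha>. sm g (r *\<^sub>R \<alpha>) (T \<alpha> k)) \<in> borel_measurable borel" for k
    by (rule sph_mean_measurable[OF w1 g cm Tmeas])
  \<comment> \<open>By polar coordinates \<open>b c T\<close> is the integral of \<open>g\<close>
    over the ball of radius \<open>T\<close> about \<open>c\<close>; its increments are the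
    integrals over shells.\<close>
  define b where "b = (\<lambda>c T. \<integral>t. indicator {0<..<T} t * (t\<^sup>2 * sm g c t) \<partial>lborel)"
  have cont: "continuous_on A (\<lambda>t. sm g c t)" for A c
    using sm_has_derivative[OF g] DERIV_isCont by (blast intro: continuous_at_imp_continuous_on)
  have bHK: "b c T = integral {0..T} (\<lambda>t. t\<^sup>2 * sm g c t)" "set_integrable lborel {0..T} (\<lambda>t. t\<^sup>2 * sm g c t)" for c T
  proof -
    show si: "set_integrable lborel {0..T} (\<lambda>t. t\<^sup>2 * sm g c t)"
      by (intro borel_integrable_atLeastAtMost' continuous_intros cont)
    have "b c T = (LINT t:{0..T}|lborel. t\<^sup>2 * sm g c t)"
      unfolding b_def set_lebesgue_integral_def
    proof (rule integral_cong_AE)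
      show "AE t in lborel. indicator {0<..<T} t * (t\<^sup>2 * sm g c t) = indicator {0..T} t *\<^sub>R (t\<^sup>2 * sm g c t)"
        using AE_lborel_singleton[of 0] AE_lborel_singleton[of T] by eventually_elim (auto simp: indicator_def)
    qed (use sph_mean_measurable[OF w1 g, of "\<lambda>_. c" borel "\<lambda>t. t"] in auto)
    also have "\<dots> = integral {0..T} (\<lambda>t. t\<^sup>2 * sm g c t)"
      by (rule set_borel_integral_eq_integral(2)[OF si])
    finally show "b c T = integral {0..T} (\<lambda>t. t\<^sup>2 * sm g c t)" .
  qed
  have db: "(b c has_real_derivative T\<^sup>2 * sm g c T) (at T)" if T: "T > 0" for c T
  proof -
    have "((\<lambda>u. integral {0..u} (\<lambda>t. t\<^sup>2 * sm g c t)) has_real_derivative T\<^sup>2 * sm g c T) (at T within {0..T + 1})"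
      using T by (intro integral_has_real_derivative continuous_intros cont) auto
    moreover have "at T within {0..T + 1} = at T" using T by (intro at_within_interior) simp
    moreover have "b c = (\<lambda>u. integral {0..u} (\<lambda>t. t\<^sup>2 * sm g c t))" using bHK(1) by (rule ext)
    ultimately show ?thesis by simp
  qed
  have bdiff: "b c T - b c R = (\<integral>t. indicator {R<..<T} t * (t\<^sup>2 * sm g c t) \<partial>lborel)" if "0 \<le> R" "R \<le> T" for c R T
  proof -
    have i: "integrable lborel (\<lambda>t. indicator {0<..<u} t * (t\<^sup>2 * sm g c t))" for u
    proof (rule Bochner_Integration.integrable_bound)
      show "integrable lborel (\<lambda>t. indicator {0..u} t *\<^sub>R (t\<^sup>2 * sm g c t))"
        using bHK(2)[where T = u] unfolding set_integrable_def .
    qed (use sph_mean_measurable[OF w1 g, of "\<lambda>_. c" borel "\<lambda>t. t"] in \<open>auto simp: indicator_def\<close>)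
    have "b c T - b c R = (\<integral>t. indicator {0<..<T} t * (t\<^sup>2 * sm g c t) - indicator {0<..<R} t * (t\<^sup>2 * sm g c t) \<partial>lborel)"
      unfolding b_def by (rule Bochner_Integration.integral_diff[symmetric]) (rule i)+
    also have "\<dots> = (\<integral>t. indicator {R<..<T} t * (t\<^sup>2 * sm g c t) \<partial>lborel)"
    proof (rule integral_cong_AE)
      show "AE t in lborel. indicator {0<..<T} t * (t\<^sup>2 * sm g c t) - indicator {0<..<R} t * (t\<^sup>2 * sm g c t) =
        indicator {R<..<T} t * (t\<^sup>2 * sm g c t)"
        using AE_lborel_singleton[of R] by eventually_elim (use that in \<open>auto simp: indicator_def\<close>)
    qed (use sph_mean_measurable[OF w1 g, of "\<lambda>_. c" borel "\<lambda>t. t"] in auto)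
    finally show ?thesis .
  qed
  have bm: "(\<lambda>\<alpha>. b (r *\<^sub>R \<alpha>) (T \<alpha> k)) \<in> borel_measurable borel" for k
  proof -
    have "(\<lambda>(\<alpha>, t). indicator {0<..<T \<alpha> k} t * (t\<^sup>2 * sm g (r *\<^sub>R \<alpha>) t)) \<in> borel_measurable (borel \<Otimes>\<^sub>M lborel)"
    proof -
      have 1: "(\<lambda>q::(real^3) \<times> real. sm g (r *\<^sub>R fst q) (snd q)) \<in> borel_measurable (borel \<Otimes>\<^sub>M lborel)"
        by (rule sph_mean_measurable[OF w1 g]) measurable
      have "(\<lambda>q. indicator {0<..<T (fst q) k} (snd q) :: real) = (\<lambda>q. indicator {0<..} (snd q) * indicator {0<..} (T (fst q) k - snd q))"
        by (auto simp: indicator_def fun_eq_iff)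
      moreover have "(\<lambda>q. indicator {0<..} (snd q) * indicator {0<..} (T (fst q) k - snd q) :: real) \<in> borel_measurable (borel \<Otimes>\<^sub>M lborel)"
        using Tmeas by measurable
      ultimately have "(\<lambda>q. indicator {0<..<T (fst q) k} (snd q) :: real) \<in> borel_measurable (borel \<Otimes>\<^sub>M lborel)"
        by simp
      moreover have "(\<lambda>q::(real^3) \<times> real. (snd q)\<^sup>2) \<in> borel_measurable (borel \<Otimes>\<^sub>M lborel)" by measurable
      ultimately show ?thesis
        unfolding split_beta' using 1 by (intro borel_measurable_times)
    qed
    then show ?thesis unfolding b_def by (rule lborel.borel_measurable_lebesgue_integral)
  qed
  \<comment> \<open>For \<open>k > 0\<close> this is the total shell mass of
    \<open>shell_average\<close>. Defining it by increments of \<open>b\<close> extends it to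
    \<open>k < 0\<close>, so that it has two-sided derivatives at 0.\<close>
  define \<Phi> where "\<Phi> = (\<lambda>k. \<integral>\<alpha>. b (r *\<^sub>R \<alpha>) (T \<alpha> k) - b (r *\<^sub>R \<alpha>) (T \<alpha> 0) \<partial>sphere_measure)"
  define \<phi> where "\<phi> = (\<lambda>k. \<integral>\<alpha>. T \<alpha> k * sm g (r *\<^sub>R \<alpha>) (T \<alpha> k) / 2 \<partial>sphere_measure)"
  define d where "d = (\<lambda>\<alpha> k. (sm g (r *\<^sub>R \<alpha>) (T \<alpha> k) + T \<alpha> k * sm' g (r *\<^sub>R \<alpha>) (T \<alpha> k)) / (4 * T \<alpha> k))"
  have X: "open {-k0<..<k0}" "convex {-k0<..<k0}" by auto
  have sp: "\<alpha> \<in> space sphere_measure \<Longrightarrow> \<alpha> \<in> sphere 0 1" for \<alpha> :: "real^3" by simp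
  have kk: "k \<in> {-k0<..<k0} \<longleftrightarrow> \<bar>k\<bar> < k0" for k by auto
  have Tpos: "T \<alpha> k > 0" if "\<alpha> \<in> sphere 0 1" "\<bar>k\<bar> < k0" for \<alpha> k using T(2)[OF that] m by linarith
  have D1: "((\<lambda>k. b (r *\<^sub>R \<alpha>) (T \<alpha> k) - b (r *\<^sub>R \<alpha>) (T \<alpha> 0)) has_real_derivative T \<alpha> k * sm g (r *\<^sub>R \<alpha>) (T \<alpha> k) / 2) (at k)"
    if \<alpha>: "\<alpha> \<in> sphere 0 1" "\<bar>k\<bar> < k0" for \<alpha> k
    using Tpos[OF \<alpha>] DERIV_chain2[OF db[OF Tpos[OF \<alpha>]] dT[OF \<alpha>], of "r *\<^sub>R \<alpha>"]
    by (auto intro!: derivative_eq_intros simp: power2_eq_square)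
  have B1: "\<bar>T \<alpha> k * sm g (r *\<^sub>R \<alpha>) (T \<alpha> k) / 2\<bar> \<le> Tm * S / 2" if \<alpha>: "\<alpha> \<in> sphere 0 1" "\<bar>k\<bar> < k0" for \<alpha> k
    using mult_mono[of "\<bar>T \<alpha> k\<bar>" Tm "\<bar>sm g (r *\<^sub>R \<alpha>) (T \<alpha> k)\<bar>" S] Tpos[OF \<alpha>] T(3)[OF \<alpha>] S(2)[of "r *\<^sub>R \<alpha>" "T \<alpha> k"]
    by (simp add: abs_mult)
  have int1: "integrable sphere_measure (\<lambda>\<alpha>. T \<alpha> k * sm g (r *\<^sub>R \<alpha>) (T \<alpha> k) / 2)" if k: "\<bar>k\<bar> < k0" for k
    using B1[OF sp k] smm Tmeas
    by (intro sphere_measure.integrable_const_bound[where B = "Tm * S / 2"] measurable_sphere_measure) auto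
  have \<Phi>int: "integrable sphere_measure (\<lambda>\<alpha>. b (r *\<^sub>R \<alpha>) (T \<alpha> k) - b (r *\<^sub>R \<alpha>) (T \<alpha> 0))" if k: "\<bar>k\<bar> < k0" for k
  proof (rule sphere_measure.integrable_const_bound[where B = "Tm * S / 2 * k0"])
    show "AE \<alpha> in sphere_measure. norm (b (r *\<^sub>R \<alpha>) (T \<alpha> k) - b (r *\<^sub>R \<alpha>) (T \<alpha> 0)) \<le> Tm * S / 2 * k0"
    proof (rule AE_I2)
      fix \<alpha> :: "real^3" assume "\<alpha> \<in> space sphere_measure"
      then have \<alpha>: "\<alpha> \<in> sphere 0 1" by simp
      have "norm ((b (r *\<^sub>R \<alpha>) (T \<alpha> k) - b (r *\<^sub>R \<alpha>) (T \<alpha> 0)) - (b (r *\<^sub>R \<alpha>) (T \<alpha> 0) - b (r *\<^sub>R \<alpha>) (T \<alpha> 0))) \<le> Tm * S / 2 * norm (k - 0)"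
        using D1[OF \<alpha>] B1[OF \<alpha>] k k0
        by (intro field_differentiable_bound[where f = "\<lambda>k. b (r *\<^sub>R \<alpha>) (T \<alpha> k) - b (r *\<^sub>R \<alpha>) (T \<alpha> 0)" and S = "{-k0<..<k0}"
            and f' = "\<lambda>k. T \<alpha> k * sm g (r *\<^sub>R \<alpha>) (T \<alpha> k) / 2"])
          (auto intro: has_field_derivative_at_within)
      also have "\<dots> \<le> Tm * S / 2 * k0"
        using k S(1) T(2,3)[OF \<alpha> k] m by (intro mult_left_mono) auto
      finally show "norm (b (r *\<^sub>R \<alpha>) (T \<alpha> k) - b (r *\<^sub>R \<alpha>) (T \<alpha> 0)) \<le> Tm * S / 2 * k0" by simp
    qed
  qed (use bm in \<open>auto intro!: measurable_sphere_measure\<close>)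
  have D\<Phi>: "(\<Phi> has_real_derivative \<phi> k) (at k)" if k: "\<bar>k\<bar> < k0" for k
    unfolding \<Phi>_def \<phi>_def
    by (rule has_real_derivative_lebesgue_integral(1)[where X = "{-k0<..<k0}" and B = "Tm * S / 2"])
      (use k bm \<Phi>int D1 B1 in \<open>auto intro!: measurable_sphere_measure\<close>)
  have D2: "((\<lambda>k. T \<alpha> k * sm g (r *\<^sub>R \<alpha>) (T \<alpha> k) / 2) has_real_derivative d \<alpha> k) (at k)"
    if \<alpha>: "\<alpha> \<in> sphere 0 1" "\<bar>k\<bar> < k0" for \<alpha> k
    using Tpos[OF \<alpha>] DERIV_chain2[OF sm_has_derivative[OF g] dT[OF \<alpha>], of "r *\<^sub>R \<alpha>"]
    by (auto intro!: derivative_eq_intros dT[OF \<alpha>] simp: d_def field_simps)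
  have B2: "\<bar>d \<alpha> k\<bar> \<le> (S + Tm * S') / (4 * m)" if \<alpha>: "\<alpha> \<in> sphere 0 1" "\<bar>k\<bar> < k0" for \<alpha> k
  proof -
    have "\<bar>T \<alpha> k * sm' g (r *\<^sub>R \<alpha>) (T \<alpha> k)\<bar> \<le> Tm * S'"
      using Tpos[OF \<alpha>] T(3)[OF \<alpha>] S'(2)[of "r *\<^sub>R \<alpha>" "T \<alpha> k"] unfolding abs_mult by (intro mult_mono) auto
    then have "\<bar>sm g (r *\<^sub>R \<alpha>) (T \<alpha> k) + T \<alpha> k * sm' g (r *\<^sub>R \<alpha>) (T \<alpha> k)\<bar> \<le> S + Tm * S'"
      using S(2)[of "r *\<^sub>R \<alpha>" "T \<alpha> k"] by linarith
    then show ?thesis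
      using Tpos[OF \<alpha>] T(2)[OF \<alpha>] m unfolding d_def abs_divide by (intro frac_le) auto
  qed
  note dint = has_real_derivative_lebesgue_integral[where M = sphere_measure and X = "{-k0<..<k0}" and x = 0
      and F = "\<lambda>k \<alpha>. T \<alpha> k * sm g (r *\<^sub>R \<alpha>) (T \<alpha> k) / 2" and F' = "\<lambda>k \<alpha>. d \<alpha> k" and B = "(S + Tm * S') / (4 * m)"]
  have D\<phi>: "(\<phi> has_real_derivative (\<integral>\<alpha>. d \<alpha> 0 \<partial>sphere_measure)) (at 0)"
    unfolding \<phi>_def by (rule dint(1)) (use k0 int1 D2 B2 borel_measurable_integrable[OF int1] in auto)
  have dI: "integrable sphere_measure (\<lambda>\<alpha>. d \<alpha> 0)"
    by (rule dint(2)) (use k0 int1 D2 B2 borel_measurable_integrable[OF int1] in auto)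
  obtain G where G: "\<And>k. k > 0 \<Longrightarrow>
    \<bar>(\<integral>\<alpha>. (\<integral>p. g p * indicator {\<rho> \<alpha><..<sqrt ((\<rho> \<alpha>)\<^sup>2 + k)} (norm (p - r *\<^sub>R \<alpha>)) \<partial>lborel) \<partial>sphere_measure)
      - pi / r * (\<integral>p. g p / norm (p - x) \<partial>lborel) * k\<bar> \<le> G * k ^ 3"
    unfolding \<rho>_def using shell_average[OF g r x \<delta> supp] by blast
  have est: "\<bar>\<Phi> k - pi / r * (\<integral>p. g p / norm (p - x) \<partial>lborel) * k\<bar> \<le> G * k ^ 3" if k: "0 < k" "k < k0" for k
  proof -
    have "\<Phi> k = (\<integral>\<alpha>. (\<integral>p. g p * indicator {\<rho> \<alpha><..<sqrt ((\<rho> \<alpha>)\<^sup>2 + k)} (norm (p - r *\<^sub>R \<alpha>)) \<partial>lborel) \<partial>sphere_measure)"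
      unfolding \<Phi>_def
    proof (rule Bochner_Integration.integral_cong[OF refl])
      fix \<alpha>
      have p: "0 \<le> \<rho> \<alpha>" "\<rho> \<alpha> \<le> T \<alpha> k" using k by (auto simp: \<rho>_def T_def real_le_rsqrt)
      show "b (r *\<^sub>R \<alpha>) (T \<alpha> k) - b (r *\<^sub>R \<alpha>) (T \<alpha> 0) =
        (\<integral>p. g p * indicator {\<rho> \<alpha><..<sqrt ((\<rho> \<alpha>)\<^sup>2 + k)} (norm (p - r *\<^sub>R \<alpha>)) \<partial>lborel)"
        unfolding T0 bdiff[OF p] integral_spherical_shell[OF g p(1)] by (simp add: T_def)
    qed
    then show ?thesis using G[OF k(1)] by simp
  qed
  have \<Phi>0: "\<Phi> 0 = 0" by (simp add: \<Phi>_def)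
  note v = second_order_vanish[OF k0 D\<Phi> D\<phi> est \<Phi>0]
  have i0: "integrable sphere_measure (\<lambda>\<alpha>. 2 * (T \<alpha> 0 * sm g (r *\<^sub>R \<alpha>) (T \<alpha> 0) / 2))"
    using int1[of 0] k0 by (intro integrable_mult_right) auto
  then show "integrable sphere_measure (\<lambda>\<alpha>. \<rho> \<alpha> * sm g (r *\<^sub>R \<alpha>) (\<rho> \<alpha>))" by (simp add: T0)
  have "(\<integral>\<alpha>. \<rho> \<alpha> * sm g (r *\<^sub>R \<alpha>) (\<rho> \<alpha>) \<partial>sphere_measure) = 2 * \<phi> 0"
    unfolding \<phi>_def T0 by simp
  then show "(\<integral>\<alpha>. \<rho> \<alpha> * sm g (r *\<^sub>R \<alpha>) (\<rho> \<alpha>) \<partial>sphere_measure) = 2 * pi / r * (\<integral>p. g p / norm (p - x) \<partial>lborel)"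
    using v(1) by simp
  have e: "(sm g (r *\<^sub>R \<alpha>) (\<rho> \<alpha>) + \<rho> \<alpha> * sm' g (r *\<^sub>R \<alpha>) (\<rho> \<alpha>)) / \<rho> \<alpha> = 4 * d \<alpha> 0" for \<alpha>
    by (cases "\<rho> \<alpha> = 0") (auto simp: d_def T0 field_simps)
  show "integrable sphere_measure (\<lambda>\<alpha>. (sm g (r *\<^sub>R \<alpha>) (\<rho> \<alpha>) + \<rho> \<alpha> * sm' g (r *\<^sub>R \<alpha>) (\<rho> \<alpha>)) / \<rho> \<alpha>)"
    unfolding e using dI by (rule integrable_mult_right)
  show "(\<integral>\<alpha>. (sm g (r *\<^sub>R \<alpha>) (\<rho> \<alpha>) + \<rho> \<alpha> * sm' g (r *\<^sub>R \<alpha>) (\<rho> \<alpha>)) / \<rho> \<alpha> \<partial>sphere_measure) = 0"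
    unfolding e using v(2) by simp
qed

section \<open>Poisson's equation and the inversion of spherical means\<close>

text \<open>In polar coordinates about \<open>x\<close> the potential is the integral of
  \<open>t * sm (laplacian f) x t\<close>. Darboux's equation exhibits this integrand as the
  derivative of \<open>sm f x t + t * sm' f x t\<close>; only the boundary term at
  \<open>t = 0\<close> survives, and there the mean is the area \<open>4 * pi\<close> times
  \<open>f x\<close>.\<close>

lemma poisson_equation:
  fixes f :: "real^3 \<Rightarrow> real"
  assumes f: "test_fun f"
  shows "(\<integral>p. laplacian f p / norm (p - x) \<partial>lborel) = - 4 * pi * f x"
proof -
  let ?L = "laplacian f"
  have L: "test_fun ?L" by (rule test_fun_laplacian[OF f])
  have [measurable]: "?L \<in> borel_measurable borel" using test_fun_measurable[OF L] .
  have w1: "continuous_on UNIV (\<lambda>_::real^3. 1::real)" by simp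
  have m: "(\<lambda>p. ?L p / norm (p - x)) \<in> borel_measurable borel" by measurable
  obtain R0 where R0: "\<And>x. f x \<noteq> 0 \<Longrightarrow> norm x \<le> R0"
    using f unfolding test_fun_def bounded_iff by auto
  obtain R1 where R1: "\<And>x. ?L x \<noteq> 0 \<Longrightarrow> norm x \<le> R1"
    using L unfolding test_fun_def bounded_iff by auto
  obtain R2 where R2: "\<And>i x. pd i f x \<noteq> 0 \<Longrightarrow> norm x \<le> R2 i"
  proof -
    have "\<forall>i. \<exists>R. \<forall>x. pd i f x \<noteq> 0 \<longrightarrow> norm x \<le> R"
      using test_fun_dir_deriv[OF f] unfolding test_fun_def bounded_iff by auto
    then show ?thesis using that by metis
  qed
  \<comment> \<open>A radius beyond which the spheres about \<open>x\<close> miss the supports of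
    \<open>f\<close>, of its partial derivatives and of its Laplacian. Adding all the bounds avoids
    a maximum over cases.\<close>
  define R where "R = \<bar>R0\<bar> + \<bar>R1\<bar> + (\<Sum>i\<in>UNIV. \<bar>R2 i\<bar>) + norm x + 1"
  have R: "R > 0" unfolding R_def by (intro add_nonneg_pos add_nonneg_nonneg sum_nonneg) auto
  have far: "norm (x + t *\<^sub>R \<beta>) > \<bar>R0\<bar> + \<bar>R1\<bar> + (\<Sum>i\<in>UNIV. \<bar>R2 i\<bar>)" if "t \<ge> R" "norm \<beta> = 1" for t \<beta>
  proof -
    have "norm (t *\<^sub>R \<beta>) \<le> norm (x + t *\<^sub>R \<beta>) + norm x" using norm_triangle_ineq4[of "x + t *\<^sub>R \<beta>" x] by simp
    then show ?thesis using that R by (simp add: R_def)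
  qed
  have S0: "0 \<le> (\<Sum>i\<in>UNIV. \<bar>R2 i\<bar>)" by (intro sum_nonneg) auto
  have z0: "f (x + t *\<^sub>R \<beta>) = 0" if "t \<ge> R" "norm \<beta> = 1" for t \<beta>
  proof (rule ccontr)
    assume "f (x + t *\<^sub>R \<beta>) \<noteq> 0"
    from R0[OF this] far[OF that] S0 show False by linarith
  qed
  have z1: "?L (x + t *\<^sub>R \<beta>) = 0" if "t \<ge> R" "norm \<beta> = 1" for t \<beta>
  proof (rule ccontr)
    assume "?L (x + t *\<^sub>R \<beta>) \<noteq> 0"
    from R1[OF this] far[OF that] S0 show False by linarith
  qed
  have z2: "pd i f (x + t *\<^sub>R \<beta>) = 0" if "t \<ge> R" "norm \<beta> = 1" for i t \<beta>
  proof (rule ccontr)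
    have "\<bar>R2 i\<bar> \<le> (\<Sum>i\<in>UNIV. \<bar>R2 i\<bar>)" by (rule member_le_sum) auto
    moreover assume "pd i f (x + t *\<^sub>R \<beta>) \<noteq> 0"
    from R2[OF this] far[OF that] have "(\<Sum>i\<in>UNIV. \<bar>R2 i\<bar>) < R2 i" by linarith
    ultimately show False by linarith
  qed
  have s0: "sm f x t = 0" and s1: "sm ?L x t = 0" and s2: "sm' f x t = 0" if t: "t \<ge> R" for t
  proof -
    show "sm f x t = 0" "sm ?L x t = 0"
      unfolding sph_mean_def using z0[OF t] z1[OF t]
      by (auto intro!: integral_eq_zero_AE AE_I2)
    have "sph_mean (\<lambda>\<beta>. \<beta> $ i) (pd i f) x t = 0" for i
      unfolding sph_mean_def using z2[OF t]
      by (auto intro!: integral_eq_zero_AE AE_I2)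
    then show "sm' f x t = 0" unfolding sm'_def by simp
  qed
  have "(\<integral>p. ?L p / norm (p - x) \<partial>lborel) = (\<integral>q. ?L (x + q) / norm q \<partial>lborel)"
    using lborel_integral_translate(2)[OF m, of x] by simp
  also have "\<dots> = (\<integral>t. (if 0 < t then t ^ (DIM(real^3) - 1) else 0) * (\<integral>\<beta>. ?L (x + t *\<^sub>R \<beta>) / norm (t *\<^sub>R \<beta>) \<partial>sphere_measure) \<partial>lborel)"
    using newton_potential_integrable[OF L, of x] lborel_integral_translate(1)[OF m, of x]
    by (intro integral_polar(2)) simp
  also have "\<dots> = (\<integral>t. indicator {0..R} t *\<^sub>R (t * sm ?L x t) \<partial>lborel)"
  proof (rule Bochner_Integration.integral_cong[OF refl])
    fix t :: real
    have "(\<integral>\<beta>. ?L (x + t *\<^sub>R \<beta>) / norm (t *\<^sub>R \<beta>) \<partial>sphere_measure) = (\<integral>\<beta>. (1 * ?L (x + t *\<^sub>R \<beta>)) / t \<partial>sphere_measure)" if "t > 0"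
      using that by (intro Bochner_Integration.integral_cong) auto
    then show "(if 0 < t then t ^ (DIM(real^3) - 1) else 0) * (\<integral>\<beta>. ?L (x + t *\<^sub>R \<beta>) / norm (t *\<^sub>R \<beta>) \<partial>sphere_measure) =
      indicator {0..R} t *\<^sub>R (t * sm ?L x t)"
      using s1[of t] by (auto simp: sph_mean_def indicator_def power2_eq_square)
  qed
  also have "\<dots> = (sm f x R + R * sm' f x R) - (sm f x 0 + 0 * sm' f x 0)"
  proof (rule integral_FTC_Icc)
    show "0 \<le> R" using R by simp
    fix t :: real
    have "((\<lambda>t. sm f x t + t * sm' f x t) has_real_derivative sm' f x t + (1 * sm' f x t + sm'' f x t * t)) (at t)"
      by (intro DERIV_add DERIV_mult sm_has_derivative[OF f] sm'_has_derivative[OF f] DERIV_ident)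
    also have "sm' f x t + (1 * sm' f x t + sm'' f x t * t) = t * sm ?L x t"
      unfolding darboux_equation[OF f] by simp
    finally show "((\<lambda>t. sm f x t + t * sm' f x t) has_vector_derivative t * sm ?L x t) (at t within {0..R})"
      by (auto simp: has_real_derivative_iff_has_vector_derivative[symmetric] intro: has_field_derivative_at_within)
    show "continuous_on {0..R} (\<lambda>t. t * sm ?L x t)"
      using sm_has_derivative[OF L] DERIV_isCont
      by (intro continuous_intros) (blast intro: continuous_at_imp_continuous_on)
  qed
  also have "\<dots> = - sm f x 0" using s0[of R] s2[of R] by simp
  also have "sm f x 0 = 4 * pi * f x"
    using emeasure_sphere_measure_sphere by (simp add: sph_mean_def measure_def)
  finally show ?thesis by simp
qed

text \<open>\<open>d/dt (t d/dt (t m))\<close> for the unnormalised spherical mean \<open>m\<close> of \<open>f\<close>, simplified by Darboux's equation.\<close>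

definition radial_op :: "(real^3 \<Rightarrow> real) \<Rightarrow> real^3 \<Rightarrow> real \<Rightarrow> real" where
  "radial_op f a t = sm f a t + t * sm' f a t + t\<^sup>2 * sm (laplacian f) a t"

text \<open>The potential identity is applied to the Laplacian of \<open>f\<close> with the same
  \<open>\<delta>\<close>. Outside the closed ball \<open>f\<close> vanishes on an open set, so all
  its derivatives vanish there too.\<close>

lemma laplacian_support:
  assumes f: "test_fun f" and supp: "\<And>p. f p \<noteq> 0 \<Longrightarrow> norm p \<le> R"
  shows "laplacian f p \<noteq> 0 \<Longrightarrow> norm p \<le> R"
proof (rule ccontr)
  assume L: "laplacian f p \<noteq> 0" and "\<not> norm p \<le> R"
  then have p: "p \<in> - cball 0 R" by simp
  have o: "open (- cball (0::real^3) R)" by (intro open_Compl closed_cball)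
  have z: "dir_deriv h v q = 0" if "\<And>q. q \<in> - cball 0 R \<Longrightarrow> h q = 0" "q \<in> - cball 0 R" for h :: "real^3 \<Rightarrow> real" and v q
  proof -
    have "((\<lambda>_. 0) has_derivative (\<lambda>_. 0)) (at q)" by simp
    then have "(h has_derivative (\<lambda>_. 0)) (at q)"
      by (rule has_derivative_transform_within_open[OF _ o that(2)]) (use that(1) in auto)
    then have "(\<lambda>_. 0) = frechet_derivative h (at q)" by (rule frechet_derivative_at)
    then show ?thesis by (rule fun_cong[symmetric])
  qed
  have "f q = 0" if "q \<in> - cball 0 R" for q using supp[of q] that by auto
  then have "pd i f q = 0" if "q \<in> - cball 0 R" for i q using that by (rule z)
  then have "pd i (pd i f) p = 0" for i using p by (rule z)
  then show False using L by (simp add: laplacian_def)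
qed

theorem spherical_mean_inversion:
  fixes f :: "real^3 \<Rightarrow> real" and x :: "real^3"
  assumes f: "test_fun f" and r: "r > 0" and x: "norm x < r" and \<delta>: "\<delta> > 0"
    and supp: "\<And>p. f p \<noteq> 0 \<Longrightarrow> norm p \<le> r - \<delta>"
  defines "\<rho> \<equiv> \<lambda>\<alpha>. norm (r *\<^sub>R \<alpha> - x)"
  shows "integrable sphere_measure (\<lambda>\<alpha>. radial_op f (r *\<^sub>R \<alpha>) (\<rho> \<alpha>) / \<rho> \<alpha>)"
    and "(\<integral>\<alpha>. radial_op f (r *\<^sub>R \<alpha>) (\<rho> \<alpha>) / \<rho> \<alpha> \<partial>sphere_measure) = - (8 * pi\<^sup>2 / r) * f x"
proof -
  have L: "test_fun (laplacian f)" by (rule test_fun_laplacian[OF f])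
  let ?N = "\<lambda>\<alpha>. (sm f (r *\<^sub>R \<alpha>) (\<rho> \<alpha>) + \<rho> \<alpha> * sm' f (r *\<^sub>R \<alpha>) (\<rho> \<alpha>)) / \<rho> \<alpha>"
  let ?E = "\<lambda>\<alpha>. \<rho> \<alpha> * sm (laplacian f) (r *\<^sub>R \<alpha>) (\<rho> \<alpha>)"
  have LS: "norm p \<le> r - \<delta>" if "laplacian f p \<noteq> 0" for p
    using laplacian_support[OF f, of "r - \<delta>"] supp that by blast
  have N1: "integrable sphere_measure ?N" and N2: "(\<integral>\<alpha>. ?N \<alpha> \<partial>sphere_measure) = 0"
    unfolding \<rho>_def by (rule sphere_integral_identities[OF f r x \<delta>], rule supp, assumption)+
  have E1: "integrable sphere_measure ?E" and
    E2: "(\<integral>\<alpha>. ?E \<alpha> \<partial>sphere_measure) = 2 * pi / r * (\<integral>p. laplacian f p / norm (p - x) \<partial>lborel)"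
    unfolding \<rho>_def by (rule sphere_integral_identities[OF L r x \<delta>], rule LS, assumption)+
  have e: "radial_op f (r *\<^sub>R \<alpha>) (\<rho> \<alpha>) / \<rho> \<alpha> = (sm f (r *\<^sub>R \<alpha>) (\<rho> \<alpha>) + \<rho> \<alpha> * sm' f (r *\<^sub>R \<alpha>) (\<rho> \<alpha>)) / \<rho> \<alpha> +
    \<rho> \<alpha> * sm (laplacian f) (r *\<^sub>R \<alpha>) (\<rho> \<alpha>)" for \<alpha>
    by (cases "\<rho> \<alpha> = 0") (auto simp: radial_op_def add_divide_distrib power2_eq_square)
  show "integrable sphere_measure (\<lambda>\<alpha>. radial_op f (r *\<^sub>R \<alpha>) (\<rho> \<alpha>) / \<rho> \<alpha>)"
    unfolding e by (rule Bochner_Integration.integrable_add[OF N1 E1])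
  have "(\<integral>\<alpha>. ?N \<alpha> + ?E \<alpha> \<partial>sphere_measure) = (\<integral>\<alpha>. ?N \<alpha> \<partial>sphere_measure) + (\<integral>\<alpha>. ?E \<alpha> \<partial>sphere_measure)"
    by (rule Bochner_Integration.integral_add[OF N1 E1])
  \<comment> \<open>The constant is \<open>2 * pi / r\<close> from the average over the centres
    times \<open>- 4 * pi\<close> from Poisson's equation.\<close>
  then show "(\<integral>\<alpha>. radial_op f (r *\<^sub>R \<alpha>) (\<rho> \<alpha>) / \<rho> \<alpha> \<partial>sphere_measure) = - (8 * pi\<^sup>2 / r) * f x"
    unfolding e N2 E2 poisson_equation[OF f] by (simp add: power2_eq_square)
qed

section \<open>Principal values and Abel integrals\<close>

lemma integral_FTC_real_line:
  fixes f F :: "real \<Rightarrow> real"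
  assumes F: "\<And>x. (F has_real_derivative f x) (at x)" and f: "\<And>x. isCont f x"
    and i: "integrable lborel f" and lim: "(F \<longlongrightarrow> A) at_bot" "(F \<longlongrightarrow> B) at_top"
  shows "(\<integral>x. f x \<partial>lborel) = B - A"
proof -
  have "(LBINT x=-\<infinity>..\<infinity>. f x) = B - A"
    using assms
    by (intro interval_integral_FTC_integrable)
      (auto simp: ereal_tendsto_simps set_integrable_def has_real_derivative_iff_has_vector_derivative[symmetric])
  then show ?thesis
    by (simp add: interval_lebesgue_integral_def set_lebesgue_integral_def)
qed

lemma einterval_atLeast_infinity: "einterval (ereal a) \<infinity> = {a<..}"
  by (auto simp: einterval_def)

lemma integral_FTC_half_line:
  fixes f F :: "real \<Rightarrow> real"
  assumes F: "\<And>x. a < x \<Longrightarrow> (F has_real_derivative f x) (at x)" and f: "\<And>x. a < x \<Longrightarrow> isCont f x"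
    and i: "set_integrable lborel {a<..} f" and lim: "(F \<longlongrightarrow> A) (at_right a)" "(F \<longlongrightarrow> B) at_top"
  shows "(LINT x:{a<..}|lborel. f x) = B - A"
proof -
  have "(LBINT x=ereal a..\<infinity>. f x) = B - A"
    using assms
    by (intro interval_integral_FTC_integrable)
      (auto simp: ereal_tendsto_simps einterval_atLeast_infinity has_real_derivative_iff_has_vector_derivative[symmetric])
  then show ?thesis
    by (simp add: interval_lebesgue_integral_def einterval_atLeast_infinity)
qed

lemma FTC_half_line_nonneg:
  fixes f F :: "real \<Rightarrow> real"
  assumes F: "\<And>x. a < x \<Longrightarrow> (F has_real_derivative f x) (at x)" and f: "\<And>x. a < x \<Longrightarrow> isCont f x"
    and nonneg: "\<And>x. a < x \<Longrightarrow> 0 \<le> f x" and lim: "(F \<longlongrightarrow> A) (at_right a)" "(F \<longlongrightarrow> B) at_top"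
  shows "set_integrable lborel {a<..} f" "(LINT x:{a<..}|lborel. f x) = B - A"
proof -
  have *: "ereal a < \<infinity>" "AE x in lborel. ereal a < ereal x \<longrightarrow> ereal x < \<infinity> \<longrightarrow> 0 \<le> f x"
    using nonneg by auto
  have "set_integrable lborel (einterval (ereal a) \<infinity>) f"
    by (rule interval_integral_FTC_nonneg(1)[where F = F and A = A and B = B])
      (use assms in \<open>auto simp: ereal_tendsto_simps\<close>)
  then show i: "set_integrable lborel {a<..} f" by (simp add: einterval_atLeast_infinity)
  show "(LINT x:{a<..}|lborel. f x) = B - A"
    using F f i lim by (rule integral_FTC_half_line)
qed

lemma inverse_square_tail:
  assumes a: "(a::real) > 0"
  shows "set_integrable lborel {a<..} (\<lambda>u. 1 / u\<^sup>2)" "(LINT u:{a<..}|lborel. 1 / u\<^sup>2) = 1 / a"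
proof -
  have 1: "((\<lambda>u. - 1 / u) has_real_derivative 1 / u\<^sup>2) (at u)" if "a < u" for u
    using that a by (auto intro!: derivative_eq_intros simp: power2_eq_square)
  have 2: "isCont (\<lambda>u. 1 / u\<^sup>2) u" if "a < u" for u
    using that a by (intro continuous_intros) auto
  have 3: "((\<lambda>u. - 1 / u) \<longlongrightarrow> - 1 / a) (at_right a)"
    using a by (intro tendsto_intros) auto
  have 4: "((\<lambda>u::real. - 1 / u) \<longlongrightarrow> 0) at_top"
    by (intro tendsto_divide_0[OF tendsto_const] filterlim_at_top_imp_at_infinity filterlim_ident)
  note FTC_half_line_nonneg[where F = "\<lambda>u. - 1 / u" and f = "\<lambda>u. 1 / u\<^sup>2", OF 1 2 _ 3 4]
  then show "set_integrable lborel {a<..} (\<lambda>u. 1 / u\<^sup>2)" "(LINT u:{a<..}|lborel. 1 / u\<^sup>2) = 1 / a" by auto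
qed

lemma inverse_cube_tail:
  assumes a: "(a::real) > 0"
  shows "set_integrable lborel {a<..} (\<lambda>u. 1 / u ^ 3)" "(LINT u:{a<..}|lborel. 1 / u ^ 3) = 1 / (2 * a\<^sup>2)"
proof -
  have 1: "((\<lambda>u. - 1 / (2 * u\<^sup>2)) has_real_derivative 1 / u ^ 3) (at u)" if "a < u" for u
    using that a by (auto intro!: derivative_eq_intros simp: power2_eq_square power3_eq_cube)
  have 2: "isCont (\<lambda>u. 1 / u ^ 3) u" if "a < u" for u
    using that a by (intro continuous_intros) auto
  have 3: "((\<lambda>u. - 1 / (2 * u\<^sup>2)) \<longlongrightarrow> - 1 / (2 * a\<^sup>2)) (at_right a)"
    using a by (intro tendsto_intros) auto
  have 4: "((\<lambda>u::real. - 1 / (2 * u\<^sup>2)) \<longlongrightarrow> 0) at_top"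
    by (intro tendsto_divide_0[OF tendsto_const] filterlim_at_top_imp_at_infinity
        filterlim_tendsto_pos_mult_at_top[OF tendsto_const] filterlim_pow_at_top filterlim_ident) auto
  note FTC_half_line_nonneg[where F = "\<lambda>u. - 1 / (2 * u\<^sup>2)" and f = "\<lambda>u. 1 / u ^ 3", OF 1 2 _ 3 4]
  then show "set_integrable lborel {a<..} (\<lambda>u. 1 / u ^ 3)" "(LINT u:{a<..}|lborel. 1 / u ^ 3) = 1 / (2 * a\<^sup>2)"
    using a by auto
qed

text \<open>The standard majorant for integrals along lines in the gnomonic plane. Its mass
  \<open>pi\<close> reappears as the limit factor in \<open>abel_tail_limit\<close>.\<close>

lemma cauchy_density:
  "integrable lborel (\<lambda>x::real. 1 / (1 + x\<^sup>2))" "(\<integral>x. 1 / (1 + x\<^sup>2) \<partial>lborel) = pi"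
proof -
  have nz: "1 + x\<^sup>2 \<noteq> 0" for x :: real
    by (metis add_pos_nonneg less_irrefl zero_le_power2 zero_less_one)
  have 1: "(arctan has_real_derivative 1 / (1 + x\<^sup>2)) (at x)" for x
    by (auto intro!: derivative_eq_intros simp: divide_inverse)
  have 2: "isCont (\<lambda>x. 1 / (1 + x\<^sup>2)) x" for x :: real
    using nz by (intro continuous_intros) auto
  have i: "set_integrable lborel (einterval (-\<infinity>) \<infinity>) (\<lambda>x::real. 1 / (1 + x\<^sup>2))"
    by (rule interval_integral_FTC_nonneg(1)[where F = arctan and A = "- pi / 2" and B = "pi / 2"])
      (use 1 2 tendsto_arctan_at_top tendsto_arctan_at_bot in \<open>auto simp: ereal_tendsto_simps\<close>)
  then show i: "integrable lborel (\<lambda>x::real. 1 / (1 + x\<^sup>2))" by (simp add: set_integrable_def)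
  have "(\<integral>x. 1 / (1 + x\<^sup>2) \<partial>lborel) = pi / 2 - (- pi / 2)"
    by (rule integral_FTC_real_line[OF 1 2 i]) (use tendsto_arctan_at_top tendsto_arctan_at_bot in auto)
  then show "(\<integral>x. 1 / (1 + x\<^sup>2) \<partial>lborel) = pi" by simp
qed

lemma cauchy_density_shift:
  "integrable lborel (\<lambda>x::real. 1 / (1 + (a + x)\<^sup>2))" "(\<integral>x. 1 / (1 + (a + x)\<^sup>2) \<partial>lborel) = pi"
  "integrable lborel (\<lambda>x::real. 1 / (1 + (a - x)\<^sup>2))" "(\<integral>x. 1 / (1 + (a - x)\<^sup>2) \<partial>lborel) = pi"
  using lborel_integrable_real_affine[OF cauchy_density(1), of 1 a] lborel_integrable_real_affine[OF cauchy_density(1), of "-1" a]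
    lborel_integral_real_affine[of 1 "\<lambda>x. 1 / (1 + x\<^sup>2)" a] lborel_integral_real_affine[of "-1" "\<lambda>x. 1 / (1 + x\<^sup>2)" a]
    cauchy_density(2) by auto

section \<open>Integration over a period\<close>

text \<open>The half-open interval matches \<^const>\<open>circle_measure\<close>.\<close>

definition period_measure :: "real measure" where
  "period_measure = restrict_space lborel {0..<2 * pi}"

lemma space_period_measure [simp]: "space period_measure = {0..<2 * pi}"
  by (simp add: period_measure_def space_restrict_space)

lemma finite_period_measure [simp]: "finite_measure period_measure"
  by standard (simp add: period_measure_def emeasure_restrict_space space_restrict_space)

interpretation period_measure: finite_measure period_measure
  by simp

lemma measure_period_measure [simp]: "measure period_measure {0..<2 * pi} = 2 * pi"
  by (simp add: period_measure_def measure_restrict_space)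

lemma measurable_period_measure [measurable (raw)]:
  "f \<in> borel_measurable borel \<Longrightarrow> f \<in> borel_measurable period_measure"
  unfolding period_measure_def by (intro measurable_restrict_space1) simp

lemma period_measure_integrable:
  fixes F :: "real \<Rightarrow> real"
  assumes "continuous_on UNIV F"
  shows "integrable period_measure F"
proof -
  have "compact (F ` {0..2 * pi})"
    using continuous_on_subset[OF assms] by (intro compact_continuous_image) auto
  then obtain B where "\<forall>y\<in>F ` {0..2 * pi}. norm y \<le> B"
    using compact_imp_bounded bounded_pos by metis
  then show ?thesis
    using borel_measurable_continuous_onI[OF assms]
    by (intro period_measure.integrable_const_bound[where B = B]) (auto intro: measurable_period_measure)
qed

lemma period_integral_eq:
  fixes F :: "real \<Rightarrow> real"
  assumes "continuous_on UNIV F"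
  shows "(\<integral>\<phi>. F \<phi> \<partial>period_measure) = integral {0..2 * pi} F"
proof -
  have i: "set_integrable lborel {0..2 * pi} F"
    using continuous_on_subset[OF assms] by (intro borel_integrable_atLeastAtMost') auto
  have "(\<integral>\<phi>. F \<phi> \<partial>period_measure) = (\<integral>\<phi>. indicator {0..<2 * pi} \<phi> *\<^sub>R F \<phi> \<partial>lborel)"
    unfolding period_measure_def by (rule integral_restrict_space) simp
  also have "\<dots> = (\<integral>\<phi>. indicator {0..2 * pi} \<phi> *\<^sub>R F \<phi> \<partial>lborel)"
  proof (rule integral_cong_AE)
    show "AE \<phi> in lborel. indicator {0..<2 * pi} \<phi> *\<^sub>R F \<phi> = indicator {0..2 * pi} \<phi> *\<^sub>R F \<phi>"
      by (rule eventually_mono[OF AE_lborel_singleton[of "2 * pi"]]) (auto simp: indicator_def)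
  qed (use borel_measurable_continuous_onI[OF assms] in auto)
  also have "\<dots> = integral {0..2 * pi} F"
    using set_borel_integral_eq_integral(2)[OF i] by (simp add: set_lebesgue_integral_def)
  finally show ?thesis .
qed

text \<open>Shifts and reflections of the integrand become differences of one primitive, and the
  last clause says that such a difference over a period does not depend on its starting point. The
  period \<open>P\<close> is left open because even functions on a great circle also have the period
  \<open>pi\<close>.\<close>

lemma periodic_primitive:
  fixes F :: "real \<Rightarrow> real"
  assumes F: "continuous_on UNIV F"
  obtains A where "\<And>x. (A has_real_derivative F x) (at x)"
    "\<And>\<delta>. (\<integral>\<phi>. F (\<phi> + \<delta>) \<partial>period_measure) = A (\<delta> + 2 * pi) - A \<delta>"
    "(\<integral>\<phi>. F (- \<phi>) \<partial>period_measure) = A 0 - A (- 2 * pi)"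
    "\<And>P x y. (\<And>z. F (z + P) = F z) \<Longrightarrow> A (x + P) - A x = A (y + P) - A y"
proof -
  have "\<exists>A. \<forall>x::real. -\<infinity> < ereal x \<longrightarrow> ereal x < \<infinity> \<longrightarrow> (A has_vector_derivative F x) (at x)"
    using F by (intro einterval_antiderivative) (auto simp: continuous_on_eq_continuous_at)
  then obtain A where A: "\<And>x. (A has_real_derivative F x) (at x)"
    by (auto simp: has_real_derivative_iff_has_vector_derivative)
  have ftc: "integral {0..2 * pi} G = H (2 * pi) - H 0" if "\<And>x. (H has_real_derivative G x) (at x)" for G H
    using that by (intro integral_unique fundamental_theorem_of_calculus)
      (auto simp: has_real_derivative_iff_has_vector_derivative[symmetric] intro: has_field_derivative_at_within)
  have 1: "(\<integral>\<phi>. F (\<phi> + \<delta>) \<partial>period_measure) = A (\<delta> + 2 * pi) - A \<delta>" for \<delta>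
  proof -
    have "continuous_on UNIV (\<lambda>\<phi>. F (\<phi> + \<delta>))"
      by (intro continuous_on_compose2[OF F] continuous_intros) auto
    moreover have "((\<lambda>\<phi>. A (\<phi> + \<delta>)) has_real_derivative F (x + \<delta>)) (at x)" for x
      using DERIV_shift[of A "F (x + \<delta>)" x \<delta>] A by blast
    ultimately show ?thesis
      using ftc[of "\<lambda>\<phi>. A (\<phi> + \<delta>)" "\<lambda>\<phi>. F (\<phi> + \<delta>)"] by (simp add: period_integral_eq add.commute)
  qed
  have 2: "(\<integral>\<phi>. F (- \<phi>) \<partial>period_measure) = A 0 - A (- 2 * pi)"
  proof -
    have "continuous_on UNIV (\<lambda>\<phi>. F (- \<phi>))"
      by (intro continuous_on_compose2[OF F] continuous_intros) auto
    moreover have "((\<lambda>\<phi>. - A (- \<phi>)) has_real_derivative F (- x)) (at x)" for x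
    proof -
      have "(uminus has_real_derivative - 1) (at x)" by (auto intro!: derivative_eq_intros)
      from DERIV_minus[OF DERIV_chain2[where f = A and g = uminus, OF A this]] show ?thesis by simp
    qed
    ultimately show ?thesis
      using ftc[of "\<lambda>\<phi>. - A (- \<phi>)" "\<lambda>\<phi>. F (- \<phi>)"] by (simp add: period_integral_eq)
  qed
  have 3: "A (x + P) - A x = A (y + P) - A y" if "\<And>z. F (z + P) = F z" for P x y
  proof -
    have "((\<lambda>x. A (x + P) - A x) has_real_derivative 0) (at z)" for z
      using DERIV_diff[OF DERIV_shift[THEN iffD1, OF A[of "z + P"]] A[of z]] that by simp
    then show ?thesis
      using DERIV_isconst_all by blast
  qed
  show ?thesis using that A 1 2 3 by blast
qed

lemma period_integral_shift:
  fixes F :: "real \<Rightarrow> real"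
  assumes F: "continuous_on UNIV F" and per: "\<And>z. F (z + 2 * pi) = F z"
  shows "(\<integral>\<phi>. F (\<phi> + \<delta>) \<partial>period_measure) = (\<integral>\<phi>. F \<phi> \<partial>period_measure)"
    and "(\<integral>\<phi>. F (\<delta> - \<phi>) \<partial>period_measure) = (\<integral>\<phi>. F \<phi> \<partial>period_measure)"
proof -
  obtain A where A: "\<And>\<delta>. (\<integral>\<phi>. F (\<phi> + \<delta>) \<partial>period_measure) = A (\<delta> + 2 * pi) - A \<delta>"
    "\<And>P x y. (\<And>z. F (z + P) = F z) \<Longrightarrow> A (x + P) - A x = A (y + P) - A y"
    using periodic_primitive[OF F] by metis
  show 1: "(\<integral>\<phi>. F (\<phi> + \<delta>) \<partial>period_measure) = (\<integral>\<phi>. F \<phi> \<partial>period_measure)"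
    using A(1)[of \<delta>] A(1)[of 0] A(2)[of "2 * pi" \<delta> 0] per by simp
  let ?F = "\<lambda>\<phi>. F (\<delta> + \<phi>)"
  have F': "continuous_on UNIV ?F"
    by (intro continuous_on_compose2[OF F] continuous_intros) auto
  have per': "?F (z + 2 * pi) = ?F z" for z using per[of "\<delta> + z"] by (simp add: add.assoc)
  obtain A' where A': "\<And>\<delta>'. (\<integral>\<phi>. ?F (\<phi> + \<delta>') \<partial>period_measure) = A' (\<delta>' + 2 * pi) - A' \<delta>'"
    "(\<integral>\<phi>. ?F (- \<phi>) \<partial>period_measure) = A' 0 - A' (- 2 * pi)"
    "\<And>P x y. (\<And>z. ?F (z + P) = ?F z) \<Longrightarrow> A' (x + P) - A' x = A' (y + P) - A' y"
    using periodic_primitive[OF F'] by metis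
  have "(\<integral>\<phi>. F (\<delta> - \<phi>) \<partial>period_measure) = (\<integral>\<phi>. F (\<delta> + \<phi>) \<partial>period_measure)"
    using A'(1)[of 0] A'(2) A'(3)[of "2 * pi" 0 "- 2 * pi"] per' by simp
  then show "(\<integral>\<phi>. F (\<delta> - \<phi>) \<partial>period_measure) = (\<integral>\<phi>. F \<phi> \<partial>period_measure)"
    using 1 by (simp add: add.commute)
qed

section \<open>Truncated integrals and principal values\<close>

lemma tendsto_integral_at_right_0:
  fixes D w :: "real \<Rightarrow> real"
  assumes D: "D \<in> borel_measurable lborel" and w: "integrable lborel w"
    and bd: "\<And>u. u > 0 \<Longrightarrow> \<bar>D u\<bar> \<le> w u" and w0: "\<And>u. 0 \<le> w u"
  shows "((\<lambda>\<epsilon>. LINT u:{\<epsilon><..}|lborel. D u) \<longlongrightarrow> (LINT u:{0<..}|lborel. D u)) (at_right 0)"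
    and "set_integrable lborel {0<..} D"
    and "\<And>\<epsilon>. \<epsilon> \<ge> 0 \<Longrightarrow> \<bar>LINT u:{\<epsilon><..}|lborel. D u\<bar> \<le> (\<integral>u. w u \<partial>lborel)"
proof -
  have i: "set_integrable lborel {\<epsilon><..} D" if "\<epsilon> \<ge> 0" for \<epsilon>
    unfolding set_integrable_def
    by (rule Bochner_Integration.integrable_bound[OF w])
      (use D bd w0 that in \<open>auto simp: indicator_def\<close>)
  then show "set_integrable lborel {0<..} D" by simp
  show "\<bar>LINT u:{\<epsilon><..}|lborel. D u\<bar> \<le> (\<integral>u. w u \<partial>lborel)" if "\<epsilon> \<ge> 0" for \<epsilon>
  proof -
    have "\<bar>LINT u:{\<epsilon><..}|lborel. D u\<bar> \<le> (\<integral>u. \<bar>indicator {\<epsilon><..} u *\<^sub>R D u\<bar> \<partial>lborel)"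
      unfolding set_lebesgue_integral_def by (rule integral_abs_bound)
    also have "\<dots> \<le> (\<integral>u. w u \<partial>lborel)"
      using i[OF that] bd w0 that w
      by (intro integral_mono) (auto simp: set_integrable_def indicator_def intro!: integrable_abs)
    finally show ?thesis .
  qed
  show "((\<lambda>\<epsilon>. LINT u:{\<epsilon><..}|lborel. D u) \<longlongrightarrow> (LINT u:{0<..}|lborel. D u)) (at_right 0)"
    unfolding tendsto_at_iff_sequentially
  proof (intro allI impI)
    fix X :: "nat \<Rightarrow> real" assume X: "\<forall>i. X i \<in> {0<..} - {0}" "X \<longlonglongrightarrow> 0"
    show "((\<lambda>\<epsilon>. LINT u:{\<epsilon><..}|lborel. D u) \<circ> X) \<longlonglongrightarrow> (LINT u:{0<..}|lborel. D u)"
      unfolding o_def set_lebesgue_integral_def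
    proof (rule integral_dominated_convergence[OF _ _ w])
      show "AE u in lborel. (\<lambda>i. indicator {X i<..} u *\<^sub>R D u) \<longlonglongrightarrow> indicator {0<..} u *\<^sub>R D u"
      proof (rule AE_I2)
        fix u :: real
        show "(\<lambda>i. indicator {X i<..} u *\<^sub>R D u) \<longlonglongrightarrow> indicator {0<..} u *\<^sub>R D u"
        proof (cases "u > 0")
          case True
          then have "\<forall>\<^sub>F i in sequentially. X i < u" using X(2) order_tendstoD(2) by blast
          then have "\<forall>\<^sub>F i in sequentially. indicator {X i<..} u *\<^sub>R D u = indicator {0<..} u *\<^sub>R D u"
            by eventually_elim (use True in auto)
          then show ?thesis by (rule tendsto_eventually)
        next
          case False
          then have "indicator {X i<..} u *\<^sub>R D u = indicator {0<..} u *\<^sub>R D u" for i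
            using X(1)[rule_format, of i] by (auto simp: indicator_def)
          then show ?thesis by (simp only: tendsto_const)
        qed
      qed
      show "AE u in lborel. norm (indicator {X i<..} u *\<^sub>R D u) \<le> w u" for i
      proof (rule AE_I2)
        fix u
        have "X i > 0" using X(1) by auto
        then show "norm (indicator {X i<..} u *\<^sub>R D u) \<le> w u"
          using bd[of u] w0[of u] by (auto simp: indicator_def)
      qed
    qed (use D in auto)
  qed
qed

text \<open>Folding the line at the pole pairs \<open>a - u\<close> with \<open>a + u\<close>. The
  folded integrand \<open>D\<close> is absolutely integrable, so the principal value becomes an
  ordinary integral. The bound on the truncations depends neither on \<open>a\<close> nor on
  \<open>\<epsilon>\<close>; it later dominates the average over all directions, where the pole
  moves.\<close>

lemma pv_integral_symmetric:
  fixes p :: "real \<Rightarrow> real" and a c :: real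
  assumes pm: "p \<in> borel_measurable borel" and C: "\<And>s. \<bar>p s\<bar> \<le> C / (1 + s\<^sup>2)"
    and K: "\<And>s s'. \<bar>p s - p s'\<bar> \<le> K * \<bar>s - s'\<bar>"
  defines "D \<equiv> \<lambda>u. (p (a - u) - p (a + u)) / u"
  shows "has_pv_integral (\<lambda>s. c * (p s / (a - s))) a (c * (LINT u:{0<..}|lborel. D u))"
    and "((\<lambda>\<epsilon>. LINT u:{\<epsilon><..}|lborel. D u) \<longlongrightarrow> (LINT u:{0<..}|lborel. D u)) (at_right 0)"
    and "\<And>\<epsilon>. \<epsilon> \<ge> 0 \<Longrightarrow> \<bar>LINT u:{\<epsilon><..}|lborel. D u\<bar> \<le> 2 * K + 2 * C * pi"
    and "\<And>\<epsilon>. \<epsilon> > 0 \<Longrightarrow> set_integrable lborel {\<epsilon><..} (\<lambda>u. p (a + u) / u)"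
    and "\<And>\<epsilon>. \<epsilon> > 0 \<Longrightarrow> set_integrable lborel {\<epsilon><..} (\<lambda>u. p (a - u) / u)"
proof -
  note [measurable] = pm
  have C0: "C \<ge> 0" using C[of 0] by (smt (verit) abs_ge_zero div_by_1 add_0_right power_zero_numeral)
  have K0: "K \<ge> 0" using K[of 0 1] by simp
  \<comment> \<open>Near the pole the Lipschitz constant controls the difference quotient, beyond
    distance 1 the decay of \<open>p\<close> does. The two Cauchy densities are extended to the
    whole line so that their mass is \<open>pi\<close> whatever \<open>a\<close> is.\<close>
  define w where "w = (\<lambda>u. 2 * K * indicator {0..1} u + C * (1 / (1 + (a - u)\<^sup>2)) + C * (1 / (1 + (a + u)\<^sup>2)))"
  have wi: "integrable lborel (\<lambda>u::real. 2 * K * indicator {0..1} u)"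
    by (intro integrable_mult_right integrable_real_indicator) auto
  have wint: "integrable lborel w"
    unfolding w_def
    by (intro Bochner_Integration.integrable_add wi integrable_mult_right cauchy_density_shift)
  have "(\<integral>u. w u \<partial>lborel) = 2 * K + C * pi + C * pi"
  proof -
    have "(\<integral>u. w u \<partial>lborel) = (\<integral>u. 2 * K * indicator {0..1} (u::real) \<partial>lborel) +
      (\<integral>u. C * (1 / (1 + (a - u)\<^sup>2)) \<partial>lborel) + (\<integral>u. C * (1 / (1 + (a + u)\<^sup>2)) \<partial>lborel)"
      unfolding w_def
      by (simp only: Bochner_Integration.integral_add Bochner_Integration.integrable_add wi integrable_mult_right cauchy_density_shift)
    then show ?thesis
      by (simp only: Bochner_Integration.integral_mult_right_zero cauchy_density_shift) simp
  qed
  then have wI: "(\<integral>u. w u \<partial>lborel) = 2 * K + 2 * C * pi" by simp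
  have w0: "0 \<le> w u" for u using C0 K0 by (auto simp: w_def intro!: add_nonneg_nonneg)
  have Db: "\<bar>D u\<bar> \<le> w u" if u: "u > 0" for u
  proof (cases "u \<le> 1")
    case True
    have "\<bar>p (a - u) - p (a + u)\<bar> \<le> K * (2 * u)" using K[of "a - u" "a + u"] u by simp
    then have "\<bar>D u\<bar> \<le> 2 * K" using u by (simp add: D_def abs_divide divide_le_eq)
    also have "\<dots> \<le> w u" using True u C0 by (auto simp: w_def)
    finally show ?thesis .
  next
    case False
    have "\<bar>D u\<bar> \<le> \<bar>p (a - u) - p (a + u)\<bar>"
      using False by (simp add: D_def abs_divide divide_le_eq mult_le_cancel_left1)
    also have "\<dots> \<le> C / (1 + (a - u)\<^sup>2) + C / (1 + (a + u)\<^sup>2)"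
      using C[of "a - u"] C[of "a + u"] by linarith
    also have "\<dots> \<le> w u" using K0 by (auto simp: w_def)
    finally show ?thesis .
  qed
  have Dm: "D \<in> borel_measurable lborel" unfolding D_def by measurable
  show lim: "((\<lambda>\<epsilon>. LINT u:{\<epsilon><..}|lborel. D u) \<longlongrightarrow> (LINT u:{0<..}|lborel. D u)) (at_right 0)"
    by (rule tendsto_integral_at_right_0(1)[OF Dm wint Db w0])
  show "\<bar>LINT u:{\<epsilon><..}|lborel. D u\<bar> \<le> 2 * K + 2 * C * pi" if "\<epsilon> \<ge> 0" for \<epsilon>
    using tendsto_integral_at_right_0(3)[OF Dm wint Db w0 that] wI by simp
  have bdd: "\<bar>p (a + u) / u\<bar> \<le> C / \<epsilon> * (1 / (1 + (a + u)\<^sup>2))" if "\<epsilon> > 0" "\<bar>u\<bar> > \<epsilon>" for u \<epsilon>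
  proof -
    have "\<bar>p (a + u)\<bar> / \<bar>u\<bar> \<le> (C / (1 + (a + u)\<^sup>2)) / \<epsilon>"
      using C[of "a + u"] that C0 by (intro frac_le) auto
    then show ?thesis by (simp add: abs_divide mult.commute)
  qed
  show i1: "set_integrable lborel {\<epsilon><..} (\<lambda>u. p (a + u) / u)" if e: "\<epsilon> > 0" for \<epsilon>
    unfolding set_integrable_def
  proof (rule Bochner_Integration.integrable_bound)
    show "integrable lborel (\<lambda>u. C / \<epsilon> * (1 / (1 + (a + u)\<^sup>2)))"
      by (intro integrable_mult_right cauchy_density_shift)
    show "AE u in lborel. norm (indicator {\<epsilon><..} u *\<^sub>R (p (a + u) / u)) \<le> norm (C / \<epsilon> * (1 / (1 + (a + u)\<^sup>2)))"
    proof (rule AE_I2)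
      fix u :: real
      have "0 \<le> C / \<epsilon> * (1 / (1 + (a + u)\<^sup>2))" using C0 e by simp
      then show "norm (indicator {\<epsilon><..} u *\<^sub>R (p (a + u) / u)) \<le> norm (C / \<epsilon> * (1 / (1 + (a + u)\<^sup>2)))"
        using bdd[OF e, of u] e C0 by (cases "u > \<epsilon>") (simp_all add: abs_divide)
    qed
  qed measurable
  show i2: "set_integrable lborel {\<epsilon><..} (\<lambda>u. p (a - u) / u)" if e: "\<epsilon> > 0" for \<epsilon>
    unfolding set_integrable_def
  proof (rule Bochner_Integration.integrable_bound)
    show "integrable lborel (\<lambda>u. C / \<epsilon> * (1 / (1 + (a - u)\<^sup>2)))"
      by (intro integrable_mult_right cauchy_density_shift)
    show "AE u in lborel. norm (indicator {\<epsilon><..} u *\<^sub>R (p (a - u) / u)) \<le> norm (C / \<epsilon> * (1 / (1 + (a - u)\<^sup>2)))"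
    proof (rule AE_I2)
      fix u :: real
      have "0 \<le> C / \<epsilon> * (1 / (1 + (a - u)\<^sup>2))" using C0 e by simp
      then show "norm (indicator {\<epsilon><..} u *\<^sub>R (p (a - u) / u)) \<le> norm (C / \<epsilon> * (1 / (1 + (a - u)\<^sup>2)))"
        using bdd[OF e, of "- u"] e C0 by (cases "u > \<epsilon>") (simp_all add: abs_divide)
    qed
  qed measurable
  have main: "set_integrable lborel {s. \<bar>s - a\<bar> > \<epsilon>} (\<lambda>s. c * (p s / (a - s)))"
    "(LINT s:{s. \<bar>s - a\<bar> > \<epsilon>}|lborel. c * (p s / (a - s))) = c * (LINT u:{\<epsilon><..}|lborel. D u)" if e: "\<epsilon> > 0" for \<epsilon>
  proof -
    have bD: "has_bochner_integral lborel (\<lambda>u. indicator {\<epsilon><..} u * (p (a + u) / u)) (LINT u:{\<epsilon><..}|lborel. p (a + u) / u)"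
      "has_bochner_integral lborel (\<lambda>u. indicator {\<epsilon><..} u * (p (a - u) / u)) (LINT u:{\<epsilon><..}|lborel. p (a - u) / u)"
      using i1[OF e] i2[OF e] by (simp_all add: has_bochner_integral_iff set_integrable_def set_lebesgue_integral_def)
    have "has_bochner_integral lborel (\<lambda>s. indicator {\<epsilon><..} (- a + 1 * s) * (p (a + (- a + 1 * s)) / (- a + 1 * s)))
        ((LINT u:{\<epsilon><..}|lborel. p (a + u) / u) /\<^sub>R \<bar>1\<bar>)"
      by (rule lborel_has_bochner_integral_real_affine_iff[THEN iffD1, OF _ bD(1)]) simp
    moreover have "has_bochner_integral lborel (\<lambda>s. indicator {\<epsilon><..} (a + (-1) * s) * (p (a - (a + (-1) * s)) / (a + (-1) * s)))
        ((LINT u:{\<epsilon><..}|lborel. p (a - u) / u) /\<^sub>R \<bar>-1\<bar>)"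
      by (rule lborel_has_bochner_integral_real_affine_iff[THEN iffD1, OF _ bD(2)]) simp
    ultimately have "has_bochner_integral lborel (\<lambda>s. c * (indicator {\<epsilon><..} (a + (-1) * s) * (p (a - (a + (-1) * s)) / (a + (-1) * s)) -
       indicator {\<epsilon><..} (- a + 1 * s) * (p (a + (- a + 1 * s)) / (- a + 1 * s))))
       (c * ((LINT u:{\<epsilon><..}|lborel. p (a - u) / u) /\<^sub>R \<bar>-1\<bar> - (LINT u:{\<epsilon><..}|lborel. p (a + u) / u) /\<^sub>R \<bar>1\<bar>))"
      by (intro has_bochner_integral_mult_right has_bochner_integral_diff)
    also have "(\<lambda>s. c * (indicator {\<epsilon><..} (a + (-1) * s) * (p (a - (a + (-1) * s)) / (a + (-1) * s)) -
       indicator {\<epsilon><..} (- a + 1 * s) * (p (a + (- a + 1 * s)) / (- a + 1 * s)))) =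
       (\<lambda>s. indicator {s. \<bar>s - a\<bar> > \<epsilon>} s *\<^sub>R (c * (p s / (a - s))))"
    proof (rule ext)
      fix s
      have "p s / (a - s) = - (p s / (s - a))" by (metis minus_diff_eq minus_divide_right)
      then show "c * (indicator {\<epsilon><..} (a + (-1) * s) * (p (a - (a + (-1) * s)) / (a + (-1) * s)) -
       indicator {\<epsilon><..} (- a + 1 * s) * (p (a + (- a + 1 * s)) / (- a + 1 * s))) =
       indicator {s. \<bar>s - a\<bar> > \<epsilon>} s *\<^sub>R (c * (p s / (a - s)))"
        using e by (auto simp: indicator_def)
    qed
    also have "(LINT u:{\<epsilon><..}|lborel. p (a - u) / u) /\<^sub>R \<bar>-1\<bar> - (LINT u:{\<epsilon><..}|lborel. p (a + u) / u) /\<^sub>R \<bar>1\<bar> =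
      (LINT u:{\<epsilon><..}|lborel. D u)"
      using set_integral_diff(2)[OF i2[OF e] i1[OF e]] by (simp add: D_def diff_divide_distrib)
    finally show "set_integrable lborel {s. \<bar>s - a\<bar> > \<epsilon>} (\<lambda>s. c * (p s / (a - s)))"
      "(LINT s:{s. \<bar>s - a\<bar> > \<epsilon>}|lborel. c * (p s / (a - s))) = c * (LINT u:{\<epsilon><..}|lborel. D u)"
      by (simp_all only: has_bochner_integral_iff set_integrable_def set_lebesgue_integral_def)
  qed
  show "has_pv_integral (\<lambda>s. c * (p s / (a - s))) a (c * (LINT u:{0<..}|lborel. D u))"
    unfolding has_pv_integral_def
  proof (intro conjI allI impI)
    show "((\<lambda>\<epsilon>. LINT s:{s. \<bar>s - a\<bar> > \<epsilon>}|lborel. c * (p s / (a - s))) \<longlongrightarrow> c * (LINT u:{0<..}|lborel. D u)) (at_right 0)"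
    proof (rule Lim_transform_eventually[OF tendsto_mult_left[OF lim]])
      show "\<forall>\<^sub>F \<epsilon> in at_right 0. c * (LINT u:{\<epsilon><..}|lborel. D u) = (LINT s:{s. \<bar>s - a\<bar> > \<epsilon>}|lborel. c * (p s / (a - s)))"
        using eventually_at_right_less[of 0] by eventually_elim (simp only: main)
    qed
  qed (rule main)
qed

section \<open>Abel integrals of a radial profile\<close>

text \<open>Prepares the integration by parts in \<open>abel_tail_identity\<close>: the quadratic
  decay of \<open>B\<close> makes it integrable along the line and removes the boundary terms, and
  its derivative returns \<open>g\<close>.\<close>

lemma newton_tail_bound:
  fixes g :: "real \<Rightarrow> real"
  assumes g: "continuous_on UNIV g" and C: "\<And>\<rho>. \<bar>g \<rho>\<bar> \<le> C / (1 + \<rho>\<^sup>2)"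
  defines "B \<equiv> \<lambda>u. LINT \<rho>:{u<..}|lborel. g \<rho> / \<rho>"
  assumes u: "u > 0"
  shows "set_integrable lborel {u<..} (\<lambda>\<rho>. g \<rho> / \<rho>)" "\<bar>B u\<bar> \<le> C / (2 * u\<^sup>2)" "(B has_real_derivative - (g u / u)) (at u)"
proof -
  have [measurable]: "g \<in> borel_measurable borel" using g by (rule borel_measurable_continuous_onI)
  have C0: "C \<ge> 0" using C[of 0] by (smt (verit) abs_ge_zero div_by_1 add_0_right power_zero_numeral)
  have b: "\<bar>g \<rho> / \<rho>\<bar> \<le> C * (1 / \<rho> ^ 3)" if "\<rho> > 0" for \<rho>
  proof -
    have "\<bar>g \<rho>\<bar> / \<rho> \<le> (C / (1 + \<rho>\<^sup>2)) / \<rho>" using C that by (intro divide_right_mono) auto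
    also have "\<dots> \<le> (C / \<rho>\<^sup>2) / \<rho>" using that C0 by (intro divide_right_mono divide_left_mono mult_pos_pos add_pos_nonneg) auto
    finally show ?thesis using that by (simp add: abs_divide power2_eq_square power3_eq_cube)
  qed
  have c: "set_integrable lborel {u<..} (\<lambda>\<rho>. C * (1 / \<rho> ^ 3))" if "u > 0" for u
    using inverse_cube_tail(1)[OF that] by (intro set_integrable_mult_right) auto
  have i: "set_integrable lborel {u<..} (\<lambda>\<rho>. g \<rho> / \<rho>)" if u: "u > 0" for u
    unfolding set_integrable_def
  proof (rule Bochner_Integration.integrable_bound[OF c[OF u, unfolded set_integrable_def]])
    show "AE x in lborel. norm (indicat_real {u<..} x *\<^sub>R (g x / x)) \<le> norm (indicat_real {u<..} x *\<^sub>R (C * (1 / x ^ 3)))"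
    proof (rule AE_I2)
      fix x show "norm (indicat_real {u<..} x *\<^sub>R (g x / x)) \<le> norm (indicat_real {u<..} x *\<^sub>R (C * (1 / x ^ 3)))"
      proof (cases "x > u")
        case True
        then have "\<bar>g x / x\<bar> \<le> C * (1 / x ^ 3)" using u b[of x] by auto
        also have "\<dots> \<le> \<bar>C * (1 / x ^ 3)\<bar>" by (rule abs_ge_self)
        finally show ?thesis using True by simp
      qed simp
    qed
  qed measurable
  show "set_integrable lborel {u<..} (\<lambda>\<rho>. g \<rho> / \<rho>)" using i[OF u] .
  have "\<bar>B u\<bar> \<le> (\<integral>x. \<bar>indicat_real {u<..} x *\<^sub>R (g x / x)\<bar> \<partial>lborel)"
    unfolding B_def set_lebesgue_integral_def by (rule integral_abs_bound)
  also have "\<dots> \<le> (\<integral>x. indicat_real {u<..} x *\<^sub>R (C * (1 / x ^ 3)) \<partial>lborel)"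
  proof (rule integral_mono)
    fix x show "\<bar>indicat_real {u<..} x *\<^sub>R (g x / x)\<bar> \<le> indicat_real {u<..} x *\<^sub>R (C * (1 / x ^ 3))"
      using b[of x] u by (auto simp: indicator_def)
    show "integrable lborel (\<lambda>x. \<bar>indicat_real {u<..} x *\<^sub>R (g x / x)\<bar>)"
      by (rule integrable_abs[OF i[OF u, unfolded set_integrable_def]])
    show "integrable lborel (\<lambda>x. indicat_real {u<..} x *\<^sub>R (C * (1 / x ^ 3)))"
      by (rule c[OF u, unfolded set_integrable_def])
  qed
  also have "\<dots> = C * (LINT x:{u<..}|lborel. 1 / x ^ 3)"
    unfolding set_integral_mult_right[symmetric] by (simp only: set_lebesgue_integral_def)
  also have "\<dots> = C / (2 * u\<^sup>2)" unfolding inverse_cube_tail(2)[OF u] by simp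
  finally show "\<bar>B u\<bar> \<le> C / (2 * u\<^sup>2)" .
  \<comment> \<open>A base point strictly between 0 and \<open>u\<close>: around \<open>u\<close>
    the tail is a constant minus a proper integral from \<open>v\<close>, which keeps away from the
    singularity of \<open>g \<rho> / \<rho>\<close> at 0.\<close>
  define v where "v = u / 2"
  have v: "0 < v" "v < u" using u by (auto simp: v_def)
  have cont: "continuous_on {v..u + 1} (\<lambda>\<rho>. g \<rho> / \<rho>)"
    using v by (intro continuous_on_divide continuous_on_subset[OF g] continuous_intros) auto
  have B: "B x = B v - integral {v..x} (\<lambda>\<rho>. g \<rho> / \<rho>)" if x: "x \<in> {v..u + 1}" for x
  proof -
    have si: "set_integrable lborel {v..x} (\<lambda>\<rho>. g \<rho> / \<rho>)"
      using x by (intro borel_integrable_atLeastAtMost' continuous_on_subset[OF cont]) auto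
    have un: "{v<..} = {v<..x} \<union> {x<..}" using x by auto
    have "(LINT \<rho>:{v<..x} \<union> {x<..}|lborel. g \<rho> / \<rho>) = (LINT \<rho>:{v<..x}|lborel. g \<rho> / \<rho>) + (LINT \<rho>:{x<..}|lborel. g \<rho> / \<rho>)"
    proof (rule set_integral_Un)
      show "set_integrable lborel {v<..x} (\<lambda>\<rho>. g \<rho> / \<rho>)"
        by (rule set_integrable_subset[OF i[OF v(1)]]) auto
      show "set_integrable lborel {x<..} (\<lambda>\<rho>. g \<rho> / \<rho>)" using x v by (intro i) auto
    qed auto
    then have "B v = (LINT \<rho>:{v<..x}|lborel. g \<rho> / \<rho>) + B x"
      unfolding B_def un .
    also have "(LINT \<rho>:{v<..x}|lborel. g \<rho> / \<rho>) = (LINT \<rho>:{v..x}|lborel. g \<rho> / \<rho>)"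
      unfolding set_lebesgue_integral_def
    proof (rule integral_cong_AE)
      show "AE \<rho> in lborel. indicat_real {v<..x} \<rho> *\<^sub>R (g \<rho> / \<rho>) = indicat_real {v..x} \<rho> *\<^sub>R (g \<rho> / \<rho>)"
        by (rule eventually_mono[OF AE_lborel_singleton[of v]]) (auto simp: indicator_def)
    qed measurable
    also have "\<dots> = integral {v..x} (\<lambda>\<rho>. g \<rho> / \<rho>)" by (rule set_borel_integral_eq_integral(2)[OF si])
    finally show ?thesis by simp
  qed
  have "((\<lambda>x. integral {v..x} (\<lambda>\<rho>. g \<rho> / \<rho>)) has_real_derivative g u / u) (at u within {v..u + 1})"
    using v by (intro integral_has_real_derivative cont) auto
  moreover have "at u within {v..u + 1} = at u" using v by (intro at_within_interior) simp
  ultimately have "((\<lambda>x. B v - integral {v..x} (\<lambda>\<rho>. g \<rho> / \<rho>)) has_real_derivative 0 - g u / u) (at u)"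
    by (intro DERIV_diff DERIV_const) simp
  then have "(B has_real_derivative 0 - g u / u) (at u)"
  proof (rule has_field_derivative_transform_within_open[where S = "{v<..<u + 1}"])
    show "B v - integral {v..x} (\<lambda>\<rho>. g \<rho> / \<rho>) = B x" if "x \<in> {v<..<u + 1}" for x
      by (rule B[symmetric]) (use that in auto)
  qed (use v in auto)
  then show "(B has_real_derivative - (g u / u)) (at u)" by simp
qed

text \<open>Both sides are integrals of \<open>g\<close> against a kernel; after scaling \<open>\<tau> = s \<sigma>\<close> the second term is the
  \<open>\<sigma>\<close>-integral of the tail \<open>B (\<epsilon> sqrt (1 + \<sigma>\<^sup>2))\<close>, and \<open>\<sigma> B (\<epsilon> sqrt (1 + \<sigma>\<^sup>2))\<close> has integral zero
  derivative over the line.\<close>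

lemma abel_tail_identity:
  fixes g :: "real \<Rightarrow> real"
  assumes g: "continuous_on UNIV g" and C: "\<And>\<rho>. \<bar>g \<rho>\<bar> \<le> C / (1 + \<rho>\<^sup>2)" and \<epsilon>: "\<epsilon> > 0"
  defines "R \<equiv> \<lambda>s. \<integral>\<tau>. g (sqrt (s\<^sup>2 + \<tau>\<^sup>2)) \<partial>lborel"
  shows "R \<epsilon> / \<epsilon> - (LINT s:{\<epsilon><..}|lborel. R s / s\<^sup>2) = (\<integral>\<sigma>. g (\<epsilon> * sqrt (1 + \<sigma>\<^sup>2)) / (1 + \<sigma>\<^sup>2) \<partial>lborel)"
proof -
  have gm [measurable]: "g \<in> borel_measurable borel" using g by (rule borel_measurable_continuous_onI)
  have C0: "C \<ge> 0" using C[of 0] by (smt (verit) abs_ge_zero div_by_1 add_0_right power_zero_numeral)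
  define B where "B = (\<lambda>u. LINT \<rho>:{u<..}|lborel. g \<rho> / \<rho>)"
  define c where "c = (\<lambda>\<sigma>. sqrt (1 + \<sigma>\<^sup>2) :: real)"
  have c1: "c \<sigma> \<ge> 1" and c0: "c \<sigma> > 0" and c2: "(c \<sigma>)\<^sup>2 = 1 + \<sigma>\<^sup>2" for \<sigma>
  proof -
    show "c \<sigma> \<ge> 1" by (simp add: c_def)
    then show "c \<sigma> > 0" by linarith
    show "(c \<sigma>)\<^sup>2 = 1 + \<sigma>\<^sup>2" by (simp add: c_def add_nonneg_nonneg)
  qed
  have [measurable]: "c \<in> borel_measurable borel" unfolding c_def by measurable
  have p: "1 + \<sigma>\<^sup>2 > 0" for \<sigma> :: real by (simp add: add_pos_nonneg)
  note B = newton_tail_bound[OF g C, folded B_def]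
  \<comment> \<open>The majorant is a product of a function of \<open>s\<close> and a function of
    \<open>\<sigma>\<close>. Divided by \<open>s\<close> it is integrable on
    \<open>s > \<epsilon>\<close>, which justifies the exchange of integrals below.\<close>
  have gb: "\<bar>g (s * c \<sigma>)\<bar> \<le> C / s\<^sup>2 * (1 / (1 + \<sigma>\<^sup>2))" if "s > 0" for s \<sigma>
  proof -
    have "\<bar>g (s * c \<sigma>)\<bar> \<le> C / (1 + (s * c \<sigma>)\<^sup>2)" by (rule C)
    also have "\<dots> \<le> C / (s * c \<sigma>)\<^sup>2" using that c0[of \<sigma>] C0 by (intro divide_left_mono mult_pos_pos add_pos_nonneg) auto
    finally show ?thesis by (simp add: power_mult_distrib c2)
  qed
  have R: "R s = s * (\<integral>\<sigma>. g (s * c \<sigma>) \<partial>lborel)" if s: "s > 0" for s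
  proof -
    have "R s = \<bar>s\<bar> *\<^sub>R (\<integral>\<sigma>. g (sqrt (s\<^sup>2 + (0 + s * \<sigma>)\<^sup>2)) \<partial>lborel)"
      unfolding R_def using s by (intro lborel_integral_real_affine) simp
    also have "(\<lambda>\<sigma>. g (sqrt (s\<^sup>2 + (0 + s * \<sigma>)\<^sup>2))) = (\<lambda>\<sigma>. g (s * c \<sigma>))"
    proof
      fix \<sigma>
      have "s\<^sup>2 + (0 + s * \<sigma>)\<^sup>2 = s\<^sup>2 * (1 + \<sigma>\<^sup>2)" by (simp add: power_mult_distrib algebra_simps)
      then show "g (sqrt (s\<^sup>2 + (0 + s * \<sigma>)\<^sup>2)) = g (s * c \<sigma>)" using s by (simp add: c_def real_sqrt_mult)
    qed
    finally show ?thesis using s by simp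
  qed
  have gi: "integrable lborel (\<lambda>\<sigma>. g (s * c \<sigma>))" if s: "s > 0" for s
  proof (rule Bochner_Integration.integrable_bound)
    show "integrable lborel (\<lambda>\<sigma>. C / s\<^sup>2 * (1 / (1 + \<sigma>\<^sup>2)))"
      by (intro integrable_mult_right cauchy_density)
    show "AE \<sigma> in lborel. norm (g (s * c \<sigma>)) \<le> norm (C / s\<^sup>2 * (1 / (1 + \<sigma>\<^sup>2)))"
      using gb[OF s] by (intro AE_I2) (metis abs_ge_self order_trans real_norm_def)
  qed measurable
  have Bi: "integrable lborel (\<lambda>\<sigma>. B (\<epsilon> * c \<sigma>))" and hi: "integrable lborel (\<lambda>\<sigma>. g (\<epsilon> * c \<sigma>) * (\<sigma>\<^sup>2 / (1 + \<sigma>\<^sup>2)))"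
    and Beq: "(\<integral>\<sigma>. B (\<epsilon> * c \<sigma>) \<partial>lborel) = (\<integral>\<sigma>. g (\<epsilon> * c \<sigma>) * (\<sigma>\<^sup>2 / (1 + \<sigma>\<^sup>2)) \<partial>lborel)"
  proof -
    have pos: "\<epsilon> * c \<sigma> > 0" for \<sigma> using \<epsilon> c0 by simp
    have dc: "(c has_real_derivative \<sigma> / c \<sigma>) (at \<sigma>)" for \<sigma>
      unfolding c_def using p[of \<sigma>] by (auto intro!: derivative_eq_intros simp: field_simps)
    have dB: "((\<lambda>\<sigma>. B (\<epsilon> * c \<sigma>)) has_real_derivative - (g (\<epsilon> * c \<sigma>) * \<sigma> / (1 + \<sigma>\<^sup>2))) (at \<sigma>)" for \<sigma>
    proof -
      have "((\<lambda>\<sigma>. \<epsilon> * c \<sigma>) has_real_derivative \<epsilon> * (\<sigma> / c \<sigma>)) (at \<sigma>)" using dc by (rule DERIV_cmult)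
      from DERIV_chain2[OF B(3)[OF pos] this]
      have "((\<lambda>\<sigma>. B (\<epsilon> * c \<sigma>)) has_real_derivative - (g (\<epsilon> * c \<sigma>) / (\<epsilon> * c \<sigma>)) * (\<epsilon> * (\<sigma> / c \<sigma>))) (at \<sigma>)" .
      also have "- (g (\<epsilon> * c \<sigma>) / (\<epsilon> * c \<sigma>)) * (\<epsilon> * (\<sigma> / c \<sigma>)) = - (g (\<epsilon> * c \<sigma>) * \<sigma> / (c \<sigma>)\<^sup>2)"
        using \<epsilon> by (simp add: power2_eq_square)
      finally show ?thesis unfolding c2 .
    qed
    have Bcont: "isCont (\<lambda>\<sigma>. B (\<epsilon> * c \<sigma>)) \<sigma>" for \<sigma> using dB by (rule DERIV_isCont)
    have Bm: "(\<lambda>\<sigma>. B (\<epsilon> * c \<sigma>)) \<in> borel_measurable borel"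
      using Bcont by (intro borel_measurable_continuous_onI) (auto simp: continuous_on_eq_continuous_at)
    have Bb: "\<bar>B (\<epsilon> * c \<sigma>)\<bar> \<le> C / (2 * \<epsilon>\<^sup>2) * (1 / (1 + \<sigma>\<^sup>2))" for \<sigma>
      using B(2)[OF pos[of \<sigma>]] by (simp add: B_def power_mult_distrib c2 mult.assoc)
    show Bi: "integrable lborel (\<lambda>\<sigma>. B (\<epsilon> * c \<sigma>))"
    proof (rule Bochner_Integration.integrable_bound)
      show "integrable lborel (\<lambda>\<sigma>. C / (2 * \<epsilon>\<^sup>2) * (1 / (1 + \<sigma>\<^sup>2)))"
        by (intro integrable_mult_right cauchy_density)
      show "AE \<sigma> in lborel. norm (B (\<epsilon> * c \<sigma>)) \<le> norm (C / (2 * \<epsilon>\<^sup>2) * (1 / (1 + \<sigma>\<^sup>2)))"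
        using Bb by (intro AE_I2) (metis abs_ge_self order_trans real_norm_def)
    qed (use Bm in auto)
    show hi: "integrable lborel (\<lambda>\<sigma>. g (\<epsilon> * c \<sigma>) * (\<sigma>\<^sup>2 / (1 + \<sigma>\<^sup>2)))"
    proof (rule Bochner_Integration.integrable_bound[OF gi[OF \<epsilon>]])
      show "AE \<sigma> in lborel. norm (g (\<epsilon> * c \<sigma>) * (\<sigma>\<^sup>2 / (1 + \<sigma>\<^sup>2))) \<le> norm (g (\<epsilon> * c \<sigma>))"
      proof (rule AE_I2)
        fix \<sigma> :: real
        have "\<bar>\<sigma>\<^sup>2 / (1 + \<sigma>\<^sup>2)\<bar> \<le> 1" using p[of \<sigma>] by (simp add: field_simps)
        then show "norm (g (\<epsilon> * c \<sigma>) * (\<sigma>\<^sup>2 / (1 + \<sigma>\<^sup>2))) \<le> norm (g (\<epsilon> * c \<sigma>))"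
          using mult_left_mono[of "\<bar>\<sigma>\<^sup>2 / (1 + \<sigma>\<^sup>2)\<bar>" 1 "\<bar>g (\<epsilon> * c \<sigma>)\<bar>"]
          by (simp only: real_norm_def abs_mult mult_1_right abs_ge_zero)
      qed
    qed measurable
    have lim: "((\<lambda>\<sigma>. \<sigma> * B (\<epsilon> * c \<sigma>)) \<longlongrightarrow> 0) F" if F: "filterlim (\<lambda>\<sigma>::real. \<sigma>) at_infinity F" for F
    proof (rule Lim_null_comparison)
      show "\<forall>\<^sub>F \<sigma> in F. norm (\<sigma> * B (\<epsilon> * c \<sigma>)) \<le> norm (C / (2 * \<epsilon>\<^sup>2) / \<sigma>)"
      proof (rule always_eventually, rule allI)
        fix \<sigma> :: real
        show "norm (\<sigma> * B (\<epsilon> * c \<sigma>)) \<le> norm (C / (2 * \<epsilon>\<^sup>2) / \<sigma>)"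
        proof (cases "\<sigma> = 0")
          case False
          have "\<bar>\<sigma>\<bar> * \<bar>B (\<epsilon> * c \<sigma>)\<bar> \<le> \<bar>\<sigma>\<bar> * (C / (2 * \<epsilon>\<^sup>2) * (1 / (1 + \<sigma>\<^sup>2)))"
            using Bb by (intro mult_left_mono) auto
          also have "\<dots> \<le> \<bar>\<sigma>\<bar> * (C / (2 * \<epsilon>\<^sup>2) * (1 / \<sigma>\<^sup>2))"
            using C0 False p[of \<sigma>] by (intro mult_left_mono divide_left_mono mult_pos_pos) auto
          also have "\<dots> = \<bar>C / (2 * \<epsilon>\<^sup>2) / \<sigma>\<bar>"
          proof -
            have "\<bar>\<sigma>\<bar> * (K * (1 / \<sigma>\<^sup>2)) = \<bar>K / \<sigma>\<bar>" if "K \<ge> 0" for K :: real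
            proof -
              have "\<sigma>\<^sup>2 = \<bar>\<sigma>\<bar> * \<bar>\<sigma>\<bar>" by (simp add: power2_eq_square)
              then have "\<bar>\<sigma>\<bar> * (K * (1 / \<sigma>\<^sup>2)) = \<bar>\<sigma>\<bar> * K / (\<bar>\<sigma>\<bar> * \<bar>\<sigma>\<bar>)" by (simp only: mult_1_right times_divide_eq_right)
              also have "\<dots> = K / \<bar>\<sigma>\<bar>" using False by (simp del: abs_mult_self_eq)
              also have "\<dots> = \<bar>K / \<sigma>\<bar>" using that by (simp add: abs_divide)
              finally show ?thesis .
            qed
            then show ?thesis using C0 by (meson divide_nonneg_nonneg mult_nonneg_nonneg zero_le_numeral zero_le_power2)
          qed
          finally show ?thesis by (simp add: abs_mult)
        qed simp
      qed
      show "((\<lambda>\<sigma>. norm (C / (2 * \<epsilon>\<^sup>2) / \<sigma>)) \<longlongrightarrow> 0) F"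
        by (intro tendsto_norm_zero tendsto_divide_0[OF tendsto_const] F)
    qed
    have "(\<integral>\<sigma>. B (\<epsilon> * c \<sigma>) - g (\<epsilon> * c \<sigma>) * (\<sigma>\<^sup>2 / (1 + \<sigma>\<^sup>2)) \<partial>lborel) = 0 - 0"
    proof (rule integral_FTC_real_line)
      fix \<sigma>
      have "((\<lambda>\<sigma>. \<sigma> * B (\<epsilon> * c \<sigma>)) has_real_derivative 1 * B (\<epsilon> * c \<sigma>) + - (g (\<epsilon> * c \<sigma>) * \<sigma> / (1 + \<sigma>\<^sup>2)) * \<sigma>) (at \<sigma>)"
        by (rule DERIV_mult[OF DERIV_ident dB])
      then show "((\<lambda>\<sigma>. \<sigma> * B (\<epsilon> * c \<sigma>)) has_real_derivative B (\<epsilon> * c \<sigma>) - g (\<epsilon> * c \<sigma>) * (\<sigma>\<^sup>2 / (1 + \<sigma>\<^sup>2))) (at \<sigma>)"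
        by (simp add: power2_eq_square mult.assoc)
      have gc: "isCont (\<lambda>\<sigma>. g (\<epsilon> * c \<sigma>)) \<sigma>"
      proof (rule isCont_o2[where f = "\<lambda>\<sigma>. \<epsilon> * c \<sigma>" and g = g])
        show "isCont (\<lambda>\<sigma>. \<epsilon> * c \<sigma>) \<sigma>"
          by (rule isCont_mult[OF continuous_const DERIV_isCont[OF dc]])
        show "isCont g (\<epsilon> * c \<sigma>)" using g by (simp add: continuous_on_eq_continuous_at)
      qed
      show "isCont (\<lambda>\<sigma>. B (\<epsilon> * c \<sigma>) - g (\<epsilon> * c \<sigma>) * (\<sigma>\<^sup>2 / (1 + \<sigma>\<^sup>2))) \<sigma>"
        using p[of \<sigma>] by (intro continuous_intros Bcont gc) auto
    next
      show "integrable lborel (\<lambda>\<sigma>. B (\<epsilon> * c \<sigma>) - g (\<epsilon> * c \<sigma>) * (\<sigma>\<^sup>2 / (1 + \<sigma>\<^sup>2)))"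
        by (rule Bochner_Integration.integrable_diff[OF Bi hi])
      show "((\<lambda>\<sigma>. \<sigma> * B (\<epsilon> * c \<sigma>)) \<longlongrightarrow> 0) at_bot"
        by (rule lim[OF filterlim_mono[OF filterlim_ident at_bot_le_at_infinity order_refl]])
      show "((\<lambda>\<sigma>. \<sigma> * B (\<epsilon> * c \<sigma>)) \<longlongrightarrow> 0) at_top"
        by (rule lim[OF filterlim_at_top_imp_at_infinity[OF filterlim_ident]])
    qed
    then show "(\<integral>\<sigma>. B (\<epsilon> * c \<sigma>) \<partial>lborel) = (\<integral>\<sigma>. g (\<epsilon> * c \<sigma>) * (\<sigma>\<^sup>2 / (1 + \<sigma>\<^sup>2)) \<partial>lborel)"
      using Bi hi by simp
  qed
  have "(LINT s:{\<epsilon><..}|lborel. R s / s\<^sup>2) = (\<integral>s. (\<integral>\<sigma>. indicator {\<epsilon><..} s * (g (s * c \<sigma>) / s) \<partial>lborel) \<partial>lborel)"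
    unfolding set_lebesgue_integral_def
  proof (rule Bochner_Integration.integral_cong[OF refl])
    fix s
    show "indicator {\<epsilon><..} s *\<^sub>R (R s / s\<^sup>2) = (\<integral>\<sigma>. indicator {\<epsilon><..} s * (g (s * c \<sigma>) / s) \<partial>lborel)"
      using R[of s] \<epsilon> by (simp add: indicator_def power2_eq_square)
  qed
  also have "\<dots> = (\<integral>\<sigma>. (\<integral>s. indicator {\<epsilon><..} s * (g (s * c \<sigma>) / s) \<partial>lborel) \<partial>lborel)"
  proof (rule lborel_pair.Fubini_integral[symmetric])
    let ?f = "\<lambda>(s, \<sigma>). indicator {\<epsilon><..} s * (g (s * c \<sigma>) / s)"
    have fm: "?f \<in> borel_measurable (lborel \<Otimes>\<^sub>M lborel)" unfolding split_beta' by measurable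
    have fb: "\<bar>?f (s, \<sigma>)\<bar> \<le> indicator {\<epsilon><..} s * (1 / s ^ 3) * (C * (1 / (1 + \<sigma>\<^sup>2)))" for s \<sigma>
    proof (cases "s > \<epsilon>")
      case True
      then have s: "s > 0" using \<epsilon> by simp
      have "\<bar>g (s * c \<sigma>)\<bar> / s \<le> (C / s\<^sup>2 * (1 / (1 + \<sigma>\<^sup>2))) / s" using gb[OF s] s by (intro divide_right_mono) auto
      also have "\<dots> = 1 / s ^ 3 * (C * (1 / (1 + \<sigma>\<^sup>2)))" by (simp add: power2_eq_square power3_eq_cube)
      finally show ?thesis using True s by (simp add: abs_divide)
    qed simp
    show "integrable (lborel \<Otimes>\<^sub>M lborel) ?f"
    proof (rule lborel_pair.Fubini_integrable[OF fm])
      have int: "integrable lborel (\<lambda>\<sigma>. indicator {\<epsilon><..} s * (1 / s ^ 3) * (C * (1 / (1 + \<sigma>\<^sup>2))))" for s :: real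
        by (intro integrable_mult_right cauchy_density)
      have fi: "integrable lborel (\<lambda>\<sigma>. ?f (s, \<sigma>))" for s
      proof (rule Bochner_Integration.integrable_bound[OF int])
        show "AE \<sigma> in lborel. norm (?f (s, \<sigma>)) \<le> norm (indicator {\<epsilon><..} s * (1 / s ^ 3) * (C * (1 / (1 + \<sigma>\<^sup>2))))"
          unfolding real_norm_def by (rule AE_I2) (rule order_trans[OF fb abs_ge_self])
      qed simp
      show "AE s in lborel. integrable lborel (\<lambda>\<sigma>. ?f (s, \<sigma>))" using fi by (intro AE_I2)
      show "integrable lborel (\<lambda>s. \<integral>\<sigma>. norm (?f (s, \<sigma>)) \<partial>lborel)"
      proof (rule Bochner_Integration.integrable_bound)
        show "integrable lborel (\<lambda>s. indicator {\<epsilon><..} s * (1 / s ^ 3) * (C * pi))"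
          using inverse_cube_tail(1)[OF \<epsilon>] by (intro integrable_mult_left) (auto simp: set_integrable_def)
        show "(\<lambda>s. \<integral>\<sigma>. norm (?f (s, \<sigma>)) \<partial>lborel) \<in> borel_measurable lborel"
          using fm by (intro lborel.borel_measurable_lebesgue_integral) simp
        show "AE s in lborel. norm (\<integral>\<sigma>. norm (?f (s, \<sigma>)) \<partial>lborel) \<le> norm (indicator {\<epsilon><..} s * (1 / s ^ 3) * (C * pi))"
        proof (rule AE_I2)
          fix s :: real
          have "(\<integral>\<sigma>. norm (?f (s, \<sigma>)) \<partial>lborel) \<le> (\<integral>\<sigma>. indicator {\<epsilon><..} s * (1 / s ^ 3) * (C * (1 / (1 + \<sigma>\<^sup>2))) \<partial>lborel)"
            by (rule integral_mono[OF integrable_norm[OF fi] int]) (unfold real_norm_def, rule fb)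
          also have "\<dots> = indicator {\<epsilon><..} s * (1 / s ^ 3) * (C * pi)"
            by (simp only: Bochner_Integration.integral_mult_right_zero cauchy_density)
          finally have "(\<integral>\<sigma>. norm (?f (s, \<sigma>)) \<partial>lborel) \<le> indicator {\<epsilon><..} s * (1 / s ^ 3) * (C * pi)" .
          moreover have "0 \<le> (\<integral>\<sigma>. norm (?f (s, \<sigma>)) \<partial>lborel)" by simp
          ultimately show "norm (\<integral>\<sigma>. norm (?f (s, \<sigma>)) \<partial>lborel) \<le> norm (indicator {\<epsilon><..} s * (1 / s ^ 3) * (C * pi))"
            unfolding real_norm_def by linarith
        qed
      qed
    qed
  qed
  also have "\<dots> = (\<integral>\<sigma>. B (\<epsilon> * c \<sigma>) \<partial>lborel)"
  proof (rule Bochner_Integration.integral_cong[OF refl])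
    fix \<sigma>
    have "B (\<epsilon> * c \<sigma>) = \<bar>c \<sigma>\<bar> *\<^sub>R (\<integral>s. indicator {\<epsilon> * c \<sigma><..} (0 + c \<sigma> * s) *\<^sub>R (g (0 + c \<sigma> * s) / (0 + c \<sigma> * s)) \<partial>lborel)"
      unfolding B_def set_lebesgue_integral_def using c0[of \<sigma>] by (intro lborel_integral_real_affine) simp
    also have "\<dots> = (\<integral>s. c \<sigma> * (indicator {\<epsilon> * c \<sigma><..} (0 + c \<sigma> * s) *\<^sub>R (g (0 + c \<sigma> * s) / (0 + c \<sigma> * s))) \<partial>lborel)"
      by (simp only: Bochner_Integration.integral_mult_right_zero abs_of_pos[OF c0] real_scaleR_def)
    also have "\<dots> = (\<integral>s. indicator {\<epsilon><..} s * (g (s * c \<sigma>) / s) \<partial>lborel)"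
      by (intro Bochner_Integration.integral_cong refl)
        (use c0[of \<sigma>] in \<open>auto simp: indicator_def mult.commute\<close>)
    finally show "(\<integral>s. indicator {\<epsilon><..} s * (g (s * c \<sigma>) / s) \<partial>lborel) = B (\<epsilon> * c \<sigma>)" by simp
  qed
  finally have "R \<epsilon> / \<epsilon> - (LINT s:{\<epsilon><..}|lborel. R s / s\<^sup>2) =
    (\<integral>\<sigma>. g (\<epsilon> * c \<sigma>) \<partial>lborel) - (\<integral>\<sigma>. g (\<epsilon> * c \<sigma>) * (\<sigma>\<^sup>2 / (1 + \<sigma>\<^sup>2)) \<partial>lborel)"
    using R[OF \<epsilon>] \<epsilon> Beq by simp
  also have "\<dots> = (\<integral>\<sigma>. g (\<epsilon> * c \<sigma>) - g (\<epsilon> * c \<sigma>) * (\<sigma>\<^sup>2 / (1 + \<sigma>\<^sup>2)) \<partial>lborel)"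
    using gi[OF \<epsilon>] hi by simp
  also have "\<dots> = (\<integral>\<sigma>. g (\<epsilon> * sqrt (1 + \<sigma>\<^sup>2)) / (1 + \<sigma>\<^sup>2) \<partial>lborel)"
  proof (rule Bochner_Integration.integral_cong[OF refl])
    fix \<sigma> :: real
    have "1 - \<sigma>\<^sup>2 / (1 + \<sigma>\<^sup>2) = 1 / (1 + \<sigma>\<^sup>2)" using p[of \<sigma>] by (simp add: field_simps)
    then have "g (\<epsilon> * c \<sigma>) * (1 - \<sigma>\<^sup>2 / (1 + \<sigma>\<^sup>2)) = g (\<epsilon> * c \<sigma>) / (1 + \<sigma>\<^sup>2)" by simp
    then show "g (\<epsilon> * c \<sigma>) - g (\<epsilon> * c \<sigma>) * (\<sigma>\<^sup>2 / (1 + \<sigma>\<^sup>2)) = g (\<epsilon> * sqrt (1 + \<sigma>\<^sup>2)) / (1 + \<sigma>\<^sup>2)"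
      by (simp only: c_def) (simp add: algebra_simps)
  qed
  finally show ?thesis .
qed

text \<open>The left side is a Cauchy average of \<open>g\<close> at scale
  \<open>\<epsilon>\<close>. As the scale shrinks it only sees \<open>g 0\<close>, weighted by the
  mass \<open>pi\<close> of the density.\<close>

lemma abel_tail_limit:
  fixes g :: "real \<Rightarrow> real"
  assumes g: "continuous_on UNIV g" and C: "\<And>\<rho>. \<bar>g \<rho>\<bar> \<le> C / (1 + \<rho>\<^sup>2)"
  shows "((\<lambda>\<epsilon>. \<integral>\<sigma>. g (\<epsilon> * sqrt (1 + \<sigma>\<^sup>2)) / (1 + \<sigma>\<^sup>2) \<partial>lborel) \<longlongrightarrow> pi * g 0) (at_right 0)"
  unfolding tendsto_at_iff_sequentially
proof (intro allI impI)
  fix X :: "nat \<Rightarrow> real" assume X: "\<forall>i. X i \<in> {0<..} - {0}" "X \<longlonglongrightarrow> 0"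
  have [measurable]: "g \<in> borel_measurable borel" using g by (rule borel_measurable_continuous_onI)
  have C0: "C \<ge> 0" using C[of 0] by (smt (verit) abs_ge_zero div_by_1 add_0_right power_zero_numeral)
  have p: "1 + \<sigma>\<^sup>2 > 0" for \<sigma> :: real by (simp add: add_pos_nonneg)
  have gC: "\<bar>g \<rho>\<bar> \<le> C" for \<rho>
    using C[of \<rho>] C0 p[of \<rho>] divide_left_mono[of 1 "1 + \<rho>\<^sup>2" C] by auto
  have "(\<lambda>i. \<integral>\<sigma>. g (X i * sqrt (1 + \<sigma>\<^sup>2)) / (1 + \<sigma>\<^sup>2) \<partial>lborel) \<longlonglongrightarrow> (\<integral>\<sigma>. g 0 * (1 / (1 + \<sigma>\<^sup>2)) \<partial>lborel)"
  proof (rule integral_dominated_convergence[where w = "\<lambda>\<sigma>. C * (1 / (1 + \<sigma>\<^sup>2))"])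
    show "integrable lborel (\<lambda>\<sigma>. C * (1 / (1 + \<sigma>\<^sup>2)))"
      by (intro integrable_mult_right cauchy_density)
    show "AE \<sigma> in lborel. (\<lambda>i. g (X i * sqrt (1 + \<sigma>\<^sup>2)) / (1 + \<sigma>\<^sup>2)) \<longlonglongrightarrow> g 0 * (1 / (1 + \<sigma>\<^sup>2))"
    proof (rule AE_I2)
      fix \<sigma> :: real
      have "(\<lambda>i. X i * sqrt (1 + \<sigma>\<^sup>2)) \<longlonglongrightarrow> 0"
        using tendsto_mult_right[OF X(2), of "sqrt (1 + \<sigma>\<^sup>2)"] by simp
      then have "(\<lambda>i. g (X i * sqrt (1 + \<sigma>\<^sup>2))) \<longlonglongrightarrow> g 0"
        using g isCont_tendsto_compose[of 0 g] by (auto simp: continuous_on_eq_continuous_at)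
      from tendsto_mult_right[OF this, of "1 / (1 + \<sigma>\<^sup>2)"]
      show "(\<lambda>i. g (X i * sqrt (1 + \<sigma>\<^sup>2)) / (1 + \<sigma>\<^sup>2)) \<longlonglongrightarrow> g 0 * (1 / (1 + \<sigma>\<^sup>2))" by simp
    qed
    show "AE \<sigma> in lborel. norm (g (X i * sqrt (1 + \<sigma>\<^sup>2)) / (1 + \<sigma>\<^sup>2)) \<le> C * (1 / (1 + \<sigma>\<^sup>2))" for i
      using gC p by (intro AE_I2) (simp add: abs_divide divide_right_mono abs_of_pos)
  qed measurable
  then show "((\<lambda>\<epsilon>. \<integral>\<sigma>. g (\<epsilon> * sqrt (1 + \<sigma>\<^sup>2)) / (1 + \<sigma>\<^sup>2) \<partial>lborel) \<circ> X) \<longlonglongrightarrow> pi * g 0"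
    unfolding o_def Bochner_Integration.integral_mult_right_zero cauchy_density by (simp add: mult.commute)
qed

text \<open>Integration by parts on the truncated half line, with primitive
  \<open>\<Gamma> u / u\<close>. The two terms on the right can each blow up as
  \<open>\<epsilon>\<close> tends to 0; only their difference is under control, so they are kept
  together.\<close>

lemma integral_divided_derivative:
  fixes \<Gamma> \<Gamma>' :: "real \<Rightarrow> real"
  assumes d: "\<And>u. (\<Gamma> has_real_derivative \<Gamma>' u) (at u)" and c: "\<And>u. isCont \<Gamma>' u"
    and b: "\<And>u. \<bar>\<Gamma> u\<bar> \<le> C" and i: "set_integrable lborel {\<epsilon><..} (\<lambda>u. \<Gamma>' u / u)" and \<epsilon>: "\<epsilon> > 0"
  shows "(LINT u:{\<epsilon><..}|lborel. - \<Gamma>' u / u) = \<Gamma> \<epsilon> / \<epsilon> - (LINT u:{\<epsilon><..}|lborel. \<Gamma> u / u\<^sup>2)"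
proof -
  have cont: "isCont \<Gamma> u" for u using d by (rule DERIV_isCont)
  have [measurable]: "\<Gamma> \<in> borel_measurable borel"
    using cont by (intro borel_measurable_continuous_onI) (auto simp: continuous_on_eq_continuous_at)
  have C0: "C \<ge> 0" using b[of 0] by simp
  have "set_integrable lborel {\<epsilon><..} (\<lambda>u. C * (1 / u\<^sup>2))"
    using inverse_square_tail(1)[OF \<epsilon>] by (intro set_integrable_mult_right) auto
  then have i2: "set_integrable lborel {\<epsilon><..} (\<lambda>u. \<Gamma> u / u\<^sup>2)"
    unfolding set_integrable_def
  proof (rule Bochner_Integration.integrable_bound)
    show "AE u in lborel. norm (indicat_real {\<epsilon><..} u *\<^sub>R (\<Gamma> u / u\<^sup>2)) \<le> norm (indicat_real {\<epsilon><..} u *\<^sub>R (C * (1 / u\<^sup>2)))"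
      using b C0 by (intro AE_I2) (auto simp: indicator_def abs_divide divide_right_mono)
  qed measurable
  have "(LINT u:{\<epsilon><..}|lborel. \<Gamma>' u / u - \<Gamma> u / u\<^sup>2) = 0 - \<Gamma> \<epsilon> / \<epsilon>"
  proof (rule integral_FTC_half_line[where F = "\<lambda>u. \<Gamma> u / u"])
    fix u assume u: "\<epsilon> < u"
    then show "((\<lambda>u. \<Gamma> u / u) has_real_derivative \<Gamma>' u / u - \<Gamma> u / u\<^sup>2) (at u)"
      using \<epsilon> by (auto intro!: derivative_eq_intros d simp: field_simps power2_eq_square)
    show "isCont (\<lambda>u. \<Gamma>' u / u - \<Gamma> u / u\<^sup>2) u"
      using u \<epsilon> by (intro continuous_intros c cont) auto
  next
    show "set_integrable lborel {\<epsilon><..} (\<lambda>u. \<Gamma>' u / u - \<Gamma> u / u\<^sup>2)" using i i2 by (rule set_integral_diff(1))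
    have "isCont (\<lambda>u. \<Gamma> u / u) \<epsilon>" using \<epsilon> by (intro continuous_intros cont) auto
    then show "((\<lambda>u. \<Gamma> u / u) \<longlongrightarrow> \<Gamma> \<epsilon> / \<epsilon>) (at_right \<epsilon>)"
      unfolding isCont_def by (rule tendsto_mono[OF at_le, rotated]) simp
    show "((\<lambda>u. \<Gamma> u / u) \<longlongrightarrow> 0) at_top"
    proof (rule Lim_null_comparison)
      show "\<forall>\<^sub>F u in at_top. norm (\<Gamma> u / u) \<le> C / u"
        using eventually_gt_at_top[of 0] by eventually_elim (use b in \<open>auto simp: abs_divide divide_right_mono\<close>)
      show "((\<lambda>u. C / u) \<longlongrightarrow> 0) at_top"
        by (intro tendsto_divide_0[OF tendsto_const] filterlim_at_top_imp_at_infinity filterlim_ident)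
    qed
  qed
  also have "(LINT u:{\<epsilon><..}|lborel. \<Gamma>' u / u - \<Gamma> u / u\<^sup>2) =
    (LINT u:{\<epsilon><..}|lborel. \<Gamma>' u / u) - (LINT u:{\<epsilon><..}|lborel. \<Gamma> u / u\<^sup>2)"
    using i i2 by (rule set_integral_diff(2))
  finally show ?thesis
    by (simp add: set_lebesgue_integral_def)
qed

section \<open>The great circle transform\<close>

lemma period_integral_continuous:
  fixes F :: "'a::topological_space \<Rightarrow> real \<Rightarrow> real"
  assumes "continuous_on UNIV (\<lambda>(x, \<phi>). F x \<phi>)"
  shows "continuous_on UNIV (\<lambda>x. \<integral>\<phi>. F x \<phi> \<partial>period_measure)"
proof -
  have "continuous_on UNIV (\<lambda>x. integral (cbox 0 (2 * pi)) (F x))"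
    by (rule integral_continuous_on_param) (rule continuous_on_subset[OF assms], simp)
  moreover have "(\<integral>\<phi>. F x \<phi> \<partial>period_measure) = integral (cbox 0 (2 * pi)) (F x)" for x
  proof -
    have "continuous_on UNIV (\<lambda>\<phi>. (\<lambda>(x, \<phi>). F x \<phi>) (x, \<phi>))"
      by (rule continuous_on_compose2[OF assms]) (auto intro!: continuous_intros)
    then show ?thesis by (simp add: period_integral_eq)
  qed
  ultimately show ?thesis by simp
qed

lemma period_integral_bound:
  fixes F :: "real \<Rightarrow> real"
  assumes F: "continuous_on UNIV F" and C: "\<And>\<phi>. \<bar>F \<phi>\<bar> \<le> C"
  shows "\<bar>\<integral>\<phi>. F \<phi> \<partial>period_measure\<bar> \<le> 2 * pi * C"
proof -
  have "\<bar>\<integral>\<phi>. F \<phi> \<partial>period_measure\<bar> \<le> (\<integral>\<phi>. \<bar>F \<phi>\<bar> \<partial>period_measure)" by (rule integral_abs_bound)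
  also have "\<dots> \<le> (\<integral>\<phi>. C \<partial>period_measure)"
    using C by (intro integral_mono integrable_abs period_measure_integrable F) auto
  also have "\<dots> = 2 * pi * C" by simp
  finally show ?thesis .
qed

text \<open>The chart \<open>s \<mapsto> (\<omega>, -s) / sqrt (1 + s\<^sup>2)\<close> of great circles: \<open>circ_u \<omega>\<close>, \<open>circ_v \<omega> s\<close> is an orthonormal
  basis of the plane of the circle and \<open>circ_n \<omega> s\<close> its normal.\<close>

definition invsq :: "real \<Rightarrow> real" where "invsq s = 1 / sqrt (1 + s\<^sup>2)"

definition circ_u :: "real^2 \<Rightarrow> real^3" where
  "circ_u \<omega> = (- \<omega> $ 2) *\<^sub>R axis 1 1 + \<omega> $ 1 *\<^sub>R axis 2 1"

definition circ_v :: "real^2 \<Rightarrow> real \<Rightarrow> real^3" where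
  "circ_v \<omega> s = invsq s *\<^sub>R ((s * \<omega> $ 1) *\<^sub>R axis 1 1 + (s * \<omega> $ 2) *\<^sub>R axis 2 1 + axis 3 1)"

definition circ_n :: "real^2 \<Rightarrow> real \<Rightarrow> real^3" where
  "circ_n \<omega> s = invsq s *\<^sub>R (\<omega> $ 1 *\<^sub>R axis 1 1 + \<omega> $ 2 *\<^sub>R axis 2 1 - s *\<^sub>R axis 3 1)"

definition circ_pt :: "real^2 \<Rightarrow> real \<Rightarrow> real \<Rightarrow> real^3" where
  "circ_pt \<omega> s \<phi> = cos \<phi> *\<^sub>R circ_v \<omega> s + sin \<phi> *\<^sub>R circ_u \<omega>"

definition funk :: "(real^3 \<Rightarrow> real) \<Rightarrow> real^2 \<Rightarrow> real \<Rightarrow> real" where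
  "funk h \<omega> s = (\<integral>\<phi>. h (circ_pt \<omega> s \<phi>) \<partial>period_measure)"

text \<open>The derivative of \<open>funk h \<omega>\<close> in \<open>s\<close> stripped of its
  chain rule factor \<open>(invsq s)\<^sup>2\<close>. The stripped integral is merely bounded, and
  all decay in \<open>s\<close> is carried by explicit powers of \<open>invsq\<close>.\<close>

definition funk' :: "(real^3 \<Rightarrow> real) \<Rightarrow> real^2 \<Rightarrow> real \<Rightarrow> real" where
  "funk' h \<omega> s = (\<integral>\<phi>. cos \<phi> * dir_deriv h (circ_n \<omega> s) (circ_pt \<omega> s \<phi>) \<partial>period_measure)"

text \<open>The factor \<open>invsq s\<close> is the one in the definition of
  \<open>radon_G\<close>, and also the one that turns the great circle integral into a line integral
  of \<open>gnomonic h\<close>; see \<open>funk_G_line\<close>.\<close>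

definition funk_G :: "(real^3 \<Rightarrow> real) \<Rightarrow> real^2 \<Rightarrow> real \<Rightarrow> real" where
  "funk_G h \<omega> s = invsq s * funk h \<omega> s"

definition funk_G' :: "(real^3 \<Rightarrow> real) \<Rightarrow> real^2 \<Rightarrow> real \<Rightarrow> real" where
  "funk_G' h \<omega> s = invsq s ^ 3 * funk' h \<omega> s - s * invsq s ^ 3 * funk h \<omega> s"

lemma invsq_pos: "invsq s > 0" and invsq_le_1: "invsq s \<le> 1" and invsq_square: "(invsq s)\<^sup>2 = 1 / (1 + s\<^sup>2)"
proof -
  have p: "1 + s\<^sup>2 > 0" by (simp add: add_pos_nonneg)
  then show "invsq s > 0" by (simp add: invsq_def)
  have "1 / sqrt (1 + s\<^sup>2) \<le> 1 / 1" by (rule divide_left_mono) (auto simp: p)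
  then show "invsq s \<le> 1" by (simp only: invsq_def div_by_1)
  show "(invsq s)\<^sup>2 = 1 / (1 + s\<^sup>2)" using p by (simp add: invsq_def power_divide)
qed

lemma invsq_mult: "(invsq s)\<^sup>2 * (1 + s\<^sup>2) = 1"
proof -
  have "1 + s\<^sup>2 > 0" by (simp add: add_pos_nonneg)
  then show ?thesis by (simp add: invsq_square)
qed

lemma s_invsq_le_1: "\<bar>s * invsq s\<bar> \<le> 1"
proof -
  have "(s * invsq s)\<^sup>2 = (invsq s)\<^sup>2 * (1 + s\<^sup>2) - (invsq s)\<^sup>2" by (simp add: power_mult_distrib algebra_simps)
  then have "(s * invsq s)\<^sup>2 \<le> 1\<^sup>2" by (simp add: invsq_mult)
  then show ?thesis by (metis abs_le_square_iff abs_one)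
qed

lemma invsq_has_derivative: "(invsq has_real_derivative - s * invsq s ^ 3) (at s)"
proof -
  have p: "1 + s\<^sup>2 > 0" by (simp add: add_pos_nonneg)
  have "((\<lambda>s. 1 / sqrt (1 + s\<^sup>2)) has_real_derivative - s * (1 / sqrt (1 + s\<^sup>2)) ^ 3) (at s)"
    using p by (auto intro!: derivative_eq_intros simp: power3_eq_cube field_simps)
  then show ?thesis by (simp add: invsq_def[abs_def])
qed

lemma continuous_on_invsq [continuous_intros]:
  "continuous_on S f \<Longrightarrow> continuous_on S (\<lambda>x. invsq (f x))"
proof -
  assume f: "continuous_on S f"
  have "1 + (f x)\<^sup>2 \<noteq> 0" for x by (metis add_pos_nonneg less_irrefl zero_le_power2 zero_less_one)
  then show ?thesis unfolding invsq_def by (intro continuous_intros f) auto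
qed

lemma circ_components:
  "circ_u \<omega> $ 1 = - \<omega> $ 2" "circ_u \<omega> $ 2 = \<omega> $ 1" "circ_u \<omega> $ 3 = 0"
  "circ_v \<omega> s $ 1 = invsq s * (s * \<omega> $ 1)" "circ_v \<omega> s $ 2 = invsq s * (s * \<omega> $ 2)" "circ_v \<omega> s $ 3 = invsq s"
  "circ_n \<omega> s $ 1 = invsq s * \<omega> $ 1" "circ_n \<omega> s $ 2 = invsq s * \<omega> $ 2" "circ_n \<omega> s $ 3 = - (s * invsq s)"
  by (simp_all add: circ_u_def circ_v_def circ_n_def axis_def)

lemma circ_orthonormal:
  assumes \<omega>: "norm \<omega> = 1"
  shows "norm (circ_u \<omega>) = 1" "norm (circ_v \<omega> s) = 1" "norm (circ_n \<omega> s) = 1" "circ_v \<omega> s \<bullet> circ_u \<omega> = 0"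
    "circ_n \<omega> s \<bullet> circ_u \<omega> = 0" "circ_n \<omega> s \<bullet> circ_v \<omega> s = 0" "norm (circ_pt \<omega> s \<phi>) = 1"
proof -
  have w: "\<omega> $ 1 * \<omega> $ 1 + \<omega> $ 2 * \<omega> $ 2 = 1"
    using \<omega> by (simp add: norm_eq_1 inner_vec_def sum_2)
  have q: "invsq s * invsq s * (1 + s * s) = 1" using invsq_mult[of s] by (simp add: power2_eq_square)
  have u: "circ_u \<omega> \<bullet> circ_u \<omega> = 1"
    using w by (simp add: inner_vec_def sum_3 circ_components add.commute)
  have "circ_v \<omega> s \<bullet> circ_v \<omega> s = invsq s * invsq s * (1 + s * s * (\<omega> $ 1 * \<omega> $ 1 + \<omega> $ 2 * \<omega> $ 2))"
    by (simp add: inner_vec_def sum_3 circ_components algebra_simps)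
  then have v: "circ_v \<omega> s \<bullet> circ_v \<omega> s = 1" using q by (simp add: w)
  have "circ_n \<omega> s \<bullet> circ_n \<omega> s = invsq s * invsq s * ((\<omega> $ 1 * \<omega> $ 1 + \<omega> $ 2 * \<omega> $ 2) + s * s)"
    by (simp add: inner_vec_def sum_3 circ_components algebra_simps)
  then have n: "circ_n \<omega> s \<bullet> circ_n \<omega> s = 1" using q by (simp add: w)
  show vu: "circ_v \<omega> s \<bullet> circ_u \<omega> = 0" and "circ_n \<omega> s \<bullet> circ_u \<omega> = 0"
    by (simp_all add: inner_vec_def sum_3 circ_components)
  have "circ_n \<omega> s \<bullet> circ_v \<omega> s = invsq s * invsq s * s * ((\<omega> $ 1 * \<omega> $ 1 + \<omega> $ 2 * \<omega> $ 2) - 1)"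
    by (simp add: inner_vec_def sum_3 circ_components algebra_simps)
  then show "circ_n \<omega> s \<bullet> circ_v \<omega> s = 0" by (simp add: w)
  show "norm (circ_u \<omega>) = 1" "norm (circ_v \<omega> s) = 1" "norm (circ_n \<omega> s) = 1"
    using u v n by (simp_all add: norm_eq_1)
  have "circ_pt \<omega> s \<phi> \<bullet> circ_pt \<omega> s \<phi> = cos \<phi> * cos \<phi> * (circ_v \<omega> s \<bullet> circ_v \<omega> s) +
    2 * cos \<phi> * sin \<phi> * (circ_v \<omega> s \<bullet> circ_u \<omega>) + sin \<phi> * sin \<phi> * (circ_u \<omega> \<bullet> circ_u \<omega>)"
    by (simp add: circ_pt_def inner_add_left inner_add_right inner_commute algebra_simps)
  then show "norm (circ_pt \<omega> s \<phi>) = 1" by (simp add: u v vu norm_eq_1)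
qed

text \<open>Changing \<open>s\<close> turns the plane of the circle about the fixed axis
  \<open>circ_u \<omega>\<close>, by an angle whose tangent is \<open>s\<close>. Its speed is
  \<open>1 / (1 + s\<^sup>2)\<close>, and \<open>circ_v\<close> and \<open>circ_n\<close> rotate
  into each other.\<close>

lemma circ_v_has_derivative: "(circ_v \<omega> has_vector_derivative (invsq s)\<^sup>2 *\<^sub>R circ_n \<omega> s) (at s)"
  and circ_n_has_derivative: "(circ_n \<omega> has_vector_derivative - (invsq s)\<^sup>2 *\<^sub>R circ_v \<omega> s) (at s)"
proof -
  have "invsq s * ((invsq s)\<^sup>2 * (1 + s\<^sup>2)) = invsq s" by (simp only: invsq_mult mult_1_right)
  then have q: "invsq s ^ 3 + invsq s ^ 3 * (s * s) = invsq s"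
    by (simp add: power2_eq_square power3_eq_cube distrib_left mult.assoc)
  have dq: "(invsq has_vector_derivative - s * invsq s ^ 3) (at s)"
    using invsq_has_derivative has_real_derivative_iff_has_vector_derivative by blast
  let ?X = "\<lambda>s. (s * \<omega> $ 1) *\<^sub>R axis 1 1 + (s * \<omega> $ 2) *\<^sub>R axis 2 1 + axis 3 1 :: real^3"
  let ?Y = "\<lambda>s. \<omega> $ 1 *\<^sub>R axis 1 1 + \<omega> $ 2 *\<^sub>R axis 2 1 - s *\<^sub>R axis 3 1 :: real^3"
  have X: "(?X has_vector_derivative (\<omega> $ 1 *\<^sub>R axis 1 1 + \<omega> $ 2 *\<^sub>R axis 2 1)) (at s)"
    by (auto intro!: derivative_eq_intros)
  have Y: "(?Y has_vector_derivative (- axis 3 1)) (at s)"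
    by (auto intro!: derivative_eq_intros)
  have "((\<lambda>s. invsq s *\<^sub>R ?X s) has_vector_derivative (invsq s *\<^sub>R (\<omega> $ 1 *\<^sub>R axis 1 1 + \<omega> $ 2 *\<^sub>R axis 2 1) + (- s * invsq s ^ 3) *\<^sub>R ?X s)) (at s)"
    by (rule has_vector_derivative_scaleR[OF invsq_has_derivative X])
  also have "invsq s *\<^sub>R (\<omega> $ 1 *\<^sub>R axis 1 1 + \<omega> $ 2 *\<^sub>R axis 2 1) + (- s * invsq s ^ 3) *\<^sub>R ?X s = (invsq s)\<^sup>2 *\<^sub>R circ_n \<omega> s"
  proof -
    have "invsq s * w - s * invsq s ^ 3 * (s * w) = (invsq s)\<^sup>2 * (invsq s * w)" for w
    proof -
      have "invsq s * w - s * invsq s ^ 3 * (s * w) = (invsq s - invsq s ^ 3 * (s * s)) * w"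
        by (simp add: algebra_simps)
      also have "invsq s - invsq s ^ 3 * (s * s) = invsq s ^ 3" using q by linarith
      finally show ?thesis by (simp add: power2_eq_square power3_eq_cube)
    qed
    then show ?thesis
      by (simp add: vec_eq_iff forall_3 circ_components axis_def power2_eq_square power3_eq_cube)
  qed
  finally show "(circ_v \<omega> has_vector_derivative (invsq s)\<^sup>2 *\<^sub>R circ_n \<omega> s) (at s)"
    by (simp only: circ_v_def[abs_def])
  have "((\<lambda>s. invsq s *\<^sub>R ?Y s) has_vector_derivative (invsq s *\<^sub>R (- axis 3 1) + (- s * invsq s ^ 3) *\<^sub>R ?Y s)) (at s)"
    by (rule has_vector_derivative_scaleR[OF invsq_has_derivative Y])
  also have "invsq s *\<^sub>R (- axis 3 1) + (- s * invsq s ^ 3) *\<^sub>R ?Y s = - (invsq s)\<^sup>2 *\<^sub>R circ_v \<omega> s"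
  proof -
    have "s * invsq s ^ 3 * s - invsq s = - ((invsq s)\<^sup>2 * invsq s)"
    proof -
      have "s * invsq s ^ 3 * s - invsq s = invsq s ^ 3 * (s * s) - invsq s" by simp
      also have "\<dots> = - (invsq s ^ 3)" using q by linarith
      finally show ?thesis by (simp add: power2_eq_square power3_eq_cube)
    qed
    then show ?thesis
      by (simp add: vec_eq_iff forall_3 circ_components axis_def power2_eq_square power3_eq_cube)
  qed
  finally show "(circ_n \<omega> has_vector_derivative - (invsq s)\<^sup>2 *\<^sub>R circ_v \<omega> s) (at s)"
    by (simp only: circ_n_def[abs_def])
qed

lemma circ_lipschitz:
  assumes \<omega>: "norm \<omega> = 1"
  shows "norm (circ_v \<omega> s - circ_v \<omega> s') \<le> \<bar>s - s'\<bar>" "norm (circ_n \<omega> s - circ_n \<omega> s') \<le> \<bar>s - s'\<bar>"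
    "norm (circ_pt \<omega> s \<phi> - circ_pt \<omega> s' \<phi>) \<le> \<bar>s - s'\<bar>"
proof -
  have q: "(invsq s)\<^sup>2 \<le> 1" for s using invsq_pos[of s] invsq_le_1[of s] by (simp add: power_le_one)
  have *: "norm (f s - f s') \<le> \<bar>s - s'\<bar>"
    if f: "\<And>s. (f has_vector_derivative f' s) (at s)" and b: "\<And>s. norm (f' s) \<le> 1" for f f' :: "real \<Rightarrow> real^3" 
  proof -
    have "norm (f s - f s') \<le> 1 * norm (s - s')"
    proof (rule differentiable_bound[where S = UNIV and f' = "\<lambda>s h. h *\<^sub>R f' s"])
      show "(f has_derivative (\<lambda>h. h *\<^sub>R f' x)) (at x within UNIV)" for x using f by (simp add: has_vector_derivative_def)
      show "onorm (\<lambda>h. h *\<^sub>R f' x) \<le> 1" for x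
        by (rule onorm_le) (use b[of x] in \<open>auto intro: mult_left_le\<close>)
    qed auto
    then show ?thesis by simp
  qed
  show v: "norm (circ_v \<omega> s - circ_v \<omega> s') \<le> \<bar>s - s'\<bar>"
    by (rule *[OF circ_v_has_derivative]) (use q circ_orthonormal[OF \<omega>] in auto)
  show "norm (circ_n \<omega> s - circ_n \<omega> s') \<le> \<bar>s - s'\<bar>"
    by (rule *[OF circ_n_has_derivative]) (use q circ_orthonormal[OF \<omega>] in auto)
  have "circ_pt \<omega> s \<phi> - circ_pt \<omega> s' \<phi> = cos \<phi> *\<^sub>R (circ_v \<omega> s - circ_v \<omega> s')"
    by (simp add: circ_pt_def algebra_simps)
  then have "norm (circ_pt \<omega> s \<phi> - circ_pt \<omega> s' \<phi>) = \<bar>cos \<phi>\<bar> * norm (circ_v \<omega> s - circ_v \<omega> s')" by simp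
  also have "\<dots> \<le> 1 * \<bar>s - s'\<bar>" using v by (intro mult_mono) auto
  finally show "norm (circ_pt \<omega> s \<phi> - circ_pt \<omega> s' \<phi>) \<le> \<bar>s - s'\<bar>" by simp
qed

section \<open>Bounds on the unit ball for differentiable functions\<close>

lemma C_k_differentiable: "C_k (Suc k) f \<Longrightarrow> f differentiable at x"
  by simp

lemma C_k_continuous: "C_k k f \<Longrightarrow> continuous_on UNIV f"
  by (cases k) (auto intro: differentiable_imp_continuous_on differentiable_at_imp_differentiable_on)

lemma C_k_Suc_imp: "C_k (Suc k) f \<Longrightarrow> C_k k f"
proof (induction k arbitrary: f)
  case 0
  then show ?case by (auto intro: differentiable_imp_continuous_on differentiable_at_imp_differentiable_on)
qed auto

lemma C_k_dir_deriv: "C_k (Suc k) f \<Longrightarrow> C_k k (dir_deriv f v)"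
  by simp

lemma continuous_bounded_cball:
  fixes f :: "'a::euclidean_space \<Rightarrow> real"
  assumes "continuous_on UNIV f"
  obtains B where "B > 0" "\<And>x. norm x \<le> R \<Longrightarrow> \<bar>f x\<bar> \<le> B"
proof -
  have "compact (f ` cball 0 R)"
    using continuous_on_subset[OF assms] by (intro compact_continuous_image) auto
  then obtain B where "B > 0" "\<forall>y\<in>f ` cball 0 R. norm y \<le> B"
    using compact_imp_bounded bounded_pos by metis
  then show ?thesis using that by auto
qed

lemma dir_deriv_bounded_cball:
  fixes h :: "real^'n \<Rightarrow> real"
  assumes h: "C_k 1 h"
  obtains B where "B > 0" "\<And>p v. norm p \<le> 1 \<Longrightarrow> \<bar>dir_deriv h v p\<bar> \<le> B * norm v"
proof -
  have h: "C_k (Suc 0) h" using h by simp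
  have "\<exists>B. \<forall>i. B i > 0 \<and> (\<forall>x. norm x \<le> 1 \<longrightarrow> \<bar>pd i h x\<bar> \<le> B i)"
  proof (rule choice, rule allI)
    fix i
    obtain C where "C > 0" "\<And>x. norm x \<le> 1 \<Longrightarrow> \<bar>pd i h x\<bar> \<le> C"
      using continuous_bounded_cball[OF C_k_continuous[OF C_k_dir_deriv[OF h, of "axis i 1"]]] by blast
    then show "\<exists>C. C > 0 \<and> (\<forall>x. norm x \<le> 1 \<longrightarrow> \<bar>pd i h x\<bar> \<le> C)" by blast
  qed
  then obtain B where B: "\<And>i. B i > 0" "\<And>i x. norm x \<le> 1 \<Longrightarrow> \<bar>pd i h x\<bar> \<le> B i" by blast
  have "\<bar>dir_deriv h v p\<bar> \<le> (\<Sum>i\<in>UNIV. B i) * norm v" if p: "norm p \<le> 1" for p v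
  proof -
    have "\<bar>dir_deriv h v p\<bar> \<le> (\<Sum>i\<in>UNIV. \<bar>v $ i * pd i h p\<bar>)"
      by (subst dir_deriv_expansion[OF C_k_differentiable[OF h]]) (rule sum_abs)
    also have "\<dots> \<le> (\<Sum>i\<in>UNIV. norm v * B i)"
      using B(2)[OF p] component_le_norm_cart[of v] by (intro sum_mono) (simp add: abs_mult mult_mono)
    finally show ?thesis by (simp add: sum_distrib_left mult.commute)
  qed
  moreover have "(\<Sum>i\<in>UNIV. B i) > 0" using B by (intro sum_pos) auto
  ultimately show ?thesis using that by blast
qed

lemma cball_lipschitz:
  fixes h :: "real^'n \<Rightarrow> real"
  assumes h: "C_k (Suc 0) h" and B: "\<And>p v. norm p \<le> 1 \<Longrightarrow> \<bar>dir_deriv h v p\<bar> \<le> B * norm v"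
    and p: "norm p \<le> 1" "norm p' \<le> 1"
  shows "\<bar>h p - h p'\<bar> \<le> B * norm (p - p')"
proof -
  have "norm (h p - h p') \<le> B * norm (p - p')"
  proof (rule differentiable_bound[where S = "cball 0 1" and f' = "\<lambda>x. frechet_derivative h (at x)"])
    show "(h has_derivative frechet_derivative h (at x)) (at x within cball 0 1)" for x
      using C_k_differentiable[OF h] frechet_derivative_works has_derivative_at_withinI by blast
    show "onorm (frechet_derivative h (at x)) \<le> B" if "x \<in> cball 0 1" for x
      by (rule onorm_le) (use B that in auto)
  qed (use p in auto)
  then show ?thesis by simp
qed

lemma dir_deriv_lipschitz_cball:
  fixes h :: "real^'n \<Rightarrow> real"
  assumes h: "C_k 2 h"
  obtains B where "B > 0" "\<And>p p' v. norm p \<le> 1 \<Longrightarrow> norm p' \<le> 1 \<Longrightarrow> \<bar>dir_deriv h v p - dir_deriv h v p'\<bar> \<le> B * norm (p - p') * norm v"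
proof -
  have h2: "C_k (Suc (Suc 0)) h" using h by (simp add: numeral_2_eq_2)
  have h1: "C_k (Suc 0) (pd i h)" for i by (rule C_k_dir_deriv[OF h2])
  have "\<exists>B. \<forall>i. B i > 0 \<and> (\<forall>p p'. norm p \<le> 1 \<longrightarrow> norm p' \<le> 1 \<longrightarrow> \<bar>pd i h p - pd i h p'\<bar> \<le> B i * norm (p - p'))"
  proof (rule choice, rule allI)
    fix i
    obtain C where "C > 0" "\<And>p v. norm p \<le> 1 \<Longrightarrow> \<bar>dir_deriv (pd i h) v p\<bar> \<le> C * norm v"
      using dir_deriv_bounded_cball[of "pd i h"] h1[of i] by auto
    then show "\<exists>C. C > 0 \<and> (\<forall>p p'. norm p \<le> 1 \<longrightarrow> norm p' \<le> 1 \<longrightarrow> \<bar>pd i h p - pd i h p'\<bar> \<le> C * norm (p - p'))"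
      using cball_lipschitz[OF h1] by blast
  qed
  then obtain B where B: "\<And>i. B i > 0"
    "\<And>i p p'. norm p \<le> 1 \<Longrightarrow> norm p' \<le> 1 \<Longrightarrow> \<bar>pd i h p - pd i h p'\<bar> \<le> B i * norm (p - p')" by blast
  have "\<bar>dir_deriv h v p - dir_deriv h v p'\<bar> \<le> (\<Sum>i\<in>UNIV. B i) * norm (p - p') * norm v"
    if p: "norm p \<le> 1" "norm p' \<le> 1" for p p' v
  proof -
    have "dir_deriv h v p - dir_deriv h v p' = (\<Sum>i\<in>UNIV. v $ i * (pd i h p - pd i h p'))"
      unfolding dir_deriv_expansion[OF C_k_differentiable[OF h2], of p v] dir_deriv_expansion[OF C_k_differentiable[OF h2], of p' v]
      by (simp add: sum_subtractf right_diff_distrib)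
    also have "\<bar>\<dots>\<bar> \<le> (\<Sum>i\<in>UNIV. \<bar>v $ i * (pd i h p - pd i h p')\<bar>)" by (rule sum_abs)
    also have "\<dots> \<le> (\<Sum>i\<in>UNIV. norm v * (B i * norm (p - p')))"
      unfolding abs_mult using B(2)[OF p] component_le_norm_cart[of v] by (intro sum_mono mult_mono) auto
    finally show ?thesis by (simp add: sum_distrib_left sum_distrib_right mult_ac)
  qed
  moreover have "(\<Sum>i\<in>UNIV. B i) > 0" using B by (intro sum_pos) auto
  ultimately show ?thesis using that by blast
qed

section \<open>Regularity and decay of the great circle transform\<close>

lemma continuous_on_circ_pt:
  "continuous_on UNIV (\<lambda>(x, \<phi>). circ_pt (fst x) (snd x) \<phi>)"
  unfolding circ_pt_def circ_v_def circ_u_def split_beta' by (intro continuous_intros)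

lemma continuous_on_circ_pt_angle: "continuous_on UNIV (circ_pt \<omega> s)"
  unfolding circ_pt_def[abs_def] by (intro continuous_intros)

lemma continuous_on_circ_n_component: "continuous_on UNIV (\<lambda>x. circ_n (fst x) (snd x) $ i)"
  unfolding circ_n_def by (intro continuous_intros)

text \<open>The direction \<open>circ_n \<omega> s\<close> moves with the parameters. Expanding
  along the axes is what makes the integrand visibly continuous in all variables jointly.\<close>

lemma funk'_integrand:
  assumes h: "C_k 2 h"
  shows "cos \<phi> * dir_deriv h (circ_n \<omega> s) (circ_pt \<omega> s \<phi>) = cos \<phi> * (\<Sum>i\<in>UNIV. circ_n \<omega> s $ i * pd i h (circ_pt \<omega> s \<phi>))"
proof -
  have h2: "C_k (Suc (Suc 0)) h" using h by (simp add: numeral_2_eq_2)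
  show ?thesis by (subst dir_deriv_expansion[OF C_k_differentiable[OF h2]]) simp
qed

lemma funk_continuous:
  assumes h: "continuous_on UNIV h"
  shows "continuous_on UNIV (\<lambda>x. funk h (fst x) (snd x))"
  unfolding funk_def
proof (rule period_integral_continuous)
  show "continuous_on UNIV (\<lambda>(x, \<phi>). h (circ_pt (fst x) (snd x) \<phi>))"
    using continuous_on_compose2[OF h continuous_on_circ_pt] by (simp add: split_beta')
qed

lemma funk'_continuous:
  assumes h: "C_k 2 h"
  shows "continuous_on UNIV (\<lambda>x. funk' h (fst x) (snd x))"
  unfolding funk'_def funk'_integrand[OF h]
proof (rule period_integral_continuous)
  have h2: "C_k (Suc (Suc 0)) h" using h by (simp add: numeral_2_eq_2)
  have 1: "continuous_on UNIV (\<lambda>y. pd i h (circ_pt (fst (fst y)) (snd (fst y)) (snd y)))" for i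
    using continuous_on_compose2[OF C_k_continuous[OF C_k_dir_deriv[OF h2]] continuous_on_circ_pt] by (simp add: split_beta')
  have 2: "continuous_on UNIV (\<lambda>y. circ_n (fst (fst y)) (snd (fst y)) $ i)" for i
    by (rule continuous_on_compose2[OF continuous_on_circ_n_component continuous_on_fst[OF continuous_on_id]]) auto
  show "continuous_on UNIV (\<lambda>(x, \<phi>). cos \<phi> * (\<Sum>i\<in>UNIV. circ_n (fst x) (snd x) $ i * pd i h (circ_pt (fst x) (snd x) \<phi>)))"
    unfolding split_beta' by (intro continuous_intros 1 2)
qed

lemma funk_G_continuous: "continuous_on UNIV h \<Longrightarrow> continuous_on UNIV (\<lambda>x. funk_G h (fst x) (snd x))"
  unfolding funk_G_def by (intro continuous_intros funk_continuous)

lemma funk_G'_continuous: "C_k 2 h \<Longrightarrow> continuous_on UNIV (\<lambda>x. funk_G' h (fst x) (snd x))"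
  unfolding funk_G'_def by (intro continuous_intros funk_continuous funk'_continuous C_k_continuous)

lemma funk_G_has_derivative:
  assumes h: "C_k 2 h" and \<omega>: "norm \<omega> = 1"
  shows "(funk_G h \<omega> has_real_derivative funk_G' h \<omega> s) (at s)"
proof -
  have h2: "C_k (Suc (Suc 0)) h" using h by (simp add: numeral_2_eq_2)
  have h1: "C_k 1 h" using C_k_Suc_imp[OF h2] by simp
  obtain B where B: "B > 0" "\<And>p v. norm p \<le> 1 \<Longrightarrow> \<bar>dir_deriv h v p\<bar> \<le> B * norm v"
    using dir_deriv_bounded_cball[OF h1] by blast
  have c: "continuous_on UNIV (\<lambda>\<phi>. h (circ_pt \<omega> s \<phi>))" for s
    using continuous_on_compose2[OF C_k_continuous[OF h] continuous_on_circ_pt_angle] by simp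
  have "((\<lambda>s. \<integral>\<phi>. h (circ_pt \<omega> s \<phi>) \<partial>period_measure) has_real_derivative
    (\<integral>\<phi>. (invsq s)\<^sup>2 * (cos \<phi> * dir_deriv h (circ_n \<omega> s) (circ_pt \<omega> s \<phi>)) \<partial>period_measure)) (at s)"
  proof (rule has_real_derivative_lebesgue_integral(1)[where X = UNIV and B = B])
    fix s \<phi> :: real
    have lin: "linear (frechet_derivative h (at x))" for x
      using C_k_differentiable[OF h2] linear_frechet_derivative by blast
    have hd: "(h has_derivative frechet_derivative h (at x)) (at x)" for x
      using C_k_differentiable[OF h2] frechet_derivative_works by blast
    have "((\<lambda>s. circ_pt \<omega> s \<phi>) has_vector_derivative (cos \<phi> *\<^sub>R ((invsq s)\<^sup>2 *\<^sub>R circ_n \<omega> s) + 0)) (at s)"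
      unfolding circ_pt_def
      by (intro has_vector_derivative_add has_vector_derivative_const
          bounded_linear.has_vector_derivative[OF bounded_linear_scaleR_right circ_v_has_derivative])
    then have "((\<lambda>s. circ_pt \<omega> s \<phi>) has_derivative (\<lambda>t. t *\<^sub>R (cos \<phi> *\<^sub>R ((invsq s)\<^sup>2 *\<^sub>R circ_n \<omega> s)))) (at s)"
      by (simp add: has_vector_derivative_def)
    from has_derivative_compose[OF this hd]
    have "((\<lambda>s. h (circ_pt \<omega> s \<phi>)) has_derivative
       (\<lambda>t. dir_deriv h (t *\<^sub>R (cos \<phi> *\<^sub>R ((invsq s)\<^sup>2 *\<^sub>R circ_n \<omega> s))) (circ_pt \<omega> s \<phi>))) (at s)" .
    moreover have "(\<lambda>t. dir_deriv h (t *\<^sub>R (cos \<phi> *\<^sub>R ((invsq s)\<^sup>2 *\<^sub>R circ_n \<omega> s))) (circ_pt \<omega> s \<phi>)) =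
      (*) ((invsq s)\<^sup>2 * (cos \<phi> * dir_deriv h (circ_n \<omega> s) (circ_pt \<omega> s \<phi>)))"
      by (rule ext) (simp only: linear_scale[OF lin], simp)
    ultimately show "((\<lambda>s. h (circ_pt \<omega> s \<phi>)) has_real_derivative (invsq s)\<^sup>2 * (cos \<phi> * dir_deriv h (circ_n \<omega> s) (circ_pt \<omega> s \<phi>))) (at s)"
      by (simp add: has_field_derivative_def)
    have "\<bar>cos \<phi> * dir_deriv h (circ_n \<omega> s) (circ_pt \<omega> s \<phi>)\<bar> \<le> 1 * B"
      unfolding abs_mult using B(2)[of "circ_pt \<omega> s \<phi>" "circ_n \<omega> s"] circ_orthonormal[OF \<omega>] by (intro mult_mono) auto
    then have "(invsq s)\<^sup>2 * \<bar>cos \<phi> * dir_deriv h (circ_n \<omega> s) (circ_pt \<omega> s \<phi>)\<bar> \<le> 1 * (1 * B)"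
      using invsq_pos[of s] invsq_le_1[of s] by (intro mult_mono) (auto simp: power_le_one)
    then show "\<bar>(invsq s)\<^sup>2 * (cos \<phi> * dir_deriv h (circ_n \<omega> s) (circ_pt \<omega> s \<phi>))\<bar> \<le> B"
      by (simp add: abs_mult)
  next
    show "(\<lambda>\<phi>. h (circ_pt \<omega> s \<phi>)) \<in> borel_measurable period_measure" for s
      by (rule borel_measurable_integrable[OF period_measure_integrable[OF c]])
    show "integrable period_measure (\<lambda>\<phi>. h (circ_pt \<omega> s \<phi>))"
      by (rule period_measure_integrable[OF c])
  qed auto
  then have "(funk h \<omega> has_real_derivative (invsq s)\<^sup>2 * funk' h \<omega> s) (at s)"
    by (simp only: funk_def[abs_def] funk'_def Bochner_Integration.integral_mult_right_zero)
  from DERIV_mult[OF invsq_has_derivative this]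
  have "((\<lambda>s. invsq s * funk h \<omega> s) has_real_derivative - s * invsq s ^ 3 * funk h \<omega> s + (invsq s)\<^sup>2 * funk' h \<omega> s * invsq s) (at s)" .
  moreover have "- s * invsq s ^ 3 * funk h \<omega> s + (invsq s)\<^sup>2 * funk' h \<omega> s * invsq s = funk_G' h \<omega> s"
    by (simp add: funk_G'_def power2_eq_square power3_eq_cube)
  ultimately show ?thesis by (simp only: funk_G_def[abs_def])
qed

lemma lipschitz_mult:
  fixes f g :: "real \<Rightarrow> real"
  assumes "\<And>s. \<bar>f s\<bar> \<le> a" "\<And>s. \<bar>g s\<bar> \<le> b" "\<bar>f s - f s'\<bar> \<le> l * \<bar>s - s'\<bar>" "\<bar>g s - g s'\<bar> \<le> m * \<bar>s - s'\<bar>"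
  shows "\<bar>f s * g s - f s' * g s'\<bar> \<le> (l * b + a * m) * \<bar>s - s'\<bar>"
proof -
  have "f s * g s - f s' * g s' = (f s - f s') * g s + f s' * (g s - g s')" by (simp add: algebra_simps)
  then have "\<bar>f s * g s - f s' * g s'\<bar> \<le> \<bar>f s - f s'\<bar> * \<bar>g s\<bar> + \<bar>f s'\<bar> * \<bar>g s - g s'\<bar>"
    by (metis abs_mult abs_triangle_ineq)
  also have "\<dots> \<le> (l * \<bar>s - s'\<bar>) * b + a * (m * \<bar>s - s'\<bar>)"
    using assms by (intro add_mono mult_mono) (auto intro: order_trans[OF abs_ge_zero])
  finally show ?thesis by (simp add: algebra_simps)
qed

lemma invsq_lipschitz:
  "\<bar>invsq s ^ 3 - invsq s' ^ 3\<bar> \<le> 3 * \<bar>s - s'\<bar>" "\<bar>s * invsq s ^ 3 - s' * invsq s' ^ 3\<bar> \<le> 4 * \<bar>s - s'\<bar>"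
proof -
  have *: "\<bar>f s - f s'\<bar> \<le> B * \<bar>s - s'\<bar>"
    if f: "\<And>s. (f has_real_derivative f' s) (at s)" and b: "\<And>s. \<bar>f' s\<bar> \<le> B" for f f' :: "real \<Rightarrow> real" and B
    using field_differentiable_bound[of UNIV f f' B s s'] f b by auto
  have q: "0 \<le> invsq s ^ n" "invsq s ^ n \<le> 1" for s n
    using invsq_pos[of s] invsq_le_1[of s] by (simp_all add: power_le_one)
  have d: "((\<lambda>s. invsq s ^ 3) has_real_derivative - (3 * (s * invsq s) * invsq s ^ 4)) (at s)" for s
    by (rule DERIV_cong[OF DERIV_power[OF invsq_has_derivative]]) (simp add: power2_eq_square power3_eq_cube eval_nat_numeral)
  have b: "\<bar>3 * (s * invsq s) * invsq s ^ 4\<bar> \<le> 3 * 1 * 1" for s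
    unfolding abs_mult[of "3 * (s * invsq s)"] using q[of s 4] s_invsq_le_1[of s]
    by (intro mult_mono) (auto simp: abs_mult)
  show "\<bar>invsq s ^ 3 - invsq s' ^ 3\<bar> \<le> 3 * \<bar>s - s'\<bar>"
    by (rule *[OF d]) (use b in auto)
  have d2: "((\<lambda>s. s * invsq s ^ 3) has_real_derivative invsq s ^ 3 - 3 * (s * invsq s) * (s * invsq s) * invsq s ^ 3) (at s)" for s
    by (rule DERIV_cong[OF DERIV_mult[OF DERIV_ident d]]) (simp add: eval_nat_numeral mult_ac)
  have b2: "\<bar>invsq s ^ 3 - 3 * (s * invsq s) * (s * invsq s) * invsq s ^ 3\<bar> \<le> 4" for s
  proof -
    have "\<bar>(s * invsq s) * (s * invsq s)\<bar> \<le> 1 * 1"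
      unfolding abs_mult[of "s * invsq s"] using s_invsq_le_1[of s] by (intro mult_mono) auto
    then have "\<bar>((s * invsq s) * (s * invsq s)) * invsq s ^ 3\<bar> \<le> (1 * 1) * 1"
      unfolding abs_mult[of "(s * invsq s) * (s * invsq s)"] using q[of s 3] by (intro mult_mono) auto
    moreover have "invsq s ^ 3 - 3 * (s * invsq s) * (s * invsq s) * invsq s ^ 3 =
      invsq s ^ 3 - 3 * (((s * invsq s) * (s * invsq s)) * invsq s ^ 3)" by simp
    ultimately show ?thesis using q[of s 3] by linarith
  qed
  show "\<bar>s * invsq s ^ 3 - s' * invsq s' ^ 3\<bar> \<le> 4 * \<bar>s - s'\<bar>"
    by (rule *[OF d2 b2])
qed

text \<open>Uniformly in the direction, these are the boundedness needed by
  \<open>integral_divided_derivative\<close> and the decay and Lipschitz bounds needed by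
  \<open>pv_integral_symmetric\<close>. The Lipschitz bound for the first derivative is where two
  derivatives of \<open>h\<close> are used.\<close>

lemma funk_G_bounds:
  assumes h: "C_k 2 h"
  obtains C where "C > 0" "\<And>\<omega> s. norm \<omega> = 1 \<Longrightarrow> \<bar>funk_G h \<omega> s\<bar> \<le> C"
    "\<And>\<omega> s. norm \<omega> = 1 \<Longrightarrow> \<bar>funk_G' h \<omega> s\<bar> \<le> C / (1 + s\<^sup>2)"
    "\<And>\<omega> s s'. norm \<omega> = 1 \<Longrightarrow> \<bar>funk_G' h \<omega> s - funk_G' h \<omega> s'\<bar> \<le> C * \<bar>s - s'\<bar>"
proof -
  have h2: "C_k (Suc (Suc 0)) h" using h by (simp add: numeral_2_eq_2)
  have h1: "C_k (Suc 0) h" by (rule C_k_Suc_imp[OF h2])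
  obtain A where A: "A > 0" "\<And>p. norm p \<le> 1 \<Longrightarrow> \<bar>h p\<bar> \<le> A"
    using continuous_bounded_cball[OF C_k_continuous[OF h]] by blast
  obtain B where B: "B > 0" "\<And>p v. norm p \<le> 1 \<Longrightarrow> \<bar>dir_deriv h v p\<bar> \<le> B * norm v"
    using dir_deriv_bounded_cball h1 by auto
  obtain D where D: "D > 0" "\<And>p p' v. norm p \<le> 1 \<Longrightarrow> norm p' \<le> 1 \<Longrightarrow> \<bar>dir_deriv h v p - dir_deriv h v p'\<bar> \<le> D * norm (p - p') * norm v"
    using dir_deriv_lipschitz_cball[OF h] by blast
  have c: "continuous_on UNIV (\<lambda>\<phi>. h (circ_pt \<omega> s \<phi>))" for \<omega> s
    using continuous_on_compose2[OF C_k_continuous[OF h] continuous_on_circ_pt_angle] by simp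
  have c': "continuous_on UNIV (\<lambda>\<phi>. cos \<phi> * dir_deriv h (circ_n \<omega> s) (circ_pt \<omega> s \<phi>))" for \<omega> s
    using continuous_on_compose2[OF C_k_continuous[OF C_k_dir_deriv[OF h2]] continuous_on_circ_pt_angle]
    by (intro continuous_intros) auto
  have f: "\<bar>funk h \<omega> s\<bar> \<le> 2 * pi * A" if w: "norm \<omega> = 1" for \<omega> s
    unfolding funk_def using A circ_orthonormal(7)[OF w] by (intro period_integral_bound c) auto
  have f': "\<bar>funk' h \<omega> s\<bar> \<le> 2 * pi * B" if w: "norm \<omega> = 1" for \<omega> s
    unfolding funk'_def
  proof (rule period_integral_bound[OF c'])
    fix \<phi>
    have "\<bar>cos \<phi> * dir_deriv h (circ_n \<omega> s) (circ_pt \<omega> s \<phi>)\<bar> \<le> 1 * B"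
      unfolding abs_mult using B(2)[of "circ_pt \<omega> s \<phi>" "circ_n \<omega> s"] circ_orthonormal[OF w] by (intro mult_mono) auto
    then show "\<bar>cos \<phi> * dir_deriv h (circ_n \<omega> s) (circ_pt \<omega> s \<phi>)\<bar> \<le> B" by simp
  qed
  have fl: "\<bar>funk h \<omega> s - funk h \<omega> s'\<bar> \<le> 2 * pi * B * \<bar>s - s'\<bar>" if w: "norm \<omega> = 1" for \<omega> s s'
  proof -
    have "funk h \<omega> s - funk h \<omega> s' = (\<integral>\<phi>. h (circ_pt \<omega> s \<phi>) - h (circ_pt \<omega> s' \<phi>) \<partial>period_measure)"
      unfolding funk_def by (rule Bochner_Integration.integral_diff[symmetric]) (intro period_measure_integrable c)+
    also have "\<bar>\<dots>\<bar> \<le> 2 * pi * (B * \<bar>s - s'\<bar>)"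
    proof (rule period_integral_bound)
      fix \<phi>
      have "\<bar>h (circ_pt \<omega> s \<phi>) - h (circ_pt \<omega> s' \<phi>)\<bar> \<le> B * norm (circ_pt \<omega> s \<phi> - circ_pt \<omega> s' \<phi>)"
        using circ_orthonormal(7)[OF w] by (intro cball_lipschitz[OF h1 B(2)]) auto
      also have "\<dots> \<le> B * \<bar>s - s'\<bar>" using B(1) circ_lipschitz(3)[OF w] by (intro mult_left_mono) auto
      finally show "\<bar>h (circ_pt \<omega> s \<phi>) - h (circ_pt \<omega> s' \<phi>)\<bar> \<le> B * \<bar>s - s'\<bar>" .
    qed (intro continuous_intros c)
    finally show ?thesis by simp
  qed
  have fl': "\<bar>funk' h \<omega> s - funk' h \<omega> s'\<bar> \<le> 2 * pi * (B + D) * \<bar>s - s'\<bar>" if w: "norm \<omega> = 1" for \<omega> s s'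
  proof -
    have lin: "linear (frechet_derivative h (at x))" for x
      using C_k_differentiable[OF h1] linear_frechet_derivative by blast
    have "funk' h \<omega> s - funk' h \<omega> s' = (\<integral>\<phi>. cos \<phi> * dir_deriv h (circ_n \<omega> s) (circ_pt \<omega> s \<phi>) -
        cos \<phi> * dir_deriv h (circ_n \<omega> s') (circ_pt \<omega> s' \<phi>) \<partial>period_measure)"
      unfolding funk'_def by (rule Bochner_Integration.integral_diff[symmetric]) (intro period_measure_integrable c')+
    also have "\<bar>\<dots>\<bar> \<le> 2 * pi * ((B + D) * \<bar>s - s'\<bar>)"
    proof (rule period_integral_bound)
      fix \<phi>
      let ?p = "circ_pt \<omega> s \<phi>" and ?p' = "circ_pt \<omega> s' \<phi>" and ?n = "circ_n \<omega> s" and ?n' = "circ_n \<omega> s'"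
      note o = circ_orthonormal[OF w]
      have "dir_deriv h ?n ?p - dir_deriv h ?n' ?p' = dir_deriv h (?n - ?n') ?p + (dir_deriv h ?n' ?p - dir_deriv h ?n' ?p')"
        by (simp add: linear_diff[OF lin])
      also have "\<bar>\<dots>\<bar> \<le> B * norm (?n - ?n') + D * norm (?p - ?p') * norm ?n'"
        using B(2)[of ?p "?n - ?n'"] D(2)[of ?p ?p' ?n'] o by (intro order_trans[OF abs_triangle_ineq] add_mono) auto
      also have "\<dots> \<le> B * \<bar>s - s'\<bar> + D * \<bar>s - s'\<bar> * 1"
        using B(1) D(1) circ_lipschitz(1,2)[OF w, of s s'] circ_lipschitz(3)[OF w, of s \<phi> s'] o by (intro add_mono mult_mono) auto
      finally have "\<bar>dir_deriv h ?n ?p - dir_deriv h ?n' ?p'\<bar> \<le> (B + D) * \<bar>s - s'\<bar>" by (simp add: algebra_simps)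
      then have "\<bar>cos \<phi>\<bar> * \<bar>dir_deriv h ?n ?p - dir_deriv h ?n' ?p'\<bar> \<le> 1 * ((B + D) * \<bar>s - s'\<bar>)"
        by (intro mult_mono) auto
      then show "\<bar>cos \<phi> * dir_deriv h ?n ?p - cos \<phi> * dir_deriv h ?n' ?p'\<bar> \<le> (B + D) * \<bar>s - s'\<bar>"
        by (simp add: abs_mult[symmetric] right_diff_distrib)
    qed (intro continuous_intros c')
    finally show ?thesis by simp
  qed
  have q: "0 \<le> invsq s ^ n" "invsq s ^ n \<le> 1" for s n
    using invsq_pos[of s] invsq_le_1[of s] by (simp_all add: power_le_one)
  have abs_q: "\<bar>invsq s ^ n\<bar> \<le> 1" for s n using q[of s n] by linarith
  \<comment> \<open>The term with the extra factor \<open>s\<close> still decays quadratically,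
    because \<open>s * invsq s\<close> is bounded.\<close>
  have sq: "\<bar>s * invsq s ^ 3\<bar> \<le> (invsq s)\<^sup>2" for s
  proof -
    have "\<bar>s * invsq s ^ 3\<bar> = \<bar>s * invsq s\<bar> * (invsq s)\<^sup>2" by (simp add: power2_eq_square power3_eq_cube abs_mult)
    also have "\<dots> \<le> 1 * (invsq s)\<^sup>2" using s_invsq_le_1 by (intro mult_right_mono) auto
    finally show ?thesis by simp
  qed
  \<comment> \<open>\<open>E\<close> serves the size and decay bounds. The remaining summands of
    \<open>C\<close> are the Lipschitz constants of the two products in \<open>funk_G'\<close>, in
    the form given by \<open>lipschitz_mult\<close>.\<close>
  define E where "E = 2 * pi * A + 2 * pi * B"
  define C where "C = E + ((3 * (2 * pi * B) + 1 * (2 * pi * (B + D))) + (4 * (2 * pi * A) + 1 * (2 * pi * B)))"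
  have nn: "2 * pi * A > 0" "2 * pi * B > 0" "2 * pi * (B + D) > 0" "E > 0" using A(1) B(1) D(1) by (auto simp: E_def add_pos_pos)
  have CE: "E \<le> C" using nn by (simp add: C_def)
  show ?thesis
  proof
    show "C > 0" using CE nn by linarith
    show "\<bar>funk_G h \<omega> s\<bar> \<le> C" if w: "norm \<omega> = 1" for \<omega> s
    proof -
      have "\<bar>funk_G h \<omega> s\<bar> \<le> 1 * (2 * pi * A)"
        unfolding funk_G_def abs_mult using f[OF w] invsq_pos[of s] invsq_le_1[of s] by (intro mult_mono) auto
      then show ?thesis using CE nn(2) unfolding E_def by linarith
    qed
    show "\<bar>funk_G' h \<omega> s\<bar> \<le> C / (1 + s\<^sup>2)" if w: "norm \<omega> = 1" for \<omega> s
    proof -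
      have "invsq s ^ 3 \<le> (invsq s)\<^sup>2"
        using invsq_pos[of s] invsq_le_1[of s] by (intro power_decreasing) auto
      then have "\<bar>invsq s ^ 3 * funk' h \<omega> s\<bar> \<le> (invsq s)\<^sup>2 * (2 * pi * B)"
        unfolding abs_mult using f'[OF w] q[of s 3] by (intro mult_mono) auto
      moreover have "\<bar>s * invsq s ^ 3 * funk h \<omega> s\<bar> \<le> (invsq s)\<^sup>2 * (2 * pi * A)"
        unfolding abs_mult[of "s * invsq s ^ 3"] using f[OF w] sq by (intro mult_mono) auto
      ultimately have "\<bar>funk_G' h \<omega> s\<bar> \<le> (invsq s)\<^sup>2 * (2 * pi * B) + (invsq s)\<^sup>2 * (2 * pi * A)"
        unfolding funk_G'_def by linarith
      also have "\<dots> = (invsq s)\<^sup>2 * E" by (simp add: E_def algebra_simps)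
      also have "\<dots> \<le> (invsq s)\<^sup>2 * C" using CE by (intro mult_left_mono) auto
      finally show ?thesis by (simp add: invsq_square)
    qed
    show "\<bar>funk_G' h \<omega> s - funk_G' h \<omega> s'\<bar> \<le> C * \<bar>s - s'\<bar>" if w: "norm \<omega> = 1" for \<omega> s s'
    proof -
      have 1: "\<bar>invsq s ^ 3 * funk' h \<omega> s - invsq s' ^ 3 * funk' h \<omega> s'\<bar> \<le> (3 * (2 * pi * B) + 1 * (2 * pi * (B + D))) * \<bar>s - s'\<bar>"
        by (rule lipschitz_mult[where f = "\<lambda>s. invsq s ^ 3"]) (use abs_q f'[OF w] fl'[OF w] invsq_lipschitz in auto)
      have s1: "\<bar>s * invsq s ^ 3\<bar> \<le> 1" for s using sq[of s] q(2)[of s 2] by linarith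
      have 2: "\<bar>s * invsq s ^ 3 * funk h \<omega> s - s' * invsq s' ^ 3 * funk h \<omega> s'\<bar> \<le> (4 * (2 * pi * A) + 1 * (2 * pi * B)) * \<bar>s - s'\<bar>"
        by (rule lipschitz_mult[where f = "\<lambda>s. s * invsq s ^ 3"]) (use s1 f[OF w] fl[OF w] invsq_lipschitz in auto)
      have "\<bar>funk_G' h \<omega> s - funk_G' h \<omega> s'\<bar> \<le> (3 * (2 * pi * B) + 1 * (2 * pi * (B + D))) * \<bar>s - s'\<bar> + (4 * (2 * pi * A) + 1 * (2 * pi * B)) * \<bar>s - s'\<bar>"
        unfolding funk_G'_def using 1 2 by linarith
      also have "\<dots> = (C - E) * \<bar>s - s'\<bar>" by (simp add: C_def algebra_simps)
      also have "\<dots> \<le> C * \<bar>s - s'\<bar>" using nn by (intro mult_right_mono) auto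
      finally show ?thesis .
    qed
  qed
qed

lemma circ_pt_uminus: "circ_pt (- \<omega>) (- s) \<phi> = circ_pt \<omega> s (- \<phi>)"
  by (simp add: circ_pt_def circ_v_def circ_u_def invsq_def vec_eq_iff forall_3 axis_def)

lemma circ_pt_periodic: "circ_pt \<omega> s (\<phi> + 2 * pi) = circ_pt \<omega> s \<phi>" "circ_pt \<omega> s (\<phi> + pi) = - circ_pt \<omega> s \<phi>"
  by (simp_all add: circ_pt_def)

text \<open>Opposite parameters describe the same great circle, traversed backwards. This is what
  allows the half of a principal value to the left of the pole to be read as the right half for the
  direction \<open>- \<omega>\<close>.\<close>

lemma funk_G_uminus:
  assumes h: "continuous_on UNIV h"
  shows "funk_G h (- \<omega>) (- s) = funk_G h \<omega> s"
proof -
  have c: "continuous_on UNIV (\<lambda>\<phi>. h (circ_pt \<omega> s \<phi>))"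
    using continuous_on_compose2[OF h continuous_on_circ_pt_angle] by simp
  show ?thesis
    using period_integral_shift(2)[OF c, of 0] by (simp add: funk_G_def funk_def circ_pt_uminus circ_pt_periodic invsq_def)
qed

section \<open>Gnomonic projection and line integrals\<close>

definition circle_dir :: "real \<Rightarrow> real^2" where
  "circle_dir \<psi> = cos \<psi> *\<^sub>R axis 1 1 + sin \<psi> *\<^sub>R axis 2 1"

definition perp :: "real^2 \<Rightarrow> real^2" where
  "perp \<omega> = (- \<omega> $ 2) *\<^sub>R axis 1 1 + \<omega> $ 1 *\<^sub>R axis 2 1"

text \<open>Places the plane as the tangent plane of the sphere at the pole, from where
  normalisation projects it onto the open upper hemisphere.\<close>

definition lift_plane :: "real^2 \<Rightarrow> real^3" where
  "lift_plane z = z $ 1 *\<^sub>R axis 1 1 + z $ 2 *\<^sub>R axis 2 1 + axis 3 1"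

text \<open>The gnomonic projection of an even function, weighted so that great circle integrals become line
  integrals.\<close>

definition gnomonic :: "(real^3 \<Rightarrow> real) \<Rightarrow> real^2 \<Rightarrow> real" where
  "gnomonic h z = h (invsq (norm z) *\<^sub>R lift_plane z) * (invsq (norm z))\<^sup>2"

lemma circle_dir_components [simp]: "circle_dir \<psi> $ 1 = cos \<psi>" "circle_dir \<psi> $ 2 = sin \<psi>"
  by (simp_all add: circle_dir_def axis_def)

lemma perp_components [simp]: "perp \<omega> $ 1 = - \<omega> $ 2" "perp \<omega> $ 2 = \<omega> $ 1"
  by (simp_all add: perp_def axis_def)

lemma lift_plane_components [simp]: "lift_plane z $ 1 = z $ 1" "lift_plane z $ 2 = z $ 2" "lift_plane z $ 3 = 1"
  by (simp_all add: lift_plane_def axis_def)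

lemma norm_circle_dir [simp]: "norm (circle_dir \<psi>) = 1"
  by (simp add: norm_eq_1 inner_vec_def sum_2 power2_eq_square[symmetric])

lemma circle_dir_pi: "circle_dir (\<psi> + pi) = - circle_dir \<psi>"
  by (simp add: vec_eq_iff forall_2)

lemma circle_dir_periodic: "circle_dir (\<psi> + 2 * pi) = circle_dir \<psi>"
  by (simp add: vec_eq_iff forall_2)

lemma continuous_on_circle_dir [continuous_intros]:
  fixes f :: "'a::t2_space \<Rightarrow> real"
  shows "continuous_on S f \<Longrightarrow> continuous_on S (\<lambda>x. circle_dir (f x))"
  unfolding circle_dir_def
  by (intro continuous_on_add continuous_on_scaleR continuous_on_const continuous_on_cos continuous_on_sin)

lemma norm_lift_plane: "(norm (lift_plane z))\<^sup>2 = 1 + (norm z)\<^sup>2"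
  by (simp add: power2_norm_eq_inner inner_vec_def sum_3 sum_2)

lemma norm_gnomonic_point: "norm (invsq (norm z) *\<^sub>R lift_plane z) = 1"
proof -
  have "(norm (invsq (norm z) *\<^sub>R lift_plane z))\<^sup>2 = (invsq (norm z))\<^sup>2 * (1 + (norm z)\<^sup>2)"
    by (simp add: power_mult_distrib norm_lift_plane)
  also have "\<dots> = 1" by (rule invsq_mult)
  finally show ?thesis by (metis norm_ge_zero power2_eq_1_iff neg_one_neq_one norm_not_less_zero neg_less_0_iff_less zero_less_one)
qed

lemma gnomonic_continuous:
  assumes "continuous_on UNIV h"
  shows "continuous_on UNIV (gnomonic h)"
proof -
  have "continuous_on UNIV (\<lambda>z. invsq (norm z) *\<^sub>R lift_plane z)"
    unfolding lift_plane_def by (intro continuous_intros)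
  then have "continuous_on UNIV (\<lambda>z. h (invsq (norm z) *\<^sub>R lift_plane z))"
    using continuous_on_compose2[OF assms] by simp
  then show ?thesis unfolding gnomonic_def[abs_def] by (intro continuous_intros)
qed

text \<open>The second bound moves the decay from \<open>y + z\<close> to \<open>z\<close> at the
  price of a factor depending on \<open>y\<close>, by Peetre's inequality \<open>1 + (norm
  z)\<^sup>2 \<le> 2 * (1 + (norm y)\<^sup>2) * (1 + (norm (y + z))\<^sup>2)\<close>. It is used
  with \<open>y\<close> fixed and \<open>z\<close> running along lines or circles about
  \<open>y\<close>.\<close>

lemma gnomonic_bound:
  assumes C: "\<And>p. norm p = 1 \<Longrightarrow> \<bar>h p\<bar> \<le> C"
  shows "\<bar>gnomonic h z\<bar> \<le> C / (1 + (norm z)\<^sup>2)"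
    and "\<bar>gnomonic h (y + z)\<bar> \<le> 2 * C * (1 + (norm y)\<^sup>2) / (1 + (norm z)\<^sup>2)"
proof -
  have C0: "C \<ge> 0" using C[of "axis 1 1"] by simp
  show 1: "\<bar>gnomonic h z\<bar> \<le> C / (1 + (norm z)\<^sup>2)" for z
  proof -
    have "\<bar>gnomonic h z\<bar> \<le> C * (invsq (norm z))\<^sup>2"
      unfolding gnomonic_def abs_mult using C[OF norm_gnomonic_point] by (simp add: mult_right_mono)
    then show ?thesis by (simp add: invsq_square)
  qed
  have "norm z \<le> norm (y + z) + norm y" using norm_triangle_ineq4[of "y + z" y] by simp
  then have "(norm z)\<^sup>2 \<le> (norm (y + z) + norm y)\<^sup>2" by (intro power_mono) auto
  also have "\<dots> \<le> 2 * (norm (y + z))\<^sup>2 + 2 * (norm y)\<^sup>2"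
    using sum_squares_ge_zero[of "norm (y + z) - norm y" 0] by (simp add: power2_eq_square algebra_simps)
  finally have "(norm z)\<^sup>2 \<le> 2 * (norm (y + z))\<^sup>2 + 2 * (norm y)\<^sup>2" .
  moreover have "2 * (1 + (norm y)\<^sup>2) * (1 + (norm (y + z))\<^sup>2) =
    2 + 2 * (norm (y + z))\<^sup>2 + 2 * (norm y)\<^sup>2 + 2 * (norm y * norm (y + z))\<^sup>2"
    by (simp add: power_mult_distrib algebra_simps)
  ultimately have "1 + (norm z)\<^sup>2 \<le> 2 * (1 + (norm y)\<^sup>2) * (1 + (norm (y + z))\<^sup>2)"
    using zero_le_power2[of "norm y * norm (y + z)"] by linarith
  then have "C * (1 + (norm z)\<^sup>2) \<le> C * (2 * (1 + (norm y)\<^sup>2) * (1 + (norm (y + z))\<^sup>2))"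
    using C0 by (rule mult_left_mono)
  moreover have p: "1 + (norm z)\<^sup>2 > 0" "1 + (norm (y + z))\<^sup>2 > 0" by (simp_all add: add_pos_nonneg)
  ultimately have "C / (1 + (norm (y + z))\<^sup>2) \<le> 2 * C * (1 + (norm y)\<^sup>2) / (1 + (norm z)\<^sup>2)"
    by (simp add: divide_le_eq le_divide_eq mult_ac)
  then show "\<bar>gnomonic h (y + z)\<bar> \<le> 2 * C * (1 + (norm y)\<^sup>2) / (1 + (norm z)\<^sup>2)"
    using 1[of "y + z"] by linarith
qed

lemma unit_frame:
  assumes \<omega>: "norm (\<omega> :: real^2) = 1"
  shows "(norm (s *\<^sub>R \<omega> + \<tau> *\<^sub>R perp \<omega>))\<^sup>2 = s\<^sup>2 + \<tau>\<^sup>2" "y = (\<omega> \<bullet> y) *\<^sub>R \<omega> + (perp \<omega> \<bullet> y) *\<^sub>R perp \<omega>"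
proof -
  have w: "\<omega> $ 1 * \<omega> $ 1 + \<omega> $ 2 * \<omega> $ 2 = 1"
    using \<omega> by (simp add: norm_eq_1 inner_vec_def sum_2)
  have "(norm (s *\<^sub>R \<omega> + \<tau> *\<^sub>R perp \<omega>))\<^sup>2 = (s\<^sup>2 + \<tau>\<^sup>2) * (\<omega> $ 1 * \<omega> $ 1 + \<omega> $ 2 * \<omega> $ 2)"
    unfolding power2_norm_eq_inner by (simp add: inner_vec_def sum_2 power2_eq_square algebra_simps)
  then show "(norm (s *\<^sub>R \<omega> + \<tau> *\<^sub>R perp \<omega>))\<^sup>2 = s\<^sup>2 + \<tau>\<^sup>2" by (simp add: w)
  have 1: "((\<omega> \<bullet> y) *\<^sub>R \<omega> + (perp \<omega> \<bullet> y) *\<^sub>R perp \<omega>) $ 1 = (\<omega> $ 1 * \<omega> $ 1 + \<omega> $ 2 * \<omega> $ 2) * y $ 1"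
    by (simp add: inner_vec_def sum_2 algebra_simps)
  have 2: "((\<omega> \<bullet> y) *\<^sub>R \<omega> + (perp \<omega> \<bullet> y) *\<^sub>R perp \<omega>) $ 2 = (\<omega> $ 1 * \<omega> $ 1 + \<omega> $ 2 * \<omega> $ 2) * y $ 2"
    by (simp add: inner_vec_def sum_2 algebra_simps)
  show "y = (\<omega> \<bullet> y) *\<^sub>R \<omega> + (perp \<omega> \<bullet> y) *\<^sub>R perp \<omega>"
    unfolding vec_eq_iff forall_2 1 2 by (simp add: w)
qed

lemma gnomonic_line_integrable:
  assumes h: "continuous_on UNIV h" and \<omega>: "norm \<omega> = 1"
  shows "integrable lborel (\<lambda>\<tau>. gnomonic h (y + (u *\<^sub>R \<omega> + \<tau> *\<^sub>R perp \<omega>)))"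
proof -
  obtain C where C: "C > 0" "\<And>p. norm p \<le> 1 \<Longrightarrow> \<bar>h p\<bar> \<le> C" using continuous_bounded_cball[OF h] by blast
  have "continuous_on UNIV (\<lambda>\<tau>. gnomonic h (y + (u *\<^sub>R \<omega> + \<tau> *\<^sub>R perp \<omega>)))"
    by (rule continuous_on_compose2[OF gnomonic_continuous[OF h]]) (auto intro!: continuous_intros)
  then have m: "(\<lambda>\<tau>. gnomonic h (y + (u *\<^sub>R \<omega> + \<tau> *\<^sub>R perp \<omega>))) \<in> borel_measurable lborel"
    by (simp add: borel_measurable_continuous_onI)
  show ?thesis
  proof (rule Bochner_Integration.integrable_bound[OF _ m])
    show "integrable lborel (\<lambda>\<tau>. 2 * C * (1 + (norm y)\<^sup>2) * (1 / (1 + \<tau>\<^sup>2)))"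
      by (intro integrable_mult_right cauchy_density)
    show "AE \<tau> in lborel. norm (gnomonic h (y + (u *\<^sub>R \<omega> + \<tau> *\<^sub>R perp \<omega>))) \<le> norm (2 * C * (1 + (norm y)\<^sup>2) * (1 / (1 + \<tau>\<^sup>2)))"
    proof (rule AE_I2)
      fix \<tau> :: real
      have p: "0 < 1 + \<tau>\<^sup>2" by (simp add: add_pos_nonneg)
      have "\<bar>gnomonic h (y + (u *\<^sub>R \<omega> + \<tau> *\<^sub>R perp \<omega>))\<bar> \<le> 2 * C * (1 + (norm y)\<^sup>2) / (1 + (u\<^sup>2 + \<tau>\<^sup>2))"
        using gnomonic_bound(2)[of h C y "u *\<^sub>R \<omega> + \<tau> *\<^sub>R perp \<omega>"] C unit_frame(1)[OF \<omega>] by simp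
      also have "\<dots> \<le> 2 * C * (1 + (norm y)\<^sup>2) / (1 + \<tau>\<^sup>2)"
        using C(1) p by (intro divide_left_mono) (auto intro!: mult_pos_pos add_pos_nonneg)
      finally show "norm (gnomonic h (y + (u *\<^sub>R \<omega> + \<tau> *\<^sub>R perp \<omega>))) \<le> norm (2 * C * (1 + (norm y)\<^sup>2) * (1 / (1 + \<tau>\<^sup>2)))"
        unfolding real_norm_def times_divide_eq_right mult_1_right by (rule order_trans[OF _ abs_ge_self])
    qed
  qed
qed

text \<open>The upper half of the great circle projects onto the line
  \<open>s *\<^sub>R \<omega> + \<tau> *\<^sub>R perp \<omega>\<close> through the angle
  \<open>arctan (invsq s * \<tau>)\<close>. The lower half contributes the same by evenness, whence
  the factor 2. The weights in \<open>funk_G\<close> and \<open>gnomonic\<close> together are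
  precisely the Jacobian of this substitution.\<close>

lemma funk_G_line:
  assumes h: "continuous_on UNIV h" and even: "\<And>p. h (- p) = h p" and \<omega>: "norm \<omega> = 1"
  shows "funk_G h \<omega> s = 2 * (\<integral>\<tau>. gnomonic h (s *\<^sub>R \<omega> + \<tau> *\<^sub>R perp \<omega>) \<partial>lborel)"
proof -
  define q where "q = invsq s"
  have q: "q > 0" "q\<^sup>2 * (1 + s\<^sup>2) = 1" using invsq_pos invsq_mult by (auto simp: q_def)
  define F where "F = (\<lambda>\<phi>. h (circ_pt \<omega> s \<phi>))"
  have F: "continuous_on UNIV F"
    unfolding F_def using continuous_on_compose2[OF h continuous_on_circ_pt_angle] by simp
  have per: "F (z + pi) = F z" "F (z + 2 * pi) = F z" for z
    unfolding F_def circ_pt_periodic by (simp_all add: even)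
  obtain A where A: "\<And>x. (A has_real_derivative F x) (at x)"
    "\<And>\<delta>. (\<integral>\<phi>. F (\<phi> + \<delta>) \<partial>period_measure) = A (\<delta> + 2 * pi) - A \<delta>"
    "\<And>P x y. (\<And>z. F (z + P) = F z) \<Longrightarrow> A (x + P) - A x = A (y + P) - A y"
    using periodic_primitive[OF F] by metis
  \<comment> \<open>The period is made to start at \<open>- pi / 2\<close>, so that its first half
    is the range of \<open>arctan\<close>.\<close>
  have "(\<integral>\<phi>. F \<phi> \<partial>period_measure) = A (- pi / 2 + 2 * pi) - A (- pi / 2)"
    using A(2)[of 0] A(3)[of "2 * pi" 0 "- pi / 2"] per by simp
  also have "\<dots> = 2 * (A (pi / 2) - A (- (pi / 2)))"
    using A(3)[of pi "- pi / 2" "pi / 2"] per by (simp add: field_simps)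
  finally have I: "funk h \<omega> s = 2 * (A (pi / 2) - A (- (pi / 2)))" by (simp add: funk_def F_def)
  let ?z = "\<lambda>\<tau>. s *\<^sub>R \<omega> + \<tau> *\<^sub>R perp \<omega>"
  \<comment> \<open>Below, \<open>c\<close> is the secant of the angle, so cosine and sine are
    \<open>1 / c\<close> and \<open>q * \<tau> / c\<close>. The point of the circle is then
    \<open>q / c\<close> times the lift of \<open>?z \<tau>\<close>, and \<open>q / c\<close> is the
    normalising factor.\<close>
  have key: "F (arctan (q * \<tau>)) * (q / (1 + (q * \<tau>)\<^sup>2)) = gnomonic h (?z \<tau>) / q" for \<tau>
  proof -
    define c where "c = sqrt (1 + (q * \<tau>)\<^sup>2)"
    have c: "c > 0" "c\<^sup>2 = 1 + (q * \<tau>)\<^sup>2"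
      by (simp_all add: c_def add_pos_nonneg)
    have "q\<^sup>2 * (1 + (norm (?z \<tau>))\<^sup>2) = q\<^sup>2 * (1 + s\<^sup>2) + (q * \<tau>)\<^sup>2"
      by (simp add: unit_frame(1)[OF \<omega>] power_mult_distrib algebra_simps)
    then have e: "q\<^sup>2 * (1 + (norm (?z \<tau>))\<^sup>2) = c\<^sup>2" by (simp add: q(2) c(2))
    have z: "1 + (norm (?z \<tau>))\<^sup>2 > 0" by (simp add: add_pos_nonneg)
    have "(invsq (norm (?z \<tau>)))\<^sup>2 = 1 / (1 + (norm (?z \<tau>))\<^sup>2)" by (rule invsq_square)
    also have "\<dots> = q\<^sup>2 / (q\<^sup>2 * (1 + (norm (?z \<tau>))\<^sup>2))" using q(1) by simp
    also have "\<dots> = (q / c)\<^sup>2" unfolding e by (simp add: power_divide)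
    finally have i2: "(invsq (norm (?z \<tau>)))\<^sup>2 = (q / c)\<^sup>2" .
    then have i: "invsq (norm (?z \<tau>)) = q / c"
      by (rule power2_eq_imp_eq) (use invsq_pos[of "norm (?z \<tau>)"] q c in auto)
    have "circ_pt \<omega> s (arctan (q * \<tau>)) = (1 / c) *\<^sub>R circ_v \<omega> s + (q * \<tau> / c) *\<^sub>R circ_u \<omega>"
      by (simp add: circ_pt_def cos_arctan sin_arctan c_def)
    also have "\<dots> = (q / c) *\<^sub>R lift_plane (?z \<tau>)"
      using q(1) by (simp add: vec_eq_iff forall_3 circ_components q_def[symmetric] algebra_simps add_divide_distrib diff_divide_distrib)
    finally have "F (arctan (q * \<tau>)) = h (invsq (norm (?z \<tau>)) *\<^sub>R lift_plane (?z \<tau>))" by (simp add: F_def i)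
    moreover have "q / (1 + (q * \<tau>)\<^sup>2) = (q / c)\<^sup>2 / q" unfolding c(2)[symmetric] using q(1) by (simp add: power_divide power2_eq_square)
    ultimately show ?thesis by (simp add: gnomonic_def i2)
  qed
  have "(\<integral>\<tau>. gnomonic h (?z \<tau>) / q \<partial>lborel) = A (pi / 2) - A (- (pi / 2))"
  proof (rule integral_FTC_real_line)
    fix \<tau>
    have "((\<lambda>\<tau>. arctan (q * \<tau>)) has_real_derivative q / (1 + (q * \<tau>)\<^sup>2)) (at \<tau>)"
      by (auto intro!: derivative_eq_intros simp: divide_inverse)
    from DERIV_chain2[OF A(1) this]
    show "((\<lambda>\<tau>. A (arctan (q * \<tau>))) has_real_derivative gnomonic h (?z \<tau>) / q) (at \<tau>)" by (simp only: key)
    have "continuous_on UNIV (\<lambda>\<tau>. gnomonic h (?z \<tau>) / q)"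
      using q(1) by (intro continuous_on_divide continuous_on_compose2[OF gnomonic_continuous[OF h]] continuous_intros) auto
    then show "isCont (\<lambda>\<tau>. gnomonic h (?z \<tau>) / q) \<tau>" by (simp add: continuous_on_eq_continuous_at)
    show "integrable lborel (\<lambda>\<tau>. gnomonic h (?z \<tau>) / q)"
      using gnomonic_line_integrable[OF h \<omega>, of 0 s] by simp
    have cA: "isCont A x" for x using A(1) by (rule DERIV_isCont)
    have "filterlim (\<lambda>\<tau>. q * \<tau>) at_top at_top"
      by (rule filterlim_tendsto_pos_mult_at_top[OF tendsto_const q(1) filterlim_ident])
    then have "((\<lambda>\<tau>. arctan (q * \<tau>)) \<longlongrightarrow> pi / 2) at_top" by (rule filterlim_compose[OF tendsto_arctan_at_top])
    then show "((\<lambda>\<tau>. A (arctan (q * \<tau>))) \<longlongrightarrow> A (pi / 2)) at_top" by (rule isCont_tendsto_compose[OF cA])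
    have "filterlim (\<lambda>\<tau>. q * \<tau>) at_bot at_bot"
      by (rule filterlim_tendsto_pos_mult_at_bot[OF tendsto_const q(1) filterlim_ident])
    then have "((\<lambda>\<tau>. arctan (q * \<tau>)) \<longlongrightarrow> - (pi / 2)) at_bot" by (rule filterlim_compose[OF tendsto_arctan_at_bot])
    then show "((\<lambda>\<tau>. A (arctan (q * \<tau>))) \<longlongrightarrow> A (- (pi / 2))) at_bot" by (rule isCont_tendsto_compose[OF cA])
  qed
  then show ?thesis using q(1) by (simp add: funk_G_def I q_def[symmetric] field_simps)
qed

section \<open>Averages over directions\<close>

lemma measurable_period_lborel:
  fixes F :: "real \<Rightarrow> real \<Rightarrow> real"
  assumes "continuous_on UNIV (\<lambda>(\<psi>, u). F \<psi> u)"
  shows "(\<lambda>(\<psi>, u). F \<psi> u) \<in> borel_measurable (period_measure \<Otimes>\<^sub>M lborel)"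
proof -
  have f: "fst \<in> borel_measurable (period_measure \<Otimes>\<^sub>M lborel)"
    using measurable_compose[OF measurable_fst measurable_period_measure[of "\<lambda>x. x"]] by simp
  have s: "snd \<in> borel_measurable (period_measure \<Otimes>\<^sub>M lborel)"
    using measurable_snd[of period_measure lborel] by (simp cong: measurable_cong_sets)
  have "(\<lambda>x. (fst x, snd x)) \<in> borel_measurable (period_measure \<Otimes>\<^sub>M lborel)"
    using f s by (rule borel_measurable_Pair)
  from measurable_compose[OF this borel_measurable_continuous_onI[OF assms]] show ?thesis by simp
qed

interpretation period_lborel: pair_sigma_finite period_measure "lborel :: real measure"
  by standard

lemma period_lborel_Fubini:
  fixes F :: "real \<Rightarrow> real \<Rightarrow> real"
  assumes F: "(\<lambda>(\<psi>, u). F \<psi> u) \<in> borel_measurable (period_measure \<Otimes>\<^sub>M lborel)" and b: "\<And>\<psi> u. \<bar>F \<psi> u\<bar> \<le> w u" and w: "integrable lborel w"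
  shows "(\<integral>\<psi>. (\<integral>u. F \<psi> u \<partial>lborel) \<partial>period_measure) = (\<integral>u. (\<integral>\<psi>. F \<psi> u \<partial>period_measure) \<partial>lborel)"
    and "integrable period_measure (\<lambda>\<psi>. \<integral>u. F \<psi> u \<partial>lborel)"
proof -
  have Fm: "F \<psi> \<in> borel_measurable lborel" if "\<psi> \<in> {0..<2 * pi}" for \<psi>
    using measurable_compose[OF measurable_Pair1' F] that by simp
  have i: "integrable lborel (F \<psi>)" if "\<psi> \<in> {0..<2 * pi}" for \<psi>
    by (rule Bochner_Integration.integrable_bound[OF w Fm[OF that]])
      (use b in \<open>auto intro: order_trans[OF _ abs_ge_self]\<close>)
  have int: "integrable (period_measure \<Otimes>\<^sub>M lborel) (\<lambda>(\<psi>, u). F \<psi> u)"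
  proof (rule period_lborel.Fubini_integrable[OF F])
    show "AE \<psi> in period_measure. integrable lborel (\<lambda>u. case (\<psi>, u) of (\<psi>, u) \<Rightarrow> F \<psi> u)"
      by (rule AE_I2) (use i in simp)
    show "integrable period_measure (\<lambda>\<psi>. \<integral>u. norm (case (\<psi>, u) of (\<psi>, u) \<Rightarrow> F \<psi> u) \<partial>lborel)"
    proof (rule period_measure.integrable_const_bound[where B = "\<integral>u. w u \<partial>lborel"])
      show "AE \<psi> in period_measure. norm (\<integral>u. norm (case (\<psi>, u) of (\<psi>, u) \<Rightarrow> F \<psi> u) \<partial>lborel) \<le> (\<integral>u. w u \<partial>lborel)"
      proof (rule AE_I2)
        fix \<psi> assume \<psi>: "\<psi> \<in> space period_measure"
        have "(\<integral>u. \<bar>F \<psi> u\<bar> \<partial>lborel) \<le> (\<integral>u. w u \<partial>lborel)"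
          by (rule integral_mono) (use i[of \<psi>] \<psi> b w in auto)
        then show "norm (\<integral>u. norm (case (\<psi>, u) of (\<psi>, u) \<Rightarrow> F \<psi> u) \<partial>lborel) \<le> (\<integral>u. w u \<partial>lborel)" by simp
      qed
      show "(\<lambda>\<psi>. \<integral>u. norm (case (\<psi>, u) of (\<psi>, u) \<Rightarrow> F \<psi> u) \<partial>lborel) \<in> borel_measurable period_measure"
        using F by (intro lborel.borel_measurable_lebesgue_integral) simp
    qed
  qed
  show "(\<integral>\<psi>. (\<integral>u. F \<psi> u \<partial>lborel) \<partial>period_measure) = (\<integral>u. (\<integral>\<psi>. F \<psi> u \<partial>period_measure) \<partial>lborel)"
    using period_lborel.Fubini_integral[OF int] by simp
  show "integrable period_measure (\<lambda>\<psi>. \<integral>u. F \<psi> u \<partial>lborel)"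
    using period_lborel.integrable_fst[OF int] by simp
qed

text \<open>The radial profile about \<open>y\<close> to which the Abel integrals are applied. It is
  left unnormalised, so at radius 0 it carries a factor \<open>2 * pi\<close>.\<close>

definition gnomonic_average :: "(real^3 \<Rightarrow> real) \<Rightarrow> real^2 \<Rightarrow> real \<Rightarrow> real" where
  "gnomonic_average h y \<rho> = (\<integral>\<psi>. gnomonic h (y + \<rho> *\<^sub>R circle_dir \<psi>) \<partial>period_measure)"

lemma gnomonic_average_continuous:
  assumes h: "continuous_on UNIV h"
  shows "continuous_on UNIV (gnomonic_average h y)"
  unfolding gnomonic_average_def[abs_def]
proof (rule period_integral_continuous)
  have "continuous_on UNIV (\<lambda>p. gnomonic h (y + fst p *\<^sub>R circle_dir (snd p)))"
    by (rule continuous_on_compose2[OF gnomonic_continuous[OF h]]) (auto intro!: continuous_intros)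
  then show "continuous_on UNIV (\<lambda>(\<rho>, \<psi>). gnomonic h (y + \<rho> *\<^sub>R circle_dir \<psi>))" by (simp add: split_beta')
qed

lemma gnomonic_average_bound:
  assumes h: "continuous_on UNIV h" and C: "\<And>p. norm p = 1 \<Longrightarrow> \<bar>h p\<bar> \<le> C"
  shows "\<bar>gnomonic_average h y \<rho>\<bar> \<le> (2 * pi * (2 * C * (1 + (norm y)\<^sup>2))) / (1 + \<rho>\<^sup>2)"
proof -
  have "\<bar>gnomonic_average h y \<rho>\<bar> \<le> 2 * pi * (2 * C * (1 + (norm y)\<^sup>2) / (1 + \<rho>\<^sup>2))"
    unfolding gnomonic_average_def
  proof (rule period_integral_bound)
    show "continuous_on UNIV (\<lambda>\<psi>. gnomonic h (y + \<rho> *\<^sub>R circle_dir \<psi>))"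
      by (rule continuous_on_compose2[OF gnomonic_continuous[OF h]]) (auto intro!: continuous_intros)
    show "\<bar>gnomonic h (y + \<rho> *\<^sub>R circle_dir \<psi>)\<bar> \<le> 2 * C * (1 + (norm y)\<^sup>2) / (1 + \<rho>\<^sup>2)" for \<psi>
      using gnomonic_bound(2)[where h = h and C = C and y = y and z = "\<rho> *\<^sub>R circle_dir \<psi>", OF C] by simp
  qed
  then show ?thesis by simp
qed

text \<open>The angle \<open>\<delta>\<close> depends only on the coordinates \<open>u\<close>,
  \<open>\<tau>\<close> in the moving frame and not on \<open>\<theta>\<close>. Averaging over the
  frame therefore moves such a point once around a circle.\<close>

lemma rotate_circle_dir:
  obtains \<delta> where "\<And>\<theta>. u *\<^sub>R circle_dir \<theta> + \<tau> *\<^sub>R perp (circle_dir \<theta>) = sqrt (u\<^sup>2 + \<tau>\<^sup>2) *\<^sub>R circle_dir (\<theta> + \<delta>)"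
proof (cases "u\<^sup>2 + \<tau>\<^sup>2 = 0")
  case True
  then have "u = 0" "\<tau> = 0" by (simp_all add: sum_power2_eq_zero_iff)
  then show ?thesis using that[of 0] by simp
next
  case False
  define \<rho> where "\<rho> = sqrt (u\<^sup>2 + \<tau>\<^sup>2)"
  have \<rho>: "\<rho> > 0" "\<rho>\<^sup>2 = u\<^sup>2 + \<tau>\<^sup>2" using False by (simp_all add: \<rho>_def order_less_le)
  have "(u / \<rho>)\<^sup>2 + (\<tau> / \<rho>)\<^sup>2 = 1"
    using \<rho> False by (simp add: power_divide add_divide_distrib[symmetric])
  then obtain \<delta> where "u / \<rho> = cos \<delta>" "\<tau> / \<rho> = sin \<delta>" using sincos_total_2pi by metis
  then have "u = \<rho> * cos \<delta>" "\<tau> = \<rho> * sin \<delta>" using \<rho>(1) by (simp_all add: field_simps)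
  then have "u *\<^sub>R circle_dir \<theta> + \<tau> *\<^sub>R perp (circle_dir \<theta>) = \<rho> *\<^sub>R circle_dir (\<theta> + \<delta>)" for \<theta>
    by (simp add: vec_eq_iff forall_2 cos_add sin_add algebra_simps)
  then show ?thesis unfolding \<rho>_def by (rule that)
qed

lemma continuous_on_perp [continuous_intros]:
  "continuous_on S f \<Longrightarrow> continuous_on S (\<lambda>x. perp (f x))"
  unfolding perp_def
  by (intro continuous_on_add continuous_on_scaleR continuous_on_const continuous_on_minus continuous_on_component)

text \<open>When the direction turns, the point at offset \<open>\<tau>\<close> on the line at
  distance \<open>u\<close> from \<open>y\<close> sweeps the circle of radius
  \<open>sqrt (u\<^sup>2 + \<tau>\<^sup>2)\<close> about \<open>y\<close>. So the average of line
  integrals is an Abel integral of the profile. The shift \<open>\<delta>0\<close> is later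
  \<open>pi\<close>, for the opposite direction.\<close>

lemma funk_G_average:
  assumes h: "continuous_on UNIV h" and even: "\<And>p. h (- p) = h p"
  shows "(\<integral>\<psi>. funk_G h (circle_dir (\<psi> + \<delta>0)) (circle_dir (\<psi> + \<delta>0) \<bullet> y + u) \<partial>period_measure) =
    2 * (\<integral>\<tau>. gnomonic_average h y (sqrt (u\<^sup>2 + \<tau>\<^sup>2)) \<partial>lborel)"
proof -
  obtain C where C: "C > 0" "\<And>p. norm p \<le> 1 \<Longrightarrow> \<bar>h p\<bar> \<le> C" using continuous_bounded_cball[OF h] by blast
  let ?\<omega> = "\<lambda>\<psi>. circle_dir (\<psi> + \<delta>0)"
  let ?K = "\<lambda>\<psi> \<tau>. gnomonic h (y + (u *\<^sub>R ?\<omega> \<psi> + \<tau> *\<^sub>R perp (?\<omega> \<psi>)))"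
  have line: "funk_G h (?\<omega> \<psi>) (?\<omega> \<psi> \<bullet> y + u) = 2 * (\<integral>\<tau>. ?K \<psi> \<tau> \<partial>lborel)" for \<psi>
  proof -
    let ?w = "?\<omega> \<psi>"
    have e: "(?w \<bullet> y + u) *\<^sub>R ?w + (perp ?w \<bullet> y + 1 * \<tau>) *\<^sub>R perp ?w = y + (u *\<^sub>R ?w + \<tau> *\<^sub>R perp ?w)" for \<tau>
    proof -
      have "(?w \<bullet> y + u) *\<^sub>R ?w + (perp ?w \<bullet> y + 1 * \<tau>) *\<^sub>R perp ?w =
        ((?w \<bullet> y) *\<^sub>R ?w + (perp ?w \<bullet> y) *\<^sub>R perp ?w) + (u *\<^sub>R ?w + \<tau> *\<^sub>R perp ?w)"
        by (simp add: algebra_simps)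
      then show ?thesis unfolding unit_frame(2)[OF norm_circle_dir, symmetric] .
    qed
    \<comment> \<open>Translating \<open>\<tau>\<close> makes the line start at
      \<open>y + u *\<^sub>R ?w\<close>, the foot of the perpendicular from
      \<open>y\<close>.\<close>
    have "(\<integral>\<tau>. gnomonic h ((?w \<bullet> y + u) *\<^sub>R ?w + \<tau> *\<^sub>R perp ?w) \<partial>lborel) =
      \<bar>1\<bar> *\<^sub>R (\<integral>\<tau>. gnomonic h ((?w \<bullet> y + u) *\<^sub>R ?w + (perp ?w \<bullet> y + 1 * \<tau>) *\<^sub>R perp ?w) \<partial>lborel)"
      by (rule lborel_integral_real_affine) simp
    then show ?thesis unfolding e using funk_G_line[OF h even norm_circle_dir] by simp
  qed
  have m: "(\<lambda>(\<psi>, \<tau>). ?K \<psi> \<tau>) \<in> borel_measurable (period_measure \<Otimes>\<^sub>M lborel)"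
  proof (rule measurable_period_lborel)
    have "continuous_on UNIV (\<lambda>p. ?K (fst p) (snd p))"
      by (rule continuous_on_compose2[OF gnomonic_continuous[OF h]]) (auto intro!: continuous_intros)
    then show "continuous_on UNIV (\<lambda>(\<psi>, \<tau>). ?K \<psi> \<tau>)" by (simp add: split_beta')
  qed
  have b: "\<bar>?K \<psi> \<tau>\<bar> \<le> 2 * C * (1 + (norm y)\<^sup>2) * (1 / (1 + \<tau>\<^sup>2))" for \<psi> \<tau>
  proof -
    have p: "0 < 1 + \<tau>\<^sup>2" by (simp add: add_pos_nonneg)
    have "\<bar>?K \<psi> \<tau>\<bar> \<le> 2 * C * (1 + (norm y)\<^sup>2) / (1 + (u\<^sup>2 + \<tau>\<^sup>2))"
      using gnomonic_bound(2)[of h C y "u *\<^sub>R ?\<omega> \<psi> + \<tau> *\<^sub>R perp (?\<omega> \<psi>)"] C unit_frame(1)[OF norm_circle_dir] by simp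
    also have "\<dots> \<le> 2 * C * (1 + (norm y)\<^sup>2) / (1 + \<tau>\<^sup>2)"
      using C(1) p by (intro divide_left_mono) (auto intro!: mult_pos_pos add_pos_nonneg)
    finally show ?thesis by simp
  qed
  have w: "integrable lborel (\<lambda>\<tau>. 2 * C * (1 + (norm y)\<^sup>2) * (1 / (1 + \<tau>\<^sup>2)))"
    by (intro integrable_mult_right cauchy_density)
  have avg: "(\<integral>\<psi>. ?K \<psi> \<tau> \<partial>period_measure) = gnomonic_average h y (sqrt (u\<^sup>2 + \<tau>\<^sup>2))" for \<tau>
  proof -
    obtain \<delta> where \<delta>: "\<And>\<theta>. u *\<^sub>R circle_dir \<theta> + \<tau> *\<^sub>R perp (circle_dir \<theta>) = sqrt (u\<^sup>2 + \<tau>\<^sup>2) *\<^sub>R circle_dir (\<theta> + \<delta>)"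
      using rotate_circle_dir[of u \<tau>] by blast
    let ?F = "\<lambda>\<psi>. gnomonic h (y + sqrt (u\<^sup>2 + \<tau>\<^sup>2) *\<^sub>R circle_dir \<psi>)"
    have "continuous_on UNIV ?F"
      by (rule continuous_on_compose2[OF gnomonic_continuous[OF h]]) (auto intro!: continuous_intros)
    moreover have "?F (z + 2 * pi) = ?F z" for z by (simp only: circle_dir_periodic)
    ultimately have "(\<integral>\<psi>. ?F (\<psi> + (\<delta>0 + \<delta>)) \<partial>period_measure) = (\<integral>\<psi>. ?F \<psi> \<partial>period_measure)"
      by (rule period_integral_shift(1))
    then show ?thesis by (simp add: \<delta> gnomonic_average_def add.assoc)
  qed
  have "(\<integral>\<psi>. funk_G h (?\<omega> \<psi>) (?\<omega> \<psi> \<bullet> y + u) \<partial>period_measure) = 2 * (\<integral>\<psi>. (\<integral>\<tau>. ?K \<psi> \<tau> \<partial>lborel) \<partial>period_measure)"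
    unfolding line by (rule Bochner_Integration.integral_mult_right_zero)
  also have "(\<integral>\<psi>. (\<integral>\<tau>. ?K \<psi> \<tau> \<partial>lborel) \<partial>period_measure) = (\<integral>\<tau>. (\<integral>\<psi>. ?K \<psi> \<tau> \<partial>period_measure) \<partial>lborel)"
    by (rule period_lborel_Fubini(1)[OF m b w])
  finally show ?thesis unfolding avg .
qed

section \<open>Inversion of the great circle transform\<close>

text \<open>The principal value folded at its pole. As an ordinary integral with the pole moved to
  0, it is visibly measurable as a function of the direction.\<close>

definition funk_pv :: "(real^3 \<Rightarrow> real) \<Rightarrow> real^2 \<Rightarrow> real^2 \<Rightarrow> real" where
  "funk_pv h y \<omega> = (LINT u:{0<..}|lborel. (funk_G' h \<omega> (\<omega> \<bullet> y - u) - funk_G' h \<omega> (\<omega> \<bullet> y + u)) / u)"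

lemma funk_G'_measurable:
  assumes "C_k 2 h"
  shows "funk_G' h \<omega> \<in> borel_measurable borel"
proof (rule borel_measurable_continuous_onI)
  show "continuous_on UNIV (funk_G' h \<omega>)"
    using continuous_on_compose2[OF funk_G'_continuous[OF assms], of UNIV "\<lambda>s. (\<omega>, s)"]
    by (simp add: continuous_on_Pair)
qed

lemma funk_pv_has_pv:
  assumes h: "C_k 2 h" and \<omega>: "norm \<omega> = 1"
  shows "has_pv_integral (\<lambda>s. c * (funk_G' h \<omega> s / (\<omega> \<bullet> y - s))) (\<omega> \<bullet> y) (c * funk_pv h y \<omega>)"
proof -
  obtain C where C: "\<And>s. \<bar>funk_G' h \<omega> s\<bar> \<le> C / (1 + s\<^sup>2)"
    "\<And>s s'. \<bar>funk_G' h \<omega> s - funk_G' h \<omega> s'\<bar> \<le> C * \<bar>s - s'\<bar>"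
    using funk_G_bounds[OF h] \<omega> by metis
  show ?thesis
    unfolding funk_pv_def by (rule pv_integral_symmetric(1)[OF funk_G'_measurable[OF h] C])
qed

lemma funk_pv_measurable:
  assumes h: "C_k 2 h"
  shows "funk_pv h y \<in> borel_measurable borel"
proof -
  have c: "continuous_on UNIV (\<lambda>p. funk_G' h (fst p) (fst p \<bullet> y - snd p))"
    "continuous_on UNIV (\<lambda>p. funk_G' h (fst p) (fst p \<bullet> y + snd p))"
    using continuous_on_compose2[OF funk_G'_continuous[OF h], of UNIV "\<lambda>p. (fst p, fst p \<bullet> y - snd p)"]
      continuous_on_compose2[OF funk_G'_continuous[OF h], of UNIV "\<lambda>p. (fst p, fst p \<bullet> y + snd p)"]
    by (simp_all add: continuous_intros)
  have [measurable]: "(\<lambda>p. funk_G' h (fst p) (fst p \<bullet> y - snd p)) \<in> borel_measurable (borel \<Otimes>\<^sub>M lborel)"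
    "(\<lambda>p. funk_G' h (fst p) (fst p \<bullet> y + snd p)) \<in> borel_measurable (borel \<Otimes>\<^sub>M lborel)"
    using c[THEN borel_measurable_continuous_onI] by (simp_all add: borel_prod[symmetric] cong: measurable_cong_sets)
  have "(\<lambda>p. indicat_real {0<..} (snd p) *\<^sub>R ((funk_G' h (fst p) (fst p \<bullet> y - snd p) - funk_G' h (fst p) (fst p \<bullet> y + snd p)) / snd p))
    \<in> borel_measurable (borel \<Otimes>\<^sub>M lborel)"
    by measurable
  then show ?thesis
    unfolding funk_pv_def[abs_def] set_lebesgue_integral_def
    by (intro lborel.borel_measurable_lebesgue_integral) (simp add: split_beta')
qed

text \<open>The value, after integration by parts, of the part of the truncated principal value integral on one side of the
  singularity; the other side is the value for the opposite direction.\<close>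

definition funk_half :: "(real^3 \<Rightarrow> real) \<Rightarrow> real^2 \<Rightarrow> real \<Rightarrow> real^2 \<Rightarrow> real" where
  "funk_half h y \<epsilon> \<omega> =
    funk_G h \<omega> (\<omega> \<bullet> y + \<epsilon>) / \<epsilon> - (LINT u:{\<epsilon><..}|lborel. funk_G h \<omega> (\<omega> \<bullet> y + u) / u\<^sup>2)"

text \<open>Integration by parts on each side of the pole separately, which the truncation permits.
  The left side is rewritten by \<open>funk_G_uminus\<close> as a right side for
  \<open>- \<omega>\<close>.\<close>

lemma funk_pv_truncated:
  assumes h: "C_k 2 h" and \<omega>: "norm \<omega> = 1" and \<epsilon>: "\<epsilon> > 0"
  shows "(LINT u:{\<epsilon><..}|lborel. (funk_G' h \<omega> (\<omega> \<bullet> y - u) - funk_G' h \<omega> (\<omega> \<bullet> y + u)) / u) =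
    funk_half h y \<epsilon> \<omega> + funk_half h y \<epsilon> (- \<omega>)"
proof -
  obtain C where C0: "\<And>s. \<bar>funk_G h \<omega> s\<bar> \<le> C" and C: "\<And>s. \<bar>funk_G' h \<omega> s\<bar> \<le> C / (1 + s\<^sup>2)"
    "\<And>s s'. \<bar>funk_G' h \<omega> s - funk_G' h \<omega> s'\<bar> \<le> C * \<bar>s - s'\<bar>"
    using funk_G_bounds[OF h] \<omega> by metis
  let ?a = "\<omega> \<bullet> y"
  note i = pv_integral_symmetric(4,5)[OF funk_G'_measurable[OF h] C \<epsilon>, of ?a]
  have i': "set_integrable lborel {\<epsilon><..} (\<lambda>u. - funk_G' h \<omega> (?a - u) / u)"
    using set_integrable_mult_right[of "- 1" lborel "{\<epsilon><..}", OF i(2)] by simp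
  have cont: "isCont (funk_G' h \<omega>) s" for s
    using continuous_on_compose2[OF funk_G'_continuous[OF h], of UNIV "\<lambda>s. (\<omega>, s)"]
    by (simp add: continuous_on_Pair continuous_on_eq_continuous_at)
  note d = funk_G_has_derivative[OF h \<omega>]
  have d1: "((\<lambda>u. funk_G h \<omega> (?a + u)) has_real_derivative funk_G' h \<omega> (?a + u)) (at u)" for u
  proof -
    have "((\<lambda>u. ?a + u) has_real_derivative 1) (at u)" by (auto intro!: derivative_eq_intros)
    from DERIV_chain2[OF d this] show ?thesis by simp
  qed
  have d2: "((\<lambda>u. funk_G h \<omega> (?a - u)) has_real_derivative - funk_G' h \<omega> (?a - u)) (at u)" for u
  proof -
    have "((\<lambda>u. ?a - u) has_real_derivative - 1) (at u)" by (auto intro!: derivative_eq_intros)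
    from DERIV_chain2[OF d this] show ?thesis by simp
  qed
  have c1: "isCont (\<lambda>u. funk_G' h \<omega> (?a + u)) u" for u
    by (rule isCont_o2[OF _ cont]) simp
  have c2: "isCont (\<lambda>u. - funk_G' h \<omega> (?a - u)) u" for u
    by (intro isCont_minus isCont_o2[OF _ cont]) simp
  have 1: "(LINT u:{\<epsilon><..}|lborel. - funk_G' h \<omega> (?a + u) / u) = funk_half h y \<epsilon> \<omega>"
    unfolding funk_half_def by (rule integral_divided_derivative[OF d1 c1 C0 i(1) \<epsilon>])
  have e: "funk_G h (- \<omega>) (- \<omega> \<bullet> y + u) = funk_G h \<omega> (?a - u)" for u
    using funk_G_uminus[OF C_k_continuous[OF h], of \<omega> "?a - u"] by simp
  have 2: "(LINT u:{\<epsilon><..}|lborel. - (- funk_G' h \<omega> (?a - u)) / u) = funk_half h y \<epsilon> (- \<omega>)"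
    unfolding funk_half_def e by (rule integral_divided_derivative[OF d2 c2 C0 i' \<epsilon>])
  have "(LINT u:{\<epsilon><..}|lborel. funk_G' h \<omega> (?a - u) / u - funk_G' h \<omega> (?a + u) / u) =
    (LINT u:{\<epsilon><..}|lborel. funk_G' h \<omega> (?a - u) / u) - (LINT u:{\<epsilon><..}|lborel. funk_G' h \<omega> (?a + u) / u)"
    by (rule set_integral_diff(2)[OF i(2) i(1)])
  moreover have "(LINT u:{\<epsilon><..}|lborel. - funk_G' h \<omega> (?a + u) / u) = - (LINT u:{\<epsilon><..}|lborel. funk_G' h \<omega> (?a + u) / u)"
    using set_integral_uminus[OF i(1)] by simp
  ultimately show ?thesis using 1 2 by (simp add: diff_divide_distrib)
qed

text \<open>The cut-off supplies the majorant \<open>C / u\<^sup>2\<close> and thus the exchange of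
  averaging and integration. Both terms of \<open>funk_half\<close> then become Abel integrals of
  the same profile, and \<open>abel_tail_identity\<close> combines them into one expression that
  converges as \<open>\<epsilon>\<close> tends to 0.\<close>

lemma funk_half_average:
  assumes h: "C_k 2 h" and even: "\<And>p. h (- p) = h p" and \<epsilon>: "\<epsilon> > 0"
  shows "integrable period_measure (\<lambda>\<psi>. funk_half h y \<epsilon> (circle_dir (\<psi> + \<delta>)))"
    and "(\<integral>\<psi>. funk_half h y \<epsilon> (circle_dir (\<psi> + \<delta>)) \<partial>period_measure) =
      2 * (\<integral>\<sigma>. gnomonic_average h y (\<epsilon> * sqrt (1 + \<sigma>\<^sup>2)) / (1 + \<sigma>\<^sup>2) \<partial>lborel)"
proof -
  note hc = C_k_continuous[OF h]
  obtain C where C: "C > 0" "\<And>\<omega> s. norm \<omega> = 1 \<Longrightarrow> \<bar>funk_G h \<omega> s\<bar> \<le> C"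
    using funk_G_bounds[OF h] by metis
  obtain A where A: "A > 0" "\<And>p. norm p \<le> 1 \<Longrightarrow> \<bar>h p\<bar> \<le> A" using continuous_bounded_cball[OF hc] by blast
  then have A': "\<And>p. norm p = 1 \<Longrightarrow> \<bar>h p\<bar> \<le> A" by simp
  let ?\<omega> = "\<lambda>\<psi>. circle_dir (\<psi> + \<delta>)"
  let ?\<Gamma> = "\<lambda>\<psi> u. funk_G h (?\<omega> \<psi>) (?\<omega> \<psi> \<bullet> y + u)"
  let ?R = "\<lambda>u. \<integral>\<tau>. gnomonic_average h y (sqrt (u\<^sup>2 + \<tau>\<^sup>2)) \<partial>lborel"
  define F where "F = (\<lambda>\<psi> u. indicat_real {\<epsilon><..} u * (?\<Gamma> \<psi> u / u\<^sup>2))"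
  have \<Gamma>c: "continuous_on UNIV (\<lambda>p. ?\<Gamma> (fst p) (snd p))"
    using continuous_on_compose2[OF funk_G_continuous[OF hc], of UNIV "\<lambda>p. (?\<omega> (fst p), ?\<omega> (fst p) \<bullet> y + snd p)"]
    by (simp add: continuous_intros)
  have \<Gamma>m: "(\<lambda>p. ?\<Gamma> (fst p) (snd p)) \<in> borel_measurable (period_measure \<Otimes>\<^sub>M lborel)"
    using measurable_period_lborel[of ?\<Gamma>] \<Gamma>c by (simp add: split_beta')
  have s: "snd \<in> borel_measurable (period_measure \<Otimes>\<^sub>M lborel)"
    using measurable_snd[of period_measure lborel] by (simp cong: measurable_cong_sets)
  have "(\<lambda>p. indicat_real {\<epsilon><..} (snd p) * (?\<Gamma> (fst p) (snd p) / (snd p)\<^sup>2)) \<in> borel_measurable (period_measure \<Otimes>\<^sub>M lborel)"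
    by (intro borel_measurable_times borel_measurable_divide \<Gamma>m borel_measurable_power s
        measurable_compose[OF s borel_measurable_indicator]) simp
  then have Fm: "(\<lambda>(\<psi>, u). F \<psi> u) \<in> borel_measurable (period_measure \<Otimes>\<^sub>M lborel)"
    by (simp add: F_def split_beta')
  have Fb: "\<bar>F \<psi> u\<bar> \<le> indicat_real {\<epsilon><..} u *\<^sub>R (C * (1 / u\<^sup>2))" for \<psi> u
    using C by (auto simp: F_def indicator_def abs_divide divide_right_mono)
  have "set_integrable lborel {\<epsilon><..} (\<lambda>u. C * (1 / u\<^sup>2))"
    using inverse_square_tail(1)[OF \<epsilon>] by (intro set_integrable_mult_right) auto
  then have w: "integrable lborel (\<lambda>u. indicat_real {\<epsilon><..} u *\<^sub>R (C * (1 / u\<^sup>2)))"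
    by (simp only: set_integrable_def)
  note Fub = period_lborel_Fubini[OF Fm Fb w]
  have Feq: "(\<integral>u. F \<psi> u \<partial>lborel) = (LINT u:{\<epsilon><..}|lborel. ?\<Gamma> \<psi> u / u\<^sup>2)" for \<psi>
    by (simp add: F_def set_lebesgue_integral_def)
  have half: "funk_half h y \<epsilon> (?\<omega> \<psi>) = ?\<Gamma> \<psi> \<epsilon> / \<epsilon> - (\<integral>u. F \<psi> u \<partial>lborel)" for \<psi>
    by (simp add: funk_half_def Feq)
  have "continuous_on UNIV (\<lambda>\<psi>. ?\<Gamma> \<psi> \<epsilon>)"
    using continuous_on_compose2[OF \<Gamma>c, of UNIV "\<lambda>\<psi>. (\<psi>, \<epsilon>)"] by (simp add: continuous_on_Pair)
  then have i1: "integrable period_measure (\<lambda>\<psi>. ?\<Gamma> \<psi> \<epsilon> / \<epsilon>)"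
    by (intro integrable_divide_zero period_measure_integrable)
  show "integrable period_measure (\<lambda>\<psi>. funk_half h y \<epsilon> (?\<omega> \<psi>))"
    unfolding half by (rule Bochner_Integration.integrable_diff[OF i1 Fub(2)])
  have avg: "(\<integral>\<psi>. ?\<Gamma> \<psi> u \<partial>period_measure) = 2 * ?R u" for u
    by (rule funk_G_average[OF hc even])
  have "(\<integral>\<psi>. F \<psi> u \<partial>period_measure) = 2 * (indicat_real {\<epsilon><..} u *\<^sub>R (?R u / u\<^sup>2))" for u
    by (simp add: F_def avg)
  then have "(\<integral>\<psi>. (\<integral>u. F \<psi> u \<partial>lborel) \<partial>period_measure) = 2 * (LINT u:{\<epsilon><..}|lborel. ?R u / u\<^sup>2)"
    by (simp only: Fub(1) set_lebesgue_integral_def Bochner_Integration.integral_mult_right_zero)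
  then have "(\<integral>\<psi>. funk_half h y \<epsilon> (?\<omega> \<psi>) \<partial>period_measure) = 2 * (?R \<epsilon> / \<epsilon> - (LINT u:{\<epsilon><..}|lborel. ?R u / u\<^sup>2))"
    unfolding half Bochner_Integration.integral_diff[OF i1 Fub(2)] by (simp add: avg)
  also have "?R \<epsilon> / \<epsilon> - (LINT u:{\<epsilon><..}|lborel. ?R u / u\<^sup>2) =
    (\<integral>\<sigma>. gnomonic_average h y (\<epsilon> * sqrt (1 + \<sigma>\<^sup>2)) / (1 + \<sigma>\<^sup>2) \<partial>lborel)"
    by (rule abel_tail_identity[OF gnomonic_average_continuous[OF hc] gnomonic_average_bound[OF hc A'] \<epsilon>])
  finally show "(\<integral>\<psi>. funk_half h y \<epsilon> (?\<omega> \<psi>) \<partial>period_measure) =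
      2 * (\<integral>\<sigma>. gnomonic_average h y (\<epsilon> * sqrt (1 + \<sigma>\<^sup>2)) / (1 + \<sigma>\<^sup>2) \<partial>lborel)" .
qed

text \<open>For every cut-off the average of the truncated principal value is
  \<open>4 * J \<epsilon>\<close>. A bound uniform in direction and cut-off lets
  \<open>\<epsilon>\<close> tend to 0 under the average. The constant is
  \<open>4 * pi * (2 * pi)\<close>: two sides of the pole, two halves of each great circle, the
  Cauchy mass, and the length of the circle of directions.\<close>

lemma funk_inversion:
  assumes h: "C_k 2 h" and even: "\<And>p. h (- p) = h p"
  shows "integrable period_measure (\<lambda>\<psi>. funk_pv h y (circle_dir \<psi>))"
    and "(\<integral>\<psi>. funk_pv h y (circle_dir \<psi>) \<partial>period_measure) = 8 * pi\<^sup>2 * gnomonic h y"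
proof -
  note hc = C_k_continuous[OF h]
  obtain A where A: "A > 0" "\<And>p. norm p \<le> 1 \<Longrightarrow> \<bar>h p\<bar> \<le> A" using continuous_bounded_cball[OF hc] by blast
  then have A': "\<And>p. norm p = 1 \<Longrightarrow> \<bar>h p\<bar> \<le> A" by simp
  obtain C where C: "\<And>\<omega> s. norm \<omega> = 1 \<Longrightarrow> \<bar>funk_G' h \<omega> s\<bar> \<le> C / (1 + s\<^sup>2)"
    "\<And>\<omega> s s'. norm \<omega> = 1 \<Longrightarrow> \<bar>funk_G' h \<omega> s - funk_G' h \<omega> s'\<bar> \<le> C * \<bar>s - s'\<bar>"
    using funk_G_bounds[OF h] by metis
  define T where "T = (\<lambda>\<epsilon> \<omega>. LINT u:{\<epsilon><..}|lborel. (funk_G' h \<omega> (\<omega> \<bullet> y - u) - funk_G' h \<omega> (\<omega> \<bullet> y + u)) / u)"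
  define J where "J = (\<lambda>\<epsilon>. \<integral>\<sigma>. gnomonic_average h y (\<epsilon> * sqrt (1 + \<sigma>\<^sup>2)) / (1 + \<sigma>\<^sup>2) \<partial>lborel)"
  have lim: "((\<lambda>\<epsilon>. T \<epsilon> \<omega>) \<longlongrightarrow> funk_pv h y \<omega>) (at_right 0)" if "norm \<omega> = 1" for \<omega>
    unfolding T_def funk_pv_def by (rule pv_integral_symmetric(2)[OF funk_G'_measurable[OF h] C(1,2)[OF that]])
  have bd: "\<bar>T \<epsilon> \<omega>\<bar> \<le> 2 * C + 2 * C * pi" if "norm \<omega> = 1" "\<epsilon> > 0" for \<epsilon> \<omega>
    unfolding T_def using that by (intro pv_integral_symmetric(3)[OF funk_G'_measurable[OF h] C(1,2)]) auto
  have Teq: "T \<epsilon> (circle_dir \<psi>) = funk_half h y \<epsilon> (circle_dir (\<psi> + 0)) + funk_half h y \<epsilon> (circle_dir (\<psi> + pi))"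
    if "\<epsilon> > 0" for \<epsilon> \<psi>
    using funk_pv_truncated[OF h norm_circle_dir that] by (simp add: T_def circle_dir_pi)
  have Ti: "integrable period_measure (\<lambda>\<psi>. T \<epsilon> (circle_dir \<psi>))" if "\<epsilon> > 0" for \<epsilon>
    unfolding Teq[OF that] by (intro Bochner_Integration.integrable_add funk_half_average(1)[OF h even that])
  \<comment> \<open>Each of the opposite directions contributes \<open>2 * J \<epsilon>\<close>,
    because the average does not see the shift by \<open>pi\<close>.\<close>
  have TI: "(\<integral>\<psi>. T \<epsilon> (circle_dir \<psi>) \<partial>period_measure) = 4 * J \<epsilon>" if "\<epsilon> > 0" for \<epsilon>
    unfolding Teq[OF that] J_def
    by (simp only: Bochner_Integration.integral_add funk_half_average[OF h even that])
  define e where "e = (\<lambda>n. 1 / real (Suc n))"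
  have e0: "e n > 0" for n by (simp add: e_def)
  have "e \<longlonglongrightarrow> 0" unfolding e_def by (rule LIMSEQ_Suc[OF lim_1_over_n])
  then have e: "filterlim e (at_right 0) sequentially"
    using e0 by (intro tendsto_imp_filterlim_at_right) (auto intro: always_eventually)
  have D: "(\<lambda>\<psi>. funk_pv h y (circle_dir \<psi>)) \<in> borel_measurable period_measure"
    "\<And>n. (\<lambda>\<psi>. T (e n) (circle_dir \<psi>)) \<in> borel_measurable period_measure"
    "integrable period_measure (\<lambda>\<psi>. 2 * C + 2 * C * pi)"
    "AE \<psi> in period_measure. (\<lambda>n. T (e n) (circle_dir \<psi>)) \<longlonglongrightarrow> funk_pv h y (circle_dir \<psi>)"
    "\<And>n. AE \<psi> in period_measure. norm (T (e n) (circle_dir \<psi>)) \<le> 2 * C + 2 * C * pi"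
  proof -
    have "circle_dir \<in> borel_measurable borel"
      by (intro borel_measurable_continuous_onI continuous_intros)
    then show "(\<lambda>\<psi>. funk_pv h y (circle_dir \<psi>)) \<in> borel_measurable period_measure"
      by (intro measurable_period_measure measurable_compose[OF _ funk_pv_measurable[OF h]])
    show "(\<lambda>\<psi>. T (e n) (circle_dir \<psi>)) \<in> borel_measurable period_measure" for n
      using Ti[OF e0] by (rule borel_measurable_integrable)
    show "AE \<psi> in period_measure. (\<lambda>n. T (e n) (circle_dir \<psi>)) \<longlonglongrightarrow> funk_pv h y (circle_dir \<psi>)"
      by (intro AE_I2 filterlim_compose[OF lim e]) simp
    show "AE \<psi> in period_measure. norm (T (e n) (circle_dir \<psi>)) \<le> 2 * C + 2 * C * pi" for n
      using bd[OF norm_circle_dir e0] by (intro AE_I2) simp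
  qed simp
  show "integrable period_measure (\<lambda>\<psi>. funk_pv h y (circle_dir \<psi>))"
    by (rule integrable_dominated_convergence[OF D])
  have "(\<lambda>n. \<integral>\<psi>. T (e n) (circle_dir \<psi>) \<partial>period_measure) \<longlonglongrightarrow> (\<integral>\<psi>. funk_pv h y (circle_dir \<psi>) \<partial>period_measure)"
    by (rule integral_dominated_convergence[OF D])
  then have "(\<lambda>n. 4 * J (e n)) \<longlonglongrightarrow> (\<integral>\<psi>. funk_pv h y (circle_dir \<psi>) \<partial>period_measure)"
    by (simp only: TI[OF e0])
  moreover have "(J \<longlongrightarrow> pi * gnomonic_average h y 0) (at_right 0)"
    unfolding J_def
    by (rule abel_tail_limit[OF gnomonic_average_continuous[OF hc] gnomonic_average_bound[OF hc A']])
  then have "(\<lambda>n. 4 * J (e n)) \<longlonglongrightarrow> 4 * (pi * gnomonic_average h y 0)"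
    by (intro tendsto_mult_left filterlim_compose[OF _ e])
  ultimately have "(\<integral>\<psi>. funk_pv h y (circle_dir \<psi>) \<partial>period_measure) = 4 * (pi * gnomonic_average h y 0)"
    by (rule LIMSEQ_unique)
  also have "gnomonic_average h y 0 = 2 * pi * gnomonic h y"
    by (simp add: gnomonic_average_def)
  finally show "(\<integral>\<psi>. funk_pv h y (circle_dir \<psi>) \<partial>period_measure) = 8 * pi\<^sup>2 * gnomonic h y"
    by (simp add: power2_eq_square)
qed

text \<open>The plane point lifts to the multiple of \<open>\<alpha>\<close> with third coordinate
  1, and normalising returns \<open>\<alpha>\<close> or \<open>- \<alpha>\<close> according to the
  sign of \<open>\<alpha> $ 3\<close>. Evenness makes the two cases agree; the square comes from the
  gnomonic weight.\<close>

lemma gnomonic_proj_xy: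
  assumes even: "\<And>p. h (- p) = h p" and \<alpha>: "norm \<alpha> = 1" "\<alpha> $ 3 \<noteq> 0"
  shows "gnomonic h ((1 / \<alpha> $ 3) *\<^sub>R proj_xy \<alpha>) = (\<alpha> $ 3)\<^sup>2 * h \<alpha>"
proof -
  let ?y = "(1 / \<alpha> $ 3) *\<^sub>R proj_xy \<alpha>"
  have n: "(\<alpha> $ 1)\<^sup>2 + (\<alpha> $ 2)\<^sup>2 + (\<alpha> $ 3)\<^sup>2 = 1"
    using \<alpha>(1) by (simp add: norm_eq_1 inner_vec_def sum_3 power2_eq_square)
  have "(norm ?y)\<^sup>2 = ((\<alpha> $ 1)\<^sup>2 + (\<alpha> $ 2)\<^sup>2) / (\<alpha> $ 3)\<^sup>2"
    unfolding power2_norm_eq_inner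
    by (simp add: inner_vec_def sum_2 proj_xy_def power2_eq_square add_divide_distrib)
  also have "(\<alpha> $ 1)\<^sup>2 + (\<alpha> $ 2)\<^sup>2 = 1 - (\<alpha> $ 3)\<^sup>2" using n by simp
  finally have "1 + (norm ?y)\<^sup>2 = 1 / (\<alpha> $ 3)\<^sup>2" using \<alpha>(2) by (simp add: field_simps)
  then have i: "invsq (norm ?y) = \<bar>\<alpha> $ 3\<bar>"
    by (simp add: invsq_def real_sqrt_divide)
  have "\<alpha> $ 3 *\<^sub>R lift_plane ?y = \<alpha>"
    using \<alpha>(2) by (simp add: vec_eq_iff forall_3 proj_xy_def)
  then have "\<bar>\<alpha> $ 3\<bar> *\<^sub>R lift_plane ?y = \<alpha> \<or> \<bar>\<alpha> $ 3\<bar> *\<^sub>R lift_plane ?y = - \<alpha>"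
    by (cases "\<alpha> $ 3 \<ge> 0") (auto simp: scaleR_minus_left)
  then have "h (\<bar>\<alpha> $ 3\<bar> *\<^sub>R lift_plane ?y) = h \<alpha>" using even by metis
  then show ?thesis unfolding gnomonic_def i by simp
qed

section \<open>The Radon-type transform\<close>

lemma circle_measure_integral:
  fixes u v :: "'a::euclidean_space" and F :: "'a \<Rightarrow> real"
  assumes uv: "norm u = 1" "norm v = 1" "u \<bullet> v = 0" and F: "F \<in> borel_measurable borel"
  shows "integrable (circle_measure u v) F \<longleftrightarrow> integrable period_measure (\<lambda>\<phi>. F (cos \<phi> *\<^sub>R u + sin \<phi> *\<^sub>R v))"
    and "(\<integral>p. F p \<partial>circle_measure u v) = (\<integral>\<phi>. F (cos \<phi> *\<^sub>R u + sin \<phi> *\<^sub>R v) \<partial>period_measure)"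
proof -
  let ?g = "\<lambda>\<phi>. cos \<phi> *\<^sub>R u + sin \<phi> *\<^sub>R v"
  let ?S = "restrict_space borel (sphere 0 1) :: 'a measure"
  have n: "norm (?g \<phi>) = 1" for \<phi>
  proof -
    have "?g \<phi> \<bullet> ?g \<phi> = cos \<phi> * cos \<phi> * (u \<bullet> u) + 2 * cos \<phi> * sin \<phi> * (u \<bullet> v) + sin \<phi> * sin \<phi> * (v \<bullet> v)"
      by (simp add: inner_add_left inner_add_right inner_commute algebra_simps)
    also have "\<dots> = 1" using uv by (simp add: norm_eq_1 flip: power2_eq_square)
    finally show ?thesis by (simp add: norm_eq_1)
  qed
  have "?g \<in> borel_measurable borel"
    by (intro borel_measurable_continuous_onI continuous_intros)
  then have "?g \<in> borel_measurable period_measure" by (rule measurable_period_measure)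
  then have g: "?g \<in> measurable period_measure ?S"
    using n by (intro measurable_restrict_space2) auto
  have FS: "F \<in> borel_measurable ?S" using F by (rule measurable_restrict_space1)
  show "integrable (circle_measure u v) F \<longleftrightarrow> integrable period_measure (\<lambda>\<phi>. F (?g \<phi>))"
    unfolding circle_measure_def period_measure_def[symmetric] by (rule integrable_distr_eq[OF g FS])
  show "(\<integral>p. F p \<partial>circle_measure u v) = (\<integral>\<phi>. F (?g \<phi>) \<partial>period_measure)"
    unfolding circle_measure_def period_measure_def[symmetric] by (rule integral_distr[OF g FS])
qed

lemma space_circle_measure [simp]: "space (circle_measure u v) = sphere 0 1"
  by (simp add: circle_measure_def space_restrict_space)

text \<open>Otherwise \<open>\<theta>\<close>, \<open>p\<close>, \<open>q\<close> and the remainder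
  of \<open>x\<close> would be four nonzero pairwise orthogonal vectors in dimension 3.\<close>

lemma orthonormal_expansion_plane:
  fixes \<theta> p q x :: "real^3"
  assumes "\<theta> \<noteq> 0" "norm p = 1" "norm q = 1" "p \<bullet> q = 0" "\<theta> \<bullet> p = 0" "\<theta> \<bullet> q = 0" "\<theta> \<bullet> x = 0"
  shows "x = (x \<bullet> p) *\<^sub>R p + (x \<bullet> q) *\<^sub>R q"
proof (rule ccontr)
  assume ne: "x \<noteq> (x \<bullet> p) *\<^sub>R p + (x \<bullet> q) *\<^sub>R q"
  define y where "y = x - ((x \<bullet> p) *\<^sub>R p + (x \<bullet> q) *\<^sub>R q)"
  have y0: "y \<noteq> 0" using ne by (simp add: y_def)
  have pq: "p \<bullet> p = 1" "q \<bullet> q = 1" using assms by (simp_all add: norm_eq_1)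
  then have nz: "p \<noteq> 0" "q \<noteq> 0" by auto
  have s: "q \<bullet> p = 0" "p \<bullet> \<theta> = 0" "q \<bullet> \<theta> = 0" "x \<bullet> \<theta> = 0" using assms by (simp_all add: inner_commute)
  have y: "y \<bullet> p = 0" "y \<bullet> q = 0" "y \<bullet> \<theta> = 0"
    using assms pq s by (simp_all add: y_def inner_diff_left inner_add_left)
  have d: "\<theta> \<noteq> p" "\<theta> \<noteq> q" "p \<noteq> q" "y \<noteq> \<theta>" "y \<noteq> p" "y \<noteq> q"
    using assms y y0 pq by auto
  have "pairwise orthogonal {\<theta>, p, q, y}"
    using assms y by (auto simp: pairwise_insert orthogonal_def inner_commute)
  then have "independent {\<theta>, p, q, y}"
    using assms(1) nz y0 by (intro pairwise_orthogonal_independent) auto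
  then have "card {\<theta>, p, q, y} \<le> 3" using independent_bound[of "{\<theta>, p, q, y}"] by simp
  moreover have "card {\<theta>, p, q, y} = 4" using d by (simp add: eq_commute)
  ultimately show False by simp
qed

text \<open>The measure is chosen by \<open>SOME\<close>, so nothing is known about its basis beyond
  orthonormality. This lemma replaces it by a basis of one's own: the change of basis shifts or
  reflects the angle, and a full period does not notice.\<close>

lemma great_circle_integral:
  fixes \<theta> p q :: "real^3" and F :: "real^3 \<Rightarrow> real"
  assumes F: "continuous_on UNIV F" and \<theta>: "\<theta> \<noteq> 0"
    and pq: "norm p = 1" "norm q = 1" "p \<bullet> q = 0" "\<theta> \<bullet> p = 0" "\<theta> \<bullet> q = 0"
  shows "(\<integral>\<alpha>. F \<alpha> \<partial>great_circle_measure \<theta>) = (\<integral>\<phi>. F (cos \<phi> *\<^sub>R p + sin \<phi> *\<^sub>R q) \<partial>period_measure)"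
proof -
  let ?P = "\<lambda>M. \<exists>u v. norm u = 1 \<and> norm v = 1 \<and> u \<bullet> v = 0 \<and> \<theta> \<bullet> u = 0 \<and> \<theta> \<bullet> v = 0 \<and> M = circle_measure u v"
  have "?P (circle_measure p q)" using pq by blast
  then have "?P (great_circle_measure \<theta>)" unfolding great_circle_measure_def by (rule someI)
  then obtain u v where uv: "norm u = 1" "norm v = 1" "u \<bullet> v = 0" "\<theta> \<bullet> u = 0" "\<theta> \<bullet> v = 0"
    and M: "great_circle_measure \<theta> = circle_measure u v" by blast
  have o: "p \<bullet> p = 1" "q \<bullet> q = 1" "p \<bullet> q = 0" "q \<bullet> p = 0" using pq by (simp_all add: norm_eq_1 inner_commute)
  define c d c' d' where "c = u \<bullet> p" and "d = u \<bullet> q" and "c' = v \<bullet> p" and "d' = v \<bullet> q"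
  have u: "u = c *\<^sub>R p + d *\<^sub>R q" and v: "v = c' *\<^sub>R p + d' *\<^sub>R q"
    unfolding c_def d_def c'_def d'_def
    by (rule orthonormal_expansion_plane[OF \<theta> pq uv(4)], rule orthonormal_expansion_plane[OF \<theta> pq uv(5)])
  have "u \<bullet> u = c\<^sup>2 + d\<^sup>2" "v \<bullet> v = c'\<^sup>2 + d'\<^sup>2" "u \<bullet> v = c * c' + d * d'"
    unfolding u v by (simp_all add: inner_add_left inner_add_right o power2_eq_square)
  then have n: "c\<^sup>2 + d\<^sup>2 = 1" "c'\<^sup>2 + d'\<^sup>2 = 1" "c * c' + d * d' = 0"
    using uv by (simp_all add: norm_eq_1)
  obtain a where a: "c = cos a" "d = sin a" using sincos_total_2pi[OF n(1)] by metis
  \<comment> \<open>The determinant of the change of basis; the value 1 is a rotation by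
    \<open>a\<close>, the value -1 a reflection.\<close>
  define k where "k = c * d' - d * c'"
  have "k\<^sup>2 = (c\<^sup>2 + d\<^sup>2) * (c'\<^sup>2 + d'\<^sup>2) - (c * c' + d * d')\<^sup>2"
    by (simp add: k_def power2_eq_square algebra_simps)
  then have k: "k = 1 \<or> k = - 1" by (simp add: n power2_eq_1_iff)
  have "- (k * d) = c' * (c\<^sup>2 + d\<^sup>2) - c * (c * c' + d * d')"
    by (simp add: k_def power2_eq_square algebra_simps)
  then have c': "c' = - (k * d)" by (simp add: n)
  have "k * c = d' * (c\<^sup>2 + d\<^sup>2) - d * (c * c' + d * d')"
    by (simp add: k_def power2_eq_square algebra_simps)
  then have d': "d' = k * c" by (simp add: n)
  let ?H = "\<lambda>\<phi>. F (cos \<phi> *\<^sub>R p + sin \<phi> *\<^sub>R q)"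
  have Hc: "continuous_on UNIV ?H"
    by (rule continuous_on_compose2[OF F]) (auto intro!: continuous_intros)
  have per: "?H (z + 2 * pi) = ?H z" for z by simp
  have "(\<integral>\<alpha>. F \<alpha> \<partial>great_circle_measure \<theta>) = (\<integral>\<phi>. F (cos \<phi> *\<^sub>R u + sin \<phi> *\<^sub>R v) \<partial>period_measure)"
    unfolding M by (rule circle_measure_integral(2)[OF uv(1-3) borel_measurable_continuous_onI[OF F]])
  also have "\<dots> = (\<integral>\<phi>. ?H \<phi> \<partial>period_measure)"
    using k
  proof
    assume "k = 1"
    then have "cos \<phi> *\<^sub>R u + sin \<phi> *\<^sub>R v = cos (\<phi> + a) *\<^sub>R p + sin (\<phi> + a) *\<^sub>R q" for \<phi>
      unfolding u v c' d' a cos_add sin_add by (simp add: algebra_simps)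
    then show ?thesis using period_integral_shift(1)[OF Hc per, of a] by simp
  next
    assume "k = - 1"
    then have "cos \<phi> *\<^sub>R u + sin \<phi> *\<^sub>R v = cos (a - \<phi>) *\<^sub>R p + sin (a - \<phi>) *\<^sub>R q" for \<phi>
      unfolding u v c' d' a cos_diff sin_diff by (simp add: algebra_simps)
    then show ?thesis using period_integral_shift(2)[OF Hc per, of a] by simp
  qed
  finally show ?thesis .
qed

section \<open>The radial operator acting on the transform\<close>

lemma sm_C_k: "test_fun f \<Longrightarrow> C_k k (\<lambda>a. sm f (c *\<^sub>R a) t)"
  by (rule sph_mean_C_k) auto

text \<open>The argument at which \<open>radon_G\<close> evaluates the transform is the unit normal
  \<open>circ_n \<omega> s\<close>, and its prefactor is \<open>invsq s\<close>. The orthonormal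
  basis of the great circle is the one of the chart.\<close>

lemma radon_G_eq_funk_G:
  assumes f: "test_fun f" and \<omega>: "norm \<omega> = 1"
  shows "radon_G r f \<omega> s t = funk_G (\<lambda>\<alpha>. sm f (r *\<^sub>R \<alpha>) t) \<omega> s"
proof -
  have n: "vector [\<omega> $ 1 / sqrt (1 + s\<^sup>2), \<omega> $ 2 / sqrt (1 + s\<^sup>2), - s / sqrt (1 + s\<^sup>2)] = circ_n \<omega> s"
    unfolding vec_eq_iff forall_3 circ_components invsq_def by simp
  note o = circ_orthonormal[OF \<omega>]
  have n0: "circ_n \<omega> s \<noteq> 0" using o(3)[of s] by (metis norm_zero zero_neq_one)
  have "radon_P r f (circ_n \<omega> s) t = (\<integral>\<alpha>. sm f (r *\<^sub>R \<alpha>) t \<partial>great_circle_measure (circ_n \<omega> s))"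
    by (simp add: radon_P_def sph_mean_def)
  also have "\<dots> = funk (\<lambda>\<alpha>. sm f (r *\<^sub>R \<alpha>) t) \<omega> s"
    unfolding funk_def circ_pt_def
    by (rule great_circle_integral[OF C_k_continuous[OF sm_C_k[OF f]] n0 o(2,1,4,6,5)])
  finally show ?thesis by (simp only: radon_G_def n funk_G_def invsq_def)
qed

lemma sm''_bounded:
  assumes f: "test_fun f"
  obtains B where "\<And>a t. \<bar>sm'' f a t\<bar> \<le> B"
proof -
  let ?S = "\<lambda>i j. sph_mean (\<lambda>\<beta>::real^3. \<beta> $ i * \<beta> $ j) (pd j (pd i f))"
  have ex: "\<exists>C. \<forall>a t. \<bar>?S i j a t\<bar> \<le> C" for i j
  proof -
    have "continuous_on UNIV (\<lambda>\<beta>::real^3. \<beta> $ i * \<beta> $ j)" by (intro continuous_intros)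
    then show ?thesis
      using sph_mean_bounded[OF _ test_fun_dir_deriv[OF test_fun_dir_deriv[OF f, of "axis i 1"], of "axis j 1"]] by blast
  qed
  define B where "B i j = (SOME C. \<forall>a t. \<bar>?S i j a t\<bar> \<le> C)" for i j
  have B: "\<bar>?S i j a t\<bar> \<le> B i j" for i j a t
    using someI_ex[OF ex, of i j] unfolding B_def by blast
  have "\<bar>sm'' f a t\<bar> \<le> (\<Sum>i\<in>UNIV. \<Sum>j\<in>UNIV. B i j)" for a t
    unfolding sm''_def by (intro order_trans[OF sum_abs] sum_mono B)
  then show ?thesis by (rule that)
qed

lemma sm'_C_k: "test_fun f \<Longrightarrow> C_k k (\<lambda>a. sm' f (c *\<^sub>R a) t)"
  unfolding sm'_def by (intro C_k_sum sph_mean_C_k test_fun_dir_deriv continuous_intros) auto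

lemma sm''_C_k: "test_fun f \<Longrightarrow> C_k k (\<lambda>a. sm'' f (c *\<^sub>R a) t)"
  unfolding sm''_def by (intro C_k_sum sph_mean_C_k test_fun_dir_deriv continuous_intros) auto

lemma radial_op_C_k: "test_fun f \<Longrightarrow> C_k k (\<lambda>a. radial_op f (c *\<^sub>R a) t)"
  unfolding radial_op_def by (intro C_k_add C_k_cmult sm_C_k sm'_C_k test_fun_laplacian)

lemma funk_G_has_derivative_parameter:
  fixes F F' :: "real \<Rightarrow> real^3 \<Rightarrow> real"
  assumes d: "\<And>t a. ((\<lambda>t. F t a) has_real_derivative F' t a) (at t)" and B: "\<And>t a. \<bar>F' t a\<bar> \<le> B"
    and c: "\<And>t. continuous_on UNIV (F t)"
  shows "((\<lambda>t. funk_G (F t) \<omega> s) has_real_derivative funk_G (F' t) \<omega> s) (at t)"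
proof -
  have c': "continuous_on UNIV (\<lambda>\<phi>. F t (circ_pt \<omega> s \<phi>))" for t
    using continuous_on_compose2[OF c continuous_on_circ_pt_angle] by simp
  have "((\<lambda>t. funk (F t) \<omega> s) has_real_derivative funk (F' t) \<omega> s) (at t)"
    unfolding funk_def
  proof (rule has_real_derivative_lebesgue_integral(1)[where X = UNIV and B = B])
    show "(\<lambda>\<phi>. F t (circ_pt \<omega> s \<phi>)) \<in> borel_measurable period_measure" for t
      by (intro measurable_period_measure borel_measurable_continuous_onI c')
    show "integrable period_measure (\<lambda>\<phi>. F t (circ_pt \<omega> s \<phi>))"
      by (rule period_measure_integrable[OF c'])
  qed (use d B in auto)
  then show ?thesis unfolding funk_G_def by (rule DERIV_cmult)
qed

text \<open>The derivatives in \<open>t\<close> pass under the great circle integral, where they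
  form \<open>sm + 3 * t * sm' + t\<^sup>2 * sm''\<close>. Darboux's equation trades the second
  derivative for the Laplacian and uses up two of the three copies of \<open>t * sm'\<close>, which
  leaves \<open>radial_op\<close>.\<close>

lemma ds_dt_t_dt_t_radon_G:
  assumes f: "test_fun f" and \<omega>: "norm \<omega> = 1"
  shows "ds_dt_t_dt_t (radon_G r f \<omega>) s t = funk_G' (\<lambda>\<alpha>. radial_op f (r *\<^sub>R \<alpha>) t) \<omega> s"
proof -
  let ?g = "\<lambda>s t. funk_G (\<lambda>\<alpha>. sm f (r *\<^sub>R \<alpha>) t) \<omega> s"
  let ?g1 = "\<lambda>s t. funk_G (\<lambda>\<alpha>. sm' f (r *\<^sub>R \<alpha>) t) \<omega> s"
  let ?g2 = "\<lambda>s t. funk_G (\<lambda>\<alpha>. sm'' f (r *\<^sub>R \<alpha>) t) \<omega> s"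
  let ?H = "\<lambda>\<alpha>. radial_op f (r *\<^sub>R \<alpha>) t"
  obtain B1 where B1: "\<And>a t. \<bar>sm' f a t\<bar> \<le> B1" using sm'_bounded[OF f] by metis
  obtain B2 where B2: "\<And>a t. \<bar>sm'' f a t\<bar> \<le> B2" using sm''_bounded[OF f] by metis
  have d1: "(?g s has_real_derivative ?g1 s t) (at t)" for s t
    by (rule funk_G_has_derivative_parameter[OF sm_has_derivative[OF f] B1 C_k_continuous[OF sm_C_k[OF f]]])
  have d2: "(?g1 s has_real_derivative ?g2 s t) (at t)" for s t
    by (rule funk_G_has_derivative_parameter[OF sm'_has_derivative[OF f] B2 C_k_continuous[OF sm'_C_k[OF f]]])
  have e1: "deriv (\<lambda>t. t * ?g s t) t = ?g s t + t * ?g1 s t" for s t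
    by (rule DERIV_imp_deriv) (auto intro!: derivative_eq_intros d1)
  have e2: "deriv (\<lambda>t. t * (?g s t + t * ?g1 s t)) t = ?g s t + 3 * t * ?g1 s t + t\<^sup>2 * ?g2 s t" for s
    by (rule DERIV_imp_deriv) (auto intro!: derivative_eq_intros d1 d2 simp: power2_eq_square algebra_simps)
  have e3: "?g s t + 3 * t * ?g1 s t + t\<^sup>2 * ?g2 s t = funk_G ?H \<omega> s" for s
  proof -
    have H: "?H \<alpha> = sm f (r *\<^sub>R \<alpha>) t + (3 * t) * sm' f (r *\<^sub>R \<alpha>) t + t\<^sup>2 * sm'' f (r *\<^sub>R \<alpha>) t" for \<alpha>
    proof -
      have "t\<^sup>2 * sm (laplacian f) (r *\<^sub>R \<alpha>) t = t * (t * sm (laplacian f) (r *\<^sub>R \<alpha>) t)"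
        by (simp add: power2_eq_square)
      also have "\<dots> = t\<^sup>2 * sm'' f (r *\<^sub>R \<alpha>) t + 2 * t * sm' f (r *\<^sub>R \<alpha>) t"
        unfolding darboux_equation[OF f] by (simp add: power2_eq_square algebra_simps)
      finally show ?thesis unfolding radial_op_def by (simp add: algebra_simps)
    qed
    have i: "integrable period_measure (\<lambda>\<phi>. G (circ_pt \<omega> s \<phi>))" if "continuous_on UNIV G" for G :: "real^3 \<Rightarrow> real"
      using continuous_on_compose2[OF that continuous_on_circ_pt_angle] by (intro period_measure_integrable) auto
    note i' = i[OF C_k_continuous[OF sm_C_k[OF f]]] i[OF C_k_continuous[OF sm'_C_k[OF f]]] i[OF C_k_continuous[OF sm''_C_k[OF f]]]
    have "funk ?H \<omega> s = funk (\<lambda>\<alpha>. sm f (r *\<^sub>R \<alpha>) t) \<omega> s + (3 * t) * funk (\<lambda>\<alpha>. sm' f (r *\<^sub>R \<alpha>) t) \<omega> s +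
      t\<^sup>2 * funk (\<lambda>\<alpha>. sm'' f (r *\<^sub>R \<alpha>) t) \<omega> s"
      unfolding H funk_def
      by (simp only: Bochner_Integration.integral_add Bochner_Integration.integrable_add integrable_mult_right
          Bochner_Integration.integral_mult_right_zero i')
    then show ?thesis by (simp add: funk_G_def algebra_simps)
  qed
  have "ds_dt_t_dt_t (radon_G r f \<omega>) s t = deriv (funk_G ?H \<omega>) s"
    unfolding ds_dt_t_dt_t_def radon_G_eq_funk_G[OF f \<omega>] e1 e2 e3 ..
  also have "\<dots> = funk_G' ?H \<omega> s"
    by (rule DERIV_imp_deriv[OF funk_G_has_derivative[OF radial_op_C_k[OF f] \<omega>]])
  finally show ?thesis .
qed

text \<open>Central symmetry of the sphere gives the claim for \<open>sm\<close> at every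
  \<open>t\<close>, hence for its derivatives in \<open>t\<close> by uniqueness. Darboux's equation
  transfers it to \<open>t * sm (laplacian f)\<close>, and that term enters \<open>radial_op\<close>
  with a factor \<open>t\<close> to spare.\<close>

lemma radial_op_even:
  assumes f: "test_fun f" and even: "\<And>y. f (- y) = f y"
  shows "radial_op f (- a) t = radial_op f a t"
proof -
  have 0: "sm f (- a) t = sm f a t" for t
  proof -
    have c: "(\<lambda>\<beta>. f (- a + t *\<^sub>R \<beta>)) \<in> borel_measurable borel"
      by (intro borel_measurable_continuous_onI continuous_on_compose2[OF test_fun_continuous[OF f]] continuous_intros) auto
    have "orthogonal_transformation (\<lambda>\<beta>::real^3. - \<beta>)"
      using orthogonal_transformation_neg[of "\<lambda>\<beta>::real^3. \<beta>"] orthogonal_transformation_id by simp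
    from integral_sphere_orthogonal[OF c this]
    have "(\<integral>\<beta>. f (- (a + t *\<^sub>R \<beta>)) \<partial>sphere_measure) = (\<integral>\<beta>. f (- a + t *\<^sub>R \<beta>) \<partial>sphere_measure)" by simp
    then show ?thesis unfolding even sph_mean_def by simp
  qed
  have 1: "sm' f (- a) t = sm' f a t" for t
    using DERIV_unique[OF sm_has_derivative[OF f, of a t]] sm_has_derivative[OF f, of "- a" t] by (simp add: 0)
  have 2: "sm'' f (- a) t = sm'' f a t" for t
    using DERIV_unique[OF sm'_has_derivative[OF f, of a t]] sm'_has_derivative[OF f, of "- a" t] by (simp add: 1)
  have "t * sm (laplacian f) (- a) t = t * sm (laplacian f) a t"
    unfolding darboux_equation[OF f] by (simp add: 1 2)
  then show ?thesis unfolding radial_op_def power2_eq_square mult.assoc by (simp add: 0 1)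
qed

text \<open>Heights are uniformly distributed by Archimedes' theorem, so a single height is a null
  set.\<close>

lemma AE_sphere_measure_third_component: "AE \<alpha> in sphere_measure. (\<alpha>::real^3) $ 3 \<noteq> 0"
proof -
  have e: "axis 3 1 \<bullet> \<alpha> = \<alpha> $ 3" for \<alpha> :: "real^3" by (simp add: inner_axis')
  have "(\<integral>\<^sup>+\<alpha>. indicator {0} (axis 3 1 \<bullet> (\<alpha>::real^3)) \<partial>sphere_measure) =
    ennreal (2 * pi) * (\<integral>\<^sup>+u. indicator {0::real} u * indicator {-1..1} u \<partial>lborel)"
    by (rule nn_integral_sphere_projection) (auto simp: norm_axis_1)
  also have "(\<integral>\<^sup>+u. indicator {0::real} u * indicator {-1..1} u \<partial>lborel) = (\<integral>\<^sup>+u. indicator {0::real} u \<partial>lborel)"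
    by (intro nn_integral_cong) (auto simp: indicator_def)
  finally have "(\<integral>\<^sup>+\<alpha>. indicator {0} ((\<alpha>::real^3) $ 3) \<partial>sphere_measure) = (0::ennreal)" by (simp add: e)
  moreover have "(\<lambda>\<alpha>::real^3. \<alpha> $ 3) \<in> borel_measurable sphere_measure"
    by (intro measurable_sphere_measure borel_measurable_continuous_onI continuous_intros)
  then have "(\<lambda>\<alpha>::real^3. indicator {0} (\<alpha> $ 3) :: ennreal) \<in> borel_measurable sphere_measure"
    by (rule measurable_compose) simp
  ultimately have "AE \<alpha> in sphere_measure. indicator {0} ((\<alpha>::real^3) $ 3) = (0::ennreal)"
    by (simp add: nn_integral_0_iff_AE)
  then show ?thesis by eventually_elim (auto simp: indicator_def split: if_splits)
qed

section \<open>The inversion formula\<close>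

text \<open>Taking \<open>(\<alpha> $ 3)\<^sup>2\<close> out of the denominator leaves a Cauchy
  kernel with pole \<open>\<omega> \<bullet> y\<close>, where \<open>y\<close> is the gnomonic image
  of \<open>\<alpha>\<close>. The radius \<open>t\<close> depends on \<open>\<alpha>\<close> alone
  and is a constant for this integral, so the kernel is the one inverted by
  \<open>funk_inversion\<close>.\<close>

lemma inversion_kernel_pv:
  fixes r :: real and x \<alpha> :: "real^3"
  assumes f: "test_fun f" and \<alpha>: "\<alpha> $ 3 \<noteq> 0" and \<omega>: "norm \<omega> = 1"
  defines "t \<equiv> norm (r *\<^sub>R \<alpha> - x)"
  shows "has_pv_integral (inversion_kernel r f x \<alpha> \<omega>) (pole \<alpha> \<omega>)
    (1 / (t * (\<alpha> $ 3)\<^sup>2) * funk_pv (\<lambda>\<beta>. radial_op f (r *\<^sub>R \<beta>) t) ((1 / \<alpha> $ 3) *\<^sub>R proj_xy \<alpha>) \<omega>)"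
proof -
  let ?y = "(1 / \<alpha> $ 3) *\<^sub>R proj_xy \<alpha>"
  let ?H = "\<lambda>\<beta>. radial_op f (r *\<^sub>R \<beta>) t"
  have p: "pole \<alpha> \<omega> = \<omega> \<bullet> ?y" by (simp add: pole_def)
  have "\<alpha> $ 3 * (\<omega> \<bullet> proj_xy \<alpha>) - s * (\<alpha> $ 3)\<^sup>2 = (\<alpha> $ 3)\<^sup>2 * (\<omega> \<bullet> ?y - s)" for s
    using \<alpha> by (simp add: power2_eq_square right_diff_distrib)
  then have "inversion_kernel r f x \<alpha> \<omega> s = 1 / (t * (\<alpha> $ 3)\<^sup>2) * (funk_G' ?H \<omega> s / (\<omega> \<bullet> ?y - s))" for s
    by (simp add: inversion_kernel_def ds_dt_t_dt_t_radon_G[OF f \<omega>] t_def[symmetric])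
  then have k: "inversion_kernel r f x \<alpha> \<omega> = (\<lambda>s. 1 / (t * (\<alpha> $ 3)\<^sup>2) * (funk_G' ?H \<omega> s / (\<omega> \<bullet> ?y - s)))" ..
  show ?thesis unfolding k p by (rule funk_pv_has_pv[OF radial_op_C_k[OF f] \<omega>])
qed

lemma S1_measure_integral:
  fixes F :: "real^2 \<Rightarrow> real"
  assumes "F \<in> borel_measurable borel"
  shows "integrable S1_measure F \<longleftrightarrow> integrable period_measure (\<lambda>\<psi>. F (circle_dir \<psi>))"
    and "(\<integral>\<omega>. F \<omega> \<partial>S1_measure) = (\<integral>\<psi>. F (circle_dir \<psi>) \<partial>period_measure)"
  unfolding S1_measure_def circle_dir_def
  by (rule circle_measure_integral; simp add: assms norm_axis_1 inner_axis_axis)+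

lemma inversion_kernel_S1:
  fixes r :: real and x \<alpha> :: "real^3"
  assumes f: "test_fun f" and even: "\<And>y. f (- y) = f y" and \<alpha>: "norm \<alpha> = 1" "\<alpha> $ 3 \<noteq> 0"
  defines "t \<equiv> norm (r *\<^sub>R \<alpha> - x)"
  shows "integrable S1_measure (\<lambda>\<omega>. pv_integral (inversion_kernel r f x \<alpha> \<omega>) (pole \<alpha> \<omega>))"
    and "(\<integral>\<omega>. pv_integral (inversion_kernel r f x \<alpha> \<omega>) (pole \<alpha> \<omega>) \<partial>S1_measure) =
      8 * pi\<^sup>2 * (radial_op f (r *\<^sub>R \<alpha>) t / t)"
proof -
  let ?H = "\<lambda>\<beta>. radial_op f (r *\<^sub>R \<beta>) t"
  let ?y = "(1 / \<alpha> $ 3) *\<^sub>R proj_xy \<alpha>"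
  let ?c = "1 / (t * (\<alpha> $ 3)\<^sup>2)"
  let ?P = "\<lambda>\<omega>. ?c * funk_pv ?H ?y \<omega>"
  have H: "C_k 2 ?H" by (rule radial_op_C_k[OF f])
  have He: "?H (- p) = ?H p" for p using radial_op_even[OF f even, of "r *\<^sub>R p"] by simp
  \<comment> \<open>The principal value is identified only for unit \<open>\<omega>\<close>.
    \<open>?P\<close> is a Borel function on the whole plane that agrees with it on the space of
    \<open>S1_measure\<close>, so the integral can be transferred to the angle.\<close>
  have pv: "pv_integral (inversion_kernel r f x \<alpha> \<omega>) (pole \<alpha> \<omega>) = ?P \<omega>" if "\<omega> \<in> space S1_measure" for \<omega>
    using that unfolding t_def S1_measure_def by (intro pv_integral_eq inversion_kernel_pv[OF f \<alpha>(2)]) simp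
  have m: "?P \<in> borel_measurable borel"
    by (intro borel_measurable_times funk_pv_measurable[OF H]) simp
  have i: "integrable S1_measure ?P"
    unfolding S1_measure_integral(1)[OF m] by (intro integrable_mult_right funk_inversion(1)[OF H He])
  show "integrable S1_measure (\<lambda>\<omega>. pv_integral (inversion_kernel r f x \<alpha> \<omega>) (pole \<alpha> \<omega>))"
    by (rule Bochner_Integration.integrable_cong[THEN iffD2, OF refl _ i]) (rule pv)
  have "(\<integral>\<omega>. pv_integral (inversion_kernel r f x \<alpha> \<omega>) (pole \<alpha> \<omega>) \<partial>S1_measure) = (\<integral>\<omega>. ?P \<omega> \<partial>S1_measure)"
    by (rule Bochner_Integration.integral_cong[OF refl pv])
  also have "\<dots> = (\<integral>\<psi>. ?P (circle_dir \<psi>) \<partial>period_measure)" by (rule S1_measure_integral(2)[OF m])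
  also have "\<dots> = ?c * (8 * pi\<^sup>2 * gnomonic ?H ?y)"
    by (simp only: Bochner_Integration.integral_mult_right_zero funk_inversion(2)[OF H He])
  \<comment> \<open>The gnomonic weight produces the factor \<open>(\<alpha> $ 3)\<^sup>2\<close>
    that cancels the one in \<open>?c\<close>.\<close>
  also have "gnomonic ?H ?y = (\<alpha> $ 3)\<^sup>2 * ?H \<alpha>" by (rule gnomonic_proj_xy[where h = ?H, OF He \<alpha>])
  also have "?c * (8 * pi\<^sup>2 * ((\<alpha> $ 3)\<^sup>2 * ?H \<alpha>)) = 8 * pi\<^sup>2 * (?H \<alpha> / t)" using \<alpha>(2) by simp
  finally show "(\<integral>\<omega>. pv_integral (inversion_kernel r f x \<alpha> \<omega>) (pole \<alpha> \<omega>) \<partial>S1_measure) =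
      8 * pi\<^sup>2 * (radial_op f (r *\<^sub>R \<alpha>) t / t)" .
qed

text \<open>Here the denominator is 0, and since division by zero yields 0 the kernel is the zero
  function. This default fixes the outer integrand on the equator, which is a null set.\<close>

lemma inversion_kernel_equator:
  assumes "\<alpha> $ 3 = 0"
  shows "pv_integral (inversion_kernel r f x \<alpha> \<omega>) a = 0"
proof (rule pv_integral_eq)
  have "inversion_kernel r f x \<alpha> \<omega> = (\<lambda>_. 0)" using assms by (simp add: inversion_kernel_def fun_eq_iff)
  then show "has_pv_integral (inversion_kernel r f x \<alpha> \<omega>) a 0"
    by (simp add: has_pv_integral_def set_integrable_def set_lebesgue_integral_def)
qed

theorem theorem5:
  fixes r :: real and f :: "real^3 \<Rightarrow> real" and x :: "real^3"
  assumes "r > 0"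
    and "C_infinity f"
    and "\<And>y. f (- y) = f y"
    and "compact (closure {y. f y \<noteq> 0})"
    and "closure {y. f y \<noteq> 0} \<subseteq> ball 0 r"
    and "x \<in> ball 0 r"
  shows "(\<forall>\<alpha>\<in>sphere 0 1. \<alpha>$3 \<noteq> 0 \<longrightarrow>
            (\<forall>\<omega>\<in>sphere 0 1. \<exists>I. has_pv_integral (inversion_kernel r f x \<alpha> \<omega>) (pole \<alpha> \<omega>) I) \<and>
            integrable S1_measure (\<lambda>\<omega>. pv_integral (inversion_kernel r f x \<alpha> \<omega>) (pole \<alpha> \<omega>))) \<and>
         integrable sphere_measure
            (\<lambda>\<alpha>. \<integral>\<omega>. pv_integral (inversion_kernel r f x \<alpha> \<omega>) (pole \<alpha> \<omega>) \<partial>S1_measure) \<and>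
         f x = - (r / (64 * pi ^ 4)) *
           (\<integral>\<alpha>. (\<integral>\<omega>. pv_integral (inversion_kernel r f x \<alpha> \<omega>) (pole \<alpha> \<omega>) \<partial>S1_measure) \<partial>sphere_measure)"
proof -
  let ?I = "\<lambda>\<alpha>. \<integral>\<omega>. pv_integral (inversion_kernel r f x \<alpha> \<omega>) (pole \<alpha> \<omega>) \<partial>S1_measure"
  let ?R = "\<lambda>\<alpha>. radial_op f (r *\<^sub>R \<alpha>) (norm (r *\<^sub>R \<alpha> - x)) / norm (r *\<^sub>R \<alpha> - x)"
  let ?K = "closure {y. f y \<noteq> 0}"
  have "bounded {y. f y \<noteq> 0}" using assms(4) compact_imp_bounded bounded_subset closure_subset by metis
  then have f: "test_fun f" using assms(2) by (simp add: test_fun_def)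
  have x: "norm x < r" using assms(6) by simp
  \<comment> \<open>A compact support in the open ball attains its largest norm, which is below
    \<open>r\<close>; the difference is the margin \<open>\<delta>\<close>. An empty support attains
    nothing and is treated apart, with any positive margin.\<close>
  have "\<exists>\<delta>>0. \<forall>p. f p \<noteq> 0 \<longrightarrow> norm p \<le> r - \<delta>"
  proof (cases "?K = {}")
    case True
    then have "f p = 0" for p using closure_subset[of "{y. f y \<noteq> 0}"] by auto
    then show ?thesis using zero_less_one by blast
  next
    case False
    have "continuous_on ?K norm" by (intro continuous_intros)
    from continuous_attains_sup[OF assms(4) False this]
    obtain p0 where p0: "p0 \<in> ?K" "\<And>p. p \<in> ?K \<Longrightarrow> norm p \<le> norm p0" by blast
    have "r - norm p0 > 0" using p0(1) assms(5) by auto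
    moreover have "norm p \<le> r - (r - norm p0)" if "f p \<noteq> 0" for p
      using p0(2)[of p] closure_subset[of "{y. f y \<noteq> 0}"] that by auto
    ultimately show ?thesis by blast
  qed
  then obtain \<delta> where \<delta>: "\<delta> > 0" "\<And>p. f p \<noteq> 0 \<Longrightarrow> norm p \<le> r - \<delta>" by blast
  have inv: "integrable sphere_measure ?R" "(\<integral>\<alpha>. ?R \<alpha> \<partial>sphere_measure) = - (8 * pi\<^sup>2 / r) * f x"
    by (rule spherical_mean_inversion[OF f assms(1) x \<delta>(1)], rule \<delta>(2), assumption)+
  \<comment> \<open>On the equator the left side has its default value 0 while \<open>?R\<close>
    need not vanish; the conditional factor makes the identity hold at every point of the sphere
    before null sets are discarded.\<close>
  have I: "?I \<alpha> = 8 * pi\<^sup>2 * ((if \<alpha> $ 3 = 0 then 0 else 1) * ?R \<alpha>)" if "\<alpha> \<in> space sphere_measure" for \<alpha>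
    using that inversion_kernel_S1(2)[OF f assms(3), of \<alpha> r x] inversion_kernel_equator[of \<alpha> r f x] by auto
  have Rm: "?R \<in> borel_measurable sphere_measure" using inv(1) by (rule borel_measurable_integrable)
  have "(\<lambda>\<alpha>::real^3. \<alpha> $ 3) \<in> borel_measurable sphere_measure"
    by (intro measurable_sphere_measure borel_measurable_continuous_onI continuous_intros)
  then have "(\<lambda>\<alpha>::real^3. (if \<alpha> $ 3 = 0 then 0 else 1) :: real) \<in> borel_measurable sphere_measure"
    by measurable
  then have Im: "(\<lambda>\<alpha>. (if \<alpha> $ 3 = 0 then 0 else 1) * ?R \<alpha>) \<in> borel_measurable sphere_measure"
    using Rm by (rule borel_measurable_times)
  have ae: "AE \<alpha> in sphere_measure. (if \<alpha> $ 3 = 0 then 0 else 1) * ?R \<alpha> = ?R \<alpha>"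
    using AE_sphere_measure_third_component by eventually_elim simp
  have i: "integrable sphere_measure (\<lambda>\<alpha>. (if \<alpha> $ 3 = 0 then 0 else 1) * ?R \<alpha>)"
    using integrable_cong_AE[OF Im Rm ae] inv(1) by simp
  have i8: "integrable sphere_measure (\<lambda>\<alpha>. 8 * pi\<^sup>2 * ((if \<alpha> $ 3 = 0 then 0 else 1) * ?R \<alpha>))"
    by (intro integrable_mult_right i)
  have int: "integrable sphere_measure ?I"
    by (rule Bochner_Integration.integrable_cong[THEN iffD2, OF refl _ i8]) (rule I)
  have "(\<integral>\<alpha>. ?I \<alpha> \<partial>sphere_measure) = (\<integral>\<alpha>. 8 * pi\<^sup>2 * ((if \<alpha> $ 3 = 0 then 0 else 1) * ?R \<alpha>) \<partial>sphere_measure)"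
    by (rule Bochner_Integration.integral_cong[OF refl I])
  also have "\<dots> = 8 * pi\<^sup>2 * (\<integral>\<alpha>. ?R \<alpha> \<partial>sphere_measure)"
    unfolding Bochner_Integration.integral_mult_right_zero integral_cong_AE[OF Im Rm ae] ..
  also have "\<dots> = 8 * pi\<^sup>2 * (- (8 * pi\<^sup>2 / r) * f x)" by (simp only: inv(2))
  \<comment> \<open>Both inversions contribute \<open>8 * pi\<^sup>2\<close>; the sign and the
    factor \<open>r\<close> come from the spherical means.\<close>
  finally have "f x = - (r / (64 * pi ^ 4)) * (\<integral>\<alpha>. ?I \<alpha> \<partial>sphere_measure)"
    using assms(1) by (simp add: power2_eq_square power4_eq_xxxx)
  moreover have "\<exists>I. has_pv_integral (inversion_kernel r f x \<alpha> \<omega>) (pole \<alpha> \<omega>) I"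
    if "\<alpha> $ 3 \<noteq> 0" "\<omega> \<in> sphere 0 1" for \<alpha> \<omega>
    using inversion_kernel_pv[OF f that(1), of \<omega>] that(2) by auto
  moreover have "integrable S1_measure (\<lambda>\<omega>. pv_integral (inversion_kernel r f x \<alpha> \<omega>) (pole \<alpha> \<omega>))"
    if "\<alpha> \<in> sphere 0 1" "\<alpha> $ 3 \<noteq> 0" for \<alpha>
    using inversion_kernel_S1(1)[OF f assms(3), of \<alpha>] that by simp
  ultimately show ?thesis using int by blast
qed

end
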